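(* Let $(X,\mathfrak m,\mathscr E,\mathscr F(X))$ be a strongly local Dirichlet space which is locally smoothing, intrinsically complete and irreducible. Then it is $L^q$-positivity preserving for all $q\in(1,\infty)$; that is, for every $q\in(1,\infty)$, every locally $1$-shift excessive function $f\in L^q(X,\mathfrak m)$ satisfies $f\ge 0$.
   Context: Function spaces are real; inequalities between classes of functions hold $\mathfrak m$-a.e. A strongly local Dirichlet space is a quadruple $(X,\mathfrak m,\mathscr E,\mathscr F(X))$, where $X$ is a locally compact, separable, metrizable space, $\mathfrak m$ is a Radon measure on $X$ with full support, and $\mathscr E$ is a closed, symmetric, nonnegative bilinear form in $L^2(X,\mathfrak m)$ with dense domain $\mathscr F(X)$ such that: (Markov) for all contractions $T:\mathbb R\to\mathbb R$ with $T(0)=0$ and $f\in\mathscr F(X)$ one has $T\circ f\in\mathscr F(X)$ and $\mathscr E(T\circ f,T\circ f)\le\mathscr E(f,f)$; (regular) $\mathscr F(X)\cap C_c(X)$ is dense in $C_c(X)$ w.r.t. $\|\cdot\|_\infty$ and in $\mathscr F(X)$ w.r.t. $\mathscr E_1(u,v)=\mathscr E(u,v)+\int uv\,d\mathfrak m$; (strongly local) $\mathscr E(u,v)=0$ whenever $u,v\in\mathscr F(X)$ and $u$ is constant on the support of $v$. For open $U,V\subset X$, $U\Subset V$ means that $\overline U$ is a compact subset of $X$ with $\overline U\subset V$. $\mathscr F_{\mathrm{loc}}(X)$ is the set of $f\in L^2_{\mathrm{loc}}(X,\mathfrak m)$ such that for every open $U\Subset X$ there is $h\in\mathscr F(X)$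 with $f=h$ on $U$; $\mathscr F_c(X)$ is the set of elements of $\mathscr F(X)$ with compact $\mathfrak m$-support. $\mathscr E$ extends to $\mathscr F_{\mathrm{loc}}(X)\times\mathscr F_c(X)$ by $\mathscr E(f,\phi):=\mathscr E(h,\phi)$ with $h\in\mathscr F(X)$ equal to $f$ in an open neighbourhood of the support of $\phi$; $\mathscr E_\lambda(u,v):=\mathscr E(u,v)+\lambda\int uv\,d\mathfrak m$. A function $f\in\mathscr F_{\mathrm{loc}}(X)$ is weakly $\lambda$-harmonic if $\mathscr E_\lambda(f,\phi)\le 0$ and $\mathscr E_\lambda(-f,\phi)\le0$ for all $0\le\phi\in\mathscr F_c(X)$. $H\ge0$ is the self-adjoint operator in $L^2(X,\mathfrak m)$ induced by $\mathscr E$, and $P_t=e^{-tH}$, extended consistently to a positivity preserving contraction semigroup on all $L^q(X,\mathfrak m)$, $q\in[1,\infty]$. For open $U\subset X$, $\mathscr F(U)$ is the closure of $C_c(U)\cap\mathscr F(X)$ w.r.t. $\mathscr E_1$; then $(U,\mathfrak m,\mathscr E,\mathscr F(U))$ is again a strongly local Dirichlet space, with semigroup denoted $P^U_t$; notions "on $U$" refer to this space. For $f\in\mathscr F(X)\cap L^\infty$ the energy measure $\Gamma(f)$ is defined by $\int\phi\,d\Gamma(f)=\mathscr E(f,\phi f)-\frac12\mathscr E(f^2,\phi)$ for $\phi\in\mathscr F(X)\cap C_c(X)$; it extends to $\mathscr F(X)$ and, by locality, to $\mathscr F_{\mathrm{loc}}(X)$. The space is: ultracontractive if $P_t(L^1(X,\mathfrak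 m))\subset L^\infty(X,\mathfrak m)$ for all $t>0$; doubly Feller if $P_t:C_0(X)\to C_0(X)$ for all $t\ge0$, $P_t:L^\infty(X,\mathfrak m)\to C(X)$ for all $t>0$, and $\lim_{t\to0+}P_tf(x)=f(x)$ for all $f\in C_0(X)$, $x\in X$ ($C_0$ = continuous functions vanishing at infinity); irreducible if every $f\in\mathscr F_{\mathrm{loc}}(X)$ with $\Gamma(f)=0$ is constant. It is locally smoothing if for every open $U\Subset X$: $(U,\mathfrak m,\mathscr E,\mathscr F(U))$ is ultracontractive, and there is an open $U'\subset X$ with $U\subset U'$, $U'\setminus\overline U\ne\emptyset$, such that $(U',\mathfrak m,\mathscr E,\mathscr F(U'))$ is doubly Feller and irreducible. A function $f\in L^1_{\mathrm{loc}}(X,\mathfrak m)$ is locally $\lambda$-shift defective if for every open $U\Subset X$ there is a weakly $\lambda$-harmonic $g\in C_b(U)$ on $U$ with $e^{-t\lambda}P^U_t(f|_U-g)\ge f|_U-g$ for all $t>0$; $f$ is locally $\lambda$-shift excessive if $-f$ is locally $\lambda$-shift defective. The intrinsic metric is the (possibly degenerate, $[0,\infty]$-valued) pseudo metric $\mathsf d^{\mathscr E}(x,y)=\sup\{f(x)-f(y): f\in\mathscr F_{\mathrm{loc}}(X)\cap C(X),\ d\Gamma(f)\le d\mathfrak m\}$, where $d\Gamma(f)\le d\mathfrak m$ means that $\Gamma(f)$ is absolutely continuous w.r.t. $\mathfrak m$ with density $\le1$. The space is strictly local if $\mathsf d^{\mathscr E}$ induces the original topology on $X$, and intrinsically complete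 if it is strictly local and complete with respect to $\mathsf d^{\mathscr E}$. *)

theory Defs
  imports "HOL-Analysis.Analysis"
begin

text \<open>
  Function classes modulo almost everywhere equality are represented by functions
  \<open>'a \<Rightarrow> real\<close>, and identities and inequalities between classes by \<open>AE\<close> statements.
  A space is an abstract topology, so only the values of a function on the \<open>topspace\<close> matter;
  in particular the restriction of \<open>f\<close> to an open set \<open>U\<close> is \<open>f\<close> itself, regarded as a
  function on the subspace \<open>U\<close>.
\<close>

section \<open>Lebesgue spaces, continuous functions, Radon measures\<close>

definition Lp :: "ennreal \<Rightarrow> 'a measure \<Rightarrow> ('a \<Rightarrow> real) set" where
  "Lp q M = {f \<in> borel_measurable M.
     if q = \<infinity> then \<exists>C. AE x in M. \<bar>f x\<bar> \<le> C
     else integrable M (\<lambda>x. \<bar>f x\<bar> powr enn2real q)}"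

definition Lp_norm :: "ennreal \<Rightarrow> 'a measure \<Rightarrow> ('a \<Rightarrow> real) \<Rightarrow> real" where
  "Lp_norm q M f =
     (if q = \<infinity> then Inf {C. 0 \<le> C \<and> (AE x in M. \<bar>f x\<bar> \<le> C)}
      else (\<integral>x. \<bar>f x\<bar> powr enn2real q \<partial>M) powr (1 / enn2real q))"

definition Lp_loc :: "ennreal \<Rightarrow> 'a topology \<Rightarrow> 'a measure \<Rightarrow> ('a \<Rightarrow> real) set" where
  "Lp_loc q X M = {f \<in> borel_measurable M. \<forall>K. compactin X K \<longrightarrow> (\<lambda>x. indicator K x * f x) \<in> Lp q M}"

definition L2_inner :: "'a measure \<Rightarrow> ('a \<Rightarrow> real) \<Rightarrow> ('a \<Rightarrow> real) \<Rightarrow> real" where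
  "L2_inner M u v = (\<integral>x. u x * v x \<partial>M)"

definition C_space :: "'a topology \<Rightarrow> ('a \<Rightarrow> real) set" where
  "C_space X = {f. continuous_map X euclideanreal f}"

definition Cb_space :: "'a topology \<Rightarrow> ('a \<Rightarrow> real) set" where
  "Cb_space X = {f \<in> C_space X. bounded (f ` topspace X)}"

definition C0_space :: "'a topology \<Rightarrow> ('a \<Rightarrow> real) set" where
  "C0_space X = {f \<in> C_space X. \<forall>\<epsilon>>0. compactin X {x \<in> topspace X. \<epsilon> \<le> \<bar>f x\<bar>}}"

text \<open>For open \<open>U\<close>, the elements of $C_c(U)$ extended by zero to \<open>X\<close>.\<close>

definition Cc_space :: "'a topology \<Rightarrow> 'a set \<Rightarrow> ('a \<Rightarrow> real) set" where
  "Cc_space X U = {f \<in> C_space X.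
     let S = X closure_of {x \<in> topspace X. f x \<noteq> 0} in compactin X S \<and> S \<subseteq> U}"

definition well_inside :: "'a topology \<Rightarrow> 'a set \<Rightarrow> 'a set \<Rightarrow> bool" where
  "well_inside X U V \<longleftrightarrow>
     openin X U \<and> openin X V \<and> compactin X (X closure_of U) \<and> X closure_of U \<subseteq> V"

definition radon_measure :: "'a topology \<Rightarrow> 'a measure \<Rightarrow> bool" where
  "radon_measure X M \<longleftrightarrow>
     sets M = sets (sigma (topspace X) {U. openin X U}) \<and>
     (\<forall>K. compactin X K \<longrightarrow> emeasure M K < \<infinity>) \<and>
     (\<forall>A\<in>sets M. emeasure M A = (SUP K\<in>{K. compactin X K \<and> K \<subseteq> A}. emeasure M K))"

definition full_support :: "'a topology \<Rightarrow> 'a measure \<Rightarrow> bool" where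
  "full_support X M \<longleftrightarrow> (\<forall>U. openin X U \<and> U \<noteq> {} \<longrightarrow> 0 < emeasure M U)"

definition ae_support :: "'a topology \<Rightarrow> 'a measure \<Rightarrow> ('a \<Rightarrow> real) \<Rightarrow> 'a set" where
  "ae_support X M f = topspace X - \<Union>{U. openin X U \<and> (AE x in M. x \<in> U \<longrightarrow> f x = 0)}"


section \<open>Strongly local Dirichlet spaces\<close>

record 'a form_space =
  top_of :: "'a topology"
  meas_of :: "'a measure"
  form_of :: "('a \<Rightarrow> real) \<Rightarrow> ('a \<Rightarrow> real) \<Rightarrow> real"
  dom_of :: "('a \<Rightarrow> real) set"

definition shifted_form :: "'a form_space \<Rightarrow> real \<Rightarrow> ('a \<Rightarrow> real) \<Rightarrow> ('a \<Rightarrow> real) \<Rightarrow> real" where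
  "shifted_form D \<alpha> u v = form_of D u v + \<alpha> * L2_inner (meas_of D) u v"

definition form_dist :: "'a form_space \<Rightarrow> ('a \<Rightarrow> real) \<Rightarrow> ('a \<Rightarrow> real) \<Rightarrow> real" where
  "form_dist D u v = sqrt (shifted_form D 1 (\<lambda>x. u x - v x) (\<lambda>x. u x - v x))"

text \<open>The second and third conjunct say that domain and form live on classes of functions.\<close>

definition closed_form :: "'a form_space \<Rightarrow> bool" where
  "closed_form D \<longleftrightarrow>
     dom_of D \<subseteq> Lp 2 (meas_of D) \<and>
     (\<forall>u\<in>dom_of D. \<forall>u'\<in>borel_measurable (meas_of D).
        (AE x in meas_of D. u x = u' x) \<longrightarrow> u' \<in> dom_of D) \<and>
     (\<forall>u\<in>dom_of D. \<forall>u'\<in>dom_of D. \<forall>v\<in>dom_of D.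
        (AE x in meas_of D. u x = u' x) \<longrightarrow> form_of D u v = form_of D u' v) \<and>
     (\<forall>u\<in>dom_of D. \<forall>v\<in>dom_of D. \<forall>a b. (\<lambda>x. a * u x + b * v x) \<in> dom_of D) \<and>
     (\<forall>u\<in>dom_of D. \<forall>v\<in>dom_of D. \<forall>w\<in>dom_of D. \<forall>a b.
        form_of D (\<lambda>x. a * u x + b * v x) w = a * form_of D u w + b * form_of D v w) \<and>
     (\<forall>u\<in>dom_of D. \<forall>v\<in>dom_of D. form_of D u v = form_of D v u) \<and>
     (\<forall>u\<in>dom_of D. 0 \<le> form_of D u u) \<and>
     (\<forall>f\<in>Lp 2 (meas_of D). \<forall>\<epsilon>>0. \<exists>u\<in>dom_of D. Lp_norm 2 (meas_of D) (\<lambda>x. f x - u x) < \<epsilon>) \<and>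
     (\<forall>s. (\<forall>n::nat. s n \<in> dom_of D) \<and>
          (\<forall>\<epsilon>>0. \<exists>N. \<forall>m\<ge>N. \<forall>n\<ge>N. form_dist D (s m) (s n) < \<epsilon>) \<longrightarrow>
          (\<exists>u\<in>dom_of D. (\<lambda>n. form_dist D (s n) u) \<longlonglongrightarrow> 0))"

definition markovian :: "'a form_space \<Rightarrow> bool" where
  "markovian D \<longleftrightarrow>
     (\<forall>T::real \<Rightarrow> real. 1-lipschitz_on UNIV T \<and> T 0 = 0 \<longrightarrow>
        (\<forall>f\<in>dom_of D. T \<circ> f \<in> dom_of D \<and> form_of D (T \<circ> f) (T \<circ> f) \<le> form_of D f f))"

definition dom_Cc :: "'a form_space \<Rightarrow> ('a \<Rightarrow> real) set" where
  "dom_Cc D = dom_of D \<inter> Cc_space (top_of D) (topspace (top_of D))"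

definition regular_form :: "'a form_space \<Rightarrow> bool" where
  "regular_form D \<longleftrightarrow>
     (\<forall>f\<in>Cc_space (top_of D) (topspace (top_of D)). \<forall>\<epsilon>>0.
        \<exists>g\<in>dom_Cc D. \<forall>x\<in>topspace (top_of D). \<bar>f x - g x\<bar> < \<epsilon>) \<and>
     (\<forall>f\<in>dom_of D. \<forall>\<epsilon>>0. \<exists>g\<in>dom_Cc D. form_dist D f g < \<epsilon>)"

definition strongly_local_form :: "'a form_space \<Rightarrow> bool" where
  "strongly_local_form D \<longleftrightarrow>
     (\<forall>u\<in>dom_of D. \<forall>v\<in>dom_of D.
        (\<exists>c. AE x in meas_of D. x \<in> ae_support (top_of D) (meas_of D) v \<longrightarrow> u x = c) \<longrightarrow>
        form_of D u v = 0)"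

definition strongly_local_dirichlet_space :: "'a form_space \<Rightarrow> bool" where
  "strongly_local_dirichlet_space D \<longleftrightarrow>
     locally_compact_space (top_of D) \<and> separable_space (top_of D) \<and> metrizable_space (top_of D) \<and>
     radon_measure (top_of D) (meas_of D) \<and> full_support (top_of D) (meas_of D) \<and>
     closed_form D \<and> markovian D \<and> regular_form D \<and> strongly_local_form D"

text \<open>
  For open \<open>U\<close>: the Dirichlet space on \<open>U\<close>. Its domain consists of the functions on \<open>U\<close> whose
  extension by zero is in the closure of $C_c(U) \cap F(X)$.
\<close>

definition subspace :: "'a form_space \<Rightarrow> 'a set \<Rightarrow> 'a form_space" where
  "subspace D U = \<lparr>
     top_of = subtopology (top_of D) U,
     meas_of = restrict_space (meas_of D) U,
     form_of = (\<lambda>u v. form_of D (\<lambda>x. indicator U x * u x) (\<lambda>x. indicator U x * v x)),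
     dom_of = {u. (\<lambda>x. indicator U x * u x) \<in> dom_of D \<and>
        (\<exists>\<phi>. (\<forall>n::nat. \<phi> n \<in> dom_of D \<inter> Cc_space (top_of D) U) \<and>
             (\<lambda>n. form_dist D (\<phi> n) (\<lambda>x. indicator U x * u x)) \<longlonglongrightarrow> 0)} \<rparr>"


section \<open>Local domain and weakly harmonic functions\<close>

definition dom_loc :: "'a form_space \<Rightarrow> ('a \<Rightarrow> real) set" where
  "dom_loc D = {f \<in> Lp_loc 2 (top_of D) (meas_of D).
     \<forall>U. well_inside (top_of D) U (topspace (top_of D)) \<longrightarrow>
       (\<exists>h\<in>dom_of D. AE x in meas_of D. x \<in> U \<longrightarrow> f x = h x)}"

definition dom_cpt :: "'a form_space \<Rightarrow> ('a \<Rightarrow> real) set" where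
  "dom_cpt D = {f \<in> dom_of D. compactin (top_of D) (ae_support (top_of D) (meas_of D) f)}"

definition form_loc :: "'a form_space \<Rightarrow> ('a \<Rightarrow> real) \<Rightarrow> ('a \<Rightarrow> real) \<Rightarrow> real" where
  "form_loc D f \<phi> = (THE r. \<exists>h\<in>dom_of D. \<exists>V.
     openin (top_of D) V \<and> ae_support (top_of D) (meas_of D) \<phi> \<subseteq> V \<and>
     (AE x in meas_of D. x \<in> V \<longrightarrow> f x = h x) \<and> r = form_of D h \<phi>)"

definition shifted_form_loc :: "'a form_space \<Rightarrow> real \<Rightarrow> ('a \<Rightarrow> real) \<Rightarrow> ('a \<Rightarrow> real) \<Rightarrow> real" where
  "shifted_form_loc D \<alpha> f \<phi> = form_loc D f \<phi> + \<alpha> * L2_inner (meas_of D) f \<phi>"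

definition weakly_harmonic :: "'a form_space \<Rightarrow> real \<Rightarrow> ('a \<Rightarrow> real) \<Rightarrow> bool" where
  "weakly_harmonic D \<alpha> f \<longleftrightarrow> f \<in> dom_loc D \<and>
     (\<forall>\<phi>\<in>dom_cpt D. (AE x in meas_of D. 0 \<le> \<phi> x) \<longrightarrow>
        shifted_form_loc D \<alpha> f \<phi> \<le> 0 \<and> shifted_form_loc D \<alpha> (\<lambda>x. - f x) \<phi> \<le> 0)"


section \<open>The heat semigroup\<close>

text \<open>\<open>form_operator D f g\<close> means that \<open>f\<close> is in the domain of the operator $H$ induced by
  the form, with $Hf = g$.\<close>

definition form_operator :: "'a form_space \<Rightarrow> ('a \<Rightarrow> real) \<Rightarrow> ('a \<Rightarrow> real) \<Rightarrow> bool" where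
  "form_operator D f g \<longleftrightarrow> f \<in> dom_of D \<and> g \<in> Lp 2 (meas_of D) \<and>
     (\<forall>v\<in>dom_of D. form_of D f v = L2_inner (meas_of D) g v)"

definition positive_contraction_semigroup ::
    "ennreal \<Rightarrow> 'a measure \<Rightarrow> (real \<Rightarrow> ('a \<Rightarrow> real) \<Rightarrow> ('a \<Rightarrow> real)) \<Rightarrow> bool" where
  "positive_contraction_semigroup q M P \<longleftrightarrow>
     (\<forall>t\<ge>0. \<forall>f\<in>Lp q M. P t f \<in> Lp q M \<and> Lp_norm q M (P t f) \<le> Lp_norm q M f) \<and>
     (\<forall>t\<ge>0. \<forall>f\<in>Lp q M. \<forall>g\<in>Lp q M. \<forall>a b.
        AE x in M. P t (\<lambda>y. a * f y + b * g y) x = a * P t f x + b * P t g x) \<and>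
     (\<forall>f\<in>Lp q M. AE x in M. P 0 f x = f x) \<and>
     (\<forall>s\<ge>0. \<forall>t\<ge>0. \<forall>f\<in>Lp q M. AE x in M. P (s + t) f x = P s (P t f) x) \<and>
     (\<forall>t\<ge>0. \<forall>f\<in>Lp q M. (AE x in M. 0 \<le> f x) \<longrightarrow> (AE x in M. 0 \<le> P t f x))"

text \<open>
  On $L^2$, the semigroup $e^{-tH}$ is the strongly continuous contraction semigroup with
  generator $-H$. A single operator \<open>P t\<close> acting on all $L^q$ encodes consistency. For
  $q < \infty$ the extension from $L^2 \cap L^q$ is unique by density; on $L^\infty$ it is
  pinned down by the usual requirement of continuity along bounded monotone sequences (the last
  conjunct).
\<close>

definition is_heat_semigroup ::
    "'a form_space \<Rightarrow> (real \<Rightarrow> ('a \<Rightarrow> real) \<Rightarrow> ('a \<Rightarrow> real)) \<Rightarrow> bool" where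
  "is_heat_semigroup D P \<longleftrightarrow>
     (\<forall>q\<ge>1. positive_contraction_semigroup q (meas_of D) P) \<and>
     (\<forall>f\<in>Lp 2 (meas_of D).
        ((\<lambda>t. Lp_norm 2 (meas_of D) (\<lambda>x. P t f x - f x)) \<longlongrightarrow> 0) (at_right 0)) \<and>
     (\<forall>f\<in>Lp 2 (meas_of D). \<forall>g\<in>Lp 2 (meas_of D).
        form_operator D f g \<longleftrightarrow>
        ((\<lambda>t. Lp_norm 2 (meas_of D) (\<lambda>x. (P t f x - f x) / t + g x)) \<longlongrightarrow> 0) (at_right 0)) \<and>
     (\<forall>t\<ge>0. \<forall>f\<in>Lp \<infinity> (meas_of D). \<forall>s. (\<forall>n::nat. s n \<in> Lp \<infinity> (meas_of D)) \<and>
        (AE x in meas_of D. (\<forall>n. 0 \<le> s n x \<and> s n x \<le> s (Suc n) x) \<and> (\<lambda>n. s n x) \<longlonglongrightarrow> f x) \<longrightarrow>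
        (AE x in meas_of D. (\<lambda>n. P t (s n) x) \<longlonglongrightarrow> P t f x))"

definition heat :: "'a form_space \<Rightarrow> real \<Rightarrow> ('a \<Rightarrow> real) \<Rightarrow> ('a \<Rightarrow> real)" where
  "heat D = (SOME P. is_heat_semigroup D P)"


section \<open>Energy measures\<close>

definition energy_bounded :: "'a form_space \<Rightarrow> ('a \<Rightarrow> real) \<Rightarrow> 'a measure" where
  "energy_bounded D f = (THE \<mu>. radon_measure (top_of D) \<mu> \<and>
     (\<forall>\<phi>\<in>dom_Cc D. (\<integral>x. \<phi> x \<partial>\<mu>) =
        form_of D f (\<lambda>x. \<phi> x * f x) - 1/2 * form_of D (\<lambda>x. (f x)\<^sup>2) \<phi>))"

text \<open>Extension to the whole domain by continuity with respect to the form norm.\<close>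

definition energy_dom :: "'a form_space \<Rightarrow> ('a \<Rightarrow> real) \<Rightarrow> 'a measure" where
  "energy_dom D f = (THE \<mu>. radon_measure (top_of D) \<mu> \<and>
     (\<forall>s. (\<forall>n::nat. s n \<in> dom_of D \<inter> Lp \<infinity> (meas_of D)) \<and> (\<lambda>n. form_dist D (s n) f) \<longlonglongrightarrow> 0 \<longrightarrow>
        (\<forall>\<phi>\<in>dom_Cc D. (\<lambda>n. \<integral>x. \<phi> x \<partial>energy_bounded D (s n)) \<longlonglongrightarrow> (\<integral>x. \<phi> x \<partial>\<mu>))))"

text \<open>Extension to the local domain by locality.\<close>

definition energy_measure :: "'a form_space \<Rightarrow> ('a \<Rightarrow> real) \<Rightarrow> 'a measure" where
  "energy_measure D f = (THE \<mu>. radon_measure (top_of D) \<mu> \<and>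
     (\<forall>U. well_inside (top_of D) U (topspace (top_of D)) \<longrightarrow>
        (\<forall>h\<in>dom_of D. (AE x in meas_of D. x \<in> U \<longrightarrow> f x = h x) \<longrightarrow>
           (\<forall>A\<in>sets \<mu>. A \<subseteq> U \<longrightarrow> emeasure \<mu> A = emeasure (energy_dom D h) A))))"


section \<open>Smoothing, irreducibility, intrinsic metric\<close>

definition ultracontractive :: "'a form_space \<Rightarrow> bool" where
  "ultracontractive D \<longleftrightarrow> (\<forall>t>0. heat D t ` Lp 1 (meas_of D) \<subseteq> Lp \<infinity> (meas_of D))"

text \<open>The continuous representative of a class, unique on the space because of full support.\<close>

definition cont_rep :: "'a form_space \<Rightarrow> ('a \<Rightarrow> real) \<Rightarrow> ('a \<Rightarrow> real)" where
  "cont_rep D u = (SOME g. g \<in> C_space (top_of D) \<and> (AE x in meas_of D. u x = g x))"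

definition doubly_feller :: "'a form_space \<Rightarrow> bool" where
  "doubly_feller D \<longleftrightarrow>
     (\<forall>t\<ge>0. \<forall>f\<in>C0_space (top_of D). \<exists>g\<in>C0_space (top_of D). AE x in meas_of D. heat D t f x = g x) \<and>
     (\<forall>t>0. \<forall>f\<in>Lp \<infinity> (meas_of D). \<exists>g\<in>C_space (top_of D). AE x in meas_of D. heat D t f x = g x) \<and>
     (\<forall>f\<in>C0_space (top_of D). \<forall>x\<in>topspace (top_of D).
        ((\<lambda>t. cont_rep D (heat D t f) x) \<longlongrightarrow> f x) (at_right 0))"

definition irreducible_form :: "'a form_space \<Rightarrow> bool" where
  "irreducible_form D \<longleftrightarrow>
     (\<forall>f\<in>dom_loc D. emeasure (energy_measure D f) (topspace (top_of D)) = 0 \<longrightarrow>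
        (\<exists>c. AE x in meas_of D. f x = c))"

definition locally_smoothing :: "'a form_space \<Rightarrow> bool" where
  "locally_smoothing D \<longleftrightarrow>
     (\<forall>U. well_inside (top_of D) U (topspace (top_of D)) \<longrightarrow>
        ultracontractive (subspace D U) \<and>
        (\<exists>U'. openin (top_of D) U' \<and> U \<subseteq> U' \<and> U' - (top_of D closure_of U) \<noteq> {} \<and>
           doubly_feller (subspace D U') \<and> irreducible_form (subspace D U')))"

definition intrinsic_dist :: "'a form_space \<Rightarrow> 'a \<Rightarrow> 'a \<Rightarrow> ereal" where
  "intrinsic_dist D x y =
     (SUP f \<in> {f \<in> dom_loc D \<inter> C_space (top_of D).
         absolutely_continuous (meas_of D) (energy_measure D f) \<and>
         (AE z in meas_of D. RN_deriv (meas_of D) (energy_measure D f) z \<le> 1)}.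
       ereal (f x - f y))"

definition strictly_local :: "'a form_space \<Rightarrow> bool" where
  "strictly_local D \<longleftrightarrow>
     (\<forall>U. openin (top_of D) U \<longleftrightarrow> U \<subseteq> topspace (top_of D) \<and>
        (\<forall>x\<in>U. \<exists>r>0. {y \<in> topspace (top_of D). intrinsic_dist D x y < ereal r} \<subseteq> U))"

definition intrinsically_complete :: "'a form_space \<Rightarrow> bool" where
  "intrinsically_complete D \<longleftrightarrow> strictly_local D \<and>
     (\<forall>s. (\<forall>n::nat. s n \<in> topspace (top_of D)) \<and>
          (\<forall>\<epsilon>>0. \<exists>N. \<forall>m\<ge>N. \<forall>n\<ge>N. intrinsic_dist D (s m) (s n) < ereal \<epsilon>) \<longrightarrow>
          (\<exists>x\<in>topspace (top_of D). (\<lambda>n. intrinsic_dist D (s n) x) \<longlonglongrightarrow> 0))"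


section \<open>Shift defective functions and positivity preservation\<close>

definition locally_shift_defective :: "'a form_space \<Rightarrow> real \<Rightarrow> ('a \<Rightarrow> real) \<Rightarrow> bool" where
  "locally_shift_defective D \<alpha> f \<longleftrightarrow> f \<in> Lp_loc 1 (top_of D) (meas_of D) \<and>
     (\<forall>U. well_inside (top_of D) U (topspace (top_of D)) \<longrightarrow>
        (\<exists>g\<in>Cb_space (subtopology (top_of D) U). weakly_harmonic (subspace D U) \<alpha> g \<and>
           (\<forall>t>0. AE x in restrict_space (meas_of D) U.
              f x - g x \<le> exp (- t * \<alpha>) * heat (subspace D U) t (\<lambda>y. f y - g y) x)))"

definition locally_shift_excessive :: "'a form_space \<Rightarrow> real \<Rightarrow> ('a \<Rightarrow> real) \<Rightarrow> bool" where
  "locally_shift_excessive D \<alpha> f \<longleftrightarrow> locally_shift_defective D \<alpha> (\<lambda>x. - f x)"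

definition Lq_positivity_preserving :: "'a form_space \<Rightarrow> ennreal \<Rightarrow> bool" where
  "Lq_positivity_preserving D q \<longleftrightarrow>
     (\<forall>f\<in>Lp q (meas_of D). locally_shift_excessive D 1 f \<longrightarrow> (AE x in meas_of D. 0 \<le> f x))"

end

theory Submission
  imports Defs
begin

text \<open>
  Put \<open>h = -f\<close> and \<open>p = q - 1\<close>. On \<open>U\<close> relatively compact there is a bounded harmonic \<open>g\<close> such that
  \<open>w = g - h\<close> is excessive for the semigroup of \<open>U\<close>; contractivity and the factor \<open>exp (- t)\<close> force \<open>w \<ge> 0\<close>. The truncations
  \<open>min w c\<close> are \<open>L\<^sup>2\<close> limits of supersolutions \<open>y\<close> in the domain, obtained from resolvents, so \<open>h\<close> is locally
  approximated by bounded subsolutions \<open>u = g - y\<close>. Testing with \<open>\<eta>\<^sup>2 \<psi> u\<close>, where \<open>\<psi>\<close> is the \<open>p\<close>-th power of the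
  positive part and \<open>\<eta>\<close> is a cutoff function, gives the Caccioppoli estimate
  \<open>\<integral> \<eta>\<^sup>2 u \<psi> u \<le> C \<integral> u \<psi> u d\<Gamma> \<eta>\<close>. Instead of a chain rule for energy measures this uses a pointwise inequality
  in two variables, integrated against the kernel of the resolvent: \<open>E u k\<close> is the limit of the integrals of
  \<open>(u x - u y) * (k x - k y)\<close>. By completeness and a Hopf-Rinow argument, for every compact set and every
  \<open>\<epsilon> > 0\<close> there is a compactly supported cutoff function equal to \<open>1\<close> on the set with energy density at most
  \<open>\<epsilon>\<^sup>2\<close>; letting \<open>\<epsilon>\<close> tend to \<open>0\<close> forces the positive part of \<open>h\<close> to vanish.
\<close>

text \<open>The obstacle is that \<open>h\<close> need not lie in the local domain and may be
  unbounded below, so no weak inequality can be tested on it directly. If \<open>c\<close> bounds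
  \<open>g\<close> on \<open>U\<close>, then \<open>g - min (g - h) c\<close> is bounded and has the
  same positive part as \<open>h\<close>: truncating at this level loses nothing that the estimate
  sees. The zeroth order term of the form shifted by 1 produces the left side of the estimate. With
  \<open>p = q - 1\<close> the function \<open>h * lip_powr p h\<close> is at most the
  \<open>q\<close>-th power of the positive part of \<open>h\<close>, whose integral is finite, and
  the constant in the estimate does not depend on the compact set. Heat semigroups and energy
  measures are given by \<open>SOME\<close> and \<open>THE\<close>, so nothing can be said about
  them before existence is proved. This explains two long constructions: a Riesz theorem for test
  functions in the domain (the energy functional is defined on these only) and an Euler scheme for
  the semigroup on relatively compact sets, where the measure is finite and all \<open>L^q\<close>
  lie in \<open>L^1\<close>. Strong locality enters by comparing functions that agree, or differ by
  a constant, near a support.\<close>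

notation LIMSEQ (infix "---->" 60)

section \<open>Semi-inner products on spaces of functions\<close>

locale semi_inner =
 fixes V :: "('a => real) set" and B :: "('a => real) => ('a => real) => real"
 assumes lin_mem: "!!u v a b. u : V ==> v : V ==> (%x. a * u x + b * v x) : V"
  and lin_left: "!!u v w a b. u : V ==> v : V ==> w : V ==>
   B (%x. a * u x + b * v x) w = a * B u w + b * B v w"
  and sym: "!!u v. u : V ==> v : V ==> B u v = B v u"
  and nonneg: "!!u. u : V ==> 0 <= B u u"
begin

lemma add_mem: "u : V ==> v : V ==> (%x. u x + v x) : V"
 using lin_mem[of u v 1 1] by simp

lemma diff_mem: "u : V ==> v : V ==> (%x. u x - v x) : V"
 using lin_mem[of u v 1 "-1"] by simp

lemma scale_mem: "u : V ==> (%x. a * u x) : V"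
 using lin_mem[of u u a 0] by simp

lemma uminus_mem: "u : V ==> (%x. - u x) : V"
 using scale_mem[of u "-1"] by simp

lemma zero_mem: "u : V ==> (%x. 0) : V"
 using scale_mem[of u 0] by simp

lemma lin_right: "u : V ==> v : V ==> w : V ==>
  B w (%x. a * u x + b * v x) = a * B w u + b * B w v"
 using lin_left[of u v w a b] sym lin_mem[of u v a b] by metis

lemma add_left: "u : V ==> v : V ==> w : V ==> B (%x. u x + v x) w = B u w + B v w"
 using lin_left[of u v w 1 1] by simp

lemma add_right: "u : V ==> v : V ==> w : V ==> B w (%x. u x + v x) = B w u + B w v"
 using lin_right[of u v w 1 1] by simp

lemma diff_left: "u : V ==> v : V ==> w : V ==> B (%x. u x - v x) w = B u w - B v w"
 using lin_left[of u v w 1 "-1"] by simp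

lemma diff_right: "u : V ==> v : V ==> w : V ==> B w (%x. u x - v x) = B w u - B w v"
 using lin_right[of u v w 1 "-1"] by simp

lemma scale_left: "u : V ==> w : V ==> B (%x. a * u x) w = a * B u w"
 using lin_left[of u u w a 0] by simp

lemma scale_right: "u : V ==> w : V ==> B w (%x. a * u x) = a * B w u"
 using lin_right[of u u w a 0] by simp

lemma uminus_left: "u : V ==> w : V ==> B (%x. - u x) w = - B u w"
 using scale_left[of u w "-1"] by simp

lemma uminus_right: "u : V ==> w : V ==> B w (%x. - u x) = - B w u"
 using scale_right[of u w "-1"] by simp

lemma zero_left: "w : V ==> B (%x. 0) w = 0"
 using scale_left[of w w 0] by simp

lemma add_self:
 assumes "u : V" "v : V"
 shows "B (%x. u x + v x) (%x. u x + v x) = B u u + 2 * B u v + B v v"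
 using assms add_mem[of u v] sym[of u v] by (simp add: add_left add_right)

lemma diff_self:
 assumes "u : V" "v : V"
 shows "B (%x. u x - v x) (%x. u x - v x) = B u u - 2 * B u v + B v v"
 using assms diff_mem[of u v] sym[of u v] by (simp add: diff_left diff_right)

lemma scale_self: "u : V ==> B (%x. a * u x) (%x. a * u x) = a\<^sup>2 * B u u"
 using scale_mem[of u a] by (simp add: scale_left scale_right power2_eq_square)

lemma diff_self_commute:
 assumes "u : V" "v : V"
 shows "B (%x. u x - v x) (%x. u x - v x) = B (%x. v x - u x) (%x. v x - u x)"
 using assms sym[of u v] by (simp add: diff_self)

lemma Cauchy_Schwarz:
 assumes u: "u : V" and v: "v : V"
 shows "(B u v)\<^sup>2 <= B u u * B v v"
proof -
 have q: "0 <= B u u - 2 * t * B u v + t\<^sup>2 * B v v" for t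
 proof -
  have "0 <= B (%x. u x - t * v x) (%x. u x - t * v x)"
   using u v by (intro nonneg diff_mem scale_mem)
  thus ?thesis
   using u v scale_mem[OF v, of t] by (simp add: diff_self scale_self scale_right)
 qed
 show ?thesis
 proof (cases "B v v = 0")
  case True
  have "B u v = 0"
  proof (rule ccontr)
   assume n: "B u v ~= 0"
   have "0 <= B u u - 2 * ((B u u + 1) / (2 * B u v)) * B u v"
    using q[of "(B u u + 1) / (2 * B u v)"] True by simp
   thus False using n by simp
  qed
  thus ?thesis using True by simp
 next
  case False
  hence p: "B v v > 0" using nonneg[OF v] by simp
  have "0 <= B u u - 2 * (B u v / B v v) * B u v + (B u v / B v v)\<^sup>2 * B v v"
   using q by blast
  also have "... = B u u - (B u v)\<^sup>2 / B v v"
   using p by (simp add: field_simps power2_eq_square)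
  finally show ?thesis using p by (simp add: field_simps)
 qed
qed

abbreviation nrm where "nrm u \<equiv> sqrt (B u u)"

lemma abs_le_nrm: "u : V ==> v : V ==> \<bar>B u v\<bar> <= nrm u * nrm v"
 using Cauchy_Schwarz[of u v] real_sqrt_le_mono[of "(B u v)\<^sup>2" "B u u * B v v"]
 by (simp add: real_sqrt_mult)

lemma nrm_add:
 assumes "u : V" "v : V"
 shows "nrm (%x. u x + v x) <= nrm u + nrm v"
proof (rule real_le_lsqrt)
 show "B (%x. u x + v x) (%x. u x + v x) <= (nrm u + nrm v)\<^sup>2"
  using abs_le_nrm[OF assms] nonneg assms by (simp add: add_self power2_sum)
qed (use nonneg assms in auto)

lemma nrm_diff_commute:
 assumes "u : V" "v : V"
 shows "nrm (%x. u x - v x) = nrm (%x. v x - u x)"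
 using diff_self_commute[OF assms] by simp

lemma nrm_diff:
 assumes "u : V" "v : V"
 shows "nrm (%x. u x - v x) <= nrm u + nrm v"
 using nrm_add[OF assms(1) uminus_mem[OF assms(2)]] assms uminus_mem[OF assms(2)]
 by (simp add: uminus_left uminus_right)

lemma nrm_triangle:
 assumes "u : V" "v : V" "w : V"
 shows "nrm (%x. u x - w x) <= nrm (%x. u x - v x) + nrm (%x. v x - w x)"
 using nrm_add[OF diff_mem[OF assms(1,2)] diff_mem[OF assms(2,3)]] by simp

lemma nrm_reverse:
 assumes "u : V" "v : V"
 shows "\<bar>nrm u - nrm v\<bar> <= nrm (%x. u x - v x)"
proof -
 have "nrm u <= nrm (%x. u x - v x) + nrm v"
  using nrm_add[OF diff_mem[OF assms] assms(2)] by simp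
 moreover have "nrm v <= nrm (%x. v x - u x) + nrm u"
  using nrm_add[OF diff_mem[OF assms(2,1)] assms(1)] by simp
 ultimately show ?thesis using nrm_diff_commute[OF assms] by auto
qed

lemma nrm_scale: "u : V ==> nrm (%x. a * u x) = \<bar>a\<bar> * nrm u"
 by (simp add: scale_self real_sqrt_mult)

lemma nrm_nonneg: "u : V ==> 0 <= nrm u"
 using nonneg by simp

lemma add_self_le:
 assumes "u : V" "v : V"
 shows "B (%x. u x + v x) (%x. u x + v x) <= 2 * B u u + 2 * B v v"
 using nonneg[OF diff_mem[OF assms]] assms by (simp add: add_self diff_self)

lemma diff_self_le:
 assumes "u : V" "v : V"
 shows "B (%x. u x - v x) (%x. u x - v x) <= 2 * B u u + 2 * B v v"
 using nonneg[OF add_mem[OF assms]] assms by (simp add: add_self diff_self)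

lemma tendsto_left:
 assumes s: "!!n. s n : V" and u: "u : V" and v: "v : V"
  and lim: "(%n::nat. nrm (%x. s n x - u x)) ----> 0"
 shows "(%n. B (s n) v) ----> B u v"
proof (rule LIM_zero_cancel, rule Lim_null_comparison)
 show "\<forall>\<^sub>F n in sequentially. norm (B (s n) v - B u v) <= nrm (%x. s n x - u x) * nrm v"
  using abs_le_nrm[OF diff_mem[OF s u] v] s u v by (simp add: diff_left)
 show "(%n. nrm (%x. s n x - u x) * nrm v) ----> 0"
  using tendsto_mult_right[OF lim, of "nrm v"] by simp
qed

lemma tendsto_nrm:
 assumes s: "!!n. s n : V" and u: "u : V"
  and lim: "(%n::nat. nrm (%x. s n x - u x)) ----> 0"
 shows "(%n. nrm (s n)) ----> nrm u"
proof (rule LIM_zero_cancel, rule Lim_null_comparison)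
 show "\<forall>\<^sub>F n in sequentially. norm (nrm (s n) - nrm u) <= nrm (%x. s n x - u x)"
  using nrm_reverse[OF s u] by simp
qed (use lim in simp)

lemma tendsto_self:
 assumes s: "!!n. s n : V" and u: "u : V"
  and lim: "(%n::nat. nrm (%x. s n x - u x)) ----> 0"
 shows "(%n. B (s n) (s n)) ----> B u u"
proof -
 have "(%n. (nrm (s n))\<^sup>2) ----> (nrm u)\<^sup>2"
  by (intro tendsto_power tendsto_nrm assms)
 thus ?thesis using s u nonneg by simp
qed

end

locale complete_semi_inner = semi_inner +
 assumes nonempty: "V ~= {}"
  and complete: "!!s. (!!n::nat. s n : V) ==>
   (!!e. e > 0 ==> EX N. ALL m>=N. ALL n>=N. B (%x. s m x - s n x) (%x. s m x - s n x) < e) ==>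
   EX u:V. (%n. nrm (%x. s n x - u x)) ----> 0"
begin

text \<open>Minimise \<open>J u = B u u - 2 * l u\<close>. The parallelogram law makes a minimising
  sequence Cauchy, and the first variation at the limit vanishes, which is the claim.
  \<open>B\<close> may be degenerate, so the minimiser is determined only up to null
  vectors.\<close>

lemma riesz_representation:
 assumes lin: "!!u v a b. u : V ==> v : V ==> l (%x. a * u x + b * v x) = a * l u + b * l v"
  and bdd: "!!u. u : V ==> \<bar>l u\<bar> <= c * nrm u"
 obtains u where "u : V" "!!v. v : V ==> B u v = l v"
proof -
 define J where "J u = B u u - 2 * l u" for u
 define j where "j = Inf (J ` V)"
 have low: "- c\<^sup>2 <= J u" if "u : V" for u
 proof -
  have "0 <= (nrm u - c)\<^sup>2" by simp
  hence "0 <= B u u - 2 * (c * nrm u) + c\<^sup>2"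
   using nonneg[OF that] by (simp add: power2_diff algebra_simps)
  thus ?thesis using bdd[OF that] unfolding J_def by linarith
 qed
 hence bb: "bdd_below (J ` V)" by (auto simp: bdd_below_def)
 have jle: "j <= J u" if "u : V" for u
  unfolding j_def using bb that by (auto intro: cInf_lower)
 have "EX u:V. J u < j + 1 / real (Suc n)" for n
  using cInf_lessD[of "J ` V" "j + 1 / real (Suc n)"] nonempty unfolding j_def by force
 then obtain s where s: "!!n. s n : V" "!!n. J (s n) < j + 1 / real (Suc n)" by metis
 have cau: "B (%x. s m x - s n x) (%x. s m x - s n x) <= 2 * (1 / real (Suc m)) + 2 * (1 / real (Suc n))" for m n
 proof -
  \<comment> \<open>The midpoint is a competitor too, so \<open>J ?h >= j\<close>; the parallelogram
    law converts this into smallness of the distance.\<close>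
  let ?h = "%x. 1/2 * s m x + 1/2 * s n x"
  have h: "?h : V" using s by (intro lin_mem)
  have "4 * B ?h ?h = B (s m) (s m) + 2 * B (s m) (s n) + B (s n) (s n)"
   using lin_left[OF s(1)[of m] s(1)[of n] h, of "1/2" "1/2"] sym[of "s m" "s n"]
    lin_right[OF s(1)[of m] s(1)[of n] s(1)[of m], of "1/2" "1/2"]
    lin_right[OF s(1)[of m] s(1)[of n] s(1)[of n], of "1/2" "1/2"] s(1)[of m] s(1)[of n]
   by argo
  moreover have "l ?h = 1/2 * l (s m) + 1/2 * l (s n)" using s by (intro lin)
  ultimately have "B (%x. s m x - s n x) (%x. s m x - s n x)
    = 2 * J (s m) + 2 * J (s n) - 4 * J ?h"
   using s by (simp add: diff_self J_def)
  thus ?thesis using jle[OF h] s(2)[of m] s(2)[of n] by linarith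
 qed
 have "EX N. ALL m>=N. ALL n>=N. B (%x. s m x - s n x) (%x. s m x - s n x) < e" if "e > 0" for e
 proof -
  obtain N where "1 / real (Suc N) < e / 4" using \<open>e > 0\<close> nat_approx_posE[of "e/4"] by auto
  hence N: "1 / real (Suc m) < e / 4" if "m >= N" for m
   using that by (smt (verit) frac_le of_nat_0_less_iff of_nat_mono Suc_le_mono zero_less_Suc)
  have "B (%x. s m x - s n x) (%x. s m x - s n x) < e" if "m >= N" "n >= N" for m n
  proof -
   have "2 * (1 / real (Suc m)) < e/2" "2 * (1 / real (Suc n)) < e/2"
    using N[of m] N[of n] that by simp_all
   thus ?thesis using cau[of m n] by linarith
  qed
  thus ?thesis by blast
 qed
 hence "EX u:V. (%n. nrm (%x. s n x - u x)) ----> 0"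
  by (rule complete[OF s(1)])
 then obtain u where u: "u : V" and lim: "(%n. nrm (%x. s n x - u x)) ----> 0" ..
 have ld: "l (%x. v x - w x) = l v - l w" if "v : V" "w : V" for v w
  using lin[OF that, of 1 "-1"] by simp
 have "(%n. l (s n) - l u) ----> 0"
 proof (rule Lim_null_comparison)
  show "\<forall>\<^sub>F n in sequentially. norm (l (s n) - l u) <= c * nrm (%x. s n x - u x)"
   using bdd[OF diff_mem[OF s(1) u]] ld[OF s(1) u] by simp
  show "(%n. c * nrm (%x. s n x - u x)) ----> 0" using tendsto_mult_left[OF lim, of c] by simp
 qed
 hence "(%n. l (s n)) ----> l u" by (rule LIM_zero_cancel)
 hence "(%n. J (s n)) ----> J u"
  unfolding J_def by (intro tendsto_diff tendsto_mult tendsto_const tendsto_self s(1) u lim)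
 moreover have "(%n. j + 1 / real (Suc n)) ----> j + 0"
  by (intro tendsto_add tendsto_const LIMSEQ_Suc[OF lim_1_over_n])
 ultimately have Ju: "J u <= j"
  using LIMSEQ_le[of "%n. J (s n)" "J u" "%n. j + 1 / real (Suc n)" j] less_imp_le[OF s(2)] by simp
 have "B u v = l v" if v: "v : V" for v
 proof -
  have q: "0 <= 2 * t * (B u v - l v) + t\<^sup>2 * B v v" for t
  proof -
   have m: "(%x. 1 * u x + t * v x) : V" using u v by (intro lin_mem)
   have "J u <= J (%x. 1 * u x + t * v x)" using Ju jle[OF m] by linarith
   thus ?thesis
    unfolding J_def lin[OF u v, of 1 t] using m u v sym[OF u v]
    by (simp add: lin_left[OF u v m, of 1 t, simplified] lin_right[OF u v u, of 1 t, simplified]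
      lin_right[OF u v v, of 1 t, simplified] algebra_simps power2_eq_square)
  qed
  define d where "d = B u v - l v"
  have "d = 0"
  proof (rule ccontr)
   assume "d ~= 0"
   \<comment> \<open>The choice \<open>t = - d / b\<close> makes the quadratic in \<open>q\<close>
     at most \<open>- (d\<^sup>2 / b)\<close>. Adding 1 keeps \<open>b\<close> positive when
     \<open>B v v = 0\<close>.\<close>
   define b where "b = B v v + 1"
   have b: "b > 0" "B v v < b" using nonneg[OF v] by (auto simp: b_def)
   have "0 <= 2 * (- d / b) * d + (- d / b)\<^sup>2 * B v v" using q unfolding d_def by blast
   also have "... <= 2 * (- d / b) * d + (- d / b)\<^sup>2 * b" using b by (intro add_left_mono mult_left_mono) auto
   also have "... = - (d\<^sup>2 / b)" using b by (simp add: field_simps power2_eq_square)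
   finally show False using b \<open>d ~= 0\<close> by (simp add: field_simps)
  qed
  thus ?thesis by (simp add: d_def)
 qed
 thus ?thesis using that u by blast
qed

end

section \<open>Square integrable functions\<close>

definition L2 :: "'a measure => ('a => real) set" where
 "L2 M = {f : borel_measurable M. integrable M (%x. (f x)\<^sup>2)}"

lemma Lp_2: "Lp 2 M = L2 M"
 by (simp add: Lp_def L2_def)

lemma L2_measurable [measurable_dest]: "f : L2 M ==> f : borel_measurable M"
 by (simp add: L2_def)

lemma L2_integrable_square: "f : L2 M ==> integrable M (%x. (f x)\<^sup>2)"
 by (simp add: L2_def)

lemma L2_integrable_mult:
 assumes "f : L2 M" "g : L2 M"
 shows "integrable M (%x. f x * g x)"
proof (rule Bochner_Integration.integrable_bound)
 show "integrable M (%x. (f x)\<^sup>2 + (g x)\<^sup>2)"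
  using assms by (intro Bochner_Integration.integrable_add L2_integrable_square)
 show "(%x. f x * g x) : borel_measurable M" using assms by measurable
 show "AE x in M. norm (f x * g x) <= norm ((f x)\<^sup>2 + (g x)\<^sup>2)"
 proof (rule AE_I2)
  fix x
  have "0 <= (\<bar>f x\<bar> - \<bar>g x\<bar>)\<^sup>2" by simp
  hence "2 * \<bar>f x * g x\<bar> <= (f x)\<^sup>2 + (g x)\<^sup>2" by (simp add: power2_diff abs_mult)
  thus "norm (f x * g x) <= norm ((f x)\<^sup>2 + (g x)\<^sup>2)" by simp
 qed
qed

lemma L2_lin:
 assumes "f : L2 M" "g : L2 M"
 shows "(%x. a * f x + b * g x) : L2 M"
proof -
 have "integrable M (%x. a\<^sup>2 * (f x)\<^sup>2 + 2 * a * b * (f x * g x) + b\<^sup>2 * (g x)\<^sup>2)"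
  using assms by (intro Bochner_Integration.integrable_add integrable_mult_right
    L2_integrable_square L2_integrable_mult)
 moreover have "(%x. a\<^sup>2 * (f x)\<^sup>2 + 2 * a * b * (f x * g x) + b\<^sup>2 * (g x)\<^sup>2) =
   (%x. (a * f x + b * g x)\<^sup>2)"
  by (auto simp: power2_eq_square algebra_simps)
 ultimately show ?thesis using assms by (auto simp: L2_def)
qed

interpretation L2: semi_inner "L2 M" "L2_inner M"
proof
 fix u v w :: "'a => real" and a b :: real
 assume *: "u : L2 M" "v : L2 M"
 thus "(%x. a * u x + b * v x) : L2 M" by (rule L2_lin)
 show "L2_inner M u v = L2_inner M v u" by (simp add: L2_inner_def mult.commute)
 assume "w : L2 M"
 hence "integrable M (%x. a * (u x * w x))" "integrable M (%x. b * (v x * w x))"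
  using * by (auto intro: L2_integrable_mult)
 hence "(LINT x|M. a * (u x * w x) + b * (v x * w x)) = (LINT x|M. a * (u x * w x)) + (LINT x|M. b * (v x * w x))"
  by (rule Bochner_Integration.integral_add)
 thus "L2_inner M (%x. a * u x + b * v x) w = a * L2_inner M u w + b * L2_inner M v w"
  by (simp add: L2_inner_def algebra_simps)
next
 show "0 <= L2_inner M u u" for u :: "'a => real" by (simp add: L2_inner_def)
qed

abbreviation L2_nrm :: "'a measure => ('a => real) => real" where
 "L2_nrm M u \<equiv> sqrt (L2_inner M u u)"

lemma Lp_norm_2: "Lp_norm 2 M f = L2_nrm M f"
 by (simp add: Lp_norm_def L2_inner_def powr_half_sqrt power2_eq_square)

lemma L2_bound:
 assumes "f : L2 M" "g : borel_measurable M" "AE x in M. \<bar>g x\<bar> <= \<bar>f x\<bar>"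
 shows "g : L2 M"
proof -
 have "integrable M (%x. (g x)\<^sup>2)"
  by (rule Bochner_Integration.integrable_bound[OF L2_integrable_square[OF assms(1)]])
   (use assms in \<open>auto simp: abs_le_square_iff\<close>)
 thus ?thesis using assms by (simp add: L2_def)
qed

lemma L2_inner_cong_AE:
 assumes "AE x in M. u x = u' x" "AE x in M. v x = v' x"
  and "u : borel_measurable M" "u' : borel_measurable M" "v : borel_measurable M" "v' : borel_measurable M"
 shows "L2_inner M u v = L2_inner M u' v'"
 unfolding L2_inner_def using assms by (intro integral_cong_AE) auto

lemma L2_inner_mono:
 assumes "u : L2 M" "v : L2 M" "u' : L2 M" "v' : L2 M"
  and "AE x in M. u x * v x <= u' x * v' x"
 shows "L2_inner M u v <= L2_inner M u' v'"
 unfolding L2_inner_def using assms by (intro integral_mono_AE L2_integrable_mult)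

lemma L2_inner_nonneg:
 assumes "AE x in M. 0 <= u x" "AE x in M. 0 <= v x"
 shows "0 <= L2_inner M u v"
 unfolding L2_inner_def using assms by (intro integral_nonneg_AE) auto

lemma L2_null:
 assumes "u : L2 M" "L2_inner M u u <= 0"
 shows "AE x in M. u x = 0"
proof -
 have "(LINT x|M. (u x)\<^sup>2) = 0"
  using assms(2) L2.nonneg[OF assms(1)] unfolding L2_inner_def power2_eq_square by linarith
 hence "AE x in M. (u x)\<^sup>2 = 0"
  using L2_integrable_square[OF assms(1)] by (subst (asm) integral_nonneg_eq_0_iff_AE) auto
 thus ?thesis by simp
qed

lemma L2_abs: "u : L2 M ==> (%x. \<bar>u x\<bar>) : L2 M"
 by (rule L2_bound[of u]) auto

section \<open>Resolvents of symmetric Markovian forms\<close>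

locale closed_markovian_form =
 fixes D :: "'a form_space"
 assumes closed: "closed_form D" and markov: "markovian D"
begin

abbreviation "M \<equiv> meas_of D"
abbreviation "E \<equiv> form_of D"
abbreviation "F \<equiv> dom_of D"
abbreviation ip :: "('a => real) => ('a => real) => real" where "ip \<equiv> L2_inner M"

lemmas closedD = closed[unfolded closed_form_def Lp_2 Lp_norm_2]

lemma dom_L2: "u : F ==> u : L2 M"
 using closedD[THEN conjunct1] by (rule subsetD)

lemma dom_measurable [measurable_dest]: "u : F ==> u : borel_measurable M"
 using dom_L2 L2_measurable by blast

lemma dom_cong: "u : F ==> u' : borel_measurable M ==> AE x in M. u x = u' x ==> u' : F"
 by (rule closedD[THEN conjunct2, THEN conjunct1, rule_format])

lemma form_cong_left:
 "u : F ==> u' : F ==> v : F ==> AE x in M. u x = u' x ==> E u v = E u' v"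
 by (rule closedD[THEN conjunct2, THEN conjunct2, THEN conjunct1, rule_format])

sublocale E: semi_inner F E
 using closed unfolding closed_form_def by unfold_locales blast+

lemma form_cong_right:
 "u : F ==> v : F ==> v' : F ==> AE x in M. v x = v' x ==> E u v = E u v'"
 using form_cong_left[of v v' u] E.sym by simp

lemma form_cong:
 "u : F ==> u' : F ==> v : F ==> v' : F ==> AE x in M. u x = u' x ==> AE x in M. v x = v' x ==>
  E u v = E u' v'"
 using form_cong_left[of u u' v] form_cong_right[of u' v v'] by simp

lemma dom_dense:
 assumes "f : L2 M" "0 < e" obtains u where "u : F" "L2_nrm M (%x. f x - u x) < e"
 using closedD[THEN conjunct2, THEN conjunct2, THEN conjunct2, THEN conjunct2, THEN conjunct2, THEN conjunct2, THEN conjunct2, THEN conjunct1,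
  rule_format, OF assms] that by blast

lemma dom_nonempty: "F ~= {}"
proof -
 have "(%x. 0) : L2 M" by (simp add: L2_def)
 then obtain u where "u : F" by (rule dom_dense[of _ 1]) simp
 thus ?thesis by blast
qed

lemma zero_dom: "(%x. 0) : F"
 using dom_nonempty E.zero_mem by blast

lemma shifted_semi_inner:
 assumes "0 <= \<alpha>" shows "semi_inner F (shifted_form D \<alpha>)"
proof
 fix u v w a b
 assume *: "u : F" "v : F"
 thus "(%x. a * u x + b * v x) : F" by (rule E.lin_mem)
 show "shifted_form D \<alpha> u v = shifted_form D \<alpha> v u"
  using E.sym[OF *] L2.sym[OF *[THEN dom_L2]] unfolding shifted_form_def by simp
 assume "w : F"
 thus "shifted_form D \<alpha> (%x. a * u x + b * v x) w = a * shifted_form D \<alpha> u w + b * shifted_form D \<alpha> v w"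
  using * by (simp add: shifted_form_def E.lin_left L2.lin_left dom_L2 algebra_simps)
next
 show "0 <= shifted_form D \<alpha> u u" if "u : F" for u
  using that assms E.nonneg[OF that] L2.nonneg[OF dom_L2[OF that]] by (simp add: shifted_form_def)
qed

text \<open>All shifted norms with positive shift are equivalent, with ratio at most
  \<open>max 1 (a / b)\<close>, so completeness passes from shift 1 to every other shift.\<close>

lemma shifted_complete:
 assumes "0 < \<alpha>" shows "complete_semi_inner F (shifted_form D \<alpha>)"
proof -
 interpret A: semi_inner F "shifted_form D \<alpha>" using assms by (intro shifted_semi_inner) simp
 interpret B: semi_inner F "shifted_form D 1" by (intro shifted_semi_inner) simp
 have le: "shifted_form D a u u <= max 1 (a / b) * shifted_form D b u u" if "u : F" "0 < a" "0 < b" for a b u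
 proof -
  have n: "0 <= E u u" "0 <= ip u u" using that E.nonneg L2.nonneg dom_L2 by auto
  have "a <= max 1 (a / b) * b" using that by (simp add: max_def field_simps)
  hence "E u u + a * ip u u <= max 1 (a/b) * E u u + max 1 (a / b) * b * ip u u"
   using n mult_right_mono[of 1 "max 1 (a/b)" "E u u"] by (intro add_mono mult_right_mono) auto
  thus ?thesis unfolding shifted_form_def by (simp add: algebra_simps)
 qed
 show ?thesis
 proof
  show "F ~= {}" by (rule dom_nonempty)
  fix s :: "nat => 'a => real"
  assume s: "!!n. s n : F"
   and c: "!!e. e > 0 ==> EX N. ALL m>=N. ALL n>=N. shifted_form D \<alpha> (%x. s m x - s n x) (%x. s m x - s n x) < e"
  define K where "K = max 1 (1 / \<alpha>)"
  have K: "K > 0" by (simp add: K_def)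
  have "EX N. ALL m>=N. ALL n>=N. form_dist D (s m) (s n) < e" if "e > 0" for e
  proof -
   have p: "0 < e\<^sup>2 / K" using K that by simp
   obtain N where N: "!!m n. m >= N ==> n >= N ==>
     shifted_form D \<alpha> (%x. s m x - s n x) (%x. s m x - s n x) < e\<^sup>2 / K"
    using c[OF p] by blast
   have "form_dist D (s m) (s n) < e" if "m >= N" "n >= N" for m n
   proof -
    have "shifted_form D 1 (%x. s m x - s n x) (%x. s m x - s n x)
      <= K * shifted_form D \<alpha> (%x. s m x - s n x) (%x. s m x - s n x)"
     unfolding K_def using s assms by (intro le E.diff_mem) auto
    also have "... < e\<^sup>2" using N[OF that] K by (simp add: field_simps)
    finally show ?thesis unfolding form_dist_def using \<open>e > 0\<close> by (intro real_less_lsqrt) auto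
   qed
   thus ?thesis by blast
  qed
  hence "(ALL n. s n : F) & (ALL e>0. EX N. ALL m>=N. ALL n>=N. form_dist D (s m) (s n) < e)" using s by blast
  hence "EX u:F. (%n. form_dist D (s n) u) ----> 0"
   by (rule closedD[THEN conjunct2, THEN conjunct2, THEN conjunct2, THEN conjunct2, THEN conjunct2,
     THEN conjunct2, THEN conjunct2, THEN conjunct2, THEN spec, THEN mp])
  then obtain u where u: "u : F" "(%n. form_dist D (s n) u) ----> 0" ..
  have "(%n. A.nrm (%x. s n x - u x)) ----> 0"
  proof (rule Lim_null_comparison)
   define L where "L = max 1 (\<alpha> / 1)"
   show "\<forall>\<^sub>F n in sequentially. norm (A.nrm (%x. s n x - u x)) <= sqrt L * form_dist D (s n) u"
   proof (rule always_eventually, rule allI)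
    fix n
    have "shifted_form D \<alpha> (%x. s n x - u x) (%x. s n x - u x) <= L * shifted_form D 1 (%x. s n x - u x) (%x. s n x - u x)"
     unfolding L_def using s[of n] u(1) assms by (intro le E.diff_mem) auto
    thus "norm (A.nrm (%x. s n x - u x)) <= sqrt L * form_dist D (s n) u"
     using A.nonneg[OF E.diff_mem[OF s u(1)]] unfolding form_dist_def real_sqrt_mult[symmetric] by simp
   qed
   show "(%n. sqrt L * form_dist D (s n) u) ----> 0" using tendsto_mult_left[OF u(2), of "sqrt L"] by simp
  qed
  thus "EX u:F. (%n. A.nrm (%x. s n x - u x)) ----> 0" using u by blast
 qed
qed

sublocale E1: complete_semi_inner F "shifted_form D 1"
 by (rule shifted_complete) simp

lemma form_dist_nrm: "form_dist D u v = E1.nrm (%x. u x - v x)"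
 by (simp add: form_dist_def)

text \<open>\<open>R \<alpha>\<close> is \<open>\<alpha>\<close> times the resolvent: $R_\alpha = \alpha (H + \alpha)^{-1}$.\<close>

definition R :: "real => ('a => real) => 'a => real" where
 "R \<alpha> g = (SOME u. u : F & (ALL v:F. E u v = \<alpha> * (ip g v - ip u v)))"

lemma R_spec:
 assumes "0 < \<alpha>" "g : L2 M"
 shows "R \<alpha> g : F & (ALL v:F. E (R \<alpha> g) v = \<alpha> * (ip g v - ip (R \<alpha> g) v))"
proof -
 interpret A: complete_semi_inner F "shifted_form D \<alpha>" by (rule shifted_complete) fact
 obtain u where u: "u : F" "!!v. v : F ==> shifted_form D \<alpha> u v = \<alpha> * ip g v"
 \<comment> \<open>The bound splits \<open>\<alpha>\<close> evenly: one factor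
   \<open>sqrt \<alpha>\<close> stays with \<open>g\<close>, the other is absorbed into the shifted
   norm of the argument.\<close>
 proof (rule A.riesz_representation[of "%v. \<alpha> * ip g v" "sqrt \<alpha> * L2_nrm M g"])
  show "\<alpha> * ip g (%x. a * u x + b * v x) = a * (\<alpha> * ip g u) + b * (\<alpha> * ip g v)" if "u : F" "v : F" for u v a b
   using that assms by (simp add: L2.lin_right dom_L2 algebra_simps)
  show "\<bar>\<alpha> * ip g u\<bar> <= sqrt \<alpha> * L2_nrm M g * A.nrm u" if "u : F" for u
  proof -
   have "\<bar>\<alpha> * ip g u\<bar> = \<alpha> * \<bar>ip g u\<bar>" using assms by (simp add: abs_mult)
   also have "... <= \<alpha> * (L2_nrm M g * L2_nrm M u)"
    using L2.abs_le_nrm[of g M u] assms that dom_L2 by (intro mult_left_mono) auto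
   also have "... = sqrt \<alpha> * L2_nrm M g * sqrt (\<alpha> * ip u u)"
    using assms by (simp add: real_sqrt_mult)
   also have "... <= sqrt \<alpha> * L2_nrm M g * A.nrm u"
    using assms E.nonneg[OF that] L2.nonneg[OF assms(2)] by (intro mult_left_mono) (auto simp: shifted_form_def)
   finally show ?thesis .
  qed
 qed auto
 hence "EX u. u : F & (ALL v:F. E u v = \<alpha> * (ip g v - ip u v))"
  by (auto simp: shifted_form_def algebra_simps)
 thus ?thesis unfolding R_def by (rule someI_ex)
qed

lemma R_mem: "0 < \<alpha> ==> g : L2 M ==> R \<alpha> g : F"
 and R_eq: "0 < \<alpha> ==> g : L2 M ==> v : F ==> E (R \<alpha> g) v = \<alpha> * (ip g v - ip (R \<alpha> g) v)"
 using R_spec by blast+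

lemma R_L2: "0 < \<alpha> ==> g : L2 M ==> R \<alpha> g : L2 M"
 using R_mem dom_L2 by blast

text \<open>Completing the square: \<open>R \<alpha> g\<close> minimises energy plus
  \<open>\<alpha>\<close> times the squared distance to \<open>g\<close>, and the excess of a
  competitor is its shifted distance to the minimiser. A competitor with no larger value must
  therefore coincide with \<open>R \<alpha> g\<close> almost everywhere.\<close>

lemma R_minimal:
 assumes "0 < \<alpha>" "g : L2 M" "v : F"
 defines "u \<equiv> R \<alpha> g"
 shows "E v v + \<alpha> * ip (%x. v x - g x) (%x. v x - g x) =
  E u u + \<alpha> * ip (%x. u x - g x) (%x. u x - g x)
   + (E (%x. v x - u x) (%x. v x - u x) + \<alpha> * ip (%x. v x - u x) (%x. v x - u x))"
proof -
 have u: "u : F" "E u v = \<alpha> * (ip g v - ip u v)" "E u u = \<alpha> * (ip g u - ip u u)"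
  unfolding u_def using assms(1-3) by (auto intro: R_mem R_eq R_eq[OF _ _ R_mem])
 have L: "u : L2 M" "v : L2 M" using u assms dom_L2 by auto
 have "ip u g = ip g u" "ip v g = ip g v" "ip u v = ip v u" "E u v = E v u"
  using L assms(2,3) u(1) L2.sym E.sym by auto
 thus ?thesis
  using u L assms by (simp add: E.diff_self L2.diff_self algebra_simps)
qed

lemma R_unique:
 assumes a: "0 < \<alpha>" and g: "g : L2 M" and u: "u : F"
  and eq: "!!v. v : F ==> E u v = \<alpha> * (ip g v - ip u v)"
 shows "AE x in M. u x = R \<alpha> g x"
proof -
 let ?r = "R \<alpha> g" and ?d = "%x. u x - R \<alpha> g x"
 have r: "?r : F" and d: "?d : F" using R_mem[OF a g] u E.diff_mem by auto
 have "E ?d ?d = - \<alpha> * ip ?d ?d"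
  using eq[OF d] R_eq[OF a g d] u r d by (simp add: E.diff_left L2.diff_left dom_L2 algebra_simps)
 hence "\<alpha> * ip ?d ?d <= 0" using E.nonneg[OF d] by simp
 hence "ip ?d ?d <= 0" using a by (simp add: mult_le_0_iff)
 thus ?thesis using L2_null[OF dom_L2[OF d]] by simp
qed

lemma R_lin:
 assumes "0 < \<alpha>" "f : L2 M" "g : L2 M"
 shows "AE x in M. R \<alpha> (%x. a * f x + b * g x) x = a * R \<alpha> f x + b * R \<alpha> g x"
proof -
 note r = R_mem[OF assms(1,2)] R_mem[OF assms(1,3)]
 have "AE x in M. a * R \<alpha> f x + b * R \<alpha> g x = R \<alpha> (%x. a * f x + b * g x) x"
 proof (rule R_unique)
  show "(%x. a * R \<alpha> f x + b * R \<alpha> g x) : F" using r by (rule E.lin_mem)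
  fix v assume v: "v : F"
  show "E (%x. a * R \<alpha> f x + b * R \<alpha> g x) v =
   \<alpha> * (ip (%x. a * f x + b * g x) v - ip (%x. a * R \<alpha> f x + b * R \<alpha> g x) v)"
   using v r assms by (simp add: E.lin_left L2.lin_left dom_L2 R_eq algebra_simps)
 qed (use assms L2_lin in auto)
 thus ?thesis by eventually_elim simp
qed

lemma R_cong:
 assumes "0 < \<alpha>" "f : L2 M" "g : L2 M" "AE x in M. f x = g x"
 shows "AE x in M. R \<alpha> f x = R \<alpha> g x"
proof (rule R_unique)
 show "E (R \<alpha> f) v = \<alpha> * (ip g v - ip (R \<alpha> f) v)" if "v : F" for v
  using R_eq[OF assms(1,2) that] L2_inner_cong_AE[OF assms(4), of v v] that assms dom_L2 L2_measurable by auto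
qed (use assms R_mem in auto)

lemma R_sum:
 fixes n :: nat
 assumes "0 < \<alpha>" "!!k. k < n ==> G k : L2 M"
 shows "(%x. \<Sum>k<n. c k * G k x) : L2 M &
  (AE x in M. R \<alpha> (%x. \<Sum>k<n. c k * G k x) x = (\<Sum>k<n. c k * R \<alpha> (G k) x))"
 using assms(2)
proof (induct n)
 case 0
 have z: "(%x. 0) : L2 M" by (simp add: L2_def)
 show ?case using R_lin[OF assms(1) z z, of 0 0] z by simp
next
 case (Suc n)
 hence G: "G n : L2 M" and IH: "(%x. \<Sum>k<n. c k * G k x) : L2 M"
  "AE x in M. R \<alpha> (%x. \<Sum>k<n. c k * G k x) x = (\<Sum>k<n. c k * R \<alpha> (G k) x)" by auto
 show ?case
  using L2_lin[OF IH(1) G, of 1 "c n"] R_lin[OF assms(1) IH(1) G, of 1 "c n"] IH(2) by auto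
qed

lemma R_sym:
 assumes "0 < \<alpha>" "f : L2 M" "g : L2 M"
 shows "ip (R \<alpha> f) g = ip f (R \<alpha> g)"
proof -
 note r = R_mem[OF assms(1,2)] R_mem[OF assms(1,3)]
 have "ip (R \<alpha> f) (R \<alpha> g) = ip (R \<alpha> g) (R \<alpha> f)" using r dom_L2 L2.sym by blast
 hence "\<alpha> * ip f (R \<alpha> g) = \<alpha> * ip g (R \<alpha> f)"
  using R_eq[OF assms(1,2) r(2)] R_eq[OF assms(1,3) r(1)] E.sym[OF r]
  by (simp only: right_diff_distrib)
 thus ?thesis using assms(1) L2.sym[OF assms(3) dom_L2[OF r(1)]] by simp
qed

lemma R_inner_ge:
 assumes "0 < \<alpha>" "g : L2 M"
 shows "ip (R \<alpha> g) (R \<alpha> g) <= ip g (R \<alpha> g)"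
proof -
 have r: "R \<alpha> g : F" using R_mem assms by blast
 have "0 <= \<alpha> * (ip g (R \<alpha> g) - ip (R \<alpha> g) (R \<alpha> g))" using R_eq[OF assms r] E.nonneg[OF r] by simp
 thus ?thesis using assms(1) by (simp add: zero_le_mult_iff)
qed

lemma R_inner_nonneg:
 assumes "0 < \<alpha>" "g : L2 M"
 shows "0 <= ip g (R \<alpha> g)"
 using R_inner_ge[OF assms] L2.nonneg[OF R_L2[OF assms]] by linarith

lemma R_contraction:
 assumes "0 < \<alpha>" "g : L2 M"
 shows "L2_nrm M (R \<alpha> g) <= L2_nrm M g"
proof -
 let ?r = "L2_nrm M (R \<alpha> g)"
 have "?r * ?r <= L2_nrm M g * ?r"
  using R_inner_ge[OF assms] L2.abs_le_nrm[OF assms(2) R_L2[OF assms]] L2.nonneg[OF R_L2[OF assms]]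
  by simp
 moreover have "0 <= ?r" using L2.nrm_nonneg[OF R_L2[OF assms]] .
 ultimately show ?thesis
  using L2.nrm_nonneg[OF assms(2)] by (metis less_eq_real_def mult_le_cancel_right not_less)
qed

lemma lipschitz_dom:
 assumes "u : F" "1-lipschitz_on UNIV T" "T 0 = 0"
 shows "(%x. T (u x)) : F" "E (%x. T (u x)) (%x. T (u x)) <= E u u"
 using markov assms unfolding markovian_def comp_def by blast+

text \<open>Cutting \<open>R \<alpha> g\<close> at \<open>c\<close> raises neither the energy
  (Markov property) nor the distance to \<open>g\<close>, which already lies below \<open>c\<close>.
  By \<open>R_minimal\<close> the cut changes nothing.\<close>

lemma R_le:
 assumes a: "0 < \<alpha>" and g: "g : L2 M" and c: "0 <= c" and gc: "AE x in M. g x <= c"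
 shows "AE x in M. R \<alpha> g x <= c"
proof -
 let ?u = "R \<alpha> g"
 define T where "T = (%x::real. min x c)"
 have T: "1-lipschitz_on UNIV T" "T 0 = 0"
  using c by (auto simp: T_def lipschitz_on_def dist_real_def)
 have u: "?u : F" using R_mem[OF a g] .
 note Tu = lipschitz_dom[OF u T]
 let ?d = "%x. T (?u x) - ?u x"
 have d: "?d : F" using Tu u E.diff_mem by blast
 have m1: "(%x. T (?u x) - g x) : L2 M" "(%x. ?u x - g x) : L2 M"
  using Tu(1) u g dom_L2 L2.diff_mem by auto
 have "ip (%x. T (?u x) - g x) (%x. T (?u x) - g x) <= ip (%x. ?u x - g x) (%x. ?u x - g x)"
 proof (rule L2_inner_mono[OF m1(1) m1(1) m1(2) m1(2)])
  have "(T (?u x) - g x) * (T (?u x) - g x) <= (?u x - g x) * (?u x - g x)" if "g x <= c" for x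
  proof -
   have "\<bar>T (?u x) - g x\<bar> <= \<bar>?u x - g x\<bar>" using that by (auto simp: T_def)
   thus ?thesis by (metis abs_le_square_iff power2_eq_square)
  qed
  thus "AE x in M. (T (?u x) - g x) * (T (?u x) - g x) <= (?u x - g x) * (?u x - g x)"
   using gc by (auto elim: eventually_mono)
 qed
 hence "\<alpha> * ip (%x. T (?u x) - g x) (%x. T (?u x) - g x) <= \<alpha> * ip (%x. ?u x - g x) (%x. ?u x - g x)"
  using a by simp
 hence "\<alpha> * ip ?d ?d <= 0"
  using R_minimal[OF a g Tu(1)] Tu(2) E.nonneg[OF d] by linarith
 hence "ip ?d ?d <= 0" using a by (simp add: mult_le_0_iff)
 hence "AE x in M. ?d x = 0" using L2_null[OF dom_L2[OF d]] by simp
 thus ?thesis by eventually_elim (simp add: T_def min_def split: if_splits)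
qed

lemma R_uminus:
 assumes "0 < \<alpha>" "g : L2 M"
 shows "AE x in M. R \<alpha> (%x. - g x) x = - R \<alpha> g x"
 using R_lin[OF assms(1,2,2), of "-1" 0] by simp

lemma R_ge:
 assumes a: "0 < \<alpha>" and g: "g : L2 M" and c: "c <= 0" and gc: "AE x in M. c <= g x"
 shows "AE x in M. c <= R \<alpha> g x"
proof -
 have "AE x in M. R \<alpha> (%x. - g x) x <= - c"
  using gc c by (intro R_le a L2.uminus_mem g) auto
 with R_uminus[OF a g] show ?thesis by eventually_elim simp
qed

lemma R_nonneg: "0 < \<alpha> ==> g : L2 M ==> AE x in M. 0 <= g x ==> AE x in M. 0 <= R \<alpha> g x"
 using R_ge[of \<alpha> g 0] by simp

lemma R_mono:
 assumes "0 < \<alpha>" "f : L2 M" "g : L2 M" "AE x in M. f x <= g x"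
 shows "AE x in M. R \<alpha> f x <= R \<alpha> g x"
proof -
 have "AE x in M. 0 <= R \<alpha> (%x. 1 * g x + (-1) * f x) x"
  by (rule R_nonneg[OF assms(1) L2_lin[OF assms(3,2)]]) (use assms(4) in auto)
 with R_lin[OF assms(1,3,2), of 1 "-1"] show ?thesis by eventually_elim simp
qed

text \<open>The resolvent identity, rewritten for resolvents that carry the factor
  \<open>\<alpha>\<close>. It is checked by inserting the right side into the equation that
  determines \<open>R \<gamma> u\<close>.\<close>

lemma R_difference:
 assumes b: "0 < \<beta>" and c: "0 < \<gamma>" and u: "u : L2 M"
 shows "AE x in M. R \<gamma> u x = R \<beta> u x + (1 - \<beta> / \<gamma>) * R \<gamma> (%x. u x - R \<beta> u x) x"
proof -
 let ?b = "R \<beta> u" and ?w = "%x. u x - R \<beta> u x"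
 let ?y = "%x. 1 * ?b x + (1 - \<beta> / \<gamma>) * R \<gamma> ?w x"
 have w: "?w : L2 M" using u R_L2[OF b u] L2.diff_mem by blast
 have F: "?b : F" "R \<gamma> ?w : F" using R_mem b c u w by auto
 have "AE x in M. ?y x = R \<gamma> u x"
 proof (rule R_unique[OF c u])
  show "?y : F" using F by (intro E.lin_mem)
  fix v assume v: "v : F"
  have L: "v : L2 M" "?b : L2 M" "R \<gamma> ?w : L2 M" using v F dom_L2 by auto
  have "E ?y v = \<beta> * (ip u v - ip ?b v) + (1 - \<beta> / \<gamma>) * (\<gamma> * (ip ?w v - ip (R \<gamma> ?w) v))"
   using E.lin_left[OF F v, of 1 "1 - \<beta> / \<gamma>"] R_eq[OF b u v] R_eq[OF c w v] by simp
  also have "... = \<gamma> * (ip u v - ip ?y v)"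
   using c u L L(1)
   unfolding L2.lin_left[OF L(2,3,1), of 1 "1 - \<beta> / \<gamma>"] L2.diff_left[OF u L(2,1)] by (simp add: field_simps)
  finally show "E ?y v = \<gamma> * (ip u v - ip ?y v)" .
 qed
 thus ?thesis by eventually_elim simp
qed

text \<open>With \<open>u\<close> itself as competitor in \<open>R_minimal\<close> the squared
  distance between \<open>u\<close> and \<open>R \<alpha> u\<close> occurs twice, hence the factor
  2.\<close>

lemma R_form_le:
 assumes "0 < \<alpha>" "u : F"
 shows "E (R \<alpha> u) (R \<alpha> u) + 2 * \<alpha> * ip (%x. R \<alpha> u x - u x) (%x. R \<alpha> u x - u x) <= E u u"
proof -
 have u: "u : L2 M" using assms dom_L2 by blast
 have "ip (%x. u x - R \<alpha> u x) (%x. u x - R \<alpha> u x) = ip (%x. R \<alpha> u x - u x) (%x. R \<alpha> u x - u x)"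
  using L2.diff_self_commute[OF u R_L2[OF assms(1) u]] .
 moreover have "ip (%x. u x - u x) (%x. u x - u x) = 0" by (simp add: L2_inner_def)
 ultimately show ?thesis
  using R_minimal[OF assms(1) u assms(2)] E.nonneg[OF E.diff_mem[OF assms(2) R_mem[OF assms(1) u]]] by simp
qed

text \<open>By the resolvent identity, \<open>E (R \<beta> u)\<close> applied to the increment is a
  nonnegative multiple of \<open>ip ?w (R \<gamma> ?w)\<close>. The energies therefore increase with
  the parameter, and their numerical increments dominate the squared form distance.\<close>

lemma R_form_increment:
 assumes b: "0 < \<beta>" and c: "\<beta> <= \<gamma>" and u: "u : F"
 shows "E (%x. R \<gamma> u x - R \<beta> u x) (%x. R \<gamma> u x - R \<beta> u x) <= E (R \<gamma> u) (R \<gamma> u) - E (R \<beta> u) (R \<beta> u)"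
proof -
 have c': "0 < \<gamma>" using b c by simp
 have uL: "u : L2 M" using u dom_L2 by blast
 let ?b = "R \<beta> u" and ?c = "R \<gamma> u" and ?w = "%x. u x - R \<beta> u x"
 have F: "?b : F" "?c : F" using R_mem b c' uL by auto
 have w: "?w : L2 M" using uL F dom_L2 L2.diff_mem by blast
 have "ip ?w (%x. ?c x - ?b x) = ip ?w (%x. (1 - \<beta> / \<gamma>) * R \<gamma> ?w x)"
  using R_difference[OF b c' uL] w F R_mem[OF c' w] dom_measurable L2_measurable
  by (intro L2_inner_cong_AE) (auto elim: eventually_mono)
 also have "... = (1 - \<beta> / \<gamma>) * ip ?w (R \<gamma> ?w)" using w R_L2[OF c' w] by (rule L2.scale_right[rotated])
 also have "... >= 0" using R_inner_nonneg[OF c' w] b c by (intro mult_nonneg_nonneg) auto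
 finally have "0 <= \<beta> * ip ?w (%x. ?c x - ?b x)" using b by simp
 also have "... = E ?b (%x. ?c x - ?b x)"
  using R_eq[OF b uL E.diff_mem[OF F(2,1)]] L2.diff_left[OF uL dom_L2[OF F(1)] dom_L2[OF E.diff_mem[OF F(2,1)]]] by simp
 also have "... = E ?b ?c - E ?b ?b" using F by (simp add: E.diff_right)
 finally have "E ?b ?b <= E ?c ?b" using E.sym[OF F] by simp
 thus ?thesis using F by (simp add: E.diff_self)
qed

end

section \<open>Convergence of resolvents, and weak convergence under bounded energy\<close>

context closed_markovian_form
begin

abbreviation Rn :: "nat => ('a => real) => 'a => real" where "Rn n \<equiv> R (real (Suc n))"

lemma L2_le_E1: "u : F ==> L2_nrm M u <= E1.nrm u"
 using E.nonneg[of u] by (simp add: shifted_form_def)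

lemma E_le_E1: "u : F ==> E.nrm u <= E1.nrm u"
 using L2.nonneg[OF dom_L2[of u]] by (simp add: shifted_form_def)

lemma E1_cong:
 assumes "u : F" "v : F" "AE x in M. u x = v x"
 shows "shifted_form D 1 u u = shifted_form D 1 v v"
 using form_cong[OF assms(1,2,1,2,3,3)] L2_inner_cong_AE[OF assms(3,3)] assms(1,2) dom_measurable
 by (simp add: shifted_form_def)

lemma Rn_L2_le:
 assumes "u : F"
 shows "ip (%x. Rn n u x - u x) (%x. Rn n u x - u x) <= E u u * (1 / real (Suc n))"
proof -
 let ?w = "%x. Rn n u x - u x"
 have L: "u : L2 M" using assms dom_L2 by blast
 have w: "?w : F" using assms R_mem[OF _ L] E.diff_mem by simp
 have "2 * real (Suc n) * ip ?w ?w <= E u u"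
  using R_form_le[of "real (Suc n)" u] assms E.nonneg[OF R_mem[OF _ L, of "real (Suc n)"]] by simp
 moreover have "real (Suc n) * ip ?w ?w <= 2 * real (Suc n) * ip ?w ?w"
  using mult_right_mono[OF _ L2.nonneg[OF dom_L2[OF w]], of "real (Suc n)" "2 * real (Suc n)"] by simp
 ultimately have "real (Suc n) * ip ?w ?w <= E u u" by linarith
 thus ?thesis by (simp add: field_simps)
qed

text \<open>The energies of \<open>Rn n u\<close> increase and stay below that of \<open>u\<close>,
  so \<open>R_form_increment\<close> makes the sequence Cauchy. Its limit is \<open>u\<close>
  because \<open>Rn_L2_le\<close> already gives convergence in \<open>L^2\<close>.\<close>

lemma Rn_form_tendsto:
 assumes u: "u : F"
 shows "(%n. E1.nrm (%x. Rn n u x - u x)) ----> 0"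
proof -
 have L: "u : L2 M" using u dom_L2 by blast
 have r: "Rn n u : F" for n using R_mem[OF _ L] by simp
 define a where "a n = E (Rn n u) (Rn n u)" for n
 have inc: "E (%x. Rn m u x - Rn n u x) (%x. Rn m u x - Rn n u x) <= \<bar>a m - a n\<bar>" for m n
 proof -
  have *: "E (%x. Rn m u x - Rn n u x) (%x. Rn m u x - Rn n u x) <= \<bar>a m - a n\<bar>" if "n <= m" for m n
   using R_form_increment[of "real (Suc n)" "real (Suc m)" u] that u unfolding a_def by auto
  show ?thesis
   using *[of n m] *[of m n] E.diff_self_commute[OF r[of m] r[of n]] by (cases "n <= m") (auto simp: abs_minus_commute)
 qed
 have "incseq a"
 proof (rule monoI)
  fix m n :: nat assume "m <= n"
  hence "E (%x. Rn n u x - Rn m u x) (%x. Rn n u x - Rn m u x) <= a n - a m"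
   using R_form_increment[of "real (Suc m)" "real (Suc n)" u] u unfolding a_def by auto
  thus "a m <= a n" using E.nonneg[OF E.diff_mem[OF r[of n] r[of m]]] by linarith
 qed
 moreover have "a n <= E u u" for n
  using R_form_le[of "real (Suc n)" u] u L2.nonneg[OF dom_L2[OF E.diff_mem[OF r[of n] u]]]
  unfolding a_def by (smt (verit) mult_nonneg_nonneg of_nat_0_less_iff zero_less_Suc)
 ultimately have "convergent a" using incseq_convergent[of a "E u u"] unfolding convergent_def by blast
 hence cau: "Cauchy a" by (rule convergent_Cauchy)
 define p where "p n = E u u * (1 / real (Suc n))" for n
 have p0: "p ----> 0"
  unfolding p_def using tendsto_mult_left[OF LIMSEQ_Suc[OF lim_1_over_n], of "E u u"] by simp
 have "EX N. ALL m>=N. ALL n>=N. shifted_form D 1 (%x. Rn m u x - Rn n u x) (%x. Rn m u x - Rn n u x) < e" if "e > 0" for e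
 proof -
  obtain N1 where N1: "!!m n. m >= N1 ==> n >= N1 ==> \<bar>a m - a n\<bar> < e / 2"
   using CauchyD[OF cau, of "e/2"] \<open>e > 0\<close> by auto
  have "\<forall>\<^sub>F n in sequentially. p n < e / 8"
   using order_tendstoD(2)[OF p0, of "e/8"] \<open>e > 0\<close> by simp
  then obtain N2 where N2: "!!n. n >= N2 ==> p n < e / 8"
   unfolding eventually_sequentially by blast
  have "shifted_form D 1 (%x. Rn m u x - Rn n u x) (%x. Rn m u x - Rn n u x) < e" if "m >= max N1 N2" "n >= max N1 N2" for m n
  proof -
   let ?w = "%k x. Rn k u x - u x"
   have w: "?w k : L2 M" "ip (?w k) (?w k) <= p k" for k
    using Rn_L2_le[OF u, of k] L2.diff_mem[OF dom_L2[OF r[of k]] L] unfolding p_def by auto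
   have "ip (%x. ?w m x - ?w n x) (%x. ?w m x - ?w n x) <= 2 * p m + 2 * p n"
    using L2.diff_self_le[OF w(1)[of m] w(1)[of n]] w(2)[of m] w(2)[of n] by linarith
   hence "ip (%x. Rn m u x - Rn n u x) (%x. Rn m u x - Rn n u x) < e / 2"
    using N2[of m] N2[of n] that by simp
   thus ?thesis using inc[of m n] N1[of m n] that by (simp add: shifted_form_def)
  qed
  thus ?thesis by blast
 qed
 hence "EX w:F. (%n. E1.nrm (%x. Rn n u x - w x)) ----> 0" by (rule E1.complete[OF r])
 then obtain w where w: "w : F" and lim: "(%n. E1.nrm (%x. Rn n u x - w x)) ----> 0" ..
 have "(%n. E1.nrm (%x. Rn n u x - w x) + sqrt (p n)) ----> 0 + sqrt 0"
  by (intro tendsto_add lim tendsto_real_sqrt p0)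
 moreover have "L2_nrm M (%x. w x - u x) <= E1.nrm (%x. Rn n u x - w x) + sqrt (p n)" for n
 proof -
  have "L2_nrm M (%x. w x - u x) <= L2_nrm M (%x. w x - Rn n u x) + L2_nrm M (%x. Rn n u x - u x)"
   using L2.nrm_triangle[OF dom_L2[OF w] dom_L2[OF r[of n]] L] .
  also have "L2_nrm M (%x. w x - Rn n u x) = L2_nrm M (%x. Rn n u x - w x)"
   using L2.nrm_diff_commute[OF dom_L2[OF w] dom_L2[OF r[of n]]] .
  finally show ?thesis
   using L2_le_E1[OF E.diff_mem[OF r[of n] w]] real_sqrt_le_mono[OF Rn_L2_le[OF u, of n]] unfolding p_def by linarith
 qed
 ultimately have "L2_nrm M (%x. w x - u x) <= 0"
  by (intro LIMSEQ_le_const[where X="%n. E1.nrm (%x. Rn n u x - w x) + sqrt (p n)"]) auto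
 hence "ip (%x. w x - u x) (%x. w x - u x) <= 0" by simp
 hence ae: "AE x in M. w x - u x = 0" by (intro L2_null dom_L2 E.diff_mem w u)
 have "E1.nrm (%x. Rn n u x - u x) = E1.nrm (%x. Rn n u x - w x)" for n
 proof -
  have "AE x in M. Rn n u x - u x = Rn n u x - w x" using ae by eventually_elim simp
  thus ?thesis using E1_cong[OF E.diff_mem[OF r[of n] u] E.diff_mem[OF r[of n] w]] by simp
 qed
 thus ?thesis using lim by simp
qed

text \<open>True on the domain by \<open>Rn_form_tendsto\<close>; density and contractivity of the
  resolvent carry it to all of \<open>L^2\<close>.\<close>

lemma Rn_L2_tendsto:
 assumes g: "g : L2 M"
 shows "(%n. L2_nrm M (%x. Rn n g x - g x)) ----> 0"
proof (rule LIMSEQ_I)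
 fix e :: real assume e: "0 < e"
 hence e4: "0 < e / 4" by simp
 obtain u where u: "u : F" and gu: "L2_nrm M (%x. g x - u x) < e / 4" by (rule dom_dense[OF g e4])
 have uL: "u : L2 M" using u dom_L2 by blast
 have "(%n. L2_nrm M (%x. Rn n u x - u x)) ----> 0"
 proof (rule Lim_null_comparison[OF _ Rn_form_tendsto[OF u]])
  show "\<forall>\<^sub>F n in sequentially. norm (L2_nrm M (%x. Rn n u x - u x)) <= E1.nrm (%x. Rn n u x - u x)"
   using L2_le_E1[OF E.diff_mem[OF R_mem[OF _ uL] u]] L2.nrm_nonneg[OF L2.diff_mem[OF R_L2[OF _ uL] uL]] by simp
 qed
 then obtain N where N: "!!n. n >= N ==> norm (L2_nrm M (%x. Rn n u x - u x) - 0) < e / 4"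
  using LIMSEQ_D[OF _ e4] by blast
 have "norm (L2_nrm M (%x. Rn n g x - g x) - 0) < e" if n: "n >= N" for n
 proof -
  have r: "Rn n g : L2 M" "Rn n u : L2 M" using R_L2 g uL by auto
  let ?d = "%x. g x - u x"
  have d: "?d : L2 M" using g uL L2.diff_mem by blast
  have "AE x in M. Rn n g x - Rn n u x = Rn n ?d x"
   using R_lin[of "real (Suc n)" g u 1 "-1"] g uL by (auto elim: eventually_mono)
  hence "L2_nrm M (%x. Rn n g x - Rn n u x) = L2_nrm M (Rn n ?d)"
   using L2_inner_cong_AE[of "%x. Rn n g x - Rn n u x" "Rn n ?d" M "%x. Rn n g x - Rn n u x" "Rn n ?d"]
    r R_L2[OF _ d] L2_measurable by simp
  also have "... <= L2_nrm M ?d" using R_contraction[OF _ d] by simp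
  finally have 1: "L2_nrm M (%x. Rn n g x - Rn n u x) < e / 4" using gu by linarith
  have "L2_nrm M (%x. Rn n g x - g x) <= L2_nrm M (%x. Rn n g x - Rn n u x) + L2_nrm M (%x. Rn n u x - g x)"
   by (rule L2.nrm_triangle[OF r g])
  also have "L2_nrm M (%x. Rn n u x - g x) <= L2_nrm M (%x. Rn n u x - u x) + L2_nrm M (%x. u x - g x)"
   by (rule L2.nrm_triangle[OF r(2) uL g])
  also have "L2_nrm M (%x. u x - g x) = L2_nrm M ?d" by (rule L2.nrm_diff_commute[OF uL g])
  finally have "L2_nrm M (%x. Rn n g x - g x) < e" using 1 N[OF n] gu by auto
  thus ?thesis using L2.nrm_nonneg[OF L2.diff_mem[OF r(1) g]] by simp
 qed
 thus "EX N. ALL n>=N. norm (L2_nrm M (%x. Rn n g x - g x) - 0) < e" by blast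
qed

lemma approx_form_tendsto:
 assumes "u : F" "v : F"
 shows "(%n. real (Suc n) * (ip u v - ip (Rn n u) v)) ----> E u v"
proof -
 have L: "u : L2 M" using assms dom_L2 by blast
 have r: "Rn n u : F" for n using R_mem[OF _ L] by simp
 have "(%n. E.nrm (%x. Rn n u x - u x)) ----> 0"
 proof (rule Lim_null_comparison[OF _ Rn_form_tendsto[OF assms(1)]])
  show "\<forall>\<^sub>F n in sequentially. norm (E.nrm (%x. Rn n u x - u x)) <= E1.nrm (%x. Rn n u x - u x)"
   using E_le_E1[OF E.diff_mem[OF r assms(1)]] E.nrm_nonneg[OF E.diff_mem[OF r assms(1)]] by simp
 qed
 hence "(%n. E (Rn n u) v) ----> E u v" by (rule E.tendsto_left[OF r assms])
 thus ?thesis using R_eq[OF _ L assms(2)] by simp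
qed

text \<open>Replace \<open>v\<close> by \<open>Rn k v\<close>. Against such a function the form is
  an \<open>L^2\<close> inner product and passes to the limit; the error is small uniformly in
  \<open>n\<close> because the energies are bounded.\<close>

lemma weak_form_tendsto:
 assumes s: "!!n. s n : F" and u: "u : F" and v: "v : F"
  and lim: "(%n::nat. L2_nrm M (%x. s n x - u x)) ----> 0"
  and bdd: "!!n. E (s n) (s n) <= C"
 shows "(%n. E (s n) v) ----> E u v"
proof (rule LIMSEQ_I)
 fix e :: real assume e: "0 < e"
 define K where "K = sqrt C + E.nrm u + 1"
 have K: "K > 0" using bdd[of 0] E.nonneg[OF s[of 0]] E.nrm_nonneg[OF u] unfolding K_def
  by (smt (verit) real_sqrt_ge_zero)
 have vL: "v : L2 M" using v dom_L2 by blast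
 have r: "Rn n v : F" for n using R_mem[OF _ vL] by simp
 obtain k where k: "E1.nrm (%x. Rn k v x - v x) < e / (2 * K)"
  using order_tendstoD(2)[OF Rn_form_tendsto[OF v], of "e / (2 * K)"] e K eventually_happens by fastforce
 let ?w = "%x. v x - Rn k v x"
 have w: "?w : F" using v r[of k] E.diff_mem by blast
 have "(%n. ip (s n) ?w) ----> ip u ?w"
  by (rule L2.tendsto_left[OF dom_L2[OF s] dom_L2[OF u] dom_L2[OF w] lim])
 hence "(%n. real (Suc k) * (ip (s n) ?w - ip u ?w)) ----> real (Suc k) * (ip u ?w - ip u ?w)"
  by (intro tendsto_mult tendsto_diff tendsto_const)
 moreover have "real (Suc k) * (ip (s n) ?w - ip u ?w) = E (s n) (Rn k v) - E u (Rn k v)" for n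
 proof -
  have "E (Rn k v) y = real (Suc k) * ip y ?w" if "y : F" for y
   using R_eq[OF _ vL that, of "real (Suc k)"] L2.diff_right[OF vL dom_L2[OF r[of k]] dom_L2[OF that]]
    L2.sym[OF vL dom_L2[OF that]] L2.sym[OF dom_L2[OF r[of k]] dom_L2[OF that]] by simp
  thus ?thesis using s[of n] u E.sym[OF r[of k]] by (simp add: right_diff_distrib)
 qed
 ultimately have "(%n. E (s n) (Rn k v) - E u (Rn k v)) ----> 0" by (simp only: diff_self mult_zero_right)
 then obtain N where N: "!!n. n >= N ==> norm (E (s n) (Rn k v) - E u (Rn k v) - 0) < e / 2"
  using LIMSEQ_D[of _ 0 "e/2"] e by (metis half_gt_zero)
 have "norm (E (s n) v - E u v) < e" if n: "n >= N" for n
 proof -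
  let ?d = "%x. s n x - u x"
  have d: "?d : F" using s u E.diff_mem by blast
  have "E.nrm ?d <= sqrt C + E.nrm u"
   using E.nrm_diff[OF s[of n] u] real_sqrt_le_mono[OF bdd[of n]] by linarith
  hence dK: "E.nrm ?d <= K" unfolding K_def by simp
  have "E.nrm ?w = E.nrm (%x. Rn k v x - v x)" by (rule E.nrm_diff_commute[OF v r])
  hence "E.nrm ?w < e / (2 * K)" using E_le_E1[OF E.diff_mem[OF r[of k] v]] k by linarith
  hence "\<bar>E ?d ?w\<bar> <= K * (e / (2 * K))"
   using E.abs_le_nrm[OF d w] dK E.nrm_nonneg[OF d] E.nrm_nonneg[OF w] K e
   by (meson less_eq_real_def mult_mono order_trans)
  hence "\<bar>E ?d ?w\<bar> <= e / 2" using K by simp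
  moreover have "E (s n) v - E u v = E ?d ?w + (E (s n) (Rn k v) - E u (Rn k v))"
   using s[of n] u v r[of k] w by (simp add: E.diff_left E.diff_right)
  ultimately show ?thesis using N[OF n] unfolding real_norm_def diff_zero by linarith
 qed
 thus "EX N. ALL n>=N. norm (E (s n) v - E u v) < e" by blast
qed

text \<open>As in a Hilbert space, weak convergence together with norms not exceeding the norm of
  the limit is strong convergence: expand \<open>E\<close> on the difference.\<close>

lemma strong_form_tendsto:
 assumes s: "!!n. s n : F" and u: "u : F"
  and lim: "(%n::nat. L2_nrm M (%x. s n x - u x)) ----> 0"
  and bdd: "!!n. E (s n) (s n) <= E u u"
 shows "(%n. E1.nrm (%x. s n x - u x)) ----> 0"
proof -
 have "(%n. 2 * E u u - 2 * E (s n) u + (L2_nrm M (%x. s n x - u x))\<^sup>2) ----> 2 * E u u - 2 * E u u + 0\<^sup>2"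
  by (intro tendsto_intros weak_form_tendsto[OF s u u lim bdd] lim)
 hence z: "(%n. 2 * E u u - 2 * E (s n) u + (L2_nrm M (%x. s n x - u x))\<^sup>2) ----> 0" by simp
 have "(%n. shifted_form D 1 (%x. s n x - u x) (%x. s n x - u x)) ----> 0"
 proof (rule Lim_null_comparison[OF _ z], rule always_eventually, rule allI)
  fix n
  have d: "(%x. s n x - u x) : F" using s u E.diff_mem by blast
  show "norm (shifted_form D 1 (%x. s n x - u x) (%x. s n x - u x))
    <= 2 * E u u - 2 * E (s n) u + (L2_nrm M (%x. s n x - u x))\<^sup>2"
   using E1.nonneg[OF d] bdd[of n] L2.nonneg[OF dom_L2[OF d]] E.diff_self[OF s[of n] u]
   by (simp add: shifted_form_def)
 qed
 thus ?thesis using tendsto_real_sqrt by fastforce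
qed

end

section \<open>Pointwise inequalities and the energy form\<close>

context closed_markovian_form
begin

text \<open>
  A substitute for integrating against the kernel $R(x, dy)$: for fixed \<open>x\<close> the inequality is one
  between functions of \<open>y\<close>, to which the positive operator \<open>R\<close> can be applied. The coefficient
  vectors for which it holds form a separable set, which makes the exceptional null set uniform.
\<close>

lemma R_kernel_sum:
 fixes f g :: "nat => 'a => real" and m :: nat
 assumes a: "0 < \<alpha>" and G: "!!k. k < m ==> g k : L2 M"
  and f0: "!!x. 0 <= f0 x" and pos: "!!x y. 0 <= f0 x + (\<Sum>k<m. f k x * g k y)"
 shows "AE x in M. 0 <= f0 x + (\<Sum>k<m. f k x * R \<alpha> (g k) x)"
proof -
 \<comment> \<open>A vector \<open>c\<close> lists the constant term \<open>c 0\<close> and the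
   coefficients \<open>c (Suc k)\<close> of \<open>g k\<close>. The condition
   \<open>0 <= c 0\<close> is imposed because \<open>R\<close> may lose mass: \<open>R_ge\<close>
   preserves lower bounds only when they are nonpositive.\<close>
 define S :: "(nat => real) set" where
  "S = {c. 0 <= c 0 & (ALL y. 0 <= c 0 + (\<Sum>k<m. c (Suc k) * g k y))}"
 obtain T where T: "countable T" "T <= S" "S <= closure T" using separable by metis
 have "AE x in M. 0 <= c 0 + (\<Sum>k<m. c (Suc k) * R \<alpha> (g k) x)" if "c : T" for c
 proof -
  have c: "0 <= c 0" "!!y. 0 <= c 0 + (\<Sum>k<m. c (Suc k) * g k y)" using that T(2) by (auto simp: S_def)
  let ?h = "%y. \<Sum>k<m. c (Suc k) * g k y"
  have s: "?h : L2 M" "AE x in M. R \<alpha> ?h x = (\<Sum>k<m. c (Suc k) * R \<alpha> (g k) x)"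
   using R_sum[of \<alpha> m g "%k. c (Suc k)"] a G by auto
  have "AE x in M. - c 0 <= R \<alpha> ?h x"
  proof (rule R_ge[OF a s(1)])
   have "- c 0 <= ?h x" for x using c(2)[of x] by linarith
   thus "AE x in M. - c 0 <= ?h x" by simp
  qed (use c in simp)
  with s(2) show ?thesis by eventually_elim simp
 qed
 hence "AE x in M. ALL c:T. 0 <= c 0 + (\<Sum>k<m. c (Suc k) * R \<alpha> (g k) x)"
  using T(1) by (simp add: AE_ball_countable)
 thus ?thesis
 proof eventually_elim
  fix x assume x: "ALL c:T. 0 <= c 0 + (\<Sum>k<m. c (Suc k) * R \<alpha> (g k) x)"
  let ?C = "{c::nat => real. 0 <= c 0 + (\<Sum>k<m. c (Suc k) * R \<alpha> (g k) x)}"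
  \<comment> \<open>At a fixed point \<open>x\<close> outside the common null set the conclusion is
    a closed condition on \<open>c\<close>, so it extends from the dense countable set to the
    coefficients that belong to \<open>x\<close>.\<close>
  have "closed ?C"
   by (intro closed_Collect_le continuous_intros continuous_on_product_coordinates)
  moreover have "T <= ?C" using x by blast
  ultimately have "S <= ?C" using T(3) closure_minimal by blast
  moreover have "case_nat (f0 x) (%k. f k x) : S" using f0[of x] pos[of x] by (simp add: S_def)
  ultimately show "0 <= f0 x + (\<Sum>k<m. f k x * R \<alpha> (g k) x)" by auto
 qed
qed

lemma R_kernel:
 assumes "0 < \<alpha>" and G: "!!f g. (f, g) : set fg ==> g : L2 M"
  and "!!x. 0 <= f0 x" and pos: "!!x y. 0 <= f0 x + (\<Sum>(f, g)\<leftarrow>fg. f x * g y)"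
 shows "AE x in M. 0 <= f0 x + (\<Sum>(f, g)\<leftarrow>fg. f x * R \<alpha> g x)"
proof -
 have eq: "(\<Sum>(f, g)\<leftarrow>fg. f x * h g) = (\<Sum>k<length fg. fst (fg ! k) x * h (snd (fg ! k)))" for x h
  by (simp add: sum_list_sum_nth case_prod_beta atLeast0LessThan)
 have "AE x in M. 0 <= f0 x + (\<Sum>k<length fg. fst (fg ! k) x * R \<alpha> (snd (fg ! k)) x)"
 proof (rule R_kernel_sum)
  show "snd (fg ! k) : L2 M" if "k < length fg" for k
   using G[of "fst (fg ! k)" "snd (fg ! k)"] that by simp
  show "0 <= f0 x + (\<Sum>k<length fg. fst (fg ! k) x * snd (fg ! k) y)" for x y
   using pos[of x y] eq[of x "%g. g y"] by simp
 qed (use assms in auto)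
 thus ?thesis by (simp add: eq)
qed

lemma L2_integrable_times_set:
 assumes "h : L2 M" "0 < c"
 shows "(indicator {x : space M. c < h x} :: 'a => real) : L2 M"
proof (rule L2_bound[of "%x. 1 / c * h x"])
 show "(%x. 1 / c * h x) : L2 M" using assms by (intro L2.scale_mem)
 have "\<bar>indicator {x : space M. c < h x} x\<bar> <= \<bar>1 / c * h x\<bar>" for x :: 'a
  using assms(2) by (auto simp: indicator_def field_simps)
 thus "AE x in M. \<bar>indicator {x : space M. c < h x} x :: real\<bar> <= \<bar>1 / c * h x\<bar>" by simp
 have "{x : space M. c < h x} : sets M" using assms by measurable
 thus "(indicator {x : space M. c < h x} :: 'a => real) : borel_measurable M" by simp
qed

text \<open>By symmetry the integral of \<open>R \<alpha> g\<close> over a set \<open>B\<close> is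
  that of \<open>g\<close> against the resolvent of the indicator, which is at most 1. The sets
  \<open>B n\<close> are superlevel sets of \<open>R \<alpha> g\<close> itself, since no other
  exhaustion with indicators in \<open>L^2\<close> is at hand for a general measure.\<close>

lemma R_L1:
 assumes a: "0 < \<alpha>" and g: "g : L2 M" "integrable M g" "AE x in M. 0 <= g x"
 shows "integrable M (R \<alpha> g)" "(LINT x|M. R \<alpha> g x) <= (LINT x|M. g x)"
proof -
 let ?r = "R \<alpha> g"
 have r: "?r : L2 M" using R_L2[OF a g(1)] .
 note [measurable] = L2_measurable[OF r]
 have r0: "AE x in M. 0 <= ?r x" using R_nonneg[OF a g(1) g(3)] .
 define B where "B n = {x : space M. 1 / real (Suc n) < ?r x}" for n
 have B: "(indicator (B n) :: 'a => real) : L2 M" for n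
  unfolding B_def by (intro L2_integrable_times_set r) simp
 have Bm [measurable]: "B n : sets M" for n unfolding B_def by measurable
 have le: "(\<integral>\<^sup>+x. ennreal (?r x * indicator (B n) x) \<partial>M) <= ennreal (LINT x|M. g x)" for n
 proof -
  have I: "integrable M (%x. ?r x * indicator (B n) x)" using L2_integrable_mult[OF r B] .
  have "(\<integral>\<^sup>+x. ennreal (?r x * indicator (B n) x) \<partial>M) = ennreal (LINT x|M. ?r x * indicator (B n) x)"
   using I by (rule nn_integral_eq_integral) (use r0 in eventually_elim, auto)
  also have "(LINT x|M. ?r x * indicator (B n) x) = ip g (R \<alpha> (indicator (B n)))"
   using R_sym[OF a g(1) B[of n]] by (simp add: L2_inner_def)
  also have "... <= (LINT x|M. g x)"
   unfolding L2_inner_def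
  proof (rule integral_mono_AE)
   show "integrable M (%x. g x * R \<alpha> (indicator (B n)) x)" by (intro L2_integrable_mult g(1) R_L2 a B)
   have "AE x in M. R \<alpha> (indicator (B n)) x <= 1" by (intro R_le a B) auto
   thus "AE x in M. g x * R \<alpha> (indicator (B n)) x <= g x" using g(3)
    by eventually_elim (simp add: mult_left_le)
  qed (rule g(2))
  finally show ?thesis by (simp add: ennreal_leI)
 qed
 have "(%n. (\<integral>\<^sup>+x. ennreal (?r x * indicator (B n) x) \<partial>M)) ----> (\<integral>\<^sup>+x. ennreal (?r x * indicator (space M) x) \<partial>M)"
 proof (rule nn_integral_LIMSEQ)
  show "incseq (%n x. ennreal (?r x * indicator (B n) x))"
  proof (intro incseq_SucI le_funI)
   fix n x
   have "1 / real (Suc (Suc n)) <= 1 / real (Suc n)" by (simp add: field_simps)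
   hence "x : B (Suc n)" if "x : B n" using that unfolding B_def by auto
   moreover have "0 <= ?r x" if "x : B n" for n
    using that less_trans[of 0 "1 / real (Suc n)" "?r x"] unfolding B_def by simp
   ultimately show "ennreal (?r x * indicator (B n) x) <= ennreal (?r x * indicator (B (Suc n)) x)"
    by (auto simp: indicator_def)
  qed
  show "(%n. ennreal (?r x * indicator (B n) x)) ----> ennreal (?r x * indicator (space M) x)" for x
  proof (cases "0 < ?r x & x : space M")
   case True
   obtain N where N: "1 / real (Suc N) < ?r x" using True nat_approx_posE[of "?r x"] by blast
   have "x : B n" if "n >= N" for n
   proof -
    have "1 / real (Suc n) <= 1 / real (Suc N)" using that by (simp add: frac_le)
    thus ?thesis using N True unfolding B_def by simp
   qed
   hence "\<forall>\<^sub>F n in sequentially. ennreal (?r x * indicator (B n) x) = ennreal (?r x * indicator (space M) x)"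
    unfolding eventually_sequentially using True by (intro exI[of _ N]) simp
   thus ?thesis by (rule tendsto_eventually)
  next
   case False
   hence "ennreal (?r x * indicator (B n) x) = ennreal (?r x * indicator (space M) x)" for n
    by (auto simp: indicator_def ennreal_neg B_def)
   thus ?thesis by simp
  qed
 qed measurable
 also have "(\<integral>\<^sup>+x. ennreal (?r x * indicator (space M) x) \<partial>M) = (\<integral>\<^sup>+x. ennreal (?r x) \<partial>M)"
  by (intro nn_integral_cong) simp
 finally have nn: "(\<integral>\<^sup>+x. ennreal (?r x) \<partial>M) <= ennreal (LINT x|M. g x)"
  using le by (intro LIMSEQ_le_const2) auto
 show I: "integrable M ?r"
  using nn r0 by (intro integrableI_nonneg) (auto simp: top_unique less_top[symmetric])
 show "(LINT x|M. ?r x) <= (LINT x|M. g x)"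
  using nn nn_integral_eq_integral[OF I r0] integral_nonneg_AE[OF g(3)] by simp
qed

section \<open>The algebra of bounded functions in the domain\<close>

text \<open>Clamping the argument to \<open>[- c, c]\<close> and dividing by \<open>L\<close> turns
  \<open>T\<close> into a contraction of the whole line without changing its values on
  \<open>u\<close>.\<close>

lemma lipschitz_mem:
 assumes u: "u : F" and c: "AE x in M. \<bar>u x\<bar> <= c"
  and T: "!!x y. \<bar>x\<bar> <= c ==> \<bar>y\<bar> <= c ==> \<bar>T x - T y\<bar> <= L * \<bar>x - y\<bar>" "T 0 = 0" "0 < L" "0 <= c"
  and m: "T : borel_measurable borel"
 shows "(%x. T (u x)) : F" "E (%x. T (u x)) (%x. T (u x)) <= L\<^sup>2 * E u u"
proof -
 define h where "h x = max (- c) (min c x)" for x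
 define S where "S x = T (h x) / L" for x
 have h: "\<bar>h x\<bar> <= c" "\<bar>h x - h y\<bar> <= \<bar>x - y\<bar>" "h 0 = 0" for x y
  using T(4) by (auto simp: h_def)
 have S: "1-lipschitz_on UNIV S" "S 0 = 0"
 proof (rule lipschitz_onI)
  show "dist (S x) (S y) <= 1 * dist x y" for x y
  proof -
   have "\<bar>T (h x) - T (h y)\<bar> <= L * \<bar>h x - h y\<bar>" by (intro T(1) h)
   also have "... <= L * \<bar>x - y\<bar>" using h(2) T(3) by (intro mult_left_mono) auto
   finally have "\<bar>T (h x) - T (h y)\<bar> / L <= \<bar>x - y\<bar>" using T(3) by (simp add: field_simps)
   moreover have "\<bar>S x - S y\<bar> = \<bar>T (h x) - T (h y)\<bar> / L"
    using T(3) by (simp add: S_def diff_divide_distrib[symmetric])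
   ultimately show ?thesis by (simp add: dist_real_def)
  qed
 qed (use h T in \<open>auto simp: S_def\<close>)
 note Su = lipschitz_dom[OF u S]
 have "AE x in M. L * S (u x) = T (u x)" using c by eventually_elim (use T(3) in \<open>auto simp: S_def h_def\<close>)
 note ae = this
 have LS: "(%x. L * S (u x)) : F" using Su by (intro E.scale_mem)
 have um: "u : borel_measurable M" using dom_measurable[OF u] .
 show Tu: "(%x. T (u x)) : F"
  by (rule dom_cong[OF LS _ ae]) (use measurable_compose[OF um m] in simp)
 have "E (%x. T (u x)) (%x. T (u x)) = E (%x. L * S (u x)) (%x. L * S (u x))"
  by (intro form_cong Tu LS) (use ae in \<open>auto elim: eventually_mono\<close>)
 also have "... = L\<^sup>2 * E (%x. S (u x)) (%x. S (u x))" by (rule E.scale_self[OF Su(1)])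
 also have "... <= L\<^sup>2 * E u u" using Su(2) by (intro mult_left_mono) auto
 finally show "E (%x. T (u x)) (%x. T (u x)) <= L\<^sup>2 * E u u" .
qed

lemma square_mem:
 assumes u: "u : F" and c: "AE x in M. \<bar>u x\<bar> <= c" "0 < c"
 shows "(%x. (u x)\<^sup>2) : F" "E (%x. (u x)\<^sup>2) (%x. (u x)\<^sup>2) <= (2 * c)\<^sup>2 * E u u"
proof -
 have "\<bar>x\<^sup>2 - y\<^sup>2\<bar> <= 2 * c * \<bar>x - y\<bar>" if "\<bar>x\<bar> <= c" "\<bar>y\<bar> <= c" for x y :: real
 proof -
  have "\<bar>x\<^sup>2 - y\<^sup>2\<bar> = \<bar>x + y\<bar> * \<bar>x - y\<bar>"
   by (simp add: power2_eq_square abs_mult[symmetric] algebra_simps)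
  also have "... <= 2 * c * \<bar>x - y\<bar>" using that by (intro mult_right_mono) auto
  finally show ?thesis .
 qed
 note l = lipschitz_mem[OF u c(1), of "%x. x\<^sup>2" "2 * c", OF this]
 show "(%x. (u x)\<^sup>2) : F" "E (%x. (u x)\<^sup>2) (%x. (u x)\<^sup>2) <= (2 * c)\<^sup>2 * E u u"
  using l c by auto
qed

text \<open>Polarisation: \<open>u * v\<close> is a quarter of the difference of the squares of
  \<open>u + v\<close> and \<open>u - v\<close>, both of which are bounded by
  \<open>2 * c\<close>.\<close>

lemma mult_mem:
 assumes u: "u : F" and v: "v : F" and c: "AE x in M. \<bar>u x\<bar> <= c" "AE x in M. \<bar>v x\<bar> <= c" "0 < c"
 shows "(%x. u x * v x) : F" "E (%x. u x * v x) (%x. u x * v x) <= 4 * c\<^sup>2 * (E u u + E v v)"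
proof -
 let ?p = "%x. u x + v x" and ?m = "%x. u x - v x"
 have F: "?p : F" "?m : F" using u v E.add_mem E.diff_mem by auto
 have b: "AE x in M. \<bar>?p x\<bar> <= 2 * c" "AE x in M. \<bar>?m x\<bar> <= 2 * c"
  using c(1,2) by (eventually_elim, auto)+
 note sp = square_mem[OF F(1) b(1)] and sm = square_mem[OF F(2) b(2)]
 let ?P = "%x. (?p x)\<^sup>2" and ?Q = "%x. (?m x)\<^sup>2"
 have PQ: "?P : F" "?Q : F" using sp sm c by auto
 have eq: "(%x. u x * v x) = (%x. 1/4 * (?P x - ?Q x))"
  by (auto simp: power2_eq_square algebra_simps)
 have "(%x. 1/4 * (?P x - ?Q x)) : F" using PQ by (intro E.scale_mem E.diff_mem)
 thus "(%x. u x * v x) : F" by (simp only: eq)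
 have "E (%x. 1/4 * (?P x - ?Q x)) (%x. 1/4 * (?P x - ?Q x)) = (1/4)\<^sup>2 * E (%x. ?P x - ?Q x) (%x. ?P x - ?Q x)"
  using PQ by (intro E.scale_self E.diff_mem)
 also have "... <= (1/4)\<^sup>2 * (2 * E ?P ?P + 2 * E ?Q ?Q)" using PQ by (intro mult_left_mono E.diff_self_le) auto
 also have "... <= (1/4)\<^sup>2 * (2 * ((2 * (2 * c))\<^sup>2 * E ?p ?p) + 2 * ((2 * (2 * c))\<^sup>2 * E ?m ?m))"
  using sp sm c by (intro mult_left_mono add_mono) auto
 also have "... = 2 * c\<^sup>2 * (E ?p ?p + E ?m ?m)" by (simp add: power2_eq_square algebra_simps)
 also have "E ?p ?p + E ?m ?m = 2 * (E u u + E v v)" using u v by (simp add: E.add_self E.diff_self)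
 finally show "E (%x. u x * v x) (%x. u x * v x) <= 4 * c\<^sup>2 * (E u u + E v v)"
  unfolding eq by (simp add: algebra_simps)
qed

definition Fb :: "('a => real) set" where
 "Fb = {u : F. EX c. AE x in M. \<bar>u x\<bar> <= c}"

lemma FbD: "u : Fb ==> u : F" by (simp add: Fb_def)

lemma Fb_L2: "u : Fb ==> u : L2 M" using FbD dom_L2 by blast

lemma Fb_bound:
 assumes "u : Fb" obtains c where "0 < c" "AE x in M. \<bar>u x\<bar> <= c"
proof -
 obtain c where c: "AE x in M. \<bar>u x\<bar> <= c" using assms unfolding Fb_def by blast
 have "AE x in M. \<bar>u x\<bar> <= max c 1" using c by eventually_elim simp
 thus thesis using that[of "max c 1"] by simp
qed

lemma FbI: "u : F ==> AE x in M. \<bar>u x\<bar> <= c ==> u : Fb" by (auto simp: Fb_def)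

lemma Fb_dom_Lp: "Fb = F \<inter> Lp \<infinity> M"
 using dom_measurable by (auto simp: Fb_def Lp_def)

lemma Fb_lin: "u : Fb ==> v : Fb ==> (%x. a * u x + b * v x) : Fb"
proof -
 assume uv: "u : Fb" "v : Fb"
 obtain c d where c: "AE x in M. \<bar>u x\<bar> <= c" and d: "AE x in M. \<bar>v x\<bar> <= d"
  using uv unfolding Fb_def by blast
 have "AE x in M. \<bar>a * u x + b * v x\<bar> <= \<bar>a\<bar> * c + \<bar>b\<bar> * d" using c d
 proof eventually_elim
  case (elim x)
  have "\<bar>a * u x + b * v x\<bar> <= \<bar>a\<bar> * \<bar>u x\<bar> + \<bar>b\<bar> * \<bar>v x\<bar>" by (metis abs_mult abs_triangle_ineq)
  also have "... <= \<bar>a\<bar> * c + \<bar>b\<bar> * d" using elim by (intro add_mono mult_left_mono) auto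
  finally show ?case .
 qed
 thus ?thesis by (rule FbI[OF E.lin_mem[OF FbD[OF uv(1)] FbD[OF uv(2)]]])
qed

sublocale B: semi_inner Fb E
 by unfold_locales (use Fb_lin E.lin_left E.sym E.nonneg FbD in auto)

lemma Fb_mult:
 assumes "u : Fb" "v : Fb" shows "(%x. u x * v x) : Fb"
proof -
 obtain c d where c: "0 < c" "AE x in M. \<bar>u x\<bar> <= c" and d: "0 < d" "AE x in M. \<bar>v x\<bar> <= d"
  using assms Fb_bound by metis
 have m: "AE x in M. \<bar>u x\<bar> <= max c d" "AE x in M. \<bar>v x\<bar> <= max c d"
  using c(2) d(2) by (eventually_elim, simp)+
 have "AE x in M. \<bar>u x * v x\<bar> <= max c d * max c d" using m
  by eventually_elim (use c d in \<open>auto simp: abs_mult intro!: mult_mono\<close>)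
 thus ?thesis using mult_mem(1)[OF FbD[OF assms(1)] FbD[OF assms(2)] m] c by (intro FbI) auto
qed

lemma Fb_square: "u : Fb ==> (%x. (u x)\<^sup>2) : Fb"
 unfolding power2_eq_square by (rule Fb_mult)

lemma Fb_lipschitz:
 assumes "u : Fb" "1-lipschitz_on UNIV T" "T 0 = 0"
 shows "(%x. T (u x)) : Fb"
proof -
 obtain c where c: "AE x in M. \<bar>u x\<bar> <= c" using assms unfolding Fb_def by blast
 have "\<bar>T x\<bar> <= \<bar>x\<bar>" for x
  using lipschitz_onD[OF assms(2), of x 0] assms(3) by (simp add: dist_real_def)
 hence "AE x in M. \<bar>T (u x)\<bar> <= c" using c by (auto elim!: eventually_mono intro: order_trans)
 thus ?thesis using lipschitz_dom[OF FbD[OF assms(1)] assms(2,3)] by (intro FbI)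
qed

end

section \<open>The energy functional\<close>

context closed_markovian_form
begin

text \<open>
  \<open>energy \<phi> f g\<close> is the integral of \<open>\<phi>\<close> against the mutual energy measure of \<open>f\<close> and \<open>g\<close>.
\<close>

definition energy :: "('a => real) => ('a => real) => ('a => real) => real" where
 "energy \<phi> f g = 1/2 * (E f (%x. \<phi> x * g x) + E g (%x. \<phi> x * f x) - E (%x. f x * g x) \<phi>)"

lemma energy_self: "energy \<phi> f f = E f (%x. \<phi> x * f x) - 1/2 * E (%x. (f x)\<^sup>2) \<phi>"
 by (simp add: energy_def power2_eq_square)

text \<open>Formally the integral of the square of \<open>f x - f y\<close> against the kernel of
  \<open>Rn n\<close> in \<open>y\<close>, plus the missing mass of the kernel at \<open>x\<close>
  times the square of \<open>f x\<close>.\<close>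

definition kernel_square :: "nat => ('a => real) => 'a => real" where
 "kernel_square n f x = (f x)\<^sup>2 - 2 * f x * Rn n f x + Rn n (%x. (f x)\<^sup>2) x"

lemma kernel_square_integrable:
 assumes f: "f : Fb" and p: "\<phi> : Fb"
 shows "integrable M (%x. \<phi> x * kernel_square n f x)"
  and "(LINT x|M. \<phi> x * kernel_square n f x) =
   ip (%x. (f x)\<^sup>2) \<phi> - 2 * ip (Rn n f) (%x. \<phi> x * f x) + ip (Rn n (%x. (f x)\<^sup>2)) \<phi>"
proof -
 have L: "f : L2 M" "\<phi> : L2 M" "(%x. (f x)\<^sup>2) : L2 M" "(%x. \<phi> x * f x) : L2 M"
  using f p Fb_square Fb_mult Fb_L2 by auto
 have r: "Rn n f : L2 M" "Rn n (%x. (f x)\<^sup>2) : L2 M" using L R_L2 by auto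
 note I = L2_integrable_mult[OF L(3,2)] L2_integrable_mult[OF r(1) L(4)] L2_integrable_mult[OF r(2) L(2)]
 have eq: "\<phi> x * kernel_square n f x =
   ((f x)\<^sup>2 * \<phi> x - 2 * (Rn n f x * (\<phi> x * f x))) + Rn n (%x. (f x)\<^sup>2) x * \<phi> x" for x
  by (simp add: kernel_square_def algebra_simps)
 show "integrable M (%x. \<phi> x * kernel_square n f x)"
  unfolding eq using I by (intro Bochner_Integration.integrable_add Bochner_Integration.integrable_diff integrable_mult_right)
 show "(LINT x|M. \<phi> x * kernel_square n f x) =
   ip (%x. (f x)\<^sup>2) \<phi> - 2 * ip (Rn n f) (%x. \<phi> x * f x) + ip (Rn n (%x. (f x)\<^sup>2)) \<phi>"
  unfolding eq L2_inner_def using I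
  by (simp add: Bochner_Integration.integral_add Bochner_Integration.integral_diff)
qed

text \<open>Each form value in \<open>energy_self\<close> is a limit of scaled differences by
  \<open>approx_form_tendsto\<close>; collected under one integral these differences are half of
  \<open>kernel_square\<close>.\<close>

lemma energy_approx:
 assumes f: "f : Fb" and p: "\<phi> : Fb"
 shows "(%n. real (Suc n) / 2 * (LINT x|M. \<phi> x * kernel_square n f x)) ----> energy \<phi> f f"
proof -
 have F: "f : F" "\<phi> : F" "(%x. (f x)\<^sup>2) : F" "(%x. \<phi> x * f x) : F"
  using f p Fb_square Fb_mult FbD by auto
 have "(%n. real (Suc n) * (ip f (%x. \<phi> x * f x) - ip (Rn n f) (%x. \<phi> x * f x))
   - 1/2 * (real (Suc n) * (ip (%x. (f x)\<^sup>2) \<phi> - ip (Rn n (%x. (f x)\<^sup>2)) \<phi>))) ----> energy \<phi> f f"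
  unfolding energy_self by (intro tendsto_diff tendsto_mult tendsto_const approx_form_tendsto F)
 moreover have "ip f (%x. \<phi> x * f x) = ip (%x. (f x)\<^sup>2) \<phi>"
  by (simp add: L2_inner_def power2_eq_square mult_ac)
 ultimately show ?thesis
  by (simp add: kernel_square_integrable[OF f p] field_simps)
qed

lemma kernel_square_nonneg:
 assumes "f : Fb"
 shows "AE x in M. 0 <= kernel_square n f x"
proof -
 have L: "f : L2 M" "(%x. (f x)\<^sup>2) : L2 M" using assms Fb_square Fb_L2 by auto
 have "AE x in M. 0 <= (f x)\<^sup>2 + (\<Sum>(g, h)\<leftarrow>[(%x. - 2 * f x, f), (%x. 1, %x. (f x)\<^sup>2)]. g x * Rn n h x)"
 proof (rule R_kernel)
  show "0 <= (f x)\<^sup>2 + (\<Sum>(g, h)\<leftarrow>[(%x. - 2 * f x, f), (%x. 1, %x. (f x)\<^sup>2)]. g x * h y)" for x y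
   using zero_le_power2[of "f x - f y"] by (simp add: power2_diff)
 qed (use L in auto)
 thus ?thesis by eventually_elim (simp add: kernel_square_def algebra_simps)
qed

lemma energy_nonneg:
 assumes "f : Fb" "\<phi> : Fb" "AE x in M. 0 <= \<phi> x"
 shows "0 <= energy \<phi> f f"
proof (rule LIMSEQ_le_const[OF energy_approx[OF assms(1,2)]], intro exI allI impI)
 fix n
 have "AE x in M. 0 <= \<phi> x * kernel_square n f x"
  using assms(3) kernel_square_nonneg[OF assms(1), of n] by eventually_elim simp
 thus "0 <= real (Suc n) / 2 * (LINT x|M. \<phi> x * kernel_square n f x)"
  by (intro mult_nonneg_nonneg integral_nonneg_AE) auto
qed

lemma energy_semi_inner:
 assumes p: "\<phi> : Fb" and pos: "AE x in M. 0 <= \<phi> x"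
 shows "semi_inner Fb (energy \<phi>)"
proof
 fix u v w a b
 assume uv: "u : Fb" "v : Fb"
 thus "(%x. a * u x + b * v x) : Fb" by (rule Fb_lin)
 show "energy \<phi> u v = energy \<phi> v u" by (simp add: energy_def mult.commute)
 assume w: "w : Fb"
 have eq: "(%x. \<phi> x * (a * u x + b * v x)) = (%x. a * (\<phi> x * u x) + b * (\<phi> x * v x))"
  "(%x. (a * u x + b * v x) * w x) = (%x. a * (u x * w x) + b * (v x * w x))"
  by (auto simp: algebra_simps)
 show "energy \<phi> (%x. a * u x + b * v x) w = a * energy \<phi> u w + b * energy \<phi> v w"
  unfolding energy_def eq using uv w p Fb_mult by (simp add: B.lin_left B.lin_right algebra_simps)
next
 show "0 <= energy \<phi> u u" if "u : Fb" for u using energy_nonneg[OF that p pos] .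
qed

text \<open>The contraction property is an inequality between squares at pairs of points, so it can
  be integrated against the kernel. \<open>T 0 = 0\<close> is what handles the missing mass.\<close>

lemma energy_contraction:
 assumes f: "f : Fb" and p: "\<phi> : Fb" "AE x in M. 0 <= \<phi> x" and T: "1-lipschitz_on UNIV T" "T 0 = 0"
 shows "energy \<phi> (%x. T (f x)) (%x. T (f x)) <= energy \<phi> f f"
proof -
 let ?g = "%x. T (f x)"
 have g: "?g : Fb" by (rule Fb_lipschitz[OF f T])
 have L: "f : L2 M" "(%x. (f x)\<^sup>2) : L2 M" "?g : L2 M" "(%x. (?g x)\<^sup>2) : L2 M"
  using f g Fb_square Fb_L2 by auto
 have T2: "(T x - T y)\<^sup>2 <= (x - y)\<^sup>2" for x y
  using lipschitz_onD[OF T(1), of x y] by (simp add: dist_real_def abs_le_square_iff)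
 have "real (Suc n) / 2 * (LINT x|M. \<phi> x * kernel_square n ?g x)
   <= real (Suc n) / 2 * (LINT x|M. \<phi> x * kernel_square n f x)" for n
 proof -
 have "AE x in M. 0 <= ((f x)\<^sup>2 - (?g x)\<^sup>2) + (\<Sum>(g, h)\<leftarrow>[(%x. - 2 * f x, f), (%x. 1, %x. (f x)\<^sup>2),
   (%x. 2 * ?g x, ?g), (%x. - 1, %x. (?g x)\<^sup>2)]. g x * Rn n h x)"
 proof (rule R_kernel)
  show "0 <= (f x)\<^sup>2 - (?g x)\<^sup>2" for x using T2[of "f x" 0] T(2) by simp
  show "0 <= ((f x)\<^sup>2 - (?g x)\<^sup>2) + (\<Sum>(g, h)\<leftarrow>[(%x. - 2 * f x, f), (%x. 1, %x. (f x)\<^sup>2),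
   (%x. 2 * ?g x, ?g), (%x. - 1, %x. (?g x)\<^sup>2)]. g x * h y)" for x y
   using T2[of "f x" "f y"] by (simp add: power2_diff)
 qed (use L in auto)
 hence "AE x in M. \<phi> x * kernel_square n ?g x <= \<phi> x * kernel_square n f x" using p(2)
  by eventually_elim (auto simp: kernel_square_def intro!: mult_left_mono)
 thus ?thesis
  using kernel_square_integrable(1)[OF f p(1)] kernel_square_integrable(1)[OF g p(1)]
  by (intro mult_left_mono integral_mono_AE) auto
 qed
 thus ?thesis by (intro LIMSEQ_le[OF energy_approx[OF g p(1)] energy_approx[OF f p(1)]]) blast
qed

text \<open>\<open>R_L1\<close> applied to the square of \<open>f\<close> bounds the integral of
  \<open>kernel_square\<close> by twice the approximating form; in the limit the total energy is at
  most \<open>E f f\<close>.\<close>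

lemma energy_le:
 assumes f: "f : Fb" and p: "\<phi> : Fb" "AE x in M. \<phi> x <= c" and c: "0 <= c"
 shows "energy \<phi> f f <= c * E f f"
proof -
 have F: "f : F" using f FbD by blast
 have lim: "(%n. c * (real (Suc n) * (ip f f - ip (Rn n f) f))) ----> c * E f f"
  by (intro tendsto_mult tendsto_const approx_form_tendsto F)
 have L: "f : L2 M" "(%x. (f x)\<^sup>2) : L2 M" using f Fb_square Fb_L2 by auto
 have "real (Suc n) / 2 * (LINT x|M. \<phi> x * kernel_square n f x) <= c * (real (Suc n) * (ip f f - ip (Rn n f) f))" for n
 proof -
 have i: "integrable M (%x. (f x)\<^sup>2)" using L2_integrable_square L by blast
 have rL: "Rn n f : L2 M" using R_L2[OF _ L(1)] by simp
 have r: "integrable M (Rn n (%x. (f x)\<^sup>2))" "(LINT x|M. Rn n (%x. (f x)\<^sup>2) x) <= (LINT x|M. (f x)\<^sup>2)"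
  using R_L1[OF _ L(2) i] by auto
 have j: "integrable M (%x. Rn n f x * f x)" using L2_integrable_mult[OF rL L(1)] .
 have eq: "kernel_square n f x = (f x)\<^sup>2 - 2 * (Rn n f x * f x) + Rn n (%x. (f x)\<^sup>2) x" for x
  by (simp add: kernel_square_def)
 have k: "integrable M (kernel_square n f)"
  unfolding eq[abs_def] using i j r(1) by (intro Bochner_Integration.integrable_add Bochner_Integration.integrable_diff integrable_mult_right)
 have "(LINT x|M. kernel_square n f x) = (LINT x|M. (f x)\<^sup>2) - 2 * (LINT x|M. Rn n f x * f x) + (LINT x|M. Rn n (%x. (f x)\<^sup>2) x)"
  unfolding eq using i j r(1) by (simp add: Bochner_Integration.integral_add Bochner_Integration.integral_diff)
 hence K: "(LINT x|M. kernel_square n f x) <= 2 * (ip f f - ip (Rn n f) f)"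
  using r(2) by (simp add: L2_inner_def power2_eq_square)
 have "AE x in M. \<phi> x * kernel_square n f x <= c * kernel_square n f x"
  using p(2) kernel_square_nonneg[OF f, of n] by eventually_elim (rule mult_right_mono)
 hence "(LINT x|M. \<phi> x * kernel_square n f x) <= (LINT x|M. c * kernel_square n f x)"
  using k kernel_square_integrable(1)[OF f p(1)] by (intro integral_mono_AE) auto
 also have "... = c * (LINT x|M. kernel_square n f x)" by simp
 finally have 1: "(LINT x|M. \<phi> x * kernel_square n f x) <= c * (LINT x|M. kernel_square n f x)" .
  have "(LINT x|M. \<phi> x * kernel_square n f x) <= c * (2 * (ip f f - ip (Rn n f) f))"
   using 1 mult_left_mono[OF K c] by linarith
  hence "real (Suc n) / 2 * (LINT x|M. \<phi> x * kernel_square n f x) <= real (Suc n) / 2 * (c * (2 * (ip f f - ip (Rn n f) f)))"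
   by (intro mult_left_mono) auto
  thus ?thesis by (simp add: mult_ac)
 qed
 thus ?thesis by (intro LIMSEQ_le[OF energy_approx[OF f p(1)] lim]) blast
qed

text \<open>The pointwise hypothesis is integrated against the kernel of \<open>R\<close>.\<close>

lemma form_energy_nonneg:
 assumes u: "u : Fb" and k: "k : Fb" and h: "\<eta> : Fb" and P: "\<Phi> : Fb" and C: "0 <= C"
  and uk: "!!x. 0 <= u x * k x" and P0: "!!x. 0 <= \<Phi> x"
  and pw: "!!x y. 0 <= (u x - u y) * (k x - k y) + C / 2 * ((\<eta> x - \<eta> y)\<^sup>2 * (\<Phi> x + \<Phi> y))"
 shows "0 <= E u k + C * energy \<Phi> \<eta> \<eta>"
proof -
 let ?uk = "%x. u x * k x" and ?hP = "%x. \<Phi> x * \<eta> x" and ?h2 = "%x. (\<eta> x)\<^sup>2" and ?h2P = "%x. (\<eta> x)\<^sup>2 * \<Phi> x"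
 have mem: "?uk : Fb" "?hP : Fb" "?h2 : Fb" "?h2P : Fb"
  using u k h P Fb_mult Fb_square by auto
 note L = mem[THEN Fb_L2] u[THEN Fb_L2] k[THEN Fb_L2] h[THEN Fb_L2] P[THEN Fb_L2]
 have I: "integrable M ?uk" "integrable M ?h2P"
  using L2_integrable_mult[OF L(5,6)] L2_integrable_mult[OF L(3,8)] by auto
 have lim: "(%n. real (Suc n) * (ip u k - ip (Rn n u) k)
   + C * (real (Suc n) / 2 * (LINT x|M. \<Phi> x * kernel_square n \<eta> x))) ----> E u k + C * energy \<Phi> \<eta> \<eta>"
  using u k h P by (intro tendsto_add tendsto_mult tendsto_const approx_form_tendsto energy_approx FbD)
 have "0 <= real (Suc n) * (ip u k - ip (Rn n u) k)
   + C * (real (Suc n) / 2 * (LINT x|M. \<Phi> x * kernel_square n \<eta> x))" for n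
 proof -
  let ?R = "Rn n"
  \<comment> \<open>\<open>?f0\<close> collects the terms of the pointwise inequality that are free
    of \<open>y\<close>, and \<open>?fg\<close> all others. \<open>R_kernel\<close> requires
    \<open>?f0\<close> to be nonnegative on its own.\<close>
  let ?f0 = "%x. ?uk x + C / 2 * ?h2P x"
  let ?fg = "[(%x. - u x, k), (%x. - k x, u), (%x. 1, ?uk), (%x. C / 2 * ?h2 x, \<Phi>), (%x. - C * ?hP x, \<eta>),
   (%x. - C * \<eta> x, ?hP), (%x. C / 2 * \<Phi> x, ?h2), (%x. C / 2, ?h2P)]"
  have "AE x in M. 0 <= ?f0 x + (\<Sum>(f, g)\<leftarrow>?fg. f x * ?R g x)"
  proof (rule R_kernel)
   show "0 <= ?f0 x" for x using uk[of x] P0[of x] C by simp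
   show "0 <= ?f0 x + (\<Sum>(f, g)\<leftarrow>?fg. f x * g y)" for x y
   proof -
    have "?f0 x + (\<Sum>(f, g)\<leftarrow>?fg. f x * g y) =
      (u x - u y) * (k x - k y) + C / 2 * ((\<eta> x - \<eta> y)\<^sup>2 * (\<Phi> x + \<Phi> y))"
     by (simp add: power2_eq_square algebra_simps)
    thus ?thesis using pw[of x y] by linarith
   qed
  qed (use L in auto)
  hence ae: "AE x in M. 0 <= ?uk x + C / 2 * ?h2P x - ?R k x * u x - ?R u x * k x + ?R ?uk x
    + C / 2 * (?R \<Phi> x * ?h2 x) - C * (?R \<eta> x * ?hP x) - C * (?R ?hP x * \<eta> x)
    + C / 2 * (?R ?h2 x * \<Phi> x) + C / 2 * ?R ?h2P x"
   by eventually_elim (simp add: mult_ac)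
  have r: "?R g : L2 M" if "g : L2 M" for g using R_L2[OF _ that] by simp
  \<comment> \<open>Only inequalities are available here because the kernel may lose mass; they have
    the right sign since both functions are nonnegative.\<close>
  have J: "integrable M (?R ?uk)" "(LINT x|M. ?R ?uk x) <= (LINT x|M. ?uk x)"
   "integrable M (?R ?h2P)" "(LINT x|M. ?R ?h2P x) <= (LINT x|M. ?h2P x)"
   using R_L1[OF _ L(1) I(1)] R_L1[OF _ L(4) I(2)] uk P0 by auto
  note K = L2_integrable_mult[OF r[OF L(6)] L(5)] L2_integrable_mult[OF r[OF L(5)] L(6)]
   L2_integrable_mult[OF r[OF L(8)] L(3)] L2_integrable_mult[OF r[OF L(7)] L(2)]
   L2_integrable_mult[OF r[OF L(2)] L(7)] L2_integrable_mult[OF r[OF L(3)] L(8)]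
  have "0 <= (\<integral>x. ?uk x + C / 2 * ?h2P x - ?R k x * u x - ?R u x * k x + ?R ?uk x
    + C / 2 * (?R \<Phi> x * ?h2 x) - C * (?R \<eta> x * ?hP x) - C * (?R ?hP x * \<eta> x)
    + C / 2 * (?R ?h2 x * \<Phi> x) + C / 2 * ?R ?h2P x \<partial>M)"
   by (rule integral_nonneg_AE[OF ae])
  also have "... = (LINT x|M. ?uk x) + C / 2 * (LINT x|M. ?h2P x) - ip (?R k) u - ip (?R u) k + (LINT x|M. ?R ?uk x)
    + C / 2 * ip (?R \<Phi>) ?h2 - C * ip (?R \<eta>) ?hP - C * ip (?R ?hP) \<eta>
    + C / 2 * ip (?R ?h2) \<Phi> + C / 2 * (LINT x|M. ?R ?h2P x)"
   unfolding L2_inner_def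
   by (intro has_bochner_integral_integral_eq has_bochner_integral_add has_bochner_integral_diff
     has_bochner_integral_mult_right has_bochner_integral_integrable I J(1,3) K)
  also have "... <= (LINT x|M. ?uk x) + C / 2 * (LINT x|M. ?h2P x) - ip (?R k) u - ip (?R u) k + (LINT x|M. ?uk x)
    + C / 2 * ip (?R \<Phi>) ?h2 - C * ip (?R \<eta>) ?hP - C * ip (?R ?hP) \<eta>
    + C / 2 * ip (?R ?h2) \<Phi> + C / 2 * (LINT x|M. ?h2P x)"
   using J(2) mult_left_mono[OF J(4), of "C / 2"] C by simp
  finally have 1: "0 <= (LINT x|M. ?uk x) + C / 2 * (LINT x|M. ?h2P x) - ip (?R k) u - ip (?R u) k + (LINT x|M. ?uk x)
    + C / 2 * ip (?R \<Phi>) ?h2 - C * ip (?R \<eta>) ?hP - C * ip (?R ?hP) \<eta>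
    + C / 2 * ip (?R ?h2) \<Phi> + C / 2 * (LINT x|M. ?h2P x)" .
  have sw: "ip (?R g) h = ip (?R h) g" if "g : L2 M" "h : L2 M" for g h
   using R_sym[OF _ that, of "real (Suc n)"] L2.sym[OF that(1) r[OF that(2)]] by simp
  \<comment> \<open>Symmetry of the resolvent pairs the cross terms. What remains is twice the
    approximating form plus \<open>C\<close> times the integral that approximates the energy, which
    explains the \<open>C / 2\<close> in the hypothesis.\<close>
  have s: "ip (?R k) u = ip (?R u) k" "ip (?R \<Phi>) ?h2 = ip (?R ?h2) \<Phi>" "ip (?R ?hP) \<eta> = ip (?R \<eta>) ?hP"
   by (intro sw L)+
  have t: "ip u k = (LINT x|M. ?uk x)" "ip ?h2 \<Phi> = (LINT x|M. ?h2P x)" by (simp_all add: L2_inner_def)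
  have "0 <= 2 * (ip u k - ip (?R u) k) + C * (LINT x|M. \<Phi> x * kernel_square n \<eta> x)"
   using 1 unfolding s kernel_square_integrable(2)[OF h P] t by (simp add: algebra_simps)
  hence "0 <= real (Suc n) / 2 * (2 * (ip u k - ip (?R u) k) + C * (LINT x|M. \<Phi> x * kernel_square n \<eta> x))"
   by (intro mult_nonneg_nonneg) auto
  moreover have "A / 2 * (2 * x + C * y) = A * x + C * (A / 2 * y)" for A x y :: real
   by (simp add: algebra_simps)
  ultimately show ?thesis by (simp only:)
 qed
 thus ?thesis by (intro LIMSEQ_le_const[OF lim]) auto
qed

end

section \<open>Locally compact separable metrizable spaces\<close>

locale lcs_space =
 fixes X :: "'a topology"
 assumes locally_compact: "locally_compact_space X"
  and separable: "separable_space X"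
  and metrizable: "metrizable_space X"
begin

lemma hausdorff: "Hausdorff_space X"
 using metrizable by (rule metrizable_imp_Hausdorff_space)

lemma normal: "normal_space X"
 using metrizable by (rule metrizable_imp_normal_space)

lemma compact_closed: "compactin X K ==> closedin X K"
 using hausdorff compactin_imp_closedin by blast

lemma compact_diff_open: "compactin X K ==> openin X U ==> compactin X (K - U)"
 by (meson Diff_subset closed_compactin closedin_diff compact_closed)

lemma second_countable: "second_countable X"
proof -
 obtain M d where "Metric_space M d" and Xeq: "X = Metric_space.mtopology M d"
  using metrizable metrizable_space_def by blast
 then interpret M: Metric_space M d by blast
 obtain C where C: "countable C" "C <= M" "M.mtopology closure_of C = M"
  using separable unfolding separable_space_def Xeq by auto
 define B where "B = (%(c, n::nat). M.mball c (1 / real (Suc n))) ` (C \<times> UNIV)"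
 have 1: "EX V:B. x : V & V <= U" if "openin X U" "x : U" for U x
 proof -
  have "openin M.mtopology U" using that Xeq by simp
  hence "U <= M & (ALL x. x : U --> (EX r>0. M.mball x r <= U))" unfolding M.openin_mtopology .
  then obtain r where r: "r > 0" "M.mball x r <= U" and x: "x : M" using \<open>x : U\<close> by blast
  obtain n where n: "1 / real (Suc n) < r / 2" using nat_approx_posE[of "r/2"] r by auto
  have "x : M.mtopology closure_of C" using x C by simp
  hence "EX c:C. c : M.mball x (1 / real (Suc n))"
   unfolding M.metric_closure_of by simp
  then obtain c where c: "c : C" "c : M.mball x (1 / real (Suc n))" by blast
  have "M.mball c (1 / real (Suc n)) <= M.mball x r"
  proof
   fix z assume z: "z : M.mball c (1 / real (Suc n))"
   hence "d x z <= d x c + d c z" using c x M.triangle by (simp add: M.in_mball)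
   thus "z : M.mball x r" using z c n x by (simp add: M.in_mball)
  qed
  moreover have "x : M.mball c (1 / real (Suc n))" using c x by (simp add: M.in_mball M.commute)
  ultimately show ?thesis using c(1) r(2) unfolding B_def by blast
 qed
 have 2: "openin X V" if "V : B" for V using that unfolding Xeq B_def by auto
 have 3: "countable B" using C(1) unfolding B_def by auto
 show ?thesis unfolding second_countable_def
  by (intro exI[of _ B] conjI ballI allI impI) (use 1 2 3 in auto)
qed

lemma lindelof:
 assumes "!!U. U : \<U> ==> openin X U"
 obtains \<V> where "countable \<V>" "\<V> <= \<U>" "\<Union>\<V> = \<Union>\<U>"
proof -
 have sub: "\<Union>\<U> <= topspace X" using assms openin_subset by blast
 have "Lindelof_space (subtopology X (\<Union>\<U>))"
  by (rule second_countable_imp_Lindelof_space[OF second_countable_subtopology[OF second_countable]])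
 note L = this[unfolded Lindelof_space_subtopology_subset[OF sub], rule_format, of \<U>]
 have "EX \<V>. countable \<V> & \<V> <= \<U> & \<Union>\<U> <= \<Union>\<V>" by (rule L, intro conjI ballI subset_refl, rule assms)
 then obtain \<V> where "countable \<V>" "\<V> <= \<U>" "\<Union>\<U> <= \<Union>\<V>" by (elim exE conjE)
 hence "countable \<V>" "\<V> <= \<U>" "\<Union>\<V> = \<Union>\<U>" by (auto dest: subsetD)
 thus thesis by (rule that)
qed

lemma compact_subcover:
 assumes "compactin X K" "!!x. x : K ==> openin X (V x) & x : V x"
 obtains I where "finite I" "I <= K" "K <= (\<Union>x\<in>I. V x)"
proof -
 have "(ALL U:V ` K. openin X U) & K <= \<Union>(V ` K)" using assms(2) by blast
 hence "EX \<F>. finite \<F> & \<F> <= V ` K & K <= \<Union>\<F>" using assms(1) unfolding compactin_def by blast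
 then obtain \<F> where F: "finite \<F>" "\<F> <= V ` K" "K <= \<Union>\<F>" by blast
 from finite_subset_image[OF F(1,2)] F(3) show thesis using that by blast
qed

text \<open>Regularity gives a closed neighbourhood inside \<open>U\<close>, local compactness one
  with compact closure. A smaller neighbourhood has both properties, and finitely many of these
  cover \<open>K\<close>.\<close>

lemma compact_open_interpolate:
 assumes "compactin X K" "openin X U" "K <= U"
 obtains W where "openin X W" "K <= W" "compactin X (X closure_of W)" "X closure_of W <= U"
proof -
 have loc: "neighbourhood_base_of (%U. openin X U & compactin X (X closure_of U)) X"
  using locally_compact_space_neighbourhood_base_open_closure_of hausdorff locally_compact by blast
 have "regular_space X" by (simp add: metrizable metrizable_imp_regular_space)
 hence reg: "neighbourhood_base_of (closedin X) X" by (simp add: neighbourhood_base_of_closedin)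
 have "EX V. openin X V & x : V & compactin X (X closure_of V) & X closure_of V <= U" if x: "x : K" for x
 proof -
  obtain V C where V: "openin X V" "closedin X C" "x : V" "V <= C" "C <= U"
   using reg x assms(2,3) unfolding neighbourhood_base_of by (metis subsetD)
  obtain W W' where W: "openin X W" "openin X W'" "compactin X (X closure_of W')" "x : W" "W <= W'" "W' <= V"
   using loc V(1,3) unfolding neighbourhood_base_of by metis
  have "X closure_of W' <= C" using W V closure_of_minimal by (meson subset_trans)
  thus ?thesis using W V by blast
 qed
 then obtain V where V: "!!x. x : K ==> openin X (V x) & x : V x & compactin X (X closure_of V x) & X closure_of V x <= U"
  by metis
 have V': "openin X (V x) & x : V x" if "x : K" for x using V[OF that] by simp
 obtain I where I: "finite I" "I <= K" "K <= (\<Union>x\<in>I. V x)" using compact_subcover[OF assms(1) V'] .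
 have cl: "X closure_of (\<Union>x\<in>I. V x) = (\<Union>x\<in>I. X closure_of V x)"
  using closure_of_Union[of "V ` I" X] I(1) by simp
 show thesis
 proof (rule that)
  show "openin X (\<Union>x\<in>I. V x)" using I V by (intro openin_Union) auto
  show "compactin X (X closure_of (\<Union>x\<in>I. V x))" unfolding cl using I V by (intro compactin_Union) auto
  show "X closure_of (\<Union>x\<in>I. V x) <= U" unfolding cl using I V by blast
 qed (rule I)
qed

lemma closed_Inter_open:
 assumes "closedin X C"
 obtains G where "!!n::nat. openin X (G n)" "!!n. G (Suc n) <= G n" "(\<Inter>n. G n) = C"
 using closed_imp_gdelta_in[OF metrizable assms] unfolding gdelta_in_descending by auto

lemma open_Union_compact:
 assumes U: "openin X U"
 obtains K where "!!n::nat. compactin X (K n)" "!!n. K n <= K (Suc n)" "(\<Union>n. K n) = U"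
proof -
 let ?U = "{W. openin X W & compactin X (X closure_of W) & X closure_of W <= U}"
 obtain \<V> where V: "countable \<V>" "\<V> <= ?U" "\<Union>\<V> = \<Union>?U" by (rule lindelof[of ?U]) auto
 have ge: "U <= \<Union>?U"
 proof
  fix x assume x: "x : U"
  have xX: "compactin X {x}" using x openin_subset[OF U] by auto
  have xU: "{x} <= U" using x by simp
  obtain W where "openin X W" "{x} <= W" "compactin X (X closure_of W)" "X closure_of W <= U"
   by (rule compact_open_interpolate[OF xX U xU])
  thus "x : \<Union>?U" by blast
 qed
 \<comment> \<open>The empty set is inserted so that the enumeration makes sense even when the
   subcover is empty.\<close>
 define v where "v = from_nat_into (insert {} \<V>)"
 have vr: "range v = insert {} \<V>" unfolding v_def using V(1) by (intro range_from_nat_into) auto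
 have vU: "v n : ?U" for n
 proof -
  have "v n : insert {} \<V>" using vr by blast
  thus ?thesis using V(2) by auto
 qed
 have v1: "compactin X (X closure_of v n)" "X closure_of v n <= U" for n using vU[of n] by simp_all
 have v2: "v n <= X closure_of v n" for n
  using vU[of n] openin_subset[of X "v n"] by (intro closure_of_subset) simp
 let ?K = "%n. \<Union>i\<le>n. X closure_of v i"
 have "U <= (\<Union>n. ?K n)"
 proof
  fix x assume "x : U"
  then obtain N where N: "x : N" "N : \<V>" using ge V(3) by blast
  hence "N : range v" unfolding vr by simp
  thus "x : (\<Union>n. ?K n)" using N(1) v2 by blast
 qed
 moreover have "(\<Union>n. ?K n) <= U" using v1(2) by blast
 ultimately have 1: "(\<Union>n. ?K n) = U" by (rule equalityI[rotated])
 have 2: "compactin X (?K n)" for n by (rule compactin_Union) (use v1(1) in auto)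
 have 3: "?K n <= ?K (Suc n)" for n by (rule UN_mono) auto
 show thesis by (rule that[OF 2 3 1])
qed

lemma urysohn_compact:
 assumes "compactin X K" "openin X U" "K <= U"
 obtains f where "continuous_map X euclideanreal f" "!!x. x : topspace X ==> 0 <= f x & f x <= 1"
  "!!x. x : K ==> f x = 1"
  "compactin X (X closure_of {x : topspace X. f x ~= 0})" "X closure_of {x : topspace X. f x ~= 0} <= U"
proof -
 obtain W where W: "openin X W" "K <= W" "compactin X (X closure_of W)" "X closure_of W <= U"
  using compact_open_interpolate[OF assms] by blast
 have "closedin X (topspace X - W)" "closedin X K" "disjnt (topspace X - W) K"
  using W compact_closed assms(1) by (auto simp: disjnt_def)
 then obtain f where f: "continuous_map X (top_of_set {0..1::real}) f" "f ` (topspace X - W) <= {0}" "f ` K <= {1}"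
  by (rule Urysohn_lemma[OF normal _ _ _ zero_le_one])
 have "{x : topspace X. f x ~= 0} <= W" using f(2) by blast
 hence cl: "X closure_of {x : topspace X. f x ~= 0} <= X closure_of W" by (rule closure_of_mono)
 show thesis
 proof (rule that)
  show "continuous_map X euclideanreal f" using f(1) by (simp add: continuous_map_in_subtopology)
  show "0 <= f x & f x <= 1" if "x : topspace X" for x
   using f(1) that by (auto simp: continuous_map_in_subtopology image_subset_iff)
  show "f x = 1" if "x : K" for x using f(3) that by blast
  show "compactin X (X closure_of {x : topspace X. f x ~= 0})"
   using closed_compactin[OF W(3) cl] by simp
  show "X closure_of {x : topspace X. f x ~= 0} <= U" using cl W(4) by blast
 qed
qed

end

section \<open>The Riesz representation theorem\<close>

lemma clamp_lipschitz: "0 <= d ==> 1-lipschitz_on UNIV (%x::real. min (max (x - c) 0) d)"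
 by (rule lipschitz_onI) (auto simp: dist_real_def)

lemma max0_lipschitz: "1-lipschitz_on UNIV (%x::real. max x 0)"
 by (rule lipschitz_onI) (auto simp: dist_real_def)

text \<open>\<open>L\<close> stands for the continuous compactly supported functions of the form
  domain. The representation theorem is proved for such a class instead of all continuous functions
  with compact support because energy functionals are defined on domain functions only. Products and
  contractions are the only operations the proof performs on them besides linear
  combinations.\<close>

locale riesz_space = lcs_space +
 fixes L :: "('a => real) set"
 assumes L_cont: "f : L ==> continuous_map X euclideanreal f"
  and L_supp: "f : L ==> compactin X (X closure_of {x : topspace X. f x ~= 0})"
  and L_lin: "f : L ==> g : L ==> (%x. a * f x + b * g x) : L"
  and L_mult: "f : L ==> g : L ==> (%x. f x * g x) : L"
  and L_lipschitz: "f : L ==> 1-lipschitz_on UNIV T ==> T 0 = 0 ==> (%x. T (f x)) : L"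
  and L_urysohn: "compactin X K ==> openin X U ==> K <= U ==> EX f:L. (ALL x. 0 <= f x & f x <= 1) &
    (ALL x:K. f x = 1) & X closure_of {x : topspace X. f x ~= 0} <= U"
begin

abbreviation supp :: "('a => real) => 'a set" where
 "supp f \<equiv> X closure_of {x : topspace X. f x ~= 0}"

lemma supp_superset: "{x : topspace X. f x ~= 0} <= supp f"
 by (rule closure_of_subset) auto

lemma L_add: "f : L ==> g : L ==> (%x. f x + g x) : L"
 using L_lin[of f g 1 1] by simp

lemma L_diff: "f : L ==> g : L ==> (%x. f x - g x) : L"
 using L_lin[of f g 1 "-1"] by simp

lemma L_scale: "f : L ==> (%x. a * f x) : L"
 using L_lin[of f f a 0] by simp

lemma L_zero: "(%x. 0) : L"
 using L_urysohn[of "{}" "{}"] L_scale[of _ 0] by auto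

lemma L_bounded:
 assumes "f : L" obtains c where "0 < c" "!!x. x : topspace X ==> \<bar>f x\<bar> <= c"
proof -
 have "compactin euclideanreal (f ` supp f)"
  using image_compactin[OF L_supp[OF assms] L_cont[OF assms]] .
 hence "bounded (f ` supp f)" by (simp add: compact_imp_bounded)
 then obtain c where c: "ALL y:f ` supp f. norm y <= c" unfolding bounded_iff by blast
 have "\<bar>f x\<bar> <= max c 1" if "x : topspace X" for x
  using c supp_superset[of f] that by (cases "f x = 0") force+
 thus thesis using that[of "max c 1"] by simp
qed

abbreviation Bo :: "'a measure" where "Bo \<equiv> sigma (topspace X) {U. openin X U}"

lemma opens_sub: "{U. openin X U} <= Pow (topspace X)"
 using openin_subset by blast

lemma sets_space: "sets M = sets Bo ==> space M = topspace X"
 by (metis sets_eq_imp_space_eq space_measure_of opens_sub)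

lemma open_sets: "sets M = sets Bo ==> openin X U ==> U : sets M"
 using opens_sub by (simp add: sets_measure_of)

lemma closed_sets: "sets M = sets Bo ==> closedin X C ==> C : sets M"
proof -
 assume M: "sets M = sets Bo" and C: "closedin X C"
 have "space M - (topspace X - C) : sets M" using open_sets[OF M] C by (intro sets.compl_sets) auto
 thus ?thesis using sets_space[OF M] closedin_subset[OF C] by (simp add: double_diff)
qed

lemma compact_sets: "sets M = sets Bo ==> compactin X K ==> K : sets M"
 using closed_sets compact_closed by blast

lemma continuous_measurable:
 assumes "sets M = sets Bo" "continuous_map X euclideanreal f"
 shows "f : borel_measurable M"
proof (rule borel_measurableI)
 fix S :: "real set" assume "open S"
 hence "openin X {x : topspace X. f x : S}" using assms(2) by (simp add: openin_continuous_map_preimage)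
 moreover have "f -` S \<inter> space M = {x : topspace X. f x : S}" using sets_space[OF assms(1)] by auto
 ultimately show "f -` S \<inter> space M : sets M" using open_sets[OF assms(1)] by simp
qed

lemma radon_L_integrable:
 assumes M: "radon_measure X M" and f: "f : L"
 shows "integrable M f"
proof -
 have s: "sets M = sets Bo" using M by (simp add: radon_measure_def)
 obtain c where c: "0 < c" "!!x. x : topspace X ==> \<bar>f x\<bar> <= c" by (rule L_bounded[OF f]) blast
 have K: "supp f : sets M" "emeasure M (supp f) < \<infinity>"
  using compact_sets[OF s L_supp[OF f]] M L_supp[OF f] by (auto simp: radon_measure_def)
 show ?thesis
 proof (rule Bochner_Integration.integrable_bound)
  show "integrable M (%x. c * indicator (supp f) x)" using K by simp
  show "f : borel_measurable M" by (rule continuous_measurable[OF s L_cont[OF f]])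
  show "AE x in M. norm (f x) <= norm (c * indicator (supp f) x)"
  proof (rule AE_I2)
   fix x assume "x : space M"
   thus "norm (f x) <= norm (c * indicator (supp f) x)"
    using c supp_superset[of f] sets_space[OF s] by (cases "f x = 0") (auto simp: indicator_def)
  qed
 qed
qed

text \<open>Urysohn functions supported in shrinking neighbourhoods of \<open>K\<close> converge to
  its indicator. They are dominated by the indicator of one compact neighbourhood, which has finite
  measure under any Radon measure.\<close>

lemma radon_compare_compact:
 assumes M: "radon_measure X M" and N: "radon_measure X N" and U: "openin X U"
  and le: "!!f. f : L ==> (!!x. 0 <= f x) ==> supp f <= U ==> (LINT x|M. f x) <= (LINT x|N. f x)"
  and K: "compactin X K" "K <= U"
 shows "emeasure M K <= emeasure N K"
proof -
 have s: "sets M = sets Bo" "sets N = sets Bo" using M N by (simp_all add: radon_measure_def)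
 have fin: "emeasure M C < \<infinity>" "emeasure N C < \<infinity>" if "compactin X C" for C
  using M N that by (auto simp: radon_measure_def)
 obtain W where W: "openin X W" "K <= W" "compactin X (X closure_of W)" "X closure_of W <= U"
  using compact_open_interpolate[OF K(1) U K(2)] by blast
 obtain G where G: "!!n::nat. openin X (G n)" "!!n. G (Suc n) <= G n" "(\<Inter>n. G n) = K"
  by (rule closed_Inter_open[OF compact_closed[OF K(1)]]) blast
 have "EX f:L. (ALL x. 0 <= f x & f x <= 1) & (ALL x:K. f x = 1) & supp f <= G n \<inter> W" for n
  using G W K by (intro L_urysohn openin_Int) auto
 hence ex: "ALL n. EX f. f : L & (ALL x. 0 <= f x & f x <= 1) & (ALL x:K. f x = 1) & supp f <= G n \<inter> W" by blast
 from choice[OF ex] obtain f where f0: "ALL n. f n : L & (ALL x. 0 <= f n x & f n x <= 1) &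
  (ALL x:K. f n x = 1) & supp (f n) <= G n \<inter> W" ..
 have f: "!!n. f n : L" "!!n x. 0 <= f n x" "!!n x. f n x <= 1" "!!n x. x : K ==> f n x = 1"
  "!!n. supp (f n) <= G n \<inter> W" using f0 by simp_all
 let ?C = "X closure_of W"
 have KC: "K <= ?C" using W(1,2) closure_of_subset[OF openin_subset] by blast
 have lim: "(%n. \<integral>x. f n x \<partial>Q) ----> (LINT x|Q. indicator K x)" if Q: "radon_measure X Q" for Q
 proof (rule integral_dominated_convergence)
  have sQ: "sets Q = sets Bo" using Q by (simp add: radon_measure_def)
  have fC: "emeasure Q ?C < \<infinity>" using Q W(3) by (simp add: radon_measure_def)
  show "(indicator K :: 'a => real) : borel_measurable Q" using compact_sets[OF sQ K(1)] by simp
  show "f n : borel_measurable Q" for n using continuous_measurable[OF sQ L_cont[OF f(1)]] .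
  show "integrable Q (indicator ?C :: 'a => real)" using compact_sets[OF sQ W(3)] fC by simp
  show "AE x in Q. norm (f n x) <= indicator ?C x" for n
  proof (rule AE_I2)
   fix x assume "x : space Q"
   hence x: "x : topspace X" using sets_space[OF sQ] by simp
   show "norm (f n x) <= indicator ?C x"
   proof (cases "f n x = 0")
    case False
    hence "x : W" using supp_superset[of "f n"] x f(5)[of n] by blast
    hence "x : ?C" using W(1) closure_of_subset[OF openin_subset] by blast
    thus ?thesis using f(2,3)[of n x] by simp
   qed simp
  qed
  show "AE x in Q. (%n. f n x) ----> indicator K x"
  proof (rule AE_I2)
   fix x assume "x : space Q"
   hence x: "x : topspace X" using sets_space[OF sQ] by simp
   show "(%n. f n x) ----> indicator K x"
   proof (cases "x : K")
    case True thus ?thesis using f(4) by simp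
   next
    case False
    then obtain m where m: "x \<notin> G m" using G(3) by blast
    have "f n x = 0" if "n >= m" for n
    proof -
     have "x \<notin> G n" using m lift_Suc_antimono_le[of G, OF G(2) that] by blast
     thus ?thesis using supp_superset[of "f n"] x f(5)[of n] by blast
    qed
    hence "\<forall>\<^sub>F n in sequentially. f n x = indicator K x"
     unfolding eventually_sequentially using False by (intro exI[of _ m]) simp
    thus ?thesis by (rule tendsto_eventually)
   qed
  qed
 qed
 have "supp (f n) <= U" for n using f(5)[of n] W closure_of_subset[OF openin_subset[OF W(1)]] by blast
 hence "(LINT x|M. f n x) <= (LINT x|N. f n x)" for n using f by (intro le) auto
 hence "(LINT x|M. indicator K x) <= (\<integral>x. indicator K x \<partial>N :: real)"
  using LIMSEQ_le[OF lim[OF M] lim[OF N]] by blast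
 hence "measure M K <= measure N K"
  using compact_sets[OF s(1) K(1)] compact_sets[OF s(2) K(1)] sets.sets_into_space[of K]
  by (simp add: Int_absorb2)
 thus ?thesis using fin[OF K(1)] by (simp add: emeasure_eq_ennreal_measure ennreal_leI)
qed

lemma radon_compare:
 assumes M: "radon_measure X M" and N: "radon_measure X N" and U: "openin X U"
  and le: "!!f. f : L ==> (!!x. 0 <= f x) ==> supp f <= U ==> (LINT x|M. f x) <= (LINT x|N. f x)"
  and A: "A : sets M" "A <= U"
 shows "emeasure M A <= emeasure N A"
proof -
 have s: "sets M = sets Bo" "sets N = sets Bo" using M N by (simp_all add: radon_measure_def)
 have inner: "emeasure Q A = (SUP K\<in>{K. compactin X K & K <= A}. emeasure Q K)" if "radon_measure X Q" for Q
  using that A(1) s by (simp add: radon_measure_def)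
 show ?thesis unfolding inner[OF M] inner[OF N]
  by (rule SUP_mono) (use radon_compare_compact[OF M N U le] A(2) in blast)
qed

lemma radon_unique_on:
 assumes M: "radon_measure X M" and N: "radon_measure X N" and U: "openin X U"
  and eq: "!!f. f : L ==> (!!x. 0 <= f x) ==> supp f <= U ==> (LINT x|M. f x) = (LINT x|N. f x)"
  and A: "A : sets M" "A <= U"
 shows "emeasure M A = emeasure N A"
proof (rule antisym)
 have "sets M = sets N" using M N by (simp add: radon_measure_def)
 hence A': "A : sets N" using A by simp
 show "emeasure M A <= emeasure N A" by (rule radon_compare[OF M N U _ A]) (simp add: eq)
 show "emeasure N A <= emeasure M A" by (rule radon_compare[OF N M U _ A' A(2)]) (simp add: eq)
qed

lemma radon_unique:
 assumes M: "radon_measure X M" and N: "radon_measure X N"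
  and eq: "!!f. f : L ==> (!!x. 0 <= f x) ==> (LINT x|M. f x) = (LINT x|N. f x)"
 shows "M = N"
proof (rule measure_eqI)
 show s: "sets M = sets N" using M N by (simp add: radon_measure_def)
 have "sets M = sets Bo" using M by (simp add: radon_measure_def)
 hence sp: "space M = topspace X" by (rule sets_space)
 show "emeasure M A = emeasure N A" if "A : sets M" for A
  using sets.sets_into_space[OF that] sp by (intro radon_unique_on[OF M N openin_topspace eq that]) auto
qed

end

section \<open>The measure that represents a positive functional\<close>

locale positive_functional = riesz_space +
 fixes \<Lambda> :: "('a => real) => real"
 assumes lin: "f : L ==> g : L ==> \<Lambda> (%x. a * f x + b * g x) = a * \<Lambda> f + b * \<Lambda> g"
  and pos: "f : L ==> (!!x. x : topspace X ==> 0 <= f x) ==> 0 <= \<Lambda> f"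
begin

lemma \<Lambda>_add: "f : L ==> g : L ==> \<Lambda> (%x. f x + g x) = \<Lambda> f + \<Lambda> g"
 using lin[of f g 1 1] by simp

lemma \<Lambda>_diff: "f : L ==> g : L ==> \<Lambda> (%x. f x - g x) = \<Lambda> f - \<Lambda> g"
 using lin[of f g 1 "-1"] by simp

lemma \<Lambda>_scale: "f : L ==> \<Lambda> (%x. a * f x) = a * \<Lambda> f"
 using lin[of f f a 0] by simp

lemma \<Lambda>_mono:
 assumes "f : L" "g : L" "!!x. x : topspace X ==> f x <= g x"
 shows "\<Lambda> f <= \<Lambda> g"
 using pos[OF L_diff[OF assms(2,1)]] \<Lambda>_diff[OF assms(2,1)] assms(3) by simp

lemma \<Lambda>_cong:
 assumes "f : L" "g : L" "!!x. x : topspace X ==> f x = g x"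
 shows "\<Lambda> f = \<Lambda> g"
 using \<Lambda>_mono[OF assms(1,2)] \<Lambda>_mono[OF assms(2,1)] assms(3) by force

lemma \<Lambda>_zero: "f : L ==> (!!x. x : topspace X ==> f x = 0) ==> \<Lambda> f = 0"
 using \<Lambda>_cong[of f "%x. 0 * f x"] \<Lambda>_scale[of f 0] L_scale[of f 0] by simp

text \<open>\<open>sub\<close>, \<open>lam\<close> and \<open>out\<close> are the classical
  construction: test functions subordinate to an open set, the content of open sets, and the outer
  measure generated by it.\<close>

definition sub :: "'a set => ('a => real) set" where
 "sub U = {f : L. (ALL x:topspace X. 0 <= f x & f x <= 1) & supp f <= U}"

definition lam :: "'a set => ennreal" where
 "lam U = (SUP f\<in>sub U. ennreal (\<Lambda> f))"

definition out :: "'a set => ennreal" where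
 "out A = (INF U\<in>{U. openin X U & A <= U}. lam U)"

lemma subD:
 assumes "f : sub U"
 shows "f : L" "supp f <= U" "!!x. x : topspace X ==> 0 <= f x" "!!x. x : topspace X ==> f x <= 1"
  "!!x. x : topspace X ==> x \<notin> U ==> f x = 0"
 using assms supp_superset[of f] by (auto simp: sub_def)

lemma sub_le_lam: "f : sub U ==> ennreal (\<Lambda> f) <= lam U"
 unfolding lam_def by (rule SUP_upper)

lemma lam_least: "(!!f. f : sub U ==> ennreal (\<Lambda> f) <= c) ==> lam U <= c"
 unfolding lam_def by (rule SUP_least)

lemma zero_sub: "(%x. 0) : sub U"
 using L_zero by (auto simp: sub_def)

lemma lam_mono: "U <= V ==> lam U <= lam V"
 unfolding lam_def by (rule SUP_subset_mono) (auto simp: sub_def)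

lemma lam_empty: "lam {} = 0"
proof -
 have "lam {} <= 0"
 proof (rule lam_least)
  fix f assume "f : sub {}"
  thus "ennreal (\<Lambda> f) <= 0" using \<Lambda>_zero[of f] subD[of f "{}"] by simp
 qed
 thus ?thesis by simp
qed

text \<open>A Urysohn function \<open>h\<close> that equals 1 near \<open>supp f - V\<close> splits
  \<open>f\<close> into \<open>f * h\<close>, subordinate to \<open>U\<close>, and the remainder,
  subordinate to \<open>V\<close>.\<close>

lemma lam_Un:
 assumes U: "openin X U" and V: "openin X V"
 shows "lam (U \<union> V) <= lam U + lam V"
proof (rule lam_least)
 fix f assume f: "f : sub (U \<union> V)"
 note fD = subD[OF f]
 have K: "compactin X (supp f - V)" using L_supp[OF fD(1)] V by (rule compact_diff_open)
 have "supp f - V <= U" using fD(2) by blast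
 then obtain W where W: "openin X W" "supp f - V <= W" "compactin X (X closure_of W)" "X closure_of W <= U"
  using compact_open_interpolate[OF K U] by blast
 obtain h where h: "h : L" "!!x. 0 <= h x & h x <= 1" "!!x. x : X closure_of W ==> h x = 1" "supp h <= U"
  using L_urysohn[OF W(3) U W(4)] by blast
 let ?a = "%x. f x * h x" and ?b = "%x. f x - f x * h x"
 have a: "?a : L" and b: "?b : L" using L_mult[OF fD(1) h(1)] L_diff[OF fD(1)] by auto
 have "supp ?a <= supp h" by (rule closure_of_mono) auto
 moreover have "0 <= ?a x & ?a x <= 1" if "x : topspace X" for x
  using fD(3,4)[OF that] h(2)[of x] by (simp add: mult_le_one)
 ultimately have as: "?a : sub U" using a h(4) by (auto simp: sub_def)
 have "supp ?b <= supp f - W"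
 proof (rule closure_of_minimal)
  have WC: "W <= X closure_of W" using W(1) by (simp add: closure_of_subset openin_subset)
  have "f x = 0" if "x : topspace X" "x \<notin> supp f" for x using supp_superset[of f] that by blast
  moreover have "?b x = 0" if "x : W" for x using h(3)[of x] that WC by auto
  ultimately show "{x : topspace X. ?b x ~= 0} <= supp f - W" by auto
  show "closedin X (supp f - W)" using W(1) by (simp add: closedin_diff)
 qed
 moreover have "0 <= ?b x & ?b x <= 1" if "x : topspace X" for x
 proof -
  have "f x * h x <= f x * 1" using fD(3)[OF that] h(2)[of x] by (intro mult_left_mono) auto
  moreover have "0 <= f x * h x" using fD(3)[OF that] h(2)[of x] by simp
  ultimately show ?thesis using fD(4)[OF that] by auto
 qed
 ultimately have bs: "?b : sub V" using b fD(2) W(2) by (auto simp: sub_def)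
 have "\<Lambda> f = \<Lambda> ?a + \<Lambda> ?b" using \<Lambda>_add[OF a b] by simp
 moreover have "0 <= \<Lambda> ?a" "0 <= \<Lambda> ?b" using pos[OF a] pos[OF b] subD[OF as] subD[OF bs] by auto
 ultimately have "ennreal (\<Lambda> f) = ennreal (\<Lambda> ?a) + ennreal (\<Lambda> ?b)" by simp
 also have "... <= lam U + lam V" using as bs by (intro add_mono sub_le_lam)
 finally show "ennreal (\<Lambda> f) <= lam U + lam V" .
qed

lemma lam_finite:
 fixes n :: nat
 assumes "!!i. openin X (U i)"
 shows "lam (\<Union>i<n. U i) <= (\<Sum>i<n. lam (U i))"
proof (induct n)
 case 0 thus ?case by (simp add: lam_empty)
next
 case (Suc n)
 have "lam (\<Union>i<Suc n. U i) <= lam (\<Union>i<n. U i) + lam (U n)"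
  using lam_Un[OF openin_Union assms, of "U ` {..<n}" n] assms by (auto simp: lessThan_Suc Un_commute)
 also have "... <= (\<Sum>i<Suc n. lam (U i))" using Suc by (simp add: add_right_mono)
 finally show ?case .
qed

lemma lam_countable:
 fixes U :: "nat => 'a set"
 assumes U: "!!i. openin X (U i)"
 shows "lam (\<Union>i. U i) <= (\<Sum>i. lam (U i))"
proof (rule lam_least)
 fix f assume f: "f : sub (\<Union>i. U i)"
 note fD = subD[OF f]
 have "EX \<F>. finite \<F> & \<F> <= range U & supp f <= \<Union>\<F>"
  using L_supp[OF fD(1)] fD(2) U unfolding compactin_def by (metis (mono_tags, lifting) rangeE)
 then obtain \<F> where F: "finite \<F>" "\<F> <= range U" "supp f <= \<Union>\<F>" by blast
 obtain I where I: "finite I" "\<F> = U ` I" using finite_subset_image[OF F(1,2)] by blast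
 obtain n where "I <= {..<n}" using finite_nat_bounded[OF I(1)] by blast
 hence "supp f <= (\<Union>i<n. U i)" using F(3) I(2) by blast
 hence "f : sub (\<Union>i<n. U i)" using f by (simp add: sub_def)
 hence "ennreal (\<Lambda> f) <= lam (\<Union>i<n. U i)" by (rule sub_le_lam)
 also have "... <= (\<Sum>i<n. lam (U i))" by (rule lam_finite[OF U])
 also have "... <= (\<Sum>i. lam (U i))" by (rule sum_le_suminf) auto
 finally show "ennreal (\<Lambda> f) <= (\<Sum>i. lam (U i))" .
qed

lemma out_le: "openin X U ==> A <= U ==> out A <= lam U"
 unfolding out_def by (rule INF_lower) auto

lemma out_greatest: "(!!U. openin X U ==> A <= U ==> c <= lam U) ==> c <= out A"
 unfolding out_def by (rule INF_greatest) auto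

lemma out_open: "openin X U ==> out U = lam U"
 by (intro antisym out_le out_greatest lam_mono) auto

lemma out_mono: "A <= B ==> out A <= out B"
 by (intro out_greatest out_le) auto

lemma out_close:
 assumes "out A < c" obtains U where "openin X U" "A <= U" "lam U < c"
 using assms unfolding out_def INF_less_iff by blast

lemma out_countable:
 fixes A :: "nat => 'a set"
 shows "out (\<Union>i. A i) <= (\<Sum>i. out (A i))"
proof (rule ennreal_le_epsilon)
 fix e :: real assume e: "0 < e" "(\<Sum>i. out (A i)) < top"
 have lt: "out (A n) < out (A n) + e * (1/2) ^ Suc n" for n
  using e by (auto simp add: less_top dest!: ennreal_suminf_lessD)
 have "EX U. openin X U & A n <= U & lam U <= out (A n) + e * (1/2) ^ Suc n" for n
  by (rule out_close[OF lt[of n]]) (auto intro: less_imp_le)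
 then obtain U where U: "!!n. openin X (U n)" "!!n. A n <= U n" "!!n. lam (U n) <= out (A n) + e * (1/2) ^ Suc n"
  by metis
 have "out (\<Union>i. A i) <= lam (\<Union>i. U i)" using U(1,2) by (intro out_le) blast+
 also have "... <= (\<Sum>i. lam (U i))" by (rule lam_countable[OF U(1)])
 also have "... <= (\<Sum>n. out (A n) + e * (1/2) ^ Suc n)" using U(3) by (intro suminf_le) auto
 also have "... = (\<Sum>n. out (A n)) + (\<Sum>n. ennreal e * ennreal ((1/2) ^ Suc n))"
  using \<open>0 < e\<close> by (subst suminf_add[symmetric])
    (auto simp del: ennreal_suminf_cmult simp add: ennreal_mult[symmetric])
 also have "... = (\<Sum>n. out (A n)) + e"
  unfolding ennreal_suminf_cmult
  by (subst suminf_ennreal_eq[OF zero_le_power power_half_series]) auto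
 finally show "out (\<Union>i. A i) <= (\<Sum>n. out (A n)) + e" .
qed

lemma out_empty: "out {} = 0"
 using out_open[of "{}"] lam_empty by simp

lemma out_Un: "out (A \<union> B) <= out A + out B"
proof -
 let ?A = "%n::nat. if n = 0 then A else if n = 1 then B else {}"
 have "(\<Union>i. ?A i) = A \<union> B" by (auto split: if_splits)
 moreover have "(\<Sum>i. out (?A i)) = (\<Sum>i<2. out (?A i))"
  by (rule suminf_finite) (auto simp: out_empty)
 moreover have "{..<2::nat} = {0, 1}" by auto
 ultimately show ?thesis using out_countable[of ?A] by simp
qed

text \<open>The nontrivial half of Caratheodory's condition. A function subordinate to
  \<open>V \<inter> U\<close> leaves \<open>V\<close> minus its support open, and adding a function
  subordinate to that set still stays below 1.\<close>

lemma out_open_additive: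
 assumes U: "openin X U" and A: "A <= topspace X"
 shows "out (A \<inter> U) + out (A - U) <= out A"
proof (rule out_greatest)
 fix V assume V: "openin X V" "A <= V"
 have "lam (V \<inter> U) + out (V - U) <= lam V"
  unfolding lam_def[of "V \<inter> U"]
 proof (subst ennreal_SUP_add_left[symmetric])
  show "sub (V \<inter> U) ~= {}" using zero_sub by blast
  show "(SUP f\<in>sub (V \<inter> U). ennreal (\<Lambda> f) + out (V - U)) <= lam V"
  proof (rule SUP_least)
   fix f assume f: "f : sub (V \<inter> U)"
   note fD = subD[OF f]
   have o: "openin X (V - supp f)" using V(1) by (simp add: openin_diff)
   have "out (V - U) <= lam (V - supp f)" using fD(2) o by (intro out_le) auto
   hence "ennreal (\<Lambda> f) + out (V - U) <= ennreal (\<Lambda> f) + lam (V - supp f)" by (rule add_left_mono)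
   also have "... = (SUP g\<in>sub (V - supp f). ennreal (\<Lambda> f) + ennreal (\<Lambda> g))"
    unfolding lam_def using zero_sub by (subst ennreal_SUP_add_right) auto
   also have "... <= lam V"
   proof (rule SUP_least)
    fix g assume g: "g : sub (V - supp f)"
    note gD = subD[OF g]
    have fg: "(%x. f x + g x) : sub V"
    proof -
     have "0 <= f x + g x & f x + g x <= 1" if x: "x : topspace X" for x
      using fD(3,4)[OF x] gD(3,4,5)[OF x] supp_superset[of f] x by (cases "f x = 0") auto
     moreover have "supp (%x. f x + g x) <= supp f \<union> supp g"
      unfolding closure_of_Un[symmetric] by (rule closure_of_mono) auto
     ultimately show ?thesis using L_add[OF fD(1) gD(1)] fD(2) gD(2) by (auto simp: sub_def)
    qed
    have "0 <= \<Lambda> f" "0 <= \<Lambda> g" using pos fD gD by auto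
    hence "ennreal (\<Lambda> f) + ennreal (\<Lambda> g) = ennreal (\<Lambda> (%x. f x + g x))"
     using \<Lambda>_add[OF fD(1) gD(1)] by simp
    thus "ennreal (\<Lambda> f) + ennreal (\<Lambda> g) <= lam V" using sub_le_lam[OF fg] by simp
   qed
   finally show "ennreal (\<Lambda> f) + out (V - U) <= lam V" .
  qed
 qed
 moreover have "out (A \<inter> U) <= lam (V \<inter> U)" using V U by (intro out_le) auto
 moreover have "out (A - U) <= out (V - U)" using V by (intro out_mono) auto
 ultimately show "out (A \<inter> U) + out (A - U) <= lam V" using add_mono order_trans by meson
qed

definition rep :: "'a measure" where
 "rep = measure_of (topspace X) {U. openin X U} out"

lemma rep_sets: "sets rep = sets Bo"
 using opens_sub by (simp add: rep_def sets_measure_of)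

lemma rep_space: "space rep = topspace X"
 using opens_sub by (simp add: rep_def space_measure_of)

text \<open>\<open>measure_of\<close> yields the zero measure unless its argument is countably
  additive, so this has to be shown first. Open sets satisfy Caratheodory's condition, hence the
  whole Borel algebra does.\<close>

lemma rep_emeasure:
 assumes "A : sets rep" shows "emeasure rep A = out A"
proof -
 interpret S: sigma_algebra "topspace X" "Pow (topspace X)" by (rule sigma_algebra_Pow)
 let ?L = "lambda_system (topspace X) (Pow (topspace X)) out"
 have oms: "outer_measure_space (Pow (topspace X)) out"
  unfolding outer_measure_space_def positive_def increasing_def countably_subadditive_def
  using out_empty out_mono out_countable by auto
 have ms: "measure_space (topspace X) ?L out" by (rule S.caratheodory_lemma[OF oms])
 have "U : ?L" if U: "openin X U" for U
 proof -
  have "out (A \<inter> U) + out (A - U) = out A" if "A <= topspace X" for A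
   using out_open_additive[OF U that] out_Un[of "A \<inter> U" "A - U"] by (simp add: Int_Diff_Un)
  thus ?thesis using openin_subset[OF U] by (simp add: S.lambda_system_eq)
 qed
 hence "sigma_sets (topspace X) {U. openin X U} <= ?L"
  using ms unfolding measure_space_def by (intro sigma_algebra.sigma_sets_subset) auto
 hence "measure_space (topspace X) (sigma_sets (topspace X) {U. openin X U}) out"
  by (rule measure_down[OF ms sigma_algebra_sigma_sets[OF opens_sub]])
 hence "positive (sets rep) out" "countably_additive (sets rep) out"
  unfolding measure_space_def rep_def using opens_sub by (simp_all add: sets_measure_of)
 thus ?thesis using assms
  by (intro emeasure_measure_of[OF rep_def opens_sub]) (auto simp: rep_def)
qed

text \<open>The set where \<open>g\<close> exceeds \<open>t * d\<close> is an open neighbourhood of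
  \<open>K\<close> only for \<open>t < 1\<close>, so the estimate is proved for such
  \<open>t\<close> and then passed to the limit.\<close>

lemma rep_compact_le:
 assumes K: "compactin X K" and g: "g : L" "!!x. x : topspace X ==> 0 <= g x" "!!x. x : K ==> d <= g x" and d: "0 < d"
 shows "ennreal d * out K <= ennreal (\<Lambda> g)"
proof -
 have Kt: "K <= topspace X" using compactin_subset_topspace[OF K] .
 have *: "ennreal (t * d) * out K <= ennreal (\<Lambda> g)" if t: "0 < t" "t < 1" for t
 proof -
  let ?U = "{x : topspace X. g x : {t * d<..}}"
  have td: "0 < t * d" "t * d < d" using t d by auto
  have o: "openin X ?U" by (rule openin_continuous_map_preimage[OF L_cont[OF g(1)]]) simp
  have KU: "K <= ?U" using g(3) td Kt by force
  have "lam ?U <= ennreal (\<Lambda> g / (t * d))"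
  proof (rule lam_least)
   fix f assume f: "f : sub ?U"
   note fD = subD[OF f]
   have "\<Lambda> f <= \<Lambda> (%x. (1 / (t * d)) * g x)"
   proof (rule \<Lambda>_mono[OF fD(1) L_scale[OF g(1)]])
    fix x assume x: "x : topspace X"
    show "f x <= 1 / (t * d) * g x"
    proof (cases "x : ?U")
     case True
     hence "1 <= 1 / (t * d) * g x" using td by (simp add: field_simps)
     thus ?thesis using fD(4)[OF x] by linarith
    next
     case False
     thus ?thesis using fD(5)[OF x] g(2)[OF x] td by simp
    qed
   qed
   thus "ennreal (\<Lambda> f) <= ennreal (\<Lambda> g / (t * d))"
    unfolding \<Lambda>_scale[OF g(1)] by (intro ennreal_leI) simp
  qed
  hence "out K <= ennreal (\<Lambda> g / (t * d))" using out_le[OF o KU] by (rule order_trans[rotated])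
  hence "ennreal (t * d) * out K <= ennreal (t * d) * ennreal (\<Lambda> g / (t * d))" by (rule mult_left_mono) simp
  also have "... = ennreal (\<Lambda> g)" using td t d pos[OF g(1,2)] by (simp add: ennreal_mult[symmetric])
  finally show ?thesis .
 qed
 have "out K ~= top"
 proof
  assume "out K = top"
  hence "ennreal (1/2 * d) * top <= ennreal (\<Lambda> g)" using *[of "1/2"] by simp
  thus False using d by (simp add: ennreal_mult_top top_unique)
 qed
 then obtain r where r: "0 <= r" "out K = ennreal r" by (cases "out K") auto
 have "t * (d * r) <= \<Lambda> g" if "0 < t" "t < 1" for t
 proof -
  have "ennreal (t * d * r) <= ennreal (\<Lambda> g)"
   using *[OF that] r d that by (simp add: ennreal_mult[symmetric])
  thus ?thesis using pos[OF g(1,2)] by (simp add: mult.assoc)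
 qed
 hence "d * r <= \<Lambda> g" by (rule field_le_mult_one_interval)
 thus ?thesis using r d by (simp add: ennreal_mult[symmetric] ennreal_leI)
qed

lemma rep_compact_ge:
 assumes K: "compactin X K" and g: "g : L" "!!x. x : topspace X ==> 0 <= g x & g x <= d" "supp g <= K" and d: "0 < d"
 shows "ennreal (\<Lambda> g) <= ennreal d * out K"
proof -
 have "ennreal (\<Lambda> g / d) <= out K"
 proof (rule out_greatest)
  fix U assume U: "openin X U" "K <= U"
  have "supp (%x. (1/d) * g x) <= supp g" by (rule closure_of_mono) auto
  hence "(%x. (1/d) * g x) : sub U"
   using g U d L_scale[OF g(1), of "1/d"] by (auto simp: sub_def)
  thus "ennreal (\<Lambda> g / d) <= lam U" using sub_le_lam \<Lambda>_scale[OF g(1), of "1/d"] by fastforce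
 qed
 hence "ennreal d * ennreal (\<Lambda> g / d) <= ennreal d * out K" by (rule mult_left_mono) simp
 moreover have "ennreal d * ennreal (\<Lambda> g / d) = ennreal (\<Lambda> g)"
  using d pos[OF g(1)] g(2) by (simp add: ennreal_mult[symmetric])
 ultimately show ?thesis by simp
qed

lemma rep_compact_finite:
 assumes "compactin X K" shows "emeasure rep K < \<infinity>"
proof -
 obtain g where g: "g : L" "!!x. 0 <= g x" "!!x. x : K ==> g x = 1"
  using L_urysohn[OF assms openin_topspace compactin_subset_topspace[OF assms]] by blast
 have "ennreal 1 * out K <= ennreal (\<Lambda> g)" using g by (intro rep_compact_le assms) auto
 hence "out K < \<infinity>" by (simp add: order_le_less_trans)
 thus ?thesis using rep_emeasure compact_sets[OF rep_sets assms] by simp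
qed

lemma rep_radon: "radon_measure X rep"
 unfolding radon_measure_def
proof (intro conjI allI impI ballI)
 show "sets rep = sets Bo" by (rule rep_sets)
 show "emeasure rep K < \<infinity>" if "compactin X K" for K using rep_compact_finite[OF that] .
 fix A assume A: "A : sets rep"
 let ?S = "SUP K\<in>{K. compactin X K & K <= A}. emeasure rep K"
 obtain C where C: "!!n::nat. compactin X (C n)" "!!n. C n <= C (Suc n)" "(\<Union>n. C n) = topspace X"
  by (rule open_Union_compact[OF openin_topspace]) blast
 have Cs: "C n : sets rep" for n using compact_sets[OF rep_sets C(1)] .
 have loc: "emeasure rep (A \<inter> C n) <= ?S" for n
 proof (rule ennreal_le_epsilon)
  fix e :: real assume e: "0 < e"
  let ?B = "C n - A"
  have B: "?B : sets rep" using A Cs by simp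
  have fin: "emeasure rep ?B < \<infinity>"
   using emeasure_mono[of ?B "C n" rep] Cs rep_compact_finite[OF C(1)] by (auto intro: order_le_less_trans)
  \<comment> \<open>Outer approximation of \<open>C n - A\<close> by an open \<open>U\<close>
    becomes inner approximation of \<open>A \<inter> C n\<close> by the compact set
    \<open>C n - U\<close>.\<close>
  have "out ?B < out ?B + ennreal e" using fin e rep_emeasure[OF B] by (simp add: less_top)
  then obtain U where U: "openin X U" "?B <= U" "lam U < out ?B + ennreal e" by (rule out_close)
  have Us: "U : sets rep" using open_sets[OF rep_sets U(1)] .
  let ?K = "C n - U"
  have K: "compactin X ?K" using C(1) U(1) by (rule compact_diff_open)
  have KA: "?K <= A" using U(2) by blast
  have Ks: "?K : sets rep" using Cs Us by simp
  have "emeasure rep ?B + emeasure rep (U - ?B) = emeasure rep U"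
   using U(2) B Us by (subst plus_emeasure) (auto simp: Un_absorb1 intro!: arg_cong[where f="emeasure rep"])
  also have "... <= emeasure rep ?B + ennreal e"
   using U(3) rep_emeasure[OF B] rep_emeasure[OF Us] out_open[OF U(1)] by simp
  finally have "emeasure rep (U - ?B) <= ennreal e" using fin by (auto simp: ennreal_add_left_cancel_le)
  moreover have "A \<inter> C n <= ?K \<union> (U - ?B)" by blast
  ultimately have "emeasure rep (A \<inter> C n) <= emeasure rep ?K + ennreal e"
   using emeasure_mono[of "A \<inter> C n" "?K \<union> (U - ?B)" rep] emeasure_subadditive[of ?K rep "U - ?B"] Ks Us B
   by (auto intro: order_trans add_left_mono)
  also have "emeasure rep ?K <= ?S" using K KA by (intro SUP_upper) auto
  finally show "emeasure rep (A \<inter> C n) <= ?S + ennreal e" by (simp add: add_right_mono)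
 qed
 have "A <= topspace X" using sets.sets_into_space[OF A] rep_space by simp
 hence "(\<Union>n. A \<inter> C n) = A" using C(3) by blast
 moreover have "(SUP n. emeasure rep (A \<inter> C n)) = emeasure rep (\<Union>n. A \<inter> C n)"
  using A Cs C(2) by (intro SUP_emeasure_incseq) (auto simp: incseq_Suc_iff)
 ultimately have "emeasure rep A = (SUP n. emeasure rep (A \<inter> C n))" by simp
 also have "... <= ?S" by (rule SUP_least) (rule loc)
 finally have "emeasure rep A <= ?S" .
 moreover have "?S <= emeasure rep A" using A by (intro SUP_least emeasure_mono) auto
 ultimately show "emeasure rep A = ?S" by (rule antisym)
qed

lemma rep_measure: "compactin X K ==> out K = ennreal (measure rep K)"
 using rep_emeasure[OF compact_sets[OF rep_sets]] rep_compact_finite[of K] emeasure_eq_ennreal_measure[of rep K] by force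

text \<open>Cut \<open>f\<close> into \<open>N\<close> horizontal slices of height
  \<open>d = 1 / N\<close>. The functional and the integral of the \<open>k\<close>-th slice both
  lie between \<open>d * c (Suc k)\<close> and \<open>d * c k\<close>, so the total discrepancy
  telescopes to at most \<open>d * c 0\<close>.\<close>

lemma rep_integral_unit:
 assumes f: "f : L" and f01: "!!x. x : topspace X ==> 0 <= f x & f x <= 1"
 shows "(LINT x|rep. f x) = \<Lambda> f"
proof -
 have est: "\<bar>\<Lambda> f - (LINT x|rep. f x)\<bar> <= measure rep (supp f) * (1 / real (Suc n))" for n
 proof -
  define N where "N = Suc n"
  define d where "d = 1 / real N"
  have d: "0 < d" "real N * d = 1" by (simp_all add: d_def N_def)
  define T where "T k x = min (max (x - real k * d) 0) d" for k and x :: real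
  define g where "g k x = T k (f x)" for k x
  \<comment> \<open>For \<open>k = 0\<close> the superlevel set would be the whole space, so the
    compact support takes its place.\<close>
  define K where "K k = (if k = 0 then supp f else {x : topspace X. f x : {real k * d..}})" for k
  have T: "1-lipschitz_on UNIV (T k)" "T k 0 = 0" for k
   unfolding T_def using d clamp_lipschitz[of d "real k * d"] by auto
  have gL: "g k : L" for k using L_lipschitz[OF f T, of k] unfolding g_def by simp
  have K: "compactin X (K k)" for k
  proof (cases "k = 0")
   case False
   hence "K k = {x : topspace X. f x : {real k * d..}}" by (simp add: K_def)
   hence "closedin X (K k)" using closedin_continuous_map_preimage[OF L_cont[OF f], of "{real k * d..}"] by simp
   moreover have "K k <= supp f"
   proof
    fix x assume "x : K k"
    hence "x : topspace X" "real k * d <= f x" using False by (auto simp: K_def)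
    moreover have "0 < real k * d" using False d by simp
    ultimately show "x : supp f" using supp_superset[of f] by force
   qed
   ultimately show ?thesis using closed_compactin[OF L_supp[OF f]] by blast
  qed (use L_supp[OF f] in \<open>simp add: K_def\<close>)
  have gb: "0 <= g k x & g k x <= d" for k x using d by (simp add: g_def T_def)
  have gK: "d <= g k x" if "x : K (Suc k)" for k x
   using that d by (simp add: g_def T_def K_def algebra_simps)
  have gs: "supp (g k) <= K k" for k
  proof (cases "k = 0")
   case True
   thus ?thesis unfolding K_def using d
    by simp (rule closure_of_mono, auto simp: g_def T_def)
  next
   case False
   show ?thesis
   proof (rule closure_of_minimal[OF _ compact_closed[OF K]])
    have "g k x = 0" if "f x < real k * d" for x using that d by (simp add: g_def T_def)
    thus "{x : topspace X. g k x ~= 0} <= K k" using False by (force simp: K_def)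
   qed
  qed
  define c where "c k = measure rep (K k)" for k
  have oK: "out (K k) = ennreal (c k)" and c0: "0 <= c k" for k
   unfolding c_def using rep_measure[OF K] by auto
  have a: "d * c (Suc k) <= \<Lambda> (g k)" "\<Lambda> (g k) <= d * c k" for k
  proof -
   have p: "0 <= \<Lambda> (g k)" using gb by (intro pos gL) auto
   have "ennreal d * out (K (Suc k)) <= ennreal (\<Lambda> (g k))"
    using gb gK d by (intro rep_compact_le K gL) auto
   thus "d * c (Suc k) <= \<Lambda> (g k)" unfolding oK using d p c0 by (simp add: ennreal_mult[symmetric])
   have "ennreal (\<Lambda> (g k)) <= ennreal d * out (K k)"
    using gb gs d by (intro rep_compact_ge K gL) auto
   thus "\<Lambda> (g k) <= d * c k" unfolding oK using d p c0 by (simp add: ennreal_mult[symmetric])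
  qed
  have I: "integrable rep (g k)" for k using radon_L_integrable[OF rep_radon gL] .
  have IK: "integrable rep (%x. d * indicator (K k) x)" "(LINT x|rep. d * indicator (K k) x) = d * c k" for k
  proof -
   have s: "K k : sets rep" using compact_sets[OF rep_sets K] .
   thus "integrable rep (%x. d * indicator (K k) x)" using rep_compact_finite[OF K] by simp
   show "(LINT x|rep. d * indicator (K k) x) = d * c k"
    using s sets.sets_into_space[OF s] by (simp add: c_def Int_absorb2)
  qed
  have b: "d * c (Suc k) <= (LINT x|rep. g k x)" "(LINT x|rep. g k x) <= d * c k" for k
  proof -
   show "d * c (Suc k) <= (LINT x|rep. g k x)" unfolding IK(2)[symmetric]
    by (rule integral_mono[OF IK(1) I]) (use gK gb in \<open>auto simp: indicator_def\<close>)
   show "(LINT x|rep. g k x) <= d * c k" unfolding IK(2)[symmetric]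
   proof (rule integral_mono[OF I IK(1)])
    fix x assume "x : space rep"
    hence "x : K k" if "g k x ~= 0" using that gs[of k] supp_superset[of "g k"] rep_space by blast
    thus "g k x <= d * indicator (K k) x" using gb[of k x] d by (cases "g k x = 0") (auto simp: indicator_def)
   qed
  qed
  have Tsum: "(\<Sum>k<m. T k x) = min x (real m * d)" if "0 <= x" for m and x :: real
   by (induct m) (use that d in \<open>auto simp: T_def algebra_simps min_def max_def\<close>)
  have fsum: "f x = (\<Sum>k<N. g k x)" if "x : topspace X" for x
   using Tsum[of "f x" N] f01[OF that] d(2) by (simp add: g_def)
  have SL: "(%x. \<Sum>k<m. g k x) : L & \<Lambda> (%x. \<Sum>k<m. g k x) = (\<Sum>k<m. \<Lambda> (g k))" for m
  proof (induct m)
   case 0 show ?case using L_zero \<Lambda>_zero[OF L_zero] by simp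
  next
   case (Suc m)
   thus ?case using L_add[of "%x. \<Sum>k<m. g k x" "g m"] \<Lambda>_add[of "%x. \<Sum>k<m. g k x" "g m"] gL by simp
  qed
  have "\<Lambda> f = (\<Sum>k<N. \<Lambda> (g k))" using \<Lambda>_cong[OF f conjunct1[OF SL] fsum] SL[of N] by simp
  moreover have "(LINT x|rep. f x) = (\<Sum>k<N. \<integral>x. g k x \<partial>rep)"
  proof -
   have "(LINT x|rep. f x) = (LINT x|rep. (\<Sum>k<N. g k x))"
    using fsum rep_space by (intro Bochner_Integration.integral_cong) auto
   thus ?thesis using I by (simp add: Bochner_Integration.integral_sum)
  qed
  ultimately have "\<bar>\<Lambda> f - (LINT x|rep. f x)\<bar> = \<bar>\<Sum>k<N. \<Lambda> (g k) - (LINT x|rep. g k x)\<bar>" by (simp add: sum_subtractf)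
  also have "... <= (\<Sum>k<N. \<bar>\<Lambda> (g k) - (LINT x|rep. g k x)\<bar>)" by (rule sum_abs)
  also have "... <= (\<Sum>k<N. d * c k - d * c (Suc k))"
  proof (rule sum_mono)
   fix k show "\<bar>\<Lambda> (g k) - (LINT x|rep. g k x)\<bar> <= d * c k - d * c (Suc k)" using a[of k] b[of k] by linarith
  qed
  also have "... = d * c 0 - d * c N" by (rule sum_lessThan_telescope')
  also have "... <= d * c 0" using d c0 by simp
  finally show ?thesis by (simp add: d_def N_def c_def K_def mult.commute)
 qed
 have "(%n. measure rep (supp f) * (1 / real (Suc n))) ----> measure rep (supp f) * 0"
  by (intro tendsto_mult tendsto_const LIMSEQ_Suc[OF lim_1_over_n])
 hence "\<bar>\<Lambda> f - (LINT x|rep. f x)\<bar> <= measure rep (supp f) * 0"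
  by (rule LIMSEQ_le_const) (use est in blast)
 thus ?thesis by simp
qed

lemma rep_integral:
 assumes f: "f : L" shows "(LINT x|rep. f x) = \<Lambda> f"
proof -
 have *: "(LINT x|rep. g x) = \<Lambda> g" if g: "g : L" "!!x. 0 <= g x" for g
 proof -
  obtain c where c: "0 < c" "!!x. x : topspace X ==> \<bar>g x\<bar> <= c" by (rule L_bounded[OF g(1)]) blast
  have "(LINT x|rep. (1 / c) * g x) = \<Lambda> (%x. (1 / c) * g x)"
   using c g by (intro rep_integral_unit L_scale) (auto simp: abs_le_iff)
  thus ?thesis using \<Lambda>_scale[OF g(1), of "1/c"] c by simp
 qed
 let ?p = "%x. max (f x) 0" and ?n = "%x. max (- f x) 0"
 have mL: "?p : L" "?n : L"
  using L_lipschitz[OF f max0_lipschitz] L_lipschitz[OF L_scale[OF f, of "-1"] max0_lipschitz] by auto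
 have eq: "f = (%x. ?p x - ?n x)" by auto
 have "(LINT x|rep. f x) = (LINT x|rep. ?p x) - (LINT x|rep. ?n x)"
  using Bochner_Integration.integral_diff[OF radon_L_integrable[OF rep_radon mL(1)] radon_L_integrable[OF rep_radon mL(2)]] eq by metis
 also have "... = \<Lambda> ?p - \<Lambda> ?n" using *[OF mL(1)] *[OF mL(2)] by simp
 also have "... = \<Lambda> f" using \<Lambda>_diff[OF mL] eq by metis
 finally show ?thesis .
qed

end

section \<open>Strongly local Dirichlet spaces\<close>

locale dirichlet =
 fixes D :: "'a form_space"
 assumes dirichlet: "strongly_local_dirichlet_space D"
begin

sublocale closed_markovian_form D
 using dirichlet by unfold_locales (simp_all add: strongly_local_dirichlet_space_def)

sublocale lcs_space "top_of D"
 using dirichlet by unfold_locales (simp_all add: strongly_local_dirichlet_space_def)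

abbreviation "X \<equiv> top_of D"
abbreviation "\<Omega> \<equiv> topspace (top_of D)"
abbreviation "L \<equiv> dom_Cc D"

lemma M_radon: "radon_measure X M"
 using dirichlet by (simp add: strongly_local_dirichlet_space_def)

lemma L_iff: "f : L \<longleftrightarrow> f : F & continuous_map X euclideanreal f &
  compactin X (X closure_of {x : \<Omega>. f x ~= 0})"
 by (auto simp: dom_Cc_def Cc_space_def C_space_def Let_def closure_of_subset_topspace)

lemma M_sets: "sets M = sets (sigma \<Omega> {U. openin X U})"
 using M_radon by (simp add: radon_measure_def)

lemma M_space: "space M = \<Omega>"
 using M_sets by (metis sets_eq_imp_space_eq space_measure_of Pow_iff mem_Collect_eq openin_subset subsetI)

lemma L_F: "f : L ==> f : F"
 by (simp add: L_iff)

lemma compact_support_bounded: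
 assumes "continuous_map X euclideanreal f" "compactin X (X closure_of {x : \<Omega>. f x ~= 0})"
 obtains c where "0 < c" "!!x. x : \<Omega> ==> \<bar>f x\<bar> <= c"
proof -
 let ?S = "X closure_of {x : \<Omega>. f x ~= 0}"
 have S: "{x : \<Omega>. f x ~= 0} <= ?S" by (rule closure_of_subset) auto
 have "compactin euclideanreal (f ` ?S)" by (rule image_compactin[OF assms(2,1)])
 hence "bounded (f ` ?S)" by (simp add: compact_imp_bounded)
 then obtain c where c: "ALL y:f ` ?S. norm y <= c" unfolding bounded_iff by blast
 have "\<bar>f x\<bar> <= max c 1" if "x : \<Omega>" for x
  using c S that by (cases "f x = 0") force+
 thus thesis using that[of "max c 1"] by simp
qed

lemma L_Fb: "f : L ==> f : Fb"
proof -
 assume f: "f : L"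
 then obtain c where c: "!!x. x : \<Omega> ==> \<bar>f x\<bar> <= c"
  using compact_support_bounded[of f] unfolding L_iff by blast
 have "AE x in M. \<bar>f x\<bar> <= c" by (rule AE_I2) (use c M_space in auto)
 thus ?thesis using f by (intro FbI L_F)
qed

lemma compact_support_mono:
 assumes "compactin X (X closure_of A)" "B <= A"
 shows "compactin X (X closure_of B)"
 using closed_compactin[OF assms(1) closure_of_mono[OF assms(2)]] by simp

sublocale riesz_space "top_of D" "dom_Cc D"
proof
 fix f g a b
 assume f: "f : L"
 show c: "continuous_map X euclideanreal f" and s: "compactin X (X closure_of {x : \<Omega>. f x ~= 0})"
  using f by (auto simp: L_iff)
 assume g: "g : L"
 show "(%x. a * f x + b * g x) : L"
  unfolding L_iff
 proof (intro conjI)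
  show "(%x. a * f x + b * g x) : F" using f g by (intro E.lin_mem L_F)
  show "continuous_map X euclideanreal (%x. a * f x + b * g x)"
   using f g by (intro continuous_intros) (auto simp: L_iff)
  have "{x : \<Omega>. a * f x + b * g x ~= 0} <= {x : \<Omega>. f x ~= 0} \<union> {x : \<Omega>. g x ~= 0}" by auto
  moreover have "compactin X (X closure_of ({x : \<Omega>. f x ~= 0} \<union> {x : \<Omega>. g x ~= 0}))"
   using f g by (simp add: L_iff compactin_Un)
  ultimately show "compactin X (X closure_of {x : \<Omega>. a * f x + b * g x ~= 0})"
   by (rule compact_support_mono[rotated])
 qed
 show "(%x. f x * g x) : L"
  unfolding L_iff
 proof (intro conjI)
  show "(%x. f x * g x) : F" using f g by (intro FbD[OF Fb_mult] L_Fb)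
  show "continuous_map X euclideanreal (%x. f x * g x)"
   using f g by (intro continuous_intros) (auto simp: L_iff)
  show "compactin X (X closure_of {x : \<Omega>. f x * g x ~= 0})"
   by (rule compact_support_mono[OF s]) auto
 qed
next
 fix f and T :: "real => real"
 assume f: "f : L" and T: "1-lipschitz_on UNIV T" "T 0 = 0"
 have "continuous_on UNIV T" using T(1) by (rule lipschitz_on_continuous_on)
 hence "continuous_map euclideanreal euclideanreal T" by simp
 with f have "continuous_map X euclideanreal (T \<circ> f)" unfolding L_iff by (blast intro: continuous_map_compose)
 thus "(%x. T (f x)) : L"
  unfolding L_iff using lipschitz_dom[OF L_F[OF f] T] f T(2)
  by (auto simp: comp_def L_iff elim!: compact_support_mono)
next
 fix K U
 assume K: "compactin X K" "openin X U" "K <= U"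
 obtain f where f: "continuous_map X euclideanreal f" "!!x. x : \<Omega> ==> 0 <= f x & f x <= 1"
  "!!x. x : K ==> f x = 1" "compactin X (X closure_of {x : \<Omega>. f x ~= 0})"
  "X closure_of {x : \<Omega>. f x ~= 0} <= U"
  using urysohn_compact[OF K] by blast
 have "f : Cc_space X \<Omega>"
  using f by (auto simp: Cc_space_def C_space_def Let_def closure_of_subset_topspace)
 moreover have "ALL f:Cc_space X \<Omega>. ALL \<epsilon>>0. EX g:L. ALL x:\<Omega>. \<bar>f x - g x\<bar> < \<epsilon>"
  using dirichlet by (simp add: strongly_local_dirichlet_space_def regular_form_def)
 moreover have "(0::real) < 1/4" by simp
 ultimately have "EX g:L. ALL x:\<Omega>. \<bar>f x - g x\<bar> < 1/4" by blast
 then obtain g where g: "g : L" "!!x. x : \<Omega> ==> \<bar>f x - g x\<bar> < 1/4" by blast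
 \<comment> \<open>Outside the support of the Urysohn function, \<open>g\<close> stays below
   \<open>1/4\<close> and is sent to 0; on \<open>K\<close> it exceeds \<open>3/4\<close>, where
   \<open>2 * S\<close> takes its maximal value 1. Approximation within \<open>1/4\<close> is thus
   turned into an exact Urysohn function of the domain.\<close>
 define S where "S x = min (max (x - 1/4) 0) (1/2)" for x :: real
 have S: "1-lipschitz_on UNIV S" "S 0 = 0" using clamp_lipschitz[of "1/2" "1/4"] by (simp_all add: S_def)
 let ?h = "%x. 2 * S (g x)"
 have sub: "{x : \<Omega>. ?h x ~= 0} <= {x : \<Omega>. f x ~= 0}"
  using g(2) by (force simp: S_def)
 have "continuous_map euclideanreal euclideanreal S"
  using lipschitz_on_continuous_on[OF S(1)] by simp
 with g(1) have "continuous_map X euclideanreal (S \<circ> g)" unfolding L_iff by (blast intro: continuous_map_compose)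
 hence "continuous_map X euclideanreal ?h" by (intro continuous_intros) (simp add: comp_def)
 hence h1: "?h : L"
  unfolding L_iff using lipschitz_dom(1)[OF L_F[OF g(1)] S] E.scale_mem compact_support_mono[OF f(4) sub] by blast
 have h2: "0 <= ?h x & ?h x <= 1" for x by (auto simp: S_def min_def)
 have h3: "?h x = 1" if "x : K" for x
 proof -
  have "x : \<Omega>" using that K(1) compactin_subset_topspace by blast
  hence "3/4 < g x" using g(2)[of x] f(3)[OF that] by linarith
  thus ?thesis by (simp add: S_def)
 qed
 have h4: "X closure_of {x : \<Omega>. ?h x ~= 0} <= U" using closure_of_mono[OF sub] f(5) by blast
 show "EX f:L. (ALL x. 0 <= f x & f x <= 1) & (ALL x:K. f x = 1) & X closure_of {x : \<Omega>. f x ~= 0} <= U"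
  by (intro bexI[OF _ h1] conjI allI ballI h4 h3 conjunct1[OF h2] conjunct2[OF h2])
qed

lemma L_dense:
 assumes "f : F" "0 < e" obtains g where "g : L" "form_dist D f g < e"
proof -
 have "ALL f:F. ALL \<epsilon>>0. EX g:L. form_dist D f g < \<epsilon>"
  using dirichlet by (simp add: strongly_local_dirichlet_space_def regular_form_def)
 thus thesis using assms that by blast
qed

lemma M_measurable: "continuous_map X euclideanreal f ==> f : borel_measurable M"
 by (rule continuous_measurable[OF M_sets])

subsection \<open>Locality\<close>

lemma ae_support_subset:
 assumes "closedin X C" "AE x in M. x \<notin> C --> v x = 0"
 shows "ae_support X M v <= C"
proof -
 have "openin X (\<Omega> - C)" using assms(1) by blast
 moreover have "AE x in M. x : \<Omega> - C --> v x = 0" using assms(2) by eventually_elim auto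
 ultimately show ?thesis unfolding ae_support_def by blast
qed

lemma form_local:
 assumes "u : F" "v : F" "closedin X C" "AE x in M. x \<notin> C --> v x = 0" "AE x in M. x : C --> u x = c"
 shows "E u v = 0"
proof -
 have "AE x in M. x : ae_support X M v --> u x = c"
  using assms(5) ae_support_subset[OF assms(3,4)] by (auto elim!: eventually_mono)
 thus ?thesis
  using dirichlet assms(1,2) unfolding strongly_local_dirichlet_space_def strongly_local_form_def by blast
qed

lemma supp_zero: "x : \<Omega> ==> x \<notin> supp \<phi> ==> \<phi> x = 0"
 using supp_superset[of \<phi>] by blast

lemma form_local_supp:
 assumes "u : F" "v : F" "AE x in M. x \<notin> supp \<phi> --> v x = 0" "AE x in M. x : V --> u x = 0" "supp \<phi> <= V"
 shows "E u v = 0"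
proof (rule form_local[OF assms(1,2) closedin_closure_of assms(3)])
 show "AE x in M. x : supp \<phi> --> u x = 0" using assms(4) by eventually_elim (use assms(5) in auto)
qed

lemma AE_supp_zero: "AE x in M. x \<notin> supp \<phi> --> \<phi> x = 0"
 by (rule AE_I2) (use supp_zero M_space in auto)

lemma energy_local:
 assumes f: "f : Fb" and h: "h : Fb" and p: "\<phi> : Fb" and V: "supp \<phi> <= V"
  and eq: "AE x in M. x : V --> f x = h x"
 shows "energy \<phi> f f = energy \<phi> h h"
proof -
 have F: "f : F" "h : F" "\<phi> : F" "(%x. \<phi> x * f x) : F" "(%x. \<phi> x * h x) : F"
  "(%x. (f x)\<^sup>2) : F" "(%x. (h x)\<^sup>2) : F"
  using f h p Fb_mult Fb_square FbD by auto
 have ae: "AE x in M. \<phi> x * f x = \<phi> x * h x"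
  using eq AE_supp_zero[of \<phi>] by eventually_elim (use V in auto)
 have "E (%x. f x - h x) (%x. \<phi> x * f x) = 0"
 proof (rule form_local_supp[of _ _ \<phi> V])
  show "AE x in M. x \<notin> supp \<phi> --> \<phi> x * f x = 0" using AE_supp_zero[of \<phi>] by eventually_elim auto
  show "AE x in M. x : V --> f x - h x = 0" using eq by eventually_elim auto
 qed (use F V E.diff_mem in auto)
 hence "E f (%x. \<phi> x * f x) = E h (%x. \<phi> x * f x)" using F by (simp add: E.diff_left)
 also have "... = E h (%x. \<phi> x * h x)" by (rule form_cong_right[OF F(2,4,5) ae])
 finally have 1: "E f (%x. \<phi> x * f x) = E h (%x. \<phi> x * h x)" .
 have "E (%x. (f x)\<^sup>2 - (h x)\<^sup>2) \<phi> = 0"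
 proof (rule form_local_supp[of _ _ \<phi> V])
  show "AE x in M. x : V --> (f x)\<^sup>2 - (h x)\<^sup>2 = 0" using eq by eventually_elim auto
 qed (use F V E.diff_mem AE_supp_zero in auto)
 hence "E (%x. (f x)\<^sup>2) \<phi> = E (%x. (h x)\<^sup>2) \<phi>" using F by (simp add: E.diff_left)
 thus ?thesis using 1 by (simp add: energy_self)
qed

text \<open>The difference of the two functions is constant near \<open>supp \<phi>\<close>, so
  strong locality makes its energy 0; the reverse triangle inequality for the energy seminorm
  finishes.\<close>

lemma energy_shift:
 assumes f: "f : Fb" and h: "h : Fb" and p: "\<phi> : Fb" "AE x in M. 0 <= \<phi> x" and V: "supp \<phi> <= V"
  and eq: "AE x in M. x : V --> h x = f x + c"
 shows "energy \<phi> h h = energy \<phi> f f"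
proof -
 interpret P: semi_inner Fb "energy \<phi>" by (rule energy_semi_inner[OF p])
 let ?d = "%x. h x - f x"
 have d: "?d : Fb" using f h by (rule P.diff_mem[rotated])
 have F: "?d : F" "(%x. (?d x)\<^sup>2) : F" "(%x. \<phi> x * ?d x) : F" "\<phi> : F"
  using d p Fb_mult Fb_square FbD by auto
 have dc: "AE x in M. x : supp \<phi> --> ?d x = c" using eq by eventually_elim (use V in auto)
 hence dc2: "AE x in M. x : supp \<phi> --> (?d x)\<^sup>2 = c\<^sup>2" by eventually_elim auto
 have "AE x in M. x \<notin> supp \<phi> --> \<phi> x * ?d x = 0" using AE_supp_zero[of \<phi>] by eventually_elim auto
 hence 1: "E ?d (%x. \<phi> x * ?d x) = 0" by (rule form_local[OF F(1,3) closedin_closure_of _ dc])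
 have 2: "E (%x. (?d x)\<^sup>2) \<phi> = 0" by (rule form_local[OF F(2,4) closedin_closure_of AE_supp_zero dc2])
 have z: "energy \<phi> ?d ?d = 0" using 1 2 by (simp add: energy_self)
 hence "\<bar>P.nrm h - P.nrm f\<bar> <= 0" using P.nrm_reverse[OF h f] by simp
 thus ?thesis by simp
qed

subsection \<open>The energy of unbounded functions\<close>

definition trunc :: "nat => ('a => real) => 'a => real" where
 "trunc n f x = max (- real n) (min (real n) (f x))"

lemma trunc_Fb:
 assumes "f : F"
 shows "trunc n f : Fb" "E (trunc n f) (trunc n f) <= E f f"
proof -
 define T where "T x = max (- real n) (min (real n) x)" for x
 have T: "1-lipschitz_on UNIV T" "T 0 = 0"
  by (auto intro!: lipschitz_onI simp: T_def dist_real_def)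
 have "trunc n f = (%x. T (f x))" by (auto simp: trunc_def T_def)
 hence 1: "trunc n f : F" "E (trunc n f) (trunc n f) <= E f f" using lipschitz_dom[OF assms T] by simp_all
 have "AE x in M. \<bar>trunc n f x\<bar> <= real n" by (auto simp: trunc_def)
 thus "trunc n f : Fb" "E (trunc n f) (trunc n f) <= E f f" using 1 FbI by auto
qed

text \<open>Truncation does not raise the energy, so convergence in \<open>L^2\<close> suffices by
  \<open>strong_form_tendsto\<close>.\<close>

lemma trunc_tendsto:
 assumes f: "f : F"
 shows "(%n. E1.nrm (%x. trunc n f x - f x)) ----> 0"
proof (rule strong_form_tendsto[OF _ f])
 show "trunc n f : F" for n using trunc_Fb(1)[OF f] FbD by blast
 show "E (trunc n f) (trunc n f) <= E f f" for n by (rule trunc_Fb(2)[OF f])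
 have fL: "f : L2 M" using dom_L2[OF f] .
 have "(%n. \<integral>x. (trunc n f x - f x) * (trunc n f x - f x) \<partial>M) ----> (LINT x|M. 0)"
 proof (rule integral_dominated_convergence)
  show "integrable M (%x. (f x)\<^sup>2)" using L2_integrable_square[OF fL] .
  show "(%x. (trunc n f x - f x) * (trunc n f x - f x)) : borel_measurable M" for n
   using dom_measurable[OF f] unfolding trunc_def by measurable
  show "AE x in M. norm ((trunc n f x - f x) * (trunc n f x - f x)) <= (f x)\<^sup>2" for n
  proof (rule AE_I2)
   fix x
   have "\<bar>trunc n f x - f x\<bar> <= \<bar>f x\<bar>" by (auto simp: trunc_def)
   hence "(trunc n f x - f x)\<^sup>2 <= (f x)\<^sup>2" by (simp add: abs_le_square_iff)
   thus "norm ((trunc n f x - f x) * (trunc n f x - f x)) <= (f x)\<^sup>2" by (simp add: power2_eq_square)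
  qed
  show "AE x in M. (%n. (trunc n f x - f x) * (trunc n f x - f x)) ----> 0"
  proof (rule AE_I2)
   fix x
   obtain N where N: "\<bar>f x\<bar> <= real N" using real_arch_simple by blast
   have "trunc n f x = f x" if "n >= N" for n
    using N that unfolding trunc_def by (smt (verit) of_nat_mono)
   hence "\<forall>\<^sub>F n in sequentially. (trunc n f x - f x) * (trunc n f x - f x) = 0"
    unfolding eventually_sequentially by (intro exI[of _ N]) simp
   thus "(%n. (trunc n f x - f x) * (trunc n f x - f x)) ----> 0" by (rule tendsto_eventually)
  qed
 qed simp
 hence "(%n. ip (%x. trunc n f x - f x) (%x. trunc n f x - f x)) ----> 0"
  by (simp add: L2_inner_def)
 thus "(%n. L2_nrm M (%x. trunc n f x - f x)) ----> 0" using tendsto_real_sqrt by fastforce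
qed

lemma energy_lin_weight:
 assumes "\<phi> : Fb" "\<psi> : Fb" "f : Fb"
 shows "energy (%x. a * \<phi> x + b * \<psi> x) f f = a * energy \<phi> f f + b * energy \<psi> f f"
proof -
 have eq: "(%x. (a * \<phi> x + b * \<psi> x) * f x) = (%x. a * (\<phi> x * f x) + b * (\<psi> x * f x))"
  by (auto simp: algebra_simps)
 show ?thesis unfolding energy_self eq using assms Fb_mult Fb_square by (simp add: B.lin_right algebra_simps)
qed

text \<open>For nonnegative \<open>\<phi>\<close> bounded by \<open>c\<close> the square root of the
  energy is a seminorm dominated by \<open>sqrt c\<close> times the form norm. This is the
  continuity on which the extension to unbounded functions rests.\<close>

lemma energy_nrm_close:
 assumes p: "\<phi> : Fb" "AE x in M. 0 <= \<phi> x" "AE x in M. \<phi> x <= c" and c: "0 <= c" and u: "u : Fb" and v: "v : Fb" and f: "f : F"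
 shows "\<bar>sqrt (energy \<phi> u u) - sqrt (energy \<phi> v v)\<bar> <=
  sqrt c * (E1.nrm (%x. u x - f x) + E1.nrm (%x. v x - f x))"
proof -
 interpret P: semi_inner Fb "energy \<phi>" by (rule energy_semi_inner[OF p(1,2)])
 let ?d = "%x. u x - v x"
 have d: "?d : Fb" using u v by (rule P.diff_mem)
 note F = FbD[OF u] FbD[OF v] FbD[OF d]
 have "\<bar>P.nrm u - P.nrm v\<bar> <= P.nrm ?d" by (rule P.nrm_reverse[OF u v])
 also have "... <= sqrt (c * E ?d ?d)" using energy_le[OF d p(1,3) c] by simp
 also have "... = sqrt c * E.nrm ?d" by (simp add: real_sqrt_mult)
 also have "... <= sqrt c * (E1.nrm (%x. u x - f x) + E1.nrm (%x. f x - v x))"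
  using c by (intro mult_left_mono order_trans[OF E_le_E1[OF F(3)] E1.nrm_triangle[OF F(1) f F(2)]]) simp
 also have "E1.nrm (%x. f x - v x) = E1.nrm (%x. v x - f x)" by (rule E1.nrm_diff_commute[OF f F(2)])
 finally show ?thesis .
qed

text \<open>The value of \<open>lim\<close> carries information only when the sequence converges;
  for \<open>\<phi>\<close> in \<open>Fb\<close> and \<open>f\<close> in \<open>F\<close>,
  \<open>energyF_tendsto\<close> supplies convergence, and also independence of the approximating
  sequence.\<close>

definition energyF :: "('a => real) => ('a => real) => real" where
 "energyF \<phi> f = lim (%n. energy \<phi> (trunc n f) (trunc n f))"

lemma energyF_tendsto_nonneg:
 assumes p: "\<phi> : Fb" "AE x in M. 0 <= \<phi> x" and f: "f : F"
  and s: "!!n. s n : Fb" "(%n. E1.nrm (%x. s n x - f x)) ----> 0"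
 shows "(%n. energy \<phi> (s n) (s n)) ----> energyF \<phi> f"
proof -
 interpret P: semi_inner Fb "energy \<phi>" by (rule energy_semi_inner[OF p])
 obtain c where c: "0 < c" "AE x in M. \<bar>\<phi> x\<bar> <= c" by (rule Fb_bound[OF p(1)])
 have c': "AE x in M. \<phi> x <= c" using c(2) by eventually_elim simp
 note close = energy_nrm_close[OF p c' less_imp_le[OF c(1)] _ _ f]
 define t where "t n = trunc n f" for n
 have t: "t n : Fb" for n unfolding t_def by (rule trunc_Fb[OF f])
 have tl: "(%n. E1.nrm (%x. t n x - f x)) ----> 0" unfolding t_def by (rule trunc_tendsto[OF f])
 have "Cauchy (%n. P.nrm (t n))"
 proof (rule CauchyI)
  fix e :: real assume e: "0 < e"
  have "(%n. sqrt c * E1.nrm (%x. t n x - f x)) ----> 0"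
   using tendsto_mult_left[OF tl, of "sqrt c"] by simp
  hence "\<forall>\<^sub>F n in sequentially. sqrt c * E1.nrm (%x. t n x - f x) < e / 2"
   using order_tendstoD(2)[of _ 0 sequentially "e/2"] e by simp
  then obtain N where N: "!!n. n >= N ==> sqrt c * E1.nrm (%x. t n x - f x) < e / 2"
   unfolding eventually_sequentially by blast
  have "norm (P.nrm (t m) - P.nrm (t n)) < e" if "m >= N" "n >= N" for m n
   using close[OF t[of m] t[of n]] N[OF that(1)] N[OF that(2)] unfolding real_norm_def distrib_left by linarith
  thus "EX M. ALL m>=M. ALL n>=M. norm (P.nrm (t m) - P.nrm (t n)) < e" by blast
 qed
 then obtain l where l: "(%n. P.nrm (t n)) ----> l" using real_Cauchy_convergent convergent_def by blast
 have sq: "(P.nrm u)\<^sup>2 = energy \<phi> u u" if "u : Fb" for u using P.nonneg[OF that] by simp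
 have tlim: "(%n. energy \<phi> (t n) (t n)) ----> l\<^sup>2"
  using tendsto_power[OF l, of 2] by (simp only: sq[OF t])
 hence eF: "energyF \<phi> f = l\<^sup>2" unfolding energyF_def t_def by (rule limI)
 have "(%n. P.nrm (s n) - P.nrm (t n)) ----> 0"
 proof (rule Lim_null_comparison)
  show "\<forall>\<^sub>F n in sequentially. norm (P.nrm (s n) - P.nrm (t n)) <= sqrt c * (E1.nrm (%x. s n x - f x) + E1.nrm (%x. t n x - f x))"
   using close[OF s(1) t] by simp
  show "(%n. sqrt c * (E1.nrm (%x. s n x - f x) + E1.nrm (%x. t n x - f x))) ----> 0"
   using tendsto_mult_left[OF tendsto_add[OF s(2) tl], of "sqrt c"] by simp
 qed
 from tendsto_add[OF this l] have "(%n. P.nrm (s n)) ----> l" by simp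
 thus ?thesis unfolding eF using tendsto_power[of "%n. P.nrm (s n)" l sequentially 2] by (simp only: sq[OF s(1)])
qed

lemma Fb_parts:
 assumes "\<phi> : Fb"
 shows "(%x. max (\<phi> x) 0) : Fb" "(%x. max (- \<phi> x) 0) : Fb"
 using Fb_lipschitz[OF assms max0_lipschitz] Fb_lipschitz[OF B.uminus_mem[OF assms] max0_lipschitz] by auto

text \<open>The seminorm argument needs a nonnegative weight; a signed weight is split into its
  positive and negative parts, which again belong to \<open>Fb\<close>.\<close>

lemma energyF_tendsto:
 assumes p: "\<phi> : Fb" and f: "f : F"
  and s: "!!n. s n : Fb" "(%n. E1.nrm (%x. s n x - f x)) ----> 0"
 shows "(%n. energy \<phi> (s n) (s n)) ----> energyF \<phi> f"
proof -
 let ?p = "%x. max (\<phi> x) 0" and ?n = "%x. max (- \<phi> x) 0"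
 note pn = Fb_parts[OF p]
 have split: "energy \<phi> u u = 1 * energy ?p u u + (-1) * energy ?n u u" if "u : Fb" for u
 proof -
  have "\<phi> = (%x. 1 * ?p x + (-1) * ?n x)" by auto
  thus ?thesis using energy_lin_weight[OF pn that, of 1 "-1"] by metis
 qed
 have lim: "(%n. energy \<phi> (r n) (r n)) ----> 1 * energyF ?p f + (-1) * energyF ?n f"
  if r: "!!n. r n : Fb" "(%n. E1.nrm (%x. r n x - f x)) ----> 0" for r
  unfolding split[OF r(1)] using r
  by (intro tendsto_add tendsto_mult tendsto_const energyF_tendsto_nonneg pn f) auto
 have "energyF \<phi> f = 1 * energyF ?p f + (-1) * energyF ?n f"
  unfolding energyF_def[of \<phi>] by (rule limI) (rule lim[OF trunc_Fb(1)[OF f] trunc_tendsto[OF f]])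
 thus ?thesis using lim[OF s] by simp
qed

lemma energyF_trunc:
 "\<phi> : Fb ==> f : F ==> (%n. energy \<phi> (trunc n f) (trunc n f)) ----> energyF \<phi> f"
 by (rule energyF_tendsto[OF _ _ trunc_Fb(1) trunc_tendsto])

lemma energyF_bounded:
 assumes "\<phi> : Fb" "f : Fb" shows "energyF \<phi> f = energy \<phi> f f"
proof -
 have "(%n::nat. E1.nrm (%x. f x - f x)) ----> 0"
  using E1.diff_self[OF FbD FbD, OF assms(2,2)] by simp
 hence "(%n::nat. energy \<phi> f f) ----> energyF \<phi> f" by (rule energyF_tendsto[OF assms(1) FbD[OF assms(2)] assms(2)])
 thus ?thesis by (simp add: LIMSEQ_const_iff)
qed

lemma energyF_lin:
 assumes "\<phi> : Fb" "\<psi> : Fb" "f : F"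
 shows "energyF (%x. a * \<phi> x + b * \<psi> x) f = a * energyF \<phi> f + b * energyF \<psi> f"
proof (rule LIMSEQ_unique)
 show "(%n. energy (%x. a * \<phi> x + b * \<psi> x) (trunc n f) (trunc n f)) ----> energyF (%x. a * \<phi> x + b * \<psi> x) f"
  using assms Fb_lin by (intro energyF_trunc) auto
 show "(%n. energy (%x. a * \<phi> x + b * \<psi> x) (trunc n f) (trunc n f)) ----> a * energyF \<phi> f + b * energyF \<psi> f"
  unfolding energy_lin_weight[OF assms(1,2) trunc_Fb(1)[OF assms(3)]]
  using assms by (intro tendsto_add tendsto_mult tendsto_const energyF_trunc)
qed

lemma energyF_nonneg:
 assumes "\<phi> : Fb" "AE x in M. 0 <= \<phi> x" "f : F"
 shows "0 <= energyF \<phi> f"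
 by (rule LIMSEQ_le_const[OF energyF_trunc[OF assms(1,3)]])
  (use energy_nonneg[OF trunc_Fb(1)[OF assms(3)] assms(1,2)] in blast)

lemma energyF_local:
 assumes f: "f : F" and h: "h : F" and p: "\<phi> : Fb" and V: "supp \<phi> <= V"
  and eq: "AE x in M. x : V --> f x = h x"
 shows "energyF \<phi> f = energyF \<phi> h"
proof -
 have "energy \<phi> (trunc n f) (trunc n f) = energy \<phi> (trunc n h) (trunc n h)" for n
  by (rule energy_local[OF trunc_Fb(1)[OF f] trunc_Fb(1)[OF h] p V])
   (use eq in \<open>eventually_elim, auto simp: trunc_def\<close>)
 thus ?thesis by (simp add: energyF_def)
qed

end

section \<open>Energy measures\<close>

context dirichlet
begin

lemma riesz_exists:
 assumes "positive_functional X L \<Lambda>"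
 shows "EX \<mu>. radon_measure X \<mu> & (ALL \<phi>:L. (\<integral>x. \<phi> x \<partial>\<mu>) = \<Lambda> \<phi>)"
proof -
 interpret P: positive_functional X L \<Lambda> by fact
 show ?thesis using P.rep_radon P.rep_integral by blast
qed

lemma energy_functional:
 assumes f: "f : F"
 shows "positive_functional X L (%\<phi>. energyF \<phi> f)"
proof
 fix \<phi> \<psi> a b
 assume p: "\<phi> : L"
 show "0 <= energyF \<phi> f" if "!!x. x : \<Omega> ==> 0 <= \<phi> x"
  by (intro energyF_nonneg L_Fb p f AE_I2) (use that M_space in auto)
 assume "\<psi> : L"
 thus "energyF (%x. a * \<phi> x + b * \<psi> x) f = a * energyF \<phi> f + b * energyF \<psi> f"
  using p f by (intro energyF_lin L_Fb)
qed

lemma radon_ex1: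
 assumes "EX \<mu>. radon_measure X \<mu> & (ALL \<phi>:L. (\<integral>x. \<phi> x \<partial>\<mu>) = \<Lambda> \<phi>)"
 shows "EX! \<mu>. radon_measure X \<mu> & (ALL \<phi>:L. (\<integral>x. \<phi> x \<partial>\<mu>) = \<Lambda> \<phi>)"
 using assms radon_unique by (auto intro!: ex_ex1I)

text \<open>Existence is the Riesz theorem, uniqueness holds because \<open>L\<close> determines
  Radon measures; together they make the \<open>THE\<close> in the definition meaningful.\<close>

lemma energy_bounded_spec:
 assumes f: "f : Fb"
 shows "radon_measure X (energy_bounded D f) &
  (ALL \<phi>:L. (\<integral>x. \<phi> x \<partial>energy_bounded D f) = energy \<phi> f f)"
proof -
 have "EX! \<mu>. radon_measure X \<mu> & (ALL \<phi>:L. (\<integral>x. \<phi> x \<partial>\<mu>) = energyF \<phi> f)"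
  by (intro radon_ex1 riesz_exists energy_functional FbD f)
 hence "EX! \<mu>. radon_measure X \<mu> & (ALL \<phi>:L. (\<integral>x. \<phi> x \<partial>\<mu>) = energy \<phi> f f)"
  using energyF_bounded[OF L_Fb f] by simp
 thus ?thesis unfolding energy_bounded_def energy_self by (rule theI')
qed

text \<open>The defining property quantifies over all approximating sequences. It is equivalent to
  representing \<open>energyF\<close>: the truncations provide one sequence, and
  \<open>energyF_tendsto\<close> treats every other.\<close>

lemma energy_dom_spec:
 assumes f: "f : F"
 shows "radon_measure X (energy_dom D f) &
  (ALL \<phi>:L. (\<integral>x. \<phi> x \<partial>energy_dom D f) = energyF \<phi> f)"
proof -
 let ?Q = "%\<mu>. radon_measure X \<mu> & (ALL \<phi>:L. (\<integral>x. \<phi> x \<partial>\<mu>) = energyF \<phi> f)"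
 let ?P = "%\<mu>. radon_measure X \<mu> &
   (ALL s. (ALL n::nat. s n : dom_of D \<inter> Lp \<infinity> (meas_of D)) & (%n. form_dist D (s n) f) ----> 0 -->
    (ALL \<phi>:L. (%n. \<integral>x. \<phi> x \<partial>energy_bounded D (s n)) ----> (\<integral>x. \<phi> x \<partial>\<mu>)))"
 have lim: "(%n. \<integral>x. \<phi> x \<partial>energy_bounded D (s n)) ----> energyF \<phi> f"
  if "!!n::nat. s n : F \<inter> Lp \<infinity> M" "(%n. form_dist D (s n) f) ----> 0" "\<phi> : L" for s \<phi>
 proof -
  have s: "s n : Fb" for n using that(1) by (simp add: Fb_dom_Lp)
  have "(%n. energy \<phi> (s n) (s n)) ----> energyF \<phi> f"
   using that(2) by (intro energyF_tendsto L_Fb that(3) f s) (simp add: form_dist_nrm)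
  thus ?thesis using energy_bounded_spec[OF s] that(3) by simp
 qed
 have PQ: "?P \<mu> \<longleftrightarrow> ?Q \<mu>" for \<mu>
 proof
  assume P: "?P \<mu>"
  have "(\<integral>x. \<phi> x \<partial>\<mu>) = energyF \<phi> f" if "\<phi> : L" for \<phi>
  proof -
   have t: "!!n. trunc n f : F \<inter> Lp \<infinity> M" using trunc_Fb(1)[OF f] by (simp add: Fb_dom_Lp)
   have t2: "(%n. form_dist D (trunc n f) f) ----> 0" using trunc_tendsto[OF f] by (simp add: form_dist_nrm)
   have "(%n. \<integral>x. \<phi> x \<partial>energy_bounded D (trunc n f)) ----> (\<integral>x. \<phi> x \<partial>\<mu>)"
    using P[THEN conjunct2, THEN spec, of "%n. trunc n f"] t t2 that by simp
   thus ?thesis using lim[OF t t2 that] by (rule LIMSEQ_unique)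
  qed
  thus "?Q \<mu>" using P by blast
 next
  assume "?Q \<mu>"
  thus "?P \<mu>" using lim by auto
 qed
 have "EX! \<mu>. ?Q \<mu>" by (intro radon_ex1 riesz_exists energy_functional f)
 hence "?Q (THE \<mu>. ?Q \<mu>)" by (rule theI')
 moreover have "energy_dom D f = (THE \<mu>. ?Q \<mu>)" unfolding energy_dom_def PQ ..
 ultimately show ?thesis by simp
qed

definition agrees :: "('a => real) => ('a => real) => ('a => real) => bool" where
 "agrees f h \<phi> \<longleftrightarrow> (EX V. openin X V & supp \<phi> <= V & (AE x in M. x : V --> f x = h x))"

lemma agrees_energyF:
 assumes "agrees f h \<phi>" "agrees f k \<phi>" "h : F" "k : F" "\<phi> : Fb"
 shows "energyF \<phi> h = energyF \<phi> k"
proof -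
 obtain V W where V: "supp \<phi> <= V" "AE x in M. x : V --> f x = h x"
  and W: "supp \<phi> <= W" "AE x in M. x : W --> f x = k x"
  using assms(1,2) unfolding agrees_def by blast
 show ?thesis
 proof (rule energyF_local[OF assms(3-5)])
  show "supp \<phi> <= V \<inter> W" using V W by blast
  show "AE x in M. x : V \<inter> W --> h x = k x" using V(2) W(2) by eventually_elim auto
 qed
qed

lemma well_inside_top: "well_inside X U \<Omega> \<longleftrightarrow> openin X U & compactin X (X closure_of U)"
 by (auto simp: well_inside_def closure_of_subset_topspace)

lemma dom_loc_agree:
 assumes f: "f : dom_loc D" and K: "compactin X K"
 obtains h V where "h : F" "openin X V" "K <= V" "well_inside X V \<Omega>" "AE x in M. x : V --> f x = h x"
proof -
 obtain V where V: "openin X V" "K <= V" "compactin X (X closure_of V)"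
  by (rule compact_open_interpolate[OF K openin_topspace compactin_subset_topspace[OF K]])
 hence w: "well_inside X V \<Omega>" by (simp add: well_inside_top)
 have "ALL U. well_inside X U \<Omega> --> (EX h:F. AE x in M. x : U --> f x = h x)"
  using f by (simp add: dom_loc_def)
 hence "EX h:F. AE x in M. x : V --> f x = h x" using w by blast
 then obtain h where "h : F" "AE x in M. x : V --> f x = h x" by blast
 thus thesis by (rule that[OF _ V(1,2) w])
qed

lemma dom_loc_agrees:
 assumes "f : dom_loc D" "\<phi> : L" obtains h where "h : F" "agrees f h \<phi>"
proof -
 obtain h V where h: "h : F" "openin X V" "supp \<phi> <= V" "AE x in M. x : V --> f x = h x"
  by (rule dom_loc_agree[OF assms(1) L_supp[OF assms(2)]])
 show thesis by (rule that[OF h(1)]) (use h in \<open>auto simp: agrees_def\<close>)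
qed

text \<open>The choice of \<open>h\<close> is harmless: two domain functions that agree with
  \<open>f\<close> near \<open>supp \<phi>\<close> have the same energy by
  \<open>agrees_energyF\<close>.\<close>

definition energy_loc :: "('a => real) => ('a => real) => real" where
 "energy_loc f \<phi> = energyF \<phi> (SOME h. h : F & agrees f h \<phi>)"

lemma energy_loc_eq:
 assumes "\<phi> : L" "h : F" "agrees f h \<phi>"
 shows "energy_loc f \<phi> = energyF \<phi> h"
proof -
 have "(SOME h. h : F & agrees f h \<phi>) : F & agrees f (SOME h. h : F & agrees f h \<phi>) \<phi>"
  by (rule someI[of _ h]) (use assms in blast)
 thus ?thesis unfolding energy_loc_def using agrees_energyF assms L_Fb by blast
qed

lemma energy_loc_functional:
 assumes f: "f : dom_loc D"
 shows "positive_functional X L (energy_loc f)"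
proof
 fix \<phi> \<psi> a b
 assume p: "\<phi> : L"
 show "0 <= energy_loc f \<phi>" if "!!x. x : \<Omega> ==> 0 <= \<phi> x"
 proof -
  obtain h where h: "h : F" "agrees f h \<phi>" by (rule dom_loc_agrees[OF f p])
  have "0 <= energyF \<phi> h" by (intro energyF_nonneg L_Fb p h AE_I2) (use that M_space in auto)
  thus ?thesis using energy_loc_eq[OF p h] by simp
 qed
 assume q: "\<psi> : L"
 have K: "compactin X (supp \<phi> \<union> supp \<psi>)" using L_supp p q by (intro compactin_Un)
 obtain h V where h: "h : F" "openin X V" "supp \<phi> \<union> supp \<psi> <= V" "AE x in M. x : V --> f x = h x"
  by (rule dom_loc_agree[OF f K])
 have lin: "(%x. a * \<phi> x + b * \<psi> x) : L" using p q by (rule L_lin)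
 have "supp (%x. a * \<phi> x + b * \<psi> x) <= supp \<phi> \<union> supp \<psi>"
  unfolding closure_of_Un[symmetric] by (rule closure_of_mono) auto
 hence "supp (%x. a * \<phi> x + b * \<psi> x) <= V" using h(3) by blast
 hence "agrees f h (%x. a * \<phi> x + b * \<psi> x)" "agrees f h \<phi>" "agrees f h \<psi>"
  unfolding agrees_def using h by auto
 thus "energy_loc f (%x. a * \<phi> x + b * \<psi> x) = a * energy_loc f \<phi> + b * energy_loc f \<psi>"
  using energyF_lin[OF L_Fb[OF p] L_Fb[OF q] h(1)] energy_loc_eq p q lin h(1) by simp
qed

lemma radon_eq_compact:
 assumes "radon_measure X \<mu>" "radon_measure X \<nu>" "!!K. compactin X K ==> emeasure \<mu> K = emeasure \<nu> K"
 shows "\<mu> = \<nu>"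
proof (rule measure_eqI)
 show s: "sets \<mu> = sets \<nu>" using assms(1,2) by (simp add: radon_measure_def)
 fix A assume A: "A : sets \<mu>"
 have "emeasure \<mu> A = (SUP K\<in>{K. compactin X K & K <= A}. emeasure \<mu> K)"
  using assms(1) A unfolding radon_measure_def by blast
 also have "... = (SUP K\<in>{K. compactin X K & K <= A}. emeasure \<nu> K)"
  using assms(3) by (intro SUP_cong) auto
 also have "... = emeasure \<nu> A" using assms(2) A s unfolding radon_measure_def by simp
 finally show "emeasure \<mu> A = emeasure \<nu> A" .
qed

text \<open>The functional \<open>energy_loc\<close> is represented by a Radon measure that has the
  defining property on every \<open>well_inside\<close> set. It is the only one, because each
  compact set lies in such a set and Radon measures are determined by compact sets.\<close>

lemma energy_measure_spec:
 assumes f: "f : dom_loc D"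
 shows "radon_measure X (energy_measure D f) &
  (ALL \<phi>:L. (\<integral>x. \<phi> x \<partial>energy_measure D f) = energy_loc f \<phi>)"
proof -
 let ?P = "%\<mu>. radon_measure X \<mu> &
   (ALL U. well_inside X U \<Omega> -->
    (ALL h:F. (AE x in M. x : U --> f x = h x) -->
      (ALL A:sets \<mu>. A <= U --> emeasure \<mu> A = emeasure (energy_dom D h) A)))"
 obtain \<mu> where m: "radon_measure X \<mu>" "!!\<phi>. \<phi> : L ==> (\<integral>x. \<phi> x \<partial>\<mu>) = energy_loc f \<phi>"
  using riesz_exists[OF energy_loc_functional[OF f]] by blast
 have Pm: "?P \<mu>"
 proof (intro conjI allI impI ballI)
  fix U h A
  assume U: "well_inside X U \<Omega>" and h: "h : F" and eq: "AE x in M. x : U --> f x = h x" and A: "A : sets \<mu>" "A <= U"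
  have o: "openin X U" using U by (simp add: well_inside_def)
  note d = energy_dom_spec[OF h]
  show "emeasure \<mu> A = emeasure (energy_dom D h) A"
  proof (rule radon_unique_on[OF m(1) conjunct1[OF d] o _ A])
   fix \<phi> assume p: "\<phi> : L" "supp \<phi> <= U"
   have "agrees f h \<phi>" unfolding agrees_def using o p(2) eq by blast
   thus "(\<integral>x. \<phi> x \<partial>\<mu>) = (\<integral>x. \<phi> x \<partial>energy_dom D h)"
    using m(2)[OF p(1)] d p(1) energy_loc_eq[OF p(1) h] by simp
  qed
 qed (rule m(1))
 have uniq: "\<nu> = \<mu>" if P: "?P \<nu>" for \<nu>
 proof (rule radon_eq_compact)
  show "radon_measure X \<nu>" "radon_measure X \<mu>" using P m by auto
  fix K assume K: "compactin X K"
  obtain h V where h: "h : F" "openin X V" "K <= V" "well_inside X V \<Omega>" "AE x in M. x : V --> f x = h x"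
   by (rule dom_loc_agree[OF f K])
  have s: "K : sets \<nu>" "K : sets \<mu>" using P m(1) compact_sets[OF _ K] by (auto simp: radon_measure_def)
  have "emeasure \<nu> K = emeasure (energy_dom D h) K"
   using P[THEN conjunct2, rule_format, OF h(4,1,5) s(1) h(3)] .
  moreover have "emeasure \<mu> K = emeasure (energy_dom D h) K"
   using Pm[THEN conjunct2, rule_format, OF h(4,1,5) s(2) h(3)] .
  ultimately show "emeasure \<nu> K = emeasure \<mu> K" by simp
 qed
 have "energy_measure D f = \<mu>" unfolding energy_measure_def
  by (rule the_equality[of ?P, OF Pm]) (rule uniq)
 thus ?thesis using m by simp
qed

lemma energy_measure_radon: "f : dom_loc D ==> radon_measure X (energy_measure D f)"
 using energy_measure_spec by blast

lemma energy_measure_integral: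
 "f : dom_loc D ==> \<phi> : L ==> h : F ==> agrees f h \<phi> ==> (\<integral>x. \<phi> x \<partial>energy_measure D f) = energyF \<phi> h"
 using energy_measure_spec energy_loc_eq by simp

lemma energy_measure_sets: "f : dom_loc D ==> sets (energy_measure D f) = sets M"
 using energy_measure_radon M_sets by (simp add: radon_measure_def)

lemma energy_measure_local:
 assumes f: "f : dom_loc D" and g: "g : dom_loc D" and Q: "openin X Q"
  and eq: "AE x in M. x : Q --> f x = g x" and A: "A : sets M" "A <= Q"
 shows "emeasure (energy_measure D f) A = emeasure (energy_measure D g) A"
proof (rule radon_unique_on[OF energy_measure_radon[OF f] energy_measure_radon[OF g] Q])
 fix \<phi> assume p: "\<phi> : L" "supp \<phi> <= Q"
 obtain h where h: "h : F" "agrees f h \<phi>" by (rule dom_loc_agrees[OF f p(1)])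
 then obtain V where V: "openin X V" "supp \<phi> <= V" "AE x in M. x : V --> f x = h x" unfolding agrees_def by blast
 have "AE x in M. x : V \<inter> Q --> g x = h x" using V(3) eq by eventually_elim auto
 hence "agrees g h \<phi>" unfolding agrees_def using V Q p(2) by (intro exI[of _ "V \<inter> Q"]) auto
 thus "(\<integral>x. \<phi> x \<partial>energy_measure D f) = (\<integral>x. \<phi> x \<partial>energy_measure D g)"
  using energy_measure_integral f g p(1) h by simp
qed (use A energy_measure_sets[OF f] in auto)

subsection \<open>Continuous functions in the local domain\<close>

definition CF :: "('a => real) set" where
 "CF = dom_loc D \<inter> C_space X"

lemma CF_D: "f : CF ==> f : dom_loc D" "f : CF ==> continuous_map X euclideanreal f"
 by (auto simp: CF_def C_space_def)

lemma continuous_bounded_on_compact: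
 assumes "continuous_map X euclideanreal f" "compactin X K"
 obtains c where "0 < c" "!!x. x : K ==> \<bar>f x\<bar> <= c"
proof -
 have "compactin euclideanreal (f ` K)" using image_compactin[OF assms(2,1)] .
 hence "bounded (f ` K)" by (simp add: compact_imp_bounded)
 then obtain c where c: "ALL y:f ` K. norm y <= c" unfolding bounded_iff by blast
 have "\<bar>f x\<bar> <= max c 1" if "x : K" for x using c that by force
 thus thesis using that[of "max c 1"] by simp
qed

text \<open>Representatives are required to be bounded, so that integrals against energy measures
  are given by \<open>energy\<close> itself, without passing through \<open>energyF\<close>.\<close>

definition local_rep :: "('a => real) => 'a set => ('a => real) => bool" where
 "local_rep f K h \<longleftrightarrow> h : Fb & (EX V. openin X V & K <= V & (AE x in M. x : V --> f x = h x))"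

lemma CF_local_rep:
 assumes f: "f : CF" and K: "compactin X K"
 obtains h where "local_rep f K h"
proof -
 obtain h V where h: "h : F" "openin X V" "K <= V" "well_inside X V \<Omega>" "AE x in M. x : V --> f x = h x"
  by (rule dom_loc_agree[OF CF_D(1)[OF f] K])
 have "compactin X (X closure_of V)" using h(4) by (simp add: well_inside_def)
 then obtain c where c: "!!x. x : X closure_of V ==> \<bar>f x\<bar> <= c"
  using continuous_bounded_on_compact[OF CF_D(2)[OF f]] by blast
 \<comment> \<open>A continuous \<open>f\<close> is bounded on the compact closure of
   \<open>V\<close>, so truncating the representative at \<open>n\<close> does not change it on
   \<open>V\<close>.\<close>
 obtain n where n: "c <= real n" using real_arch_simple by blast
 have V: "V <= X closure_of V" using h(2) by (simp add: closure_of_subset openin_subset)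
 have "AE x in M. x : V --> f x = trunc n h x" using h(5)
 proof eventually_elim
  case (elim x)
  have "\<bar>f x\<bar> <= real n" if "x : V" using c[of x] V that n by force
  thus ?case using elim by (auto simp: trunc_def)
 qed
 hence "local_rep f K (trunc n h)" unfolding local_rep_def using trunc_Fb(1)[OF h(1)] h(2,3) by blast
 thus thesis by (rule that)
qed

lemma continuous_L2_loc:
 assumes f: "continuous_map X euclideanreal f"
 shows "f : Lp_loc 2 X M"
proof -
 have fm: "f : borel_measurable M" using M_measurable[OF f] .
 have "(%x. indicator K x * f x) : Lp 2 M" if K: "compactin X K" for K
 proof -
  obtain c where c: "0 < c" "!!x. x : K ==> \<bar>f x\<bar> <= c" by (rule continuous_bounded_on_compact[OF f K]) blast
  have Km: "K : sets M" using compact_sets[OF M_sets K] .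
  have fin: "emeasure M K < \<infinity>" using M_radon K by (simp add: radon_measure_def)
  have "integrable M (indicator K :: 'a => real)" using Km fin by simp
  moreover have "(indicator K :: 'a => real) = (%x. (indicator K x)\<^sup>2)" by (auto simp: indicator_def)
  ultimately have "integrable M (%x. (indicator K x)\<^sup>2 :: real)" by simp
  hence "(indicator K :: 'a => real) : L2 M" using Km by (simp add: L2_def)
  hence "(%x. c * indicator K x) : L2 M" by (rule L2.scale_mem)
  hence "(%x. indicator K x * f x) : L2 M"
  proof (rule L2_bound)
   show "(%x. indicator K x * f x) : borel_measurable M" using fm Km by measurable
   show "AE x in M. \<bar>indicator K x * f x\<bar> <= \<bar>c * indicator K x\<bar>"
    by (rule AE_I2) (use c in \<open>auto simp: indicator_def\<close>)
  qed
  thus ?thesis by (simp add: Lp_2)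
 qed
 thus ?thesis using fm by (simp add: Lp_loc_def)
qed

lemma CF_I:
 assumes f: "continuous_map X euclideanreal f"
  and h: "!!K. compactin X K ==> EX h. local_rep f K h"
 shows "f : CF"
proof -
 have "EX h:F. AE x in M. x : U --> f x = h x" if U: "well_inside X U \<Omega>" for U
 proof -
  obtain k where "local_rep f (X closure_of U) k" using h U by (auto simp: well_inside_def)
  then obtain V where V: "k : Fb" "X closure_of U <= V" "AE x in M. x : V --> f x = k x"
   unfolding local_rep_def by blast
  have "U <= X closure_of U" using U by (simp add: well_inside_def closure_of_subset openin_subset)
  hence "AE x in M. x : U --> f x = k x" using V(2,3) by (auto elim!: eventually_mono)
  thus ?thesis using FbD[OF V(1)] by blast
 qed
 thus ?thesis using f continuous_L2_loc[OF f] by (simp add: CF_def dom_loc_def C_space_def)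
qed

lemma local_rep_agrees: "local_rep f (supp \<phi>) h ==> agrees f h \<phi>"
 unfolding local_rep_def agrees_def by blast

lemma CF_energy_integral:
 assumes "f : CF" "\<phi> : L" "local_rep f (supp \<phi>) h"
 shows "(\<integral>x. \<phi> x \<partial>energy_measure D f) = energy \<phi> h h"
 using energy_measure_integral[OF CF_D(1)[OF assms(1)] assms(2) _ local_rep_agrees[OF assms(3)]]
  energyF_bounded[OF L_Fb[OF assms(2)]] assms(3) FbD unfolding local_rep_def by simp

end

section \<open>Functions of energy density at most one\<close>

context dirichlet
begin

definition Lip :: "('a => real) set" where
 "Lip = {f : dom_loc D \<inter> C_space X. absolutely_continuous M (energy_measure D f) &
   (AE z in M. RN_deriv M (energy_measure D f) z <= 1)}"

lemma M_compact_finite: "compactin X K ==> emeasure M K < \<infinity>"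
 using M_radon by (simp add: radon_measure_def)

lemma M_sigma_finite: "sigma_finite_measure M"
proof -
 obtain C where C: "!!n::nat. compactin X (C n)" "!!n. C n <= C (Suc n)" "(\<Union>n. C n) = \<Omega>"
  by (rule open_Union_compact[OF openin_topspace]) blast
 show ?thesis
 proof
  show "EX A. countable A & A <= sets M & \<Union>A = space M & (ALL a:A. emeasure M a ~= \<infinity>)"
   by (rule exI[of _ "range C"])
    (use C M_compact_finite compact_sets[OF M_sets] M_space in \<open>auto simp: less_top\<close>)
 qed
qed

lemma Lip_CF: "f : Lip ==> f : CF"
 by (simp add: Lip_def CF_def)

lemma Lip_density:
 assumes "f : Lip"
 shows "density M (RN_deriv M (energy_measure D f)) = energy_measure D f"
  and "AE z in M. RN_deriv M (energy_measure D f) z <= 1"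
 using assms sigma_finite_measure.density_RN_deriv[OF M_sigma_finite] energy_measure_sets by (auto simp: Lip_def)

lemma Lip_measure_le:
 assumes "f : Lip" "A : sets M"
 shows "emeasure (energy_measure D f) A <= emeasure M A"
proof -
 let ?r = "RN_deriv M (energy_measure D f)"
 have "emeasure (energy_measure D f) A = emeasure (density M ?r) A" using Lip_density(1)[OF assms(1)] by simp
 also have "... = (\<integral>\<^sup>+x. ?r x * indicator A x \<partial>M)" using assms(2) by (intro emeasure_density) auto
 also have "... <= (\<integral>\<^sup>+x. indicator A x \<partial>M)"
  using Lip_density(2)[OF assms(1)] by (intro nn_integral_mono_AE) (auto elim!: eventually_mono simp: indicator_def)
 finally show ?thesis using assms(2) by simp
qed

lemma Lip_I_measure:
 assumes f: "f : CF" and le: "!!A. A : sets M ==> emeasure (energy_measure D f) A <= emeasure M A"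
 shows "f : Lip"
proof -
 interpret S: sigma_finite_measure M by (rule M_sigma_finite)
 let ?N = "energy_measure D f" let ?r = "RN_deriv M ?N"
 have s: "sets ?N = sets M" using energy_measure_sets CF_D f by blast
 have ac: "absolutely_continuous M ?N"
  unfolding absolutely_continuous_def using le s by (auto simp: null_sets_def) (metis le_zero_eq)
 have d: "density M ?r = ?N" using S.density_RN_deriv[OF ac s] .
 obtain C where C: "!!n::nat. compactin X (C n)" "!!n. C n <= C (Suc n)" "(\<Union>n. C n) = \<Omega>"
  by (rule open_Union_compact[OF openin_topspace]) blast
 have "AE x in M. x : C n --> ?r x <= 1" for n
 proof -
  \<comment> \<open>Intersecting with the compact set \<open>C n\<close> makes the measure finite,
    which permits subtracting the two integrals.\<close>
  let ?B = "{x : space M. 1 < ?r x} \<inter> C n"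
  have B: "?B : sets M" using compact_sets[OF M_sets C(1)] by measurable
  have fin: "emeasure M ?B ~= \<infinity>"
   using emeasure_mono[of ?B "C n" M] compact_sets[OF M_sets C(1)] M_compact_finite[OF C(1)[of n]] by (auto simp: top_unique)
  have "(\<integral>\<^sup>+x. (?r x - 1) * indicator ?B x \<partial>M) = (\<integral>\<^sup>+x. ?r x * indicator ?B x - indicator ?B x \<partial>M)"
   by (intro nn_integral_cong) (auto simp: indicator_def)
  also have "... = (\<integral>\<^sup>+x. ?r x * indicator ?B x \<partial>M) - (\<integral>\<^sup>+x. indicator ?B x \<partial>M)"
  proof (rule nn_integral_diff)
   show bm: "(indicator ?B :: _ => ennreal) : borel_measurable M" using B by simp
   show "(%x. ?r x * indicator ?B x) : borel_measurable M" using bm by measurable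
   show "(\<integral>\<^sup>+x. indicator ?B x \<partial>M) ~= \<infinity>" unfolding nn_integral_indicator[OF B] by (rule fin)
  qed (auto simp: indicator_def)
  also have "... = emeasure (density M ?r) ?B - emeasure M ?B" using B by (simp add: emeasure_density)
  also have "... = 0" unfolding d using le[OF B] fin by (simp add: diff_eq_0_iff_ennreal less_top le_less_trans)
  finally have "AE x in M. (?r x - 1) * indicator ?B x = 0" using B by (subst (asm) nn_integral_0_iff_AE) auto
  thus ?thesis using AE_space
   by eventually_elim (auto simp: indicator_def diff_eq_0_iff_ennreal not_le split: if_splits)
 qed
 hence "AE x in M. ALL n. x : C n --> ?r x <= 1" unfolding AE_all_countable by blast
 hence "AE x in M. ?r x <= 1" using AE_space by eventually_elim (use C(3) M_space in blast)
 thus ?thesis using f ac by (simp add: Lip_def CF_def)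
qed

lemma Lip_integral_le:
 assumes f: "f : Lip" and p: "\<phi> : L" "!!x. 0 <= \<phi> x"
 shows "(\<integral>x. \<phi> x \<partial>energy_measure D f) <= (\<integral>x. \<phi> x \<partial>M)"
proof -
 let ?N = "energy_measure D f" let ?r = "RN_deriv M ?N"
 have pm: "\<phi> : borel_measurable M" using M_measurable L_cont[OF p(1)] by blast
 have I: "integrable M \<phi>" "integrable ?N \<phi>"
  using radon_L_integrable[OF _ p(1)] M_radon energy_measure_radon CF_D(1) Lip_CF[OF f] by auto
 have "(\<integral>\<^sup>+x. ennreal (\<phi> x) \<partial>?N) = (\<integral>\<^sup>+x. ennreal (\<phi> x) \<partial>density M ?r)"
  using Lip_density(1)[OF f] by simp
 also have "... = (\<integral>\<^sup>+x. ?r x * ennreal (\<phi> x) \<partial>M)" using pm by (intro nn_integral_density) auto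
 also have "... <= (\<integral>\<^sup>+x. ennreal (\<phi> x) \<partial>M)"
  using Lip_density(2)[OF f]
  by (intro nn_integral_mono_AE) (auto elim!: eventually_mono dest: mult_right_mono[where b=1])
 finally have "ennreal (\<integral>x. \<phi> x \<partial>?N) <= ennreal (\<integral>x. \<phi> x \<partial>M)"
  using I p(2) by (simp add: nn_integral_eq_integral)
 thus ?thesis using p(2) by (simp add: integral_nonneg_AE)
qed

lemma Lip_energy_le:
 assumes "f : Lip" "\<phi> : L" "!!x. 0 <= \<phi> x" "local_rep f (supp \<phi>) h"
 shows "energy \<phi> h h <= (LINT x|M. \<phi> x)"
 using Lip_integral_le[OF assms(1-3)] CF_energy_integral[OF Lip_CF[OF assms(1)] assms(2,4)] by simp

lemma Lip_I:
 assumes f: "f : CF"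
  and le: "!!\<phi>. \<phi> : L ==> (!!x. 0 <= \<phi> x) ==> EX h. local_rep f (supp \<phi>) h & energy \<phi> h h <= (LINT x|M. \<phi> x)"
 shows "f : Lip"
proof (rule Lip_I_measure[OF f])
 fix A assume A: "A : sets M"
 show "emeasure (energy_measure D f) A <= emeasure M A"
 proof (rule radon_compare[OF energy_measure_radon[OF CF_D(1)[OF f]] M_radon openin_topspace])
  show "(\<integral>x. \<phi> x \<partial>energy_measure D f) <= (\<integral>x. \<phi> x \<partial>M)" if p: "\<phi> : L" "!!x. 0 <= \<phi> x" for \<phi>
   using le[OF p] CF_energy_integral[OF f p(1)] by auto
  show "A : sets (energy_measure D f)" using A energy_measure_sets[OF CF_D(1)[OF f]] by simp
  show "A <= \<Omega>" using sets.sets_into_space[OF A] M_space by simp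
 qed
qed

lemma local_rep_lin:
 assumes "local_rep f K h" "local_rep g K k"
 shows "local_rep (%x. a * f x + b * g x) K (%x. a * h x + b * k x)"
proof -
 obtain V W where V: "openin X V" "K <= V" "AE x in M. x : V --> f x = h x"
  and W: "openin X W" "K <= W" "AE x in M. x : W --> g x = k x"
  using assms unfolding local_rep_def by blast
 have "AE x in M. x : V \<inter> W --> a * f x + b * g x = a * h x + b * k x"
  using V(3) W(3) by eventually_elim auto
 thus ?thesis using assms Fb_lin V W unfolding local_rep_def
  by (intro conjI exI[of _ "V \<inter> W"]) auto
qed

lemma local_rep_const:
 assumes K: "compactin X K"
 shows "EX h. local_rep (%x. c) K h"
proof -
 obtain W where W: "openin X W" "K <= W" "compactin X (X closure_of W)"
  by (rule compact_open_interpolate[OF K openin_topspace compactin_subset_topspace[OF K]])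
 obtain w where x: "w : L" "!!x. x : X closure_of W ==> w x = 1"
  using L_urysohn[OF W(3) openin_topspace closure_of_subset_topspace] by blast
 have "W <= X closure_of W" using W(1) by (simp add: closure_of_subset openin_subset)
 hence "AE x in M. x : W --> c = c * w x" using x(2) by (intro AE_I2) auto
 moreover have "(%x. c * w x) : Fb" by (rule L_Fb[OF L_scale[OF x(1)]])
 ultimately show ?thesis unfolding local_rep_def using W by blast
qed

lemma local_rep_lipschitz:
 assumes "local_rep f K h" "1-lipschitz_on UNIV T" "T 0 = 0"
 shows "local_rep (%x. T (f x)) K (%x. T (h x))"
proof -
 obtain V where V: "openin X V" "K <= V" "AE x in M. x : V --> f x = h x" and h: "h : Fb"
  using assms unfolding local_rep_def by blast
 have "AE x in M. x : V --> T (f x) = T (h x)" using V(3) by eventually_elim auto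
 thus ?thesis using V Fb_lipschitz[OF h assms(2,3)] unfolding local_rep_def by blast
qed

lemma CF_lin:
 assumes f: "f : CF" and g: "g : CF"
 shows "(%x. a * f x + b * g x) : CF"
proof (rule CF_I)
 show "continuous_map X euclideanreal (%x. a * f x + b * g x)"
  using CF_D(2)[OF f] CF_D(2)[OF g] by (intro continuous_intros) auto
 fix K assume K: "compactin X K"
 obtain h where h: "local_rep f K h" by (rule CF_local_rep[OF f K])
 obtain k where "local_rep g K k" by (rule CF_local_rep[OF g K])
 with h show "EX h. local_rep (%x. a * f x + b * g x) K h" using local_rep_lin by blast
qed

lemma CF_const: "(%x. c) : CF"
 by (rule CF_I) (auto intro: local_rep_const)

lemma CF_lipschitz:
 assumes f: "f : CF" and T: "1-lipschitz_on UNIV T" "T 0 = 0"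
 shows "(%x. T (f x)) : CF"
proof (rule CF_I)
 have "continuous_map euclideanreal euclideanreal T" using lipschitz_on_continuous_on[OF T(1)] by simp
 hence "continuous_map X euclideanreal (T \<circ> f)" by (rule continuous_map_compose[OF CF_D(2)[OF f]])
 thus "continuous_map X euclideanreal (%x. T (f x))" by (simp add: comp_def)
 fix K assume K: "compactin X K"
 obtain h where "local_rep f K h" by (rule CF_local_rep[OF f K])
 thus "EX h. local_rep (%x. T (f x)) K h" using local_rep_lipschitz T by blast
qed

lemma Lip_shift:
 assumes f: "f : Lip"
 shows "(%x. f x + c) : Lip"
proof (rule Lip_I)
 note fc = Lip_CF[OF f]
 show "(%x. f x + c) : CF" using CF_lin[OF fc CF_const[of c], of 1 1] by simp
 fix \<phi> assume p: "\<phi> : L" "!!x. 0 <= \<phi> x"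
 obtain h where h: "local_rep f (supp \<phi>) h" by (rule CF_local_rep[OF fc L_supp[OF p(1)]])
 obtain k where k: "local_rep (%x. c) (supp \<phi>) k" using local_rep_const[OF L_supp[OF p(1)]] by blast
 have r: "local_rep (%x. f x + c) (supp \<phi>) (%x. h x + k x)" using local_rep_lin[OF h k, of 1 1] by simp
 obtain V where V: "supp \<phi> <= V" "AE x in M. x : V --> c = k x" using k unfolding local_rep_def by blast
 have "AE x in M. x : V --> h x + k x = h x + c" using V(2) by eventually_elim auto
 hence "energy \<phi> (%x. h x + k x) (%x. h x + k x) = energy \<phi> h h"
  using h r p(2) V(1) unfolding local_rep_def by (intro energy_shift[OF _ _ L_Fb[OF p(1)]]) auto
 thus "EX h. local_rep (%x. f x + c) (supp \<phi>) h & energy \<phi> h h <= (LINT x|M. \<phi> x)"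
  using r Lip_energy_le[OF f p h] by auto
qed

lemma Lip_lipschitz:
 assumes f: "f : Lip" and T: "1-lipschitz_on UNIV T" "T 0 = 0"
 shows "(%x. T (f x)) : Lip"
proof (rule Lip_I)
 note fc = Lip_CF[OF f]
 show "(%x. T (f x)) : CF" by (rule CF_lipschitz[OF fc T])
 fix \<phi> assume p: "\<phi> : L" "!!x. 0 <= \<phi> x"
 obtain h where h: "local_rep f (supp \<phi>) h" by (rule CF_local_rep[OF fc L_supp[OF p(1)]])
 have "energy \<phi> (%x. T (h x)) (%x. T (h x)) <= energy \<phi> h h"
  using h p(2) T unfolding local_rep_def by (intro energy_contraction[OF _ L_Fb[OF p(1)]]) auto
 thus "EX h. local_rep (%x. T (f x)) (supp \<phi>) h & energy \<phi> h h <= (LINT x|M. \<phi> x)"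
  using local_rep_lipschitz[OF h T] Lip_energy_le[OF f p h] by force
qed

lemma Lip_uminus: "f : Lip ==> (%x. - f x) : Lip"
 by (rule Lip_lipschitz) (auto intro!: lipschitz_onI simp: dist_real_def)

text \<open>The crude bound by twice the sum of the energies is sharp enough here: each half
  contributes \<open>2 * (1/4)\<close>, and the total is 1.\<close>

lemma Lip_half_sum:
 assumes f: "f : Lip" and g: "g : Lip"
 shows "(%x. 1/2 * f x + 1/2 * g x) : Lip"
proof (rule Lip_I)
 note fc = Lip_CF[OF f] and gc = Lip_CF[OF g]
 show "(%x. 1/2 * f x + 1/2 * g x) : CF" by (rule CF_lin[OF fc gc])
 fix \<phi> assume p: "\<phi> : L" "!!x. 0 <= \<phi> x"
 obtain h where h: "local_rep f (supp \<phi>) h" by (rule CF_local_rep[OF fc L_supp[OF p(1)]])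
 obtain k where k: "local_rep g (supp \<phi>) k" by (rule CF_local_rep[OF gc L_supp[OF p(1)]])
 interpret P: semi_inner Fb "energy \<phi>" using p by (intro energy_semi_inner L_Fb) auto
 have hk: "h : Fb" "k : Fb" using h k by (auto simp: local_rep_def)
 have h2: "(%x. 1/2 * h x) : Fb" "(%x. 1/2 * k x) : Fb" using hk P.scale_mem by blast+
 have "energy \<phi> (%x. 1/2 * h x + 1/2 * k x) (%x. 1/2 * h x + 1/2 * k x)
   <= 2 * energy \<phi> (%x. 1/2 * h x) (%x. 1/2 * h x) + 2 * energy \<phi> (%x. 1/2 * k x) (%x. 1/2 * k x)"
  by (rule P.add_self_le[OF h2])
 also have "... = 1/2 * energy \<phi> h h + 1/2 * energy \<phi> k k"
  unfolding P.scale_self[OF hk(1)] P.scale_self[OF hk(2)] by (simp add: power2_eq_square)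
 also have "... <= (LINT x|M. \<phi> x)" using Lip_energy_le[OF f p h] Lip_energy_le[OF g p k] by simp
 finally show "EX h. local_rep (%x. 1/2 * f x + 1/2 * g x) (supp \<phi>) h & energy \<phi> h h <= (LINT x|M. \<phi> x)"
  using local_rep_lin[OF h k] by blast
qed

lemma Lip_const: "(%x. c) : Lip"
proof -
 have "(%x. 0) : Lip"
 proof (rule Lip_I[OF CF_const])
  fix \<phi> assume p: "\<phi> : L" "!!x. 0 <= \<phi> x"
  have "local_rep (%x. 0) (supp \<phi>) (%x. 0)"
   unfolding local_rep_def using L_Fb[OF L_zero] closure_of_subset_topspace[of X]
   by (intro conjI exI[of _ \<Omega>]) auto
  moreover have "energy \<phi> (%x. 0) (%x. 0) = 0"
  proof -
   interpret P: semi_inner Fb "energy \<phi>" using p by (intro energy_semi_inner L_Fb) auto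
   show ?thesis using P.zero_left[OF L_Fb[OF L_zero]] by simp
  qed
  ultimately show "EX h. local_rep (%x. 0) (supp \<phi>) h & energy \<phi> h h <= (LINT x|M. \<phi> x)"
   using p(2) integral_nonneg_AE[of \<phi> M] by auto
 qed
 thus ?thesis using Lip_shift[of "%x. 0" c] by simp
qed

text \<open>Doubling multiplies the energy by 4, so the energy measure of \<open>f\<close> is still
  dominated by a multiple of the reference measure and charges no null set.
  \<open>Lip_max_generic\<close> applies this to the set where the maximum switches.\<close>

lemma Lip_double_null:
 assumes f: "(%x. 1/2 * f x) : Lip" and A: "A : sets M" "emeasure M A = 0"
 shows "f : CF" "emeasure (energy_measure D f) A = 0"
proof -
 let ?g = "%x. 1/2 * f x"
 note gc = Lip_CF[OF f]
 show fc: "f : CF" using CF_lin[OF gc gc, of 1 1] by simp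
 let ?N = "density M (%_. ennreal 4)"
 have N: "radon_measure X ?N"
  unfolding radon_measure_def
 proof (intro conjI allI impI ballI)
  show "sets ?N = sets Bo" using M_sets by simp
  show "emeasure ?N K < \<infinity>" if K: "compactin X K" for K
   using compact_sets[OF M_sets K] M_compact_finite[OF K] by (simp add: emeasure_density_const ennreal_mult_less_top)
  fix A assume "A : sets ?N"
  hence A: "A : sets M" by simp
  have "emeasure ?N A = ennreal 4 * (SUP K\<in>{K. compactin X K & K <= A}. emeasure M K)"
   using A M_radon by (simp add: emeasure_density_const radon_measure_def)
  also have "... = (SUP K\<in>{K. compactin X K & K <= A}. emeasure ?N K)"
   unfolding SUP_mult_left_ennreal using compact_sets[OF M_sets] by (intro SUP_cong) (auto simp: emeasure_density_const)
  finally show "emeasure ?N A = (SUP K\<in>{K. compactin X K & K <= A}. emeasure ?N K)" .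
 qed
 have "emeasure (energy_measure D f) A <= emeasure ?N A"
 proof (rule radon_compare[OF energy_measure_radon[OF CF_D(1)[OF fc]] N openin_topspace])
  fix \<phi> assume p: "\<phi> : L" "!!x. 0 <= \<phi> x"
  obtain h where h: "local_rep f (supp \<phi>) h" by (rule CF_local_rep[OF fc L_supp[OF p(1)]])
  have hF: "h : Fb" using h by (simp add: local_rep_def)
  interpret P: semi_inner Fb "energy \<phi>" using p by (intro energy_semi_inner L_Fb) auto
  have "local_rep ?g (supp \<phi>) (%x. 1/2 * h x)" using local_rep_lin[OF h h, of "1/2" 0] by simp
  hence "energy \<phi> (%x. 1/2 * h x) (%x. 1/2 * h x) <= (LINT x|M. \<phi> x)" by (rule Lip_energy_le[OF f p])
  hence "energy \<phi> h h <= 4 * (LINT x|M. \<phi> x)"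
   unfolding P.scale_self[OF hF] by (simp add: power2_eq_square)
  moreover have "(\<integral>x. \<phi> x \<partial>?N) = 4 * (\<integral>x. \<phi> x \<partial>M)"
   using M_measurable[OF L_cont[OF p(1)]] by (subst integral_density) auto
  ultimately show "(\<integral>x. \<phi> x \<partial>energy_measure D f) <= (\<integral>x. \<phi> x \<partial>?N)"
   using CF_energy_integral[OF fc p(1) h] by simp
 next
  show "A : sets (energy_measure D f)" using A energy_measure_sets[OF CF_D(1)[OF fc]] by simp
  show "A <= \<Omega>" using sets.sets_into_space[OF A(1)] M_space by simp
 qed
 also have "emeasure ?N A = 0" using A by (simp add: emeasure_density_const)
 finally show "emeasure (energy_measure D f) A = 0" by simp
qed

text \<open>On each compact piece the distribution of \<open>f\<close> is a finite measure and has
  at most countably many atoms; an interval contains a value that avoids all of them.\<close>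

lemma level_set_null:
 fixes f :: "'a => real"
 assumes f: "f : borel_measurable M" and d: "0 < \<delta>"
 obtains c where "0 < c" "c < \<delta>" "emeasure M {x : \<Omega>. f x = c} = 0"
proof -
 obtain C where C: "!!n::nat. compactin X (C n)" "!!n. C n <= C (Suc n)" "(\<Union>n. C n) = \<Omega>"
  by (rule open_Union_compact[OF openin_topspace]) blast
 have Cs: "C n : sets M" for n using compact_sets[OF M_sets C(1)] .
 have lev: "{x : \<Omega>. f x = c} : sets M" for c
 proof -
  have "f -` {c} \<inter> space M : sets M" using f by (rule measurable_sets) simp
  moreover have "f -` {c} \<inter> space M = {x : \<Omega>. f x = c}" by (auto simp: M_space)
  ultimately show ?thesis by simp
 qed
 define N where "N n = distr (restrict_space M (C n)) borel f" for n
 have fm: "f : borel_measurable (restrict_space M (C n))" for n using f by (rule measurable_restrict_space1)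
 have "countable {c. measure (N n) {c} ~= 0}" for n
 proof (rule finite_measure.countable_support, rule finite_measureI)
  have "emeasure (N n) (space (N n)) = emeasure (restrict_space M (C n)) (space (restrict_space M (C n)))"
   unfolding N_def using fm by (subst emeasure_distr) auto
  also have "... = emeasure M (C n)"
   using Cs[of n] sets.sets_into_space[OF Cs[of n]] by (simp add: emeasure_restrict_space space_restrict_space Int_absorb2)
  finally show "emeasure (N n) (space (N n)) ~= \<infinity>" using M_compact_finite[OF C(1)[of n]] by simp
 qed
 hence "countable (\<Union>n. {c. measure (N n) {c} ~= 0})" by blast
 hence "\<not> {0<..<\<delta>} <= (\<Union>n. {c. measure (N n) {c} ~= 0})"
  using countable_subset uncountable_open_interval[of 0 \<delta>] d by blast
 then obtain c where "c : {0<..<\<delta>}" "c \<notin> (\<Union>n. {c. measure (N n) {c} ~= 0})" unfolding subset_iff by auto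
 hence c: "0 < c" "c < \<delta>" "!!n. measure (N n) {c} = 0" by auto
 have "emeasure M ({x : \<Omega>. f x = c} \<inter> C n) = 0" for n
 proof -
  have e: "emeasure (N n) {c} = emeasure M ({x : \<Omega>. f x = c} \<inter> C n)"
  proof -
   have "f -` {c} \<inter> space (restrict_space M (C n)) = {x : \<Omega>. f x = c} \<inter> C n"
    by (auto simp: space_restrict_space M_space)
   thus ?thesis unfolding N_def using fm Cs[of n] sets.sets_into_space[OF Cs[of n]]
    by (subst emeasure_distr) (auto simp: emeasure_restrict_space Int_absorb2)
  qed
  have "emeasure M ({x : \<Omega>. f x = c} \<inter> C n) <= emeasure M (C n)" using Cs by (intro emeasure_mono) auto
  hence "emeasure (N n) {c} ~= \<infinity>" using M_compact_finite[OF C(1)[of n]] unfolding e by (auto simp: top_unique)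
  hence "emeasure (N n) {c} = 0" using emeasure_eq_ennreal_measure[of "N n" "{c}"] c(3)[of n] by simp
  thus ?thesis using e by simp
 qed
 moreover have "{x : \<Omega>. f x = c} = (\<Union>n. {x : \<Omega>. f x = c} \<inter> C n)" using C(3) by blast
 ultimately have "emeasure M {x : \<Omega>. f x = c} = 0"
  using emeasure_UN_eq_0[of M "%n. {x : \<Omega>. f x = c} \<inter> C n"] lev Cs by (metis (no_types, lifting) range_subsetD sets.Int image_subsetI)
 thus thesis using that c by blast
qed

text \<open>
  For generic \<open>c\<close> the set where the maximum switches is a null set, so locality alone bounds the
  energy of the maximum; no chain rule is needed.
\<close>

lemma Lip_max_generic:
 assumes f: "f : Lip" and g: "g : Lip" and d: "0 < \<delta>"
 obtains c where "0 < c" "c < \<delta>" "(%x. max (f x) (g x + c)) : Lip"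
proof -
 note fc = Lip_CF[OF f] and gc = Lip_CF[OF g]
 have fg: "continuous_map X euclideanreal (%x. f x - g x)"
  using CF_D(2)[OF fc] CF_D(2)[OF gc] by (intro continuous_intros) auto
 obtain c where c: "0 < c" "c < \<delta>" and null: "emeasure M {x : \<Omega>. f x - g x = c} = 0"
  by (rule level_set_null[OF M_measurable[OF fg] d])
 let ?g = "%x. g x + c" let ?u = "%x. max (f x) (g x + c)"
 have g': "?g : Lip" by (rule Lip_shift[OF g])
 \<comment> \<open>The maximum is half the sum plus half the absolute difference, but
   \<open>Lip\<close> is only known to be closed under half-sums, so this yields half of the
   maximum. The lost factor 2 is recovered by locality on the two open sets where one function
   dominates, the remaining set being null.\<close>
 have "(%x. \<bar>1/2 * f x + 1/2 * (- ?g x)\<bar>) : Lip"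
  by (rule Lip_lipschitz[OF Lip_half_sum[OF f Lip_uminus[OF g']]]) (auto intro!: lipschitz_onI simp: dist_real_def)
 from Lip_half_sum[OF Lip_half_sum[OF f g'] this]
 have "(%x. 1/2 * (1/2 * f x + 1/2 * ?g x) + 1/2 * \<bar>1/2 * f x + 1/2 * (- ?g x)\<bar>) : Lip" .
 also have "(%x. 1/2 * (1/2 * f x + 1/2 * ?g x) + 1/2 * \<bar>1/2 * f x + 1/2 * (- ?g x)\<bar>) = (%x. 1/2 * ?u x)"
  by (rule ext) (auto simp: max_def abs_if field_simps)
 finally have u2: "(%x. 1/2 * ?u x) : Lip" .
 let ?N = "{x : \<Omega>. f x - g x = c}"
 let ?P = "{x : \<Omega>. f x - g x : {c<..}}" and ?Q = "{x : \<Omega>. f x - g x : {..<c}}"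
 have o: "openin X ?P" "openin X ?Q" by (rule openin_continuous_map_preimage[OF fg], simp)+
 have s: "?P : sets M" "?Q : sets M" using open_sets[OF M_sets] o by auto
 have "closedin X {x : \<Omega>. f x - g x : {c}}" by (rule closedin_continuous_map_preimage[OF fg]) simp
 hence Ns: "?N : sets M" using closed_sets[OF M_sets] by simp
 have uc: "?u : CF" and uN: "emeasure (energy_measure D ?u) ?N = 0"
  using Lip_double_null[OF u2 Ns null] by auto
 have "?u : Lip"
 proof (rule Lip_I_measure[OF uc])
  fix A assume A: "A : sets M"
  let ?e = "energy_measure D ?u"
  have se: "sets ?e = sets M" by (rule energy_measure_sets[OF CF_D(1)[OF uc]])
  have At: "A <= \<Omega>" using sets.sets_into_space[OF A] M_space by simp
  have split: "A = (A \<inter> ?P) \<union> ((A \<inter> ?Q) \<union> (A \<inter> ?N))" using At by auto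
  have 1: "emeasure ?e (A \<inter> ?P) = emeasure (energy_measure D f) (A \<inter> ?P)"
   by (rule energy_measure_local[OF CF_D(1)[OF uc] CF_D(1)[OF fc] o(1)]) (use A s in auto)
  have 2: "emeasure ?e (A \<inter> ?Q) = emeasure (energy_measure D ?g) (A \<inter> ?Q)"
   by (rule energy_measure_local[OF CF_D(1)[OF uc] CF_D(1)[OF Lip_CF[OF g']] o(2)]) (use A s in auto)
  have 3: "emeasure ?e (A \<inter> ?N) = 0"
   using emeasure_mono[of "A \<inter> ?N" ?N ?e] uN Ns se by simp
  have "emeasure ?e A <= emeasure ?e (A \<inter> ?P) + (emeasure ?e (A \<inter> ?Q) + emeasure ?e (A \<inter> ?N))"
   by (subst split) (intro order_trans[OF emeasure_subadditive] add_left_mono emeasure_subadditive; use A s Ns se in auto)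
  also have "... <= emeasure M (A \<inter> ?P) + emeasure M (A \<inter> ?Q)"
   unfolding 1 2 3 using Lip_measure_le[OF f] Lip_measure_le[OF g'] A s by (intro add_mono) auto
  also have "... = emeasure M ((A \<inter> ?P) \<union> (A \<inter> ?Q))" using A s by (intro plus_emeasure) auto
  also have "... <= emeasure M A" using A by (intro emeasure_mono) auto
  finally show "emeasure ?e A <= emeasure M A" .
 qed
 thus thesis using that c by blast
qed

text \<open>Interpolate between the two representatives with a test function \<open>w\<close> that
  is 1 near \<open>K\<close> and supported where the first one is valid.\<close>

lemma local_rep_Un:
 assumes "local_rep f K h" "local_rep f K' h'" and K: "compactin X K"
 shows "EX k. local_rep f (K \<union> K') k"
proof -
 obtain V W where V: "openin X V" "K <= V" "AE x in M. x : V --> f x = h x"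
  and W: "openin X W" "K' <= W" "AE x in M. x : W --> f x = h' x" and h: "h : Fb" "h' : Fb"
  using assms unfolding local_rep_def by blast
 obtain G where G: "openin X G" "K <= G" "compactin X (X closure_of G)" "X closure_of G <= V"
  by (rule compact_open_interpolate[OF K V(1,2)])
 obtain w where x: "w : L" "!!x. x : X closure_of G ==> w x = 1" "supp w <= V"
  using L_urysohn[OF G(3) V(1) G(4)] by blast
 let ?k = "%x. h' x + w x * (h x - h' x)"
 have "?k : Fb" using h L_Fb[OF x(1)] by (intro B.add_mem Fb_mult B.diff_mem)
 moreover have "AE x in M. x : G \<union> W --> f x = ?k x" using V(3) W(3) AE_supp_zero[of w]
 proof eventually_elim
  case (elim x)
  have "G <= X closure_of G" using G(1) by (simp add: closure_of_subset openin_subset)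
  thus ?case using elim x(2)[of x] x(3) G(4) by (cases "x : G"; cases "x : V") auto
 qed
 ultimately show ?thesis unfolding local_rep_def using G W by (intro exI[of _ ?k] conjI exI[of _ "G \<union> W"]) auto
qed

lemma local_rep_mono: "local_rep f K h ==> K' <= K ==> local_rep f K' h"
 unfolding local_rep_def by blast

lemma local_rep_glue:
 assumes loc: "!!x. x : K ==> EX Q g. openin X Q & x : Q & g : CF & (ALL y:Q. f y = g y)" and K: "compactin X K"
 shows "EX h. local_rep f K h"
proof -
 have "EX W h. openin X W & x : W & compactin X (X closure_of W) & local_rep f (X closure_of W) h" if x: "x : K" for x
 proof -
  obtain Q g where Q: "openin X Q" "x : Q" "g : CF" "!!y. y : Q ==> f y = g y" using loc[OF x] by blast
  have "compactin X {x}" using x K compactin_subset_topspace by fastforce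
  then obtain W where W: "openin X W" "{x} <= W" "compactin X (X closure_of W)" "X closure_of W <= Q"
   by (rule compact_open_interpolate) (use Q in auto)
  obtain h where h: "local_rep g (X closure_of W) h" by (rule CF_local_rep[OF Q(3) W(3)])
  then obtain V where V: "openin X V" "X closure_of W <= V" "AE x in M. x : V --> g x = h x" and hF: "h : Fb"
   unfolding local_rep_def by blast
  have "AE x in M. x : V \<inter> Q --> f x = h x" using V(3) by eventually_elim (use Q(4) in auto)
  hence "local_rep f (X closure_of W) h"
   unfolding local_rep_def using hF V Q W by (intro conjI exI[of _ "V \<inter> Q"]) auto
  thus ?thesis using W by blast
 qed
 hence "ALL x:K. EX W. openin X W & x : W & compactin X (X closure_of W) & (EX h. local_rep f (X closure_of W) h)" by blast
 from bchoice[OF this] obtain W where W: "!!x. x : K ==> openin X (W x) & x : W x & compactin X (X closure_of W x) &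
  (EX h. local_rep f (X closure_of W x) h)" by blast
 have W': "openin X (W x) & x : W x" if "x : K" for x using W[OF that] by simp
 obtain I where I: "finite I" "I <= K" "K <= (\<Union>x\<in>I. W x)" using compact_subcover[OF K W'] .
 have "EX h. local_rep f (\<Union>x\<in>I. X closure_of W x) h" using I(1,2)
 proof (induct I rule: finite_induct)
  case empty
  have "local_rep f {} (%x. 0)" unfolding local_rep_def using L_Fb[OF L_zero] by (auto intro: exI[of _ "{}"])
  thus ?case by auto
 next
  case (insert x I)
  then obtain h h' where "local_rep f (X closure_of W x) h" "local_rep f (\<Union>x\<in>I. X closure_of W x) h'"
   using W[of x] by auto
  thus ?case using local_rep_Un W[of x] insert by simp
 qed
 moreover have "K <= (\<Union>x\<in>I. X closure_of W x)"
 proof -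
  have "W x <= X closure_of W x" if "x : I" for x
   using W[of x] I(2) that by (intro closure_of_subset openin_subset) auto
  thus ?thesis using I(3) by blast
 qed
 ultimately show ?thesis using local_rep_mono by blast
qed

text \<open>Energy density at most one is a local condition: a countable subcover, made disjoint,
  reduces the domination of measures to pieces on which \<open>f\<close> coincides with a function
  in \<open>Lip\<close>. This is how the functions of the Hopf-Rinow argument are assembled.\<close>

lemma Lip_glue:
 assumes loc: "!!x. x : \<Omega> ==> EX Q g. openin X Q & x : Q & g : Lip & (ALL y:Q. f y = g y)"
 shows "f : Lip"
proof -
 from bchoice[of \<Omega> "%x Q. EX g. openin X Q & x : Q & g : Lip & (ALL y:Q. f y = g y)"] loc
 obtain Q where "ALL x:\<Omega>. EX g. openin X (Q x) & x : Q x & g : Lip & (ALL y:Q x. f y = g y)" by blast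
 from bchoice[OF this] obtain g where
  g: "!!x. x : \<Omega> ==> openin X (Q x) & x : Q x & g x : Lip & (ALL y:Q x. f y = g x y)" by blast
 have "continuous_map X euclideanreal f"
 proof (rule pasting_lemma[of \<Omega> X Q euclideanreal g])
  show "continuous_map (subtopology X (Q i)) euclideanreal (g i)" if "i : \<Omega>" for i
   using g[OF that] CF_D(2)[OF Lip_CF] by (intro continuous_map_from_subtopology) auto
  show "openin X (Q i)" if "i : \<Omega>" for i using g[OF that] by blast
  show "g i x = g j x" if "i : \<Omega>" "j : \<Omega>" "x : \<Omega> \<inter> Q i \<inter> Q j" for i j x
   using g[OF that(1)] g[OF that(2)] that(3) by (metis IntD1 IntD2)
  show "EX j. j : \<Omega> & x : Q j & f x = g j x" if "x : \<Omega>" for x using g[OF that] that by blast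
 qed
 moreover have "EX h. local_rep f K h" if K: "compactin X K" for K
 proof (rule local_rep_glue[OF _ K])
  fix x assume "x : K"
  hence "x : \<Omega>" using compactin_subset_topspace[OF K] by blast
  thus "EX Q g. openin X Q & x : Q & g : CF & (ALL y:Q. f y = g y)" using g Lip_CF by blast
 qed
 ultimately have fc: "f : CF" by (rule CF_I)
 show ?thesis
 proof (rule Lip_I_measure[OF fc])
  fix A assume A: "A : sets M"
  let ?e = "energy_measure D f"
  have se: "sets ?e = sets M" by (rule energy_measure_sets[OF CF_D(1)[OF fc]])
  obtain \<V> where V: "countable \<V>" "\<V> <= Q ` \<Omega>" "\<Union>\<V> = \<Union>(Q ` \<Omega>)"
   by (rule lindelof[of "Q ` \<Omega>"]) (use g in auto)
  define v where "v = from_nat_into (insert {} \<V>)"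
  have vr: "range v = insert {} \<V>" unfolding v_def using V(1) by (intro range_from_nat_into) auto
  have vs: "v n : sets M" for n
  proof -
   have "v n : insert {} \<V>" using vr by blast
   thus ?thesis using V(2) g open_sets[OF M_sets] by auto
  qed
  define B where "B n = A \<inter> disjointed v n" for n
  have Bs: "B n : sets M" for n unfolding B_def
   using A vs sets.range_disjointed_sets[of v M] by auto
  have disj: "disjoint_family B" using disjoint_family_disjointed[of v] unfolding B_def disjoint_family_on_def by auto
  have "A <= \<Omega>" using sets.sets_into_space[OF A] M_space by simp
  moreover have "\<Omega> <= (\<Union>n. v n)"
  proof
   fix x assume "x : \<Omega>"
   hence "x : \<Union>\<V>" using g unfolding V(3) by blast
   thus "x : (\<Union>n. v n)" using vr by auto
  qed
  ultimately have "A \<inter> (\<Union>n. v n) = A" by blast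
  moreover have "(\<Union>n. B n) = A \<inter> (\<Union>n. disjointed v n)" unfolding B_def by simp
  ultimately have UB: "(\<Union>n. B n) = A" by (simp add: UN_disjointed_eq)
  have le: "emeasure ?e (B n) <= emeasure M (B n)" for n
  proof (cases "v n = {}")
   case True
   hence "B n = {}" using disjointed_subset[of v n] unfolding B_def by blast
   thus ?thesis by simp
  next
   case False
   have "v n : insert {} \<V>" using vr by blast
   hence "v n : \<V>" using False by simp
   hence "v n : Q ` \<Omega>" by (rule subsetD[OF V(2)])
   then obtain x where x: "x : \<Omega>" "v n = Q x" by (rule imageE)
   have "B n <= Q x" using disjointed_subset[of v n] x unfolding B_def by blast
   hence "emeasure ?e (B n) = emeasure (energy_measure D (g x)) (B n)"
    using g[OF x(1)] CF_D(1)[OF Lip_CF] Bs by (intro energy_measure_local[OF CF_D(1)[OF fc]]) auto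
   thus ?thesis using Lip_measure_le[of "g x" "B n"] g[OF x(1)] Bs by simp
  qed
  have "emeasure ?e A = (\<Sum>n. emeasure ?e (B n))" using disj Bs se unfolding UB[symmetric] by (intro suminf_emeasure[symmetric]) auto
  also have "... <= (\<Sum>n. emeasure M (B n))" using le by (intro suminf_le) auto
  also have "... = emeasure M A" using disj Bs unfolding UB[symmetric] by (intro suminf_emeasure) auto
  finally show "emeasure ?e A <= emeasure M A" .
 qed
qed

end

section \<open>Cutoff functions from intrinsic completeness\<close>

context dirichlet
begin

text \<open>The slack \<open>\<delta>\<close> is due to the generic shift in
  \<open>Lip_max_generic\<close>. It does not accumulate, because each shift is applied only to the
  newly added function.\<close>

lemma Lip_finite_max:
 assumes "finite I" "I ~= {}" "!!i. i : I ==> f i : Lip" "0 < \<delta>"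
 shows "EX g:Lip. ALL x. (ALL i:I. f i x <= g x) & (EX i:I. g x <= f i x + \<delta>)"
 using assms(1-3)
proof (induct I rule: finite_ne_induct)
 case (singleton i)
 thus ?case using assms(4) by (intro bexI[of _ "f i"]) auto
next
 case (insert i I)
 then obtain g where g: "g : Lip" "!!x. (ALL i:I. f i x <= g x) & (EX i:I. g x <= f i x + \<delta>)" by auto
 have fi: "f i : Lip" using insert by simp
 obtain c where c: "0 < c" "c < \<delta>" "(%x. max (g x) (f i x + c)) : Lip"
  by (rule Lip_max_generic[OF g(1) fi assms(4)])
 have *: "(ALL j:insert i I. f j x <= max (g x) (f i x + c)) & (EX j:insert i I. max (g x) (f i x + c) <= f j x + \<delta>)" for x
 proof
  show "ALL j:insert i I. f j x <= max (g x) (f i x + c)"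
   using g(2)[of x] c(1) by (auto intro: max.coboundedI1)
  show "EX j:insert i I. max (g x) (f i x + c) <= f j x + \<delta>"
   using g(2)[of x] c(2) by (cases "g x <= f i x + c") (auto simp: max_def)
 qed
 show ?case by (intro bexI[OF _ c(3)] allI *)
qed

lemma Lip_min: "f : Lip ==> 0 <= c ==> (%x. min (f x) c) : Lip"
 by (rule Lip_lipschitz) (auto intro!: lipschitz_onI simp: dist_real_def)

lemma Lip_open:
 assumes "f : Lip" shows "openin X {x : \<Omega>. f x < c}" "openin X {x : \<Omega>. c < f x}"
proof -
 note f = CF_D(2)[OF Lip_CF[OF assms]]
 show "openin X {x : \<Omega>. f x < c}" "openin X {x : \<Omega>. c < f x}"
  using openin_continuous_map_preimage[OF f, of "{..<c}"] openin_continuous_map_preimage[OF f, of "{c<..}"] by auto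
qed

section \<open>The intrinsic distance as a metric\<close>

lemma intrinsic_dist_Lip: "intrinsic_dist D x y = (SUP f\<in>Lip. ereal (f x - f y))"
 unfolding intrinsic_dist_def Lip_def ..

lemma Lip_le_dist: "f : Lip ==> ereal (f x - f y) <= intrinsic_dist D x y"
 unfolding intrinsic_dist_Lip by (rule SUP_upper)

lemma dist_self: "intrinsic_dist D x x = 0"
 unfolding intrinsic_dist_Lip using Lip_const by (auto simp: zero_ereal_def[symmetric] intro!: SUP_eq_const)

lemma dist_nonneg: "0 <= intrinsic_dist D x y"
 using Lip_le_dist[OF Lip_const, of 0 x y] by (simp add: zero_ereal_def)

lemma dist_sym: "intrinsic_dist D x y = intrinsic_dist D y x"
proof -
 have le: "intrinsic_dist D x y <= intrinsic_dist D y x" for x y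
  unfolding intrinsic_dist_Lip[of x y]
 proof (rule SUP_least)
  fix f assume "f : Lip"
  thus "ereal (f x - f y) <= intrinsic_dist D y x" using Lip_le_dist[OF Lip_uminus, of f y x] by simp
 qed
 show ?thesis by (rule antisym[OF le le])
qed

lemma dist_triangle: "intrinsic_dist D x z <= intrinsic_dist D x y + intrinsic_dist D y z"
 unfolding intrinsic_dist_Lip[of x z]
proof (rule SUP_least)
 fix f assume f: "f : Lip"
 have "ereal (f x - f z) = ereal (f x - f y) + ereal (f y - f z)" by simp
 also have "... <= intrinsic_dist D x y + intrinsic_dist D y z" by (intro add_mono Lip_le_dist f)
 finally show "ereal (f x - f z) <= intrinsic_dist D x y + intrinsic_dist D y z" .
qed

lemma dist_witness:
 assumes "ereal r < intrinsic_dist D x y" obtains f where "f : Lip" "r < f x - f y"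
 using assms unfolding intrinsic_dist_Lip less_SUP_iff by auto

text \<open>The intrinsic distance may be infinite, while \<open>Metric_space\<close> takes real
  distances. Cutting at 1 changes neither small balls nor Cauchy sequences.\<close>

definition fin_dist :: "'a => 'a => real" where
 "fin_dist x y = real_of_ereal (min (intrinsic_dist D x y) 1)"

lemma fin_dist_ereal: "ereal (fin_dist x y) = min (intrinsic_dist D x y) 1"
proof -
 have "0 <= min (intrinsic_dist D x y) 1" "min (intrinsic_dist D x y) 1 <= 1" using dist_nonneg by auto
 thus ?thesis unfolding fin_dist_def by (cases "min (intrinsic_dist D x y) 1") auto
qed

lemma fin_dist_less: "intrinsic_dist D x y < ereal r ==> fin_dist x y < r"
proof -
 assume r: "intrinsic_dist D x y < ereal r"
 have "ereal (fin_dist x y) <= intrinsic_dist D x y" unfolding fin_dist_ereal by simp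
 also note r
 finally show ?thesis by simp
qed

lemma fin_dist_lessD: "fin_dist x y < r ==> r <= 1 ==> intrinsic_dist D x y < ereal r"
proof -
 assume "fin_dist x y < r" and r1: "r <= 1"
 hence "ereal (fin_dist x y) < ereal r" by simp
 hence "min (intrinsic_dist D x y) 1 < ereal r" unfolding fin_dist_ereal .
 thus ?thesis using r1 by (auto simp: min_less_iff_disj one_ereal_def)
qed

end

locale complete_dirichlet = dirichlet +
 assumes complete: "intrinsically_complete D"
begin

lemma open_iff: "openin X U \<longleftrightarrow> U <= \<Omega> &
  (ALL x:U. EX r>0. {y : \<Omega>. intrinsic_dist D x y < ereal r} <= U)"
 using complete unfolding intrinsically_complete_def strictly_local_def by blast

sublocale MS: Metric_space "\<Omega>" fin_dist
proof
 show "0 <= fin_dist x y" for x y unfolding fin_dist_def using dist_nonneg[of x y] by (simp add: real_of_ereal_pos)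
 show "fin_dist x y = fin_dist y x" for x y unfolding fin_dist_def using dist_sym[of x y] by simp
 show "fin_dist x y = 0 \<longleftrightarrow> x = y" if x: "x : \<Omega>" and y: "y : \<Omega>" for x y
 proof
  assume z: "fin_dist x y = 0"
  show "x = y"
  proof (rule ccontr)
   assume "x ~= y"
   \<comment> \<open>Distinct points have positive distance because the complement of
     \<open>y\<close> is open and, by strict locality, contains an intrinsic ball around
     \<open>x\<close>.\<close>
   have "openin X (\<Omega> - {y})" using compact_closed[of "{y}"] y by auto
   then obtain r where r: "r > 0" "{z : \<Omega>. intrinsic_dist D x z < ereal r} <= \<Omega> - {y}"
    using open_iff[of "\<Omega> - {y}"] x \<open>x ~= y\<close> by blast
   have "fin_dist x y < min r 1" using z r by simp
   hence "intrinsic_dist D x y < ereal (min r 1)" by (rule fin_dist_lessD) simp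
   also have "... <= ereal r" by simp
   finally show False using r(2) y by blast
  qed
 next
  assume "x = y" thus "fin_dist x y = 0" by (simp add: fin_dist_def dist_self)
 qed
 show "fin_dist x z <= fin_dist x y + fin_dist y z" for x y z
 proof -
  have "ereal (fin_dist x z) <= ereal (fin_dist x y) + ereal (fin_dist y z)"
   unfolding fin_dist_ereal using dist_triangle[of x z y] dist_nonneg[of x y] dist_nonneg[of y z]
   by (cases "intrinsic_dist D x y"; cases "intrinsic_dist D y z"; cases "intrinsic_dist D x z")
    (auto simp: min_def one_ereal_def split: if_splits)
  thus ?thesis by simp
 qed
qed

lemma mtopology_eq: "MS.mtopology = X"
proof (rule topology_eq[THEN iffD2], intro allI)
 fix U
 have "(EX r>0. MS.mball x r <= U) \<longleftrightarrow> (EX r>0. {y : \<Omega>. intrinsic_dist D x y < ereal r} <= U)" if "x : \<Omega>" for x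
 proof
  assume "EX r>0. MS.mball x r <= U"
  then obtain r where r: "r > 0" "MS.mball x r <= U" by blast
  have "{y : \<Omega>. intrinsic_dist D x y < ereal r} <= MS.mball x r"
   using that fin_dist_less by (auto simp: MS.in_mball)
  thus "EX r>0. {y : \<Omega>. intrinsic_dist D x y < ereal r} <= U" using r by (intro exI[of _ r]) auto
 next
  assume "EX r>0. {y : \<Omega>. intrinsic_dist D x y < ereal r} <= U"
  then obtain r where r: "r > 0" "{y : \<Omega>. intrinsic_dist D x y < ereal r} <= U" by blast
  have "MS.mball x (min r 1) <= {y : \<Omega>. intrinsic_dist D x y < ereal r}"
  proof
   fix y assume y: "y : MS.mball x (min r 1)"
   hence "intrinsic_dist D x y < ereal (min r 1)" by (intro fin_dist_lessD) (simp_all add: MS.in_mball)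
   also have "... <= ereal r" by simp
   finally show "y : {y : \<Omega>. intrinsic_dist D x y < ereal r}" using y by simp
  qed
  thus "EX r>0. MS.mball x r <= U" using r by (intro exI[of _ "min r 1"]) auto
 qed
 thus "openin MS.mtopology U = openin X U"
  unfolding MS.openin_mtopology open_iff by blast
qed

lemma mcomplete: "MS.mcomplete"
 unfolding MS.mcomplete_def
proof (intro allI impI)
 fix s :: "nat => 'a" assume s: "MS.MCauchy s"
 have "EX N. ALL m>=N. ALL n>=N. intrinsic_dist D (s m) (s n) < ereal e" if "e > 0" for e
 proof -
  obtain N where N: "!!m n. m >= N ==> n >= N ==> fin_dist (s m) (s n) < min e 1"
  proof -
   have "ALL \<epsilon>>0. EX N. ALL n n'. N <= n --> N <= n' --> fin_dist (s n) (s n') < \<epsilon>"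
    using s unfolding MS.MCauchy_def by (rule conjunct2)
   moreover have "0 < min e 1" using \<open>0 < e\<close> by simp
   ultimately have "EX N. ALL n n'. N <= n --> N <= n' --> fin_dist (s n) (s n') < min e 1" by (elim allE impE)
   thus thesis using that by blast
  qed
  have "intrinsic_dist D (s m) (s n) < ereal e" if "m >= N" "n >= N" for m n
  proof -
   have "intrinsic_dist D (s m) (s n) < ereal (min e 1)" using N[OF that] by (rule fin_dist_lessD) simp
   also have "... <= ereal e" by simp
   finally show ?thesis .
  qed
  thus ?thesis by blast
 qed
 moreover have "ALL n. s n : \<Omega>" using s unfolding MS.MCauchy_def by blast
 ultimately obtain x where x: "x : \<Omega>" "(%n. intrinsic_dist D (s n) x) ----> 0"
  using complete unfolding intrinsically_complete_def by blast
 have "limitin MS.mtopology s x sequentially"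
  unfolding MS.limitin_metric
 proof (intro conjI allI impI)
  fix e :: real assume "0 < e"
  hence "(0::ereal) < ereal (min e 1)" by simp
  hence "\<forall>\<^sub>F n in sequentially. intrinsic_dist D (s n) x < ereal (min e 1)"
   by (rule order_tendstoD(2)[OF x(2)])
  thus "\<forall>\<^sub>F n in sequentially. s n : \<Omega> & fin_dist (s n) x < e"
  proof eventually_elim
   case (elim n)
   hence "fin_dist (s n) x < min e 1" by (rule fin_dist_less)
   thus ?case using \<open>ALL n. s n : \<Omega>\<close> by simp
  qed
 qed (rule x(1))
 thus "EX x. limitin MS.mtopology s x sequentially" by blast
qed

text \<open>
  A Hopf-Rinow argument without chains or distance functions: \<open>far K r\<close> says that some function of
  energy density at most one vanishes on \<open>K\<close> and is at least \<open>r\<close> off a compact set.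
\<close>

definition far :: "'a set => real => bool" where
 "far K r \<longleftrightarrow> (EX C. compactin X C & (EX z:Lip. (ALL x:K. z x <= 0) & (ALL x:\<Omega> - C. r <= z x)))"

text \<open>The closed neighbourhood of radius \<open>r\<close> around \<open>K\<close>, where the
  distance from \<open>K\<close> is expressed as the supremum over functions in \<open>Lip\<close>
  that are nonpositive on \<open>K\<close>.\<close>

definition near :: "'a set => real => 'a set" where
 "near K r = {y : \<Omega>. ALL f:Lip. (ALL x:K. f x <= 0) --> f y <= r}"

text \<open>Points of \<open>near K r\<close> are close to a compact set. If \<open>z\<close>
  witnesses \<open>far K R'\<close> with \<open>R'\<close> nearly \<open>r\<close>, then outside
  \<open>?C\<close> any further growth of a function \<open>f\<close> can be stacked on top of
  \<open>z\<close> within \<open>Lip\<close>, so it cannot exceed about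
  \<open>r - R'\<close>.\<close>

lemma near_compact_set:
 assumes K: "compactin X K" and f: "far K R'" and R': "0 <= R'" "r - \<delta> < R'" and d: "0 < \<delta>"
 shows "EX C. compactin X C & (ALL y:near K r. ALL f:Lip. (ALL x:C. f x <= 0) --> f y <= 2 * \<delta>)"
proof -
 obtain C0 z where z: "compactin X C0" "z : Lip" "!!x. x : K ==> z x <= 0" "!!x. x : \<Omega> ==> x \<notin> C0 ==> R' <= z x"
  using f unfolding far_def by blast
 let ?C = "C0 \<union> K"
 have C: "compactin X ?C" using z(1) K by (rule compactin_Un)
 have "f y <= 2 * \<delta>" if y: "y : near K r" and f: "f : Lip" "!!x. x : ?C ==> f x <= 0" for y f
 proof (rule ccontr)
  assume "\<not> f y <= 2 * \<delta>"
  hence fy: "2 * \<delta> < f y" by simp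
  let ?a = "%x. min (z x) R'" and ?b = "%x. max (f x + (- \<delta> / 2)) 0"
  have a: "?a : Lip" by (rule Lip_min[OF z(2) R'(1)])
  have b: "?b : Lip" by (rule Lip_lipschitz[OF Lip_shift[OF f(1)] max0_lipschitz]) simp
  let ?h = "%x. ?a x + ?b x"
  \<comment> \<open>The two summands never vary at the same place: near \<open>?C\<close> the second
    one vanishes, since \<open>f\<close> is below \<open>\<delta> / 2\<close> there, and off
    \<open>?C\<close> the first one is the constant \<open>R'\<close>.\<close>
  have hL: "?h : Lip"
  proof (rule Lip_glue)
   fix x assume x: "x : \<Omega>"
   show "EX Q g. openin X Q & x : Q & g : Lip & (ALL y:Q. ?h y = g y)"
   proof (cases "x : ?C")
    case True
    hence "x : {x : \<Omega>. f x < \<delta> / 2}" using f(2)[of x] x d by simp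
    thus ?thesis using a Lip_open(1)[OF f(1), of "\<delta> / 2"]
     by (intro exI[of _ "{x : \<Omega>. f x < \<delta> / 2}"] exI[of _ ?a]) auto
   next
    case False
    have "?h y = ?b y + R'" if "y : \<Omega> - ?C" for y using z(4)[of y] that by simp
    thus ?thesis using Lip_shift[OF b, of R'] compact_closed[OF C] False x
     by (intro exI[of _ "\<Omega> - ?C"] exI[of _ "%x. ?b x + R'"]) auto
   qed
  qed
  have hK: "ALL x:K. ?h x <= 0"
  proof
   fix x assume x: "x : K"
   thus "?h x <= 0" using z(3)[OF x] f(2)[of x] d by (simp add: min_le_iff_disj)
  qed
  have "ALL f:Lip. (ALL x:K. f x <= 0) --> f y <= r" using y by (simp add: near_def)
  from mp[OF bspec[OF this hL] hK] have "?h y <= r" .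
  moreover have "y \<notin> ?C" using f(2)[of y] fy d by force
  moreover have "y : \<Omega>" using y by (simp add: near_def)
  ultimately show False using z(4)[of y] fy R'(2) d by (simp add: min_def max_def split: if_splits)
 qed
 thus ?thesis using C by blast
qed

text \<open>Suppose \<open>y\<close> has distance at least \<open>4 * \<delta>\<close> from every
  centre. Each centre \<open>z\<close> then has a function growing by more than
  \<open>7/2 * \<delta>\<close> from \<open>z\<close> to \<open>y\<close>. Their combination
  \<open>- g - \<delta>\<close> is nonpositive on \<open>C\<close>, all of whose points are within
  \<open>\<delta>\<close> of a centre, yet exceeds \<open>2 * \<delta>\<close> at
  \<open>y\<close>.\<close>

lemma near_net:
 assumes C: "compactin X C" and d: "0 < \<delta>" "\<delta> <= 1"
  and le: "!!y f. y : B ==> f : Lip ==> (!!x. x : C ==> f x <= 0) ==> f y <= 2 * \<delta>"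
 shows "EX Z. finite Z & Z <= \<Omega> & (ALL y:B. EX z:Z. intrinsic_dist D z y < ereal (4 * \<delta>))"
proof -
 have Ct: "C <= \<Omega>" by (rule compactin_subset_topspace[OF C])
 have op: "openin X (MS.mball x \<delta>)" for x using MS.openin_mball[of x \<delta>] unfolding mtopology_eq .
 obtain Z where Z: "finite Z" "Z <= C" "C <= (\<Union>x\<in>Z. MS.mball x \<delta>)"
  using compact_subcover[OF C, of "%x. MS.mball x \<delta>"] op Ct d by (metis MS.centre_in_mball_iff subsetD)
 have cov: "EX z:Z. intrinsic_dist D z x < ereal \<delta>" if "x : C" for x
 proof -
  obtain z where "z : Z" "x : MS.mball z \<delta>" using Z(3) \<open>x : C\<close> by blast
  thus ?thesis using d fin_dist_lessD by (auto simp: MS.in_mball)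
 qed
 have "EX z:Z. intrinsic_dist D z y < ereal (4 * \<delta>)" if y: "y : B" for y
 proof (rule ccontr)
  assume "\<not> ?thesis"
  hence far: "!!z. z : Z ==> ereal (4 * \<delta>) <= intrinsic_dist D y z" using dist_sym[of y] by (simp add: not_less)
  have "EX f. f : Lip & 7/2 * \<delta> < f y - f z" if "z : Z" for z
  proof -
   have "ereal (7/2 * \<delta>) < ereal (4 * \<delta>)" using d by simp
   hence "ereal (7/2 * \<delta>) < intrinsic_dist D y z" using far[OF that] by (rule order_less_le_trans)
   thus ?thesis by (elim dist_witness) blast
  qed
  hence "ALL z:Z. EX f. f : Lip & 7/2 * \<delta> < f y - f z" by blast
  from bchoice[OF this] obtain f where f: "!!z. z : Z ==> f z : Lip & 7/2 * \<delta> < f z y - f z z" by blast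
  show False
  proof (cases "Z = {}")
   case True
   hence "C = {}" using cov by auto
   thus False using le[OF y Lip_const[of "3 * \<delta>"]] d by simp
  next
   case False
   have gL: "(%x. - (f z x) + f z z) : Lip" if "z : Z" for z
    using f[OF that] by (intro Lip_shift Lip_uminus) simp
   have d2: "0 < \<delta> / 2" using d by simp
   obtain g where g: "g : Lip" "!!x z. z : Z ==> - (f z x) + f z z <= g x"
    "!!x. EX z:Z. g x <= - (f z x) + f z z + \<delta> / 2"
    using Lip_finite_max[of Z "%z x. - (f z x) + f z z", OF Z(1) False gL d2] by blast
   have "(%x. - g x + (- \<delta>)) : Lip" by (intro Lip_shift Lip_uminus g)
   moreover have "- g x + (- \<delta>) <= 0" if x: "x : C" for x
   proof -
    obtain z where z: "z : Z" "intrinsic_dist D z x < ereal \<delta>" using cov[OF x] by blast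
    have "ereal (f z x - f z z) <= intrinsic_dist D x z" using f[OF z(1)] by (intro Lip_le_dist) simp
    hence "ereal (f z x - f z z) < ereal \<delta>" using z(2) dist_sym[of x z] by (metis order_le_less_trans)
    thus ?thesis using g(2)[OF z(1), of x] by simp
   qed
   ultimately have "- g y + (- \<delta>) <= 2 * \<delta>" by (rule le[OF y])
   moreover obtain z where "z : Z" "g y <= - (f z y) + f z z + \<delta> / 2" using g(3) by blast
   ultimately show False using f[of z] by simp
  qed
 qed
 thus ?thesis using Z Ct by blast
qed

text \<open>Otherwise let \<open>r\<close> be the supremum of the attained radii. The set
  \<open>near K r\<close> turns out to be totally bounded, hence relatively compact by completeness,
  and then a slightly larger radius is attained as well.\<close>

lemma far_all:
 assumes K: "compactin X K"
 shows "far K R0"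
proof (rule ccontr)
 assume nf: "\<not> far K R0"
 have mono: "far K r" if "far K s" "r <= s" for r s
  using that unfolding far_def by (meson order_trans)
 have z0: "far K 0"
  unfolding far_def using Lip_const[of 0] by (intro exI[of _ "{}"]) auto
 define S where "S = {r. far K r}"
 have bdd: "bdd_above S" using nf mono unfolding S_def bdd_above_def by (metis linear mem_Collect_eq)
 define r where "r = Sup S"
 have R0: "0 <= r" unfolding r_def using z0 bdd by (intro cSup_upper) (auto simp: S_def)
 have notfar: "\<not> far K (r + s)" if "0 < s" for s
  using cSup_upper[of "r + s" S] bdd that unfolding r_def[symmetric] by (auto simp: S_def)
 let ?B = "near K r"
 have Bt: "?B <= \<Omega>" by (auto simp: near_def)
 have "MS.mtotally_bounded ?B"
  unfolding MS.mtotally_bounded_def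
 proof (intro allI impI)
  fix e :: real assume e: "0 < e"
  \<comment> \<open>Two points within \<open>4 * \<delta>\<close> of the same centre are within
    \<open>8 * \<delta> <= e\<close> of each other; this allows the net to be moved into
    \<open>near K r\<close>, as total boundedness requires.\<close>
  define \<delta> where "\<delta> = min (e / 8) (1 / 8)"
  have d: "0 < \<delta>" "\<delta> <= 1" "8 * \<delta> <= e" "8 * \<delta> <= 1" using e by (auto simp: \<delta>_def)
  have "S ~= {}" using z0 by (auto simp: S_def)
  moreover have "r - \<delta> < Sup S" using d unfolding r_def[symmetric] by simp
  ultimately obtain R1 where R1: "R1 : S" "r - \<delta> < R1" using less_cSup_iff[OF _ bdd] by blast
  have "far K (max 0 R1)" using R1(1) z0 by (auto simp: S_def max_def)
  moreover have "r - \<delta> < max 0 R1" using R1(2) by linarith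
  ultimately obtain C where C: "compactin X C" "ALL y:?B. ALL f:Lip. (ALL x:C. f x <= 0) --> f y <= 2 * \<delta>"
   using near_compact_set[OF K _ max.cobounded1 _ d(1)] by blast
  have "EX Z. finite Z & Z <= \<Omega> & (ALL y:?B. EX z:Z. intrinsic_dist D z y < ereal (4 * \<delta>))"
  proof (rule near_net[OF C(1) d(1,2)])
   fix y f assume "y : ?B" "f : Lip" "!!x. x : C ==> f x <= 0"
   thus "f y <= 2 * \<delta>" using C(2)[THEN bspec, THEN bspec, of y f] by simp
  qed
  then obtain Z where Z: "finite Z" "Z <= \<Omega>" "!!y. y : ?B ==> EX z:Z. intrinsic_dist D z y < ereal (4 * \<delta>)"
   by auto
  let ?Z = "{z : Z. EX y:?B. intrinsic_dist D z y < ereal (4 * \<delta>)}"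
  have "ALL z:?Z. EX y. y : ?B & intrinsic_dist D z y < ereal (4 * \<delta>)" by blast
  from bchoice[OF this] obtain b where b: "!!z. z : ?Z ==> b z : ?B & intrinsic_dist D z (b z) < ereal (4 * \<delta>)" by blast
  have "?B <= (\<Union>x\<in>b ` ?Z. MS.mball x e)"
  proof
   fix y assume y: "y : ?B"
   obtain z where z: "z : Z" "intrinsic_dist D z y < ereal (4 * \<delta>)" using Z(3)[OF y] by blast
   hence zz: "z : ?Z" using y by blast
   have "intrinsic_dist D (b z) y <= intrinsic_dist D z (b z) + intrinsic_dist D z y"
    using dist_triangle[of "b z" y z] dist_sym[of z "b z"] by simp
   also have "... < ereal (4 * \<delta>) + ereal (4 * \<delta>)" using b[OF zz] z(2) by (intro ereal_add_strict_mono2) auto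
   finally have "intrinsic_dist D (b z) y < ereal (8 * \<delta>)" by simp
   hence "fin_dist (b z) y < 8 * \<delta>" by (rule fin_dist_less)
   hence "y : MS.mball (b z) e" using d b[OF zz] y Bt by (auto simp: MS.in_mball)
   thus "y : (\<Union>x\<in>b ` ?Z. MS.mball x e)" using zz by blast
  qed
  thus "EX K. finite K & K <= ?B & ?B <= (\<Union>x\<in>K. MS.mball x e)"
   using Z(1) b by (intro exI[of _ "b ` ?Z"]) auto
 qed
 \<comment> \<open>This is where intrinsic completeness is used.\<close>
 hence C1: "compactin X (X closure_of ?B)"
  using MS.mtotally_bounded_eq_compact_closure_of[OF mcomplete] unfolding mtopology_eq by blast
 have BC: "?B <= X closure_of ?B" using Bt by (rule closure_of_subset)
 have KB: "K <= ?B" using R0 compactin_subset_topspace[OF K] by (auto simp: near_def intro: order_trans)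
 obtain W where W: "openin X W" "X closure_of ?B <= W" "compactin X (X closure_of W)"
  by (rule compact_open_interpolate[OF C1 openin_topspace closure_of_subset_topspace])
 let ?E = "X closure_of W - W"
 have E: "compactin X ?E" by (rule compact_diff_open[OF W(3,1)])
 have Et: "?E <= \<Omega>" using closure_of_subset_topspace[of X] by blast
 \<comment> \<open>Every point of the compact set \<open>?E\<close> lies outside
   \<open>near K r\<close>, so some admissible function exceeds \<open>r\<close> there. A finite
   subcover and \<open>Lip_finite_max\<close> produce one function exceeding \<open>r\<close> by a
   uniform margin on all of \<open>?E\<close>.\<close>
 have "EX s>0. EX z:Lip. (ALL x:K. z x <= 0) & (ALL x:?E. r + s < z x)"
 proof -
  have "EX f. f : Lip & (ALL x:K. f x <= 0) & r < f y" if y: "y : ?E" for y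
  proof -
   have "y \<notin> ?B" using y W(2) BC by blast
   thus ?thesis using y Et unfolding near_def by (auto simp: not_le)
  qed
  hence "ALL y:?E. EX f. f : Lip & (ALL x:K. f x <= 0) & r < f y" by blast
  from bchoice[OF this] obtain f where f: "!!y. y : ?E ==> f y : Lip & (ALL x:K. f y x <= 0) & r < f y y" by blast
  define s where "s y = (f y y - r) / 2" for y
  have s: "0 < s y" "r + s y < f y y" if "y : ?E" for y using f[OF that] by (auto simp: s_def field_simps)
  define G where "G y = {x : \<Omega>. r + s y < f y x}" for y
  have G: "openin X (G y)" "y : G y" if "y : ?E" for y
   unfolding G_def using Lip_open(2) f[OF that] s[OF that] Et that by auto
  obtain I where I: "finite I" "I <= ?E" "?E <= (\<Union>x\<in>I. G x)"
   using compact_subcover[OF E conjI[OF G]] .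
  show ?thesis
  proof (cases "I = {}")
   case True
   hence "?E = {}" using I(3) by blast
   thus ?thesis using Lip_const[of 0] by (intro exI[of _ 1] conjI bexI[of _ "%x. 0"]) auto
  next
   case False
   define t where "t = Min (s ` I)"
   have t: "0 < t" "!!i. i : I ==> t <= s i"
    unfolding t_def using I False s by (auto simp: Min_gr_iff)
   have t2: "0 < t / 2" using t by simp
   obtain g where g: "g : Lip" "!!x i. i : I ==> f i x <= g x" "!!x. EX i:I. g x <= f i x + t / 2"
    using Lip_finite_max[OF I(1) False _ t2, of f] f I(2) by blast
   have "(%x. g x + (- t / 2)) : Lip" by (rule Lip_shift[OF g(1)])
   moreover have "g x + (- t / 2) <= 0" if "x : K" for x
   proof -
    obtain i where "i : I" "g x <= f i x + t / 2" using g(3) by blast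
    thus ?thesis using f[of i] I(2) that by fastforce
   qed
   moreover have "r + t / 2 < g x + (- t / 2)" if "x : ?E" for x
   proof -
    obtain i where i: "i : I" "x : G i" using I(3) \<open>x : ?E\<close> by blast
    hence "r + s i < f i x" by (simp add: G_def)
    thus ?thesis using g(2)[OF i(1), of x] t(2)[OF i(1)] by simp
   qed
   ultimately show ?thesis using t2 by (intro exI[of _ "t / 2"] conjI bexI[of _ "%x. g x + (- t / 2)"]) auto
  qed
 qed
 then obtain s z where s: "0 < s" and z: "z : Lip" "!!x. x : K ==> z x <= 0" "!!x. x : ?E ==> r + s < z x" by blast
 \<comment> \<open>On a neighbourhood of \<open>?E\<close> the cut function
   \<open>min (z x) (r + s)\<close> is already constant, so continuing it by that constant outside
   \<open>W\<close> stays in \<open>Lip\<close>.\<close>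
 let ?h = "%x. if x : W then min (z x) (r + s) else r + s"
 have h1: "?h : Lip"
 proof (rule Lip_glue)
  fix x assume x: "x : \<Omega>"
  consider "x : W" | "x : ?E" | "x \<notin> X closure_of W"
   using closure_of_subset[OF openin_subset[OF W(1)]] by blast
  thus "EX Q g. openin X Q & x : Q & g : Lip & (ALL y:Q. ?h y = g y)"
  proof cases
   case 1
   thus ?thesis using W(1) Lip_min[OF z(1), of "r + s"] R0 s
    by (intro exI[of _ W] exI[of _ "%x. min (z x) (r + s)"]) auto
  next
   case 2
   hence "x : {x : \<Omega>. r + s < z x}" using z(3) x by simp
   thus ?thesis using Lip_open(2)[OF z(1)] Lip_const[of "r + s"]
    by (intro exI[of _ "{x : \<Omega>. r + s < z x}"] exI[of _ "%x. r + s"]) auto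
  next
   case 3
   have "openin X (\<Omega> - X closure_of W)" by (intro openin_diff openin_topspace closedin_closure_of)
   moreover have "W <= X closure_of W" using W(1) by (simp add: closure_of_subset openin_subset)
   ultimately show ?thesis using 3 x Lip_const[of "r + s"]
    by (intro exI[of _ "\<Omega> - X closure_of W"] exI[of _ "%x. r + s"]) auto
  qed
 qed
 have h2: "?h x <= 0" if "x : K" for x
 proof -
  have "x : W" using that KB BC W(2) by blast
  thus ?thesis using z(2)[OF that] by (simp add: min_le_iff_disj)
 qed
 have h3: "r + s <= ?h x" if "x : \<Omega> - X closure_of W" for x
  using that closure_of_subset[OF openin_subset[OF W(1)]] by auto
 have "far K (r + s)" unfolding far_def
  by (intro exI[of _ "X closure_of W"] conjI W(3) bexI[OF _ h1] ballI h2 h3)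
 thus False using notfar[OF s] by blast
qed

theorem cutoff:
 assumes K: "compactin X K" and e: "0 < \<epsilon>"
 obtains \<eta> where "\<eta> : L" "!!x. 0 <= \<eta> x & \<eta> x <= 1" "!!x. x : K ==> \<eta> x = 1"
  "!!\<phi>. \<phi> : L ==> (!!x. 0 <= \<phi> x) ==> energy \<phi> \<eta> \<eta> <= \<epsilon>\<^sup>2 * (LINT x|M. \<phi> x)"
proof -
 \<comment> \<open>A function in \<open>Lip\<close> that vanishes on \<open>K\<close> and reaches
   \<open>r\<close> off a compact set gives a cutoff function of slope \<open>1 / r\<close>, that
   is, of energy density at most \<open>\<epsilon>\<^sup>2\<close>.\<close>
 define r where "r = 1 / \<epsilon>"
 have r: "0 < r" using e by (simp add: r_def)
 obtain C z where C: "compactin X C" and z: "z : Lip" "!!x. x : K ==> z x <= 0" "!!x. x : \<Omega> - C ==> r <= z x"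
  using far_all[OF K, of r] unfolding far_def by blast
 let ?t = "%x. min (max (z x - 0) 0) r"
 have t: "?t : Lip" by (rule Lip_lipschitz[OF z(1) clamp_lipschitz]) (use r in auto)
 define \<eta> where "\<eta> x = 1 * 1 + (- 1 / r) * ?t x" for x
 have eta: "0 <= \<eta> x" "\<eta> x <= 1" for x using r by (auto simp: \<eta>_def field_simps min_def)
 have etaC: "\<eta> x = 0" if "x : \<Omega> - C" for x using z(3)[OF that] r by (simp add: \<eta>_def min_def max_def)
 have ec: "\<eta> : CF" unfolding \<eta>_def by (rule CF_lin[OF CF_const Lip_CF[OF t]])
 have sup: "X closure_of {x : \<Omega>. \<eta> x ~= 0} <= C"
  by (rule closure_of_minimal[OF _ compact_closed[OF C]]) (use etaC in auto)
 obtain h where h: "local_rep \<eta> C h" by (rule CF_local_rep[OF ec C])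
 then obtain V where V: "openin X V" "C <= V" "AE x in M. x : V --> \<eta> x = h x" and hF: "h : Fb"
  unfolding local_rep_def by blast
 \<comment> \<open>Membership in the global domain is obtained by writing \<open>\<eta>\<close>
   almost everywhere as the product of its local representative and a test function that is 1 on
   \<open>C\<close>.\<close>
 obtain w where w: "w : L" "!!x. x : C ==> w x = 1" "supp w <= V" using L_urysohn[OF C V(1,2)] by blast
 have wh: "(%x. w x * h x) : F" by (rule FbD[OF Fb_mult[OF L_Fb[OF w(1)] hF]])
 have "AE x in M. w x * h x = \<eta> x" using V(3) AE_space
 proof eventually_elim
  case (elim x)
  hence x: "x : \<Omega>" by (simp add: M_space)
  show ?case
  proof (cases "x : C")
   case True thus ?thesis using elim(1) w(2) V(2) by auto
  next
   case False
   hence "\<eta> x = 0" using etaC x by blast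
   thus ?thesis using elim(1) supp_zero[OF x, of w] w(3) by (cases "x : V") auto
  qed
 qed
 hence "\<eta> : F" by (rule dom_cong[OF wh M_measurable[OF CF_D(2)[OF ec]]])
 hence eL: "\<eta> : L" unfolding L_iff using CF_D(2)[OF ec] closed_compactin[OF C sup] by simp
 have "energy \<phi> \<eta> \<eta> <= \<epsilon>\<^sup>2 * (LINT x|M. \<phi> x)" if p: "\<phi> : L" "!!x. 0 <= \<phi> x" for \<phi>
 proof -
  interpret P: semi_inner Fb "energy \<phi>" using p by (intro energy_semi_inner L_Fb) auto
  obtain k where k: "local_rep ?t (supp \<phi>) k" by (rule CF_local_rep[OF Lip_CF[OF t] L_supp[OF p(1)]])
  then obtain V where V: "supp \<phi> <= V" "AE x in M. x : V --> ?t x = k x" and kF: "k : Fb"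
   unfolding local_rep_def by blast
  have e2: "(%x. - r * \<eta> x) : Fb" by (rule L_Fb[OF L_scale[OF eL]])
  have "AE x in M. x : V --> k x = - r * \<eta> x + r" using V(2)
   by eventually_elim (use r in \<open>auto simp: \<eta>_def field_simps\<close>)
  hence "energy \<phi> k k = energy \<phi> (%x. - r * \<eta> x) (%x. - r * \<eta> x)"
   using p(2) by (intro energy_shift[OF e2 kF L_Fb[OF p(1)] _ V(1)]) auto
  also have "... = (- r)\<^sup>2 * energy \<phi> \<eta> \<eta>" by (rule P.scale_self[OF L_Fb[OF eL]])
  finally have "r\<^sup>2 * energy \<phi> \<eta> \<eta> <= (LINT x|M. \<phi> x)" using Lip_energy_le[OF t p k] by simp
  thus ?thesis using e by (simp add: r_def field_simps)
 qed
 moreover have "\<eta> x = 1" if "x : K" for x using z(2)[OF that] r by (simp add: \<eta>_def max_def min_def)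
 ultimately show thesis using that eL eta by blast
qed

end

section \<open>The Dirichlet form on an open subset\<close>

context dirichlet
begin

section \<open>Approximation in \<open>L^2\<close> under a uniform energy bound\<close>

lemma E_bounded_of_tendsto:
 assumes s: "!!n::nat. s n : F" and u: "u : F" and lim: "(%n. E1.nrm (%x. s n x - u x)) ----> 0"
 obtains C where "0 <= C" "!!n. E (s n) (s n) <= C"
proof -
 have "(%n. shifted_form D 1 (s n) (s n)) ----> shifted_form D 1 u u" by (rule E1.tendsto_self[OF s u lim])
 hence "Bseq (%n. shifted_form D 1 (s n) (s n))" by (intro convergent_imp_Bseq convergentI)
 then obtain C where C: "0 < C" "!!n. norm (shifted_form D 1 (s n) (s n)) <= C" unfolding Bseq_def by blast
 have "E (s n) (s n) <= C" for n
  using C(2)[of n] L2.nonneg[OF dom_L2[OF s[of n]]] by (simp add: shifted_form_def)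
 thus thesis using that[of C] C(1) by simp
qed

lemma L2_tendsto_of_E1:
 assumes s: "!!n::nat. s n : F" and u: "u : F" and lim: "(%n. E1.nrm (%x. s n x - u x)) ----> 0"
 shows "(%n. L2_nrm M (%x. s n x - u x)) ----> 0"
proof (rule Lim_null_comparison[OF _ lim])
 show "\<forall>\<^sub>F n in sequentially. norm (L2_nrm M (%x. s n x - u x)) <= E1.nrm (%x. s n x - u x)"
  using L2_le_E1[OF E.diff_mem[OF s u]] L2.nrm_nonneg[OF dom_L2[OF E.diff_mem[OF s u]]] by simp
qed

lemma L2_nrm_mono:
 assumes "u : L2 M" "v : borel_measurable M" "AE x in M. \<bar>v x\<bar> <= \<bar>u x\<bar>"
 shows "L2_nrm M v <= L2_nrm M u"
proof -
 have v: "v : L2 M" by (rule L2_bound[OF assms])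
 have "AE x in M. v x * v x <= u x * u x" using assms(3)
  by eventually_elim (metis abs_le_square_iff power2_eq_square)
 thus ?thesis using L2_inner_mono[OF v v assms(1,1)] by simp
qed

text \<open>Clamping a form-convergent sequence to \<open>[a, b]\<close> keeps the energy bound and
  the \<open>L^2\<close> convergence. Convergence in form norm is not claimed;
  \<open>weak_form_tendsto\<close> does not ask for it.\<close>

lemma L_bounded_sequence:
 assumes v: "v : F" "AE x in M. a <= v x & v x <= b" and ab: "a <= 0" "0 <= b"
 obtains g C where "!!n::nat. g n : L" "!!n x. a <= g n x & g n x <= b"
  "(%n. L2_nrm M (%x. g n x - v x)) ----> 0" "0 <= C" "!!n. E (g n) (g n) <= C"
proof -
 have "ALL n::nat. EX g. g : L & E1.nrm (%x. v x - g x) < 1 / real (Suc n)"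
 proof
  fix n :: nat
  have "0 < 1 / real (Suc n)" by simp
  then obtain g where "g : L" "form_dist D v g < 1 / real (Suc n)" by (rule L_dense[OF v(1)])
  thus "EX g. g : L & E1.nrm (%x. v x - g x) < 1 / real (Suc n)" unfolding form_dist_nrm by blast
 qed
 from choice[OF this] obtain g where g: "!!n. g n : L" "!!n. E1.nrm (%x. v x - g n x) < 1 / real (Suc n)" by blast
 note gF = L_F[OF g(1)]
 have lim: "(%n. E1.nrm (%x. g n x - v x)) ----> 0"
 proof (rule Lim_null_comparison[OF _ LIMSEQ_Suc[OF lim_1_over_n]])
  show "\<forall>\<^sub>F n in sequentially. norm (E1.nrm (%x. g n x - v x)) <= 1 / real (Suc n)"
   using g(2) E1.nrm_diff_commute[OF gF v(1)] E1.nrm_nonneg[OF E.diff_mem[OF gF v(1)]]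
   by (auto intro!: always_eventually less_imp_le simp del: of_nat_Suc)
 qed
 obtain C where C: "0 <= C" "!!n. E (g n) (g n) <= C" by (rule E_bounded_of_tendsto[OF gF v(1) lim]) blast
 define T where "T x = max a (min b x)" for x :: real
 have T: "1-lipschitz_on UNIV T" "T 0 = 0" using ab by (auto intro!: lipschitz_onI simp: T_def dist_real_def)
 have Tv: "AE x in M. T (v x) = v x" using v(2) by eventually_elim (auto simp: T_def)
 note TL = L_lipschitz[OF g(1) T]
 show thesis
 proof (rule that[of "%n x. T (g n x)"])
  show "(%x. T (g n x)) : L" for n by (rule TL)
  show "a <= T (g n x) & T (g n x) <= b" for n x using ab by (auto simp: T_def)
  show "E (%x. T (g n x)) (%x. T (g n x)) <= C" for n using lipschitz_dom(2)[OF gF T, of n] C(2)[of n] by simp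
  show "(%n. L2_nrm M (%x. T (g n x) - v x)) ----> 0"
  proof (rule Lim_null_comparison[OF always_eventually L2_tendsto_of_E1[OF gF v(1) lim]], rule allI)
   fix n
   note d = L2.diff_mem[OF dom_L2[OF L_F[OF TL[of n]]] dom_L2[OF v(1)]]
   have "AE x in M. \<bar>T (g n x) - v x\<bar> <= \<bar>g n x - v x\<bar>" using Tv
   proof eventually_elim
    case (elim x)
    thus ?case using lipschitz_onD[OF T(1), of "g n x" "v x"] by (simp add: dist_real_def)
   qed
   thus "norm (L2_nrm M (%x. T (g n x) - v x)) <= L2_nrm M (%x. g n x - v x)"
    using L2_nrm_mono[OF L2.diff_mem[OF dom_L2[OF gF] dom_L2[OF v(1)]] L2_measurable[OF d]] L2.nrm_nonneg[OF d] by simp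
  qed
 qed (rule C)
qed

lemma mult_bounded_tendsto:
 fixes s :: "nat => 'a => real"
 assumes k: "k : Fb" and s: "!!n. s n : Fb" and v: "v : Fb" and b: "!!n. AE x in M. \<bar>s n x\<bar> <= b"
  and lim: "(%n. L2_nrm M (%x. s n x - v x)) ----> 0" and C: "!!n. E (s n) (s n) <= C"
 obtains C' where "(%n. L2_nrm M (%x. k x * s n x - k x * v x)) ----> 0"
  "!!n. E (%x. k x * s n x) (%x. k x * s n x) <= C'"
proof -
 obtain a where a: "0 < a" "AE x in M. \<bar>k x\<bar> <= a" by (rule Fb_bound[OF k])
 have l: "(%n. a * L2_nrm M (%x. s n x - v x)) ----> 0" using tendsto_mult_left[OF lim, of a] by simp
 have 1: "(%n. L2_nrm M (%x. k x * s n x - k x * v x)) ----> 0"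
 proof (rule Lim_null_comparison[OF always_eventually l], rule allI)
  fix n
  note d = L2.diff_mem[OF Fb_L2[OF s[of n]] Fb_L2[OF v]]
  note d' = L2.diff_mem[OF Fb_L2[OF Fb_mult[OF k s[of n]]] Fb_L2[OF Fb_mult[OF k v]]]
  have "AE x in M. \<bar>k x * s n x - k x * v x\<bar> <= \<bar>a * (s n x - v x)\<bar>" using a(2)
   by eventually_elim (use a(1) in \<open>auto simp: abs_mult right_diff_distrib[symmetric] intro: mult_right_mono\<close>)
  hence "L2_nrm M (%x. k x * s n x - k x * v x) <= L2_nrm M (%x. a * (s n x - v x))"
   by (intro L2_nrm_mono L2.scale_mem d L2_measurable[OF d'])
  thus "norm (L2_nrm M (%x. k x * s n x - k x * v x)) <= a * L2_nrm M (%x. s n x - v x)"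
   using L2.nrm_scale[OF d, of a] L2.nrm_nonneg[OF d'] a(1) by simp
 qed
 have "E (%x. k x * s n x) (%x. k x * s n x) <= 4 * (max a b)\<^sup>2 * (E k k + C)" for n
 proof -
  have "AE x in M. \<bar>k x\<bar> <= max a b" "AE x in M. \<bar>s n x\<bar> <= max a b"
   using a(2) b[of n] by (eventually_elim, simp)+
  hence "E (%x. k x * s n x) (%x. k x * s n x) <= 4 * (max a b)\<^sup>2 * (E k k + E (s n) (s n))"
   by (rule mult_mem(2)[OF FbD[OF k] FbD[OF s]]) (use a(1) in simp)
  also have "... <= 4 * (max a b)\<^sup>2 * (E k k + C)" using C[of n] by (intro mult_left_mono add_left_mono) auto
  finally show ?thesis .
 qed
 with 1 show thesis by (rule that)
qed

lemma lipschitz_L2_tendsto: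
 fixes s :: "nat => 'a => real"
 assumes s: "!!n. s n : L2 M" "!!n. AE x in M. \<bar>s n x\<bar> <= c" and z: "z : L2 M" "AE x in M. \<bar>z x\<bar> <= c"
  and lim: "(%n. L2_nrm M (%x. s n x - z x)) ----> 0"
  and T: "T : borel_measurable borel" "T 0 = 0" "!!x y. \<bar>x\<bar> <= c ==> \<bar>y\<bar> <= c ==> \<bar>T x - T y\<bar> <= K * \<bar>x - y\<bar>"
  and K: "0 <= K" "0 <= c"
 shows "(%x. T (z x)) : L2 M" "(%n. L2_nrm M (%x. T (s n x) - T (z x))) ----> 0"
proof -
 have TL: "(%x. T (v x)) : L2 M" if v: "v : L2 M" "AE x in M. \<bar>v x\<bar> <= c" for v
 proof (rule L2_bound[OF L2.scale_mem[OF v(1), of K]])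
  show "(%x. T (v x)) : borel_measurable M" using T(1) L2_measurable[OF v(1)] by measurable
  show "AE x in M. \<bar>T (v x)\<bar> <= \<bar>K * v x\<bar>" using v(2)
  proof eventually_elim
   case (elim x)
   thus ?case using T(3)[OF elim, of 0] T(2) K by (simp add: abs_mult)
  qed
 qed
 show "(%x. T (z x)) : L2 M" by (rule TL[OF z])
 have l: "(%n. K * L2_nrm M (%x. s n x - z x)) ----> 0" using tendsto_mult_left[OF lim, of K] by simp
 show "(%n. L2_nrm M (%x. T (s n x) - T (z x))) ----> 0"
 proof (rule Lim_null_comparison[OF always_eventually l], rule allI)
  fix n
  note d = L2.diff_mem[OF TL[OF s] TL[OF z], of n] and d' = L2.diff_mem[OF s(1)[of n] z(1)]
  have "AE x in M. \<bar>T (s n x) - T (z x)\<bar> <= \<bar>K * (s n x - z x)\<bar>" using s(2)[of n] z(2)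
   by eventually_elim (use T(3) K in \<open>simp add: abs_mult\<close>)
  hence "L2_nrm M (%x. T (s n x) - T (z x)) <= L2_nrm M (%x. K * (s n x - z x))"
   by (intro L2_nrm_mono L2.scale_mem d' L2_measurable[OF d])
  thus "norm (L2_nrm M (%x. T (s n x) - T (z x))) <= K * L2_nrm M (%x. s n x - z x)"
   using L2.nrm_scale[OF d', of K] L2.nrm_nonneg[OF d] K by simp
 qed
qed

end

locale open_subset = dirichlet +
 fixes U :: "'a set"
 assumes U_open: "openin (top_of D) U"
begin

abbreviation "DU \<equiv> subspace D U"

abbreviation ext :: "('a => real) => 'a => real" where "ext u \<equiv> (%x. indicator U x * u x)"

lemma U_sets: "U : sets M"
 by (rule open_sets[OF M_sets U_open])

lemma MU: "meas_of DU = restrict_space M U"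
 by (simp add: subspace_def)

lemma MU_measurable: "u : borel_measurable (meas_of DU) \<longleftrightarrow> ext u : borel_measurable M"
 using U_sets sets.sets_into_space[OF U_sets]
 by (simp add: MU borel_measurable_restrict_space_iff Int_absorb2)

lemma MU_integrable: "integrable (meas_of DU) u \<longleftrightarrow> integrable M (ext u)"
 for u :: "'a => real"
 using U_sets sets.sets_into_space[OF U_sets]
 by (simp add: MU integrable_restrict_space Int_absorb2)

lemma MU_integral: "(\<integral>x. u x \<partial>meas_of DU) = (\<integral>x. ext u x \<partial>M)"
 for u :: "'a => real"
 using U_sets sets.sets_into_space[OF U_sets]
 by (simp add: MU integral_restrict_space Int_absorb2)

lemma MU_AE: "(AE x in meas_of DU. P x) \<longleftrightarrow> (AE x in M. x : U --> P x)"
 unfolding MU by (rule AE_restrict_space_iff) (use U_sets sets.sets_into_space[OF U_sets] in \<open>simp add: Int_absorb2\<close>)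

lemma MU_AE_eq: "(AE x in meas_of DU. u x = v x) \<longleftrightarrow> (AE x in M. ext u x = ext v x)"
 unfolding MU_AE by (rule AE_cong) (auto simp: indicator_def)

lemma MU_L2: "u : L2 (meas_of DU) \<longleftrightarrow> ext u : L2 M"
proof -
 have "(%x. indicator U x * (u x)\<^sup>2) = (%x. (ext u x)\<^sup>2)" by (auto simp: indicator_def)
 thus ?thesis by (simp add: L2_def MU_measurable MU_integrable)
qed

lemma MU_inner: "L2_inner (meas_of DU) u v = ip (ext u) (ext v)"
proof -
 have "ext (%x. u x * v x) = (%x. ext u x * ext v x)" by (auto simp: indicator_def)
 thus ?thesis by (simp add: L2_inner_def MU_integral)
qed

lemma DU_form: "form_of DU u v = E (ext u) (ext v)"
 by (simp add: subspace_def)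

lemma ext_lin: "ext (%x. a * u x + b * v x) = (%x. a * ext u x + b * ext v x)"
 by (auto simp: algebra_simps)

lemma ext_diff: "ext (%x. u x - v x) = (%x. ext u x - ext v x)"
 by (auto simp: algebra_simps)

lemma DU_shifted_form: "shifted_form DU \<alpha> u v = shifted_form D \<alpha> (ext u) (ext v)"
 by (simp add: shifted_form_def DU_form MU_inner)

lemma DU_form_dist: "form_dist DU u v = form_dist D (ext u) (ext v)"
 by (simp add: form_dist_def DU_shifted_form ext_diff)

definition LU :: "('a => real) set" where
 "LU = {f : L. supp f <= U}"

lemma LU_L: "f : LU ==> f : L" by (simp add: LU_def)

lemma LU_F: "f : LU ==> f : F" using LU_L L_F by blast

lemma LU_eq: "F \<inter> Cc_space X U = LU"
 by (auto simp: LU_def L_iff Cc_space_def C_space_def Let_def)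

lemma LU_lin: "f : LU ==> g : LU ==> (%x. a * f x + b * g x) : LU"
proof -
 assume f: "f : LU" and g: "g : LU"
 have "supp (%x. a * f x + b * g x) <= supp f \<union> supp g"
  unfolding closure_of_Un[symmetric] by (rule closure_of_mono) auto
 thus ?thesis using L_lin[of f g a b] f g by (auto simp: LU_def)
qed

lemma LU_lipschitz:
 assumes f: "f : LU" and T: "1-lipschitz_on UNIV T" "T 0 = 0"
 shows "(%x. T (f x)) : LU"
proof -
 have "supp (%x. T (f x)) <= supp f" by (rule closure_of_mono) (use T(2) in auto)
 thus ?thesis using L_lipschitz[OF LU_L[OF f] T] f by (auto simp: LU_def)
qed

lemma LU_mult:
 assumes f: "f : LU" and g: "g : L"
 shows "(%x. f x * g x) : LU"
proof -
 have "supp (%x. f x * g x) <= supp f" by (rule closure_of_mono) auto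
 thus ?thesis using L_mult[OF LU_L[OF f] g] f by (auto simp: LU_def)
qed

text \<open>Elements are functions on all of \<open>X\<close>; the domain on \<open>U\<close>
  consists of the functions whose extension by zero lies here, see \<open>DU_dom\<close>. The
  closure is phrased with a tolerance instead of a sequence, which makes it visibly closed.\<close>

definition FU :: "('a => real) set" where
 "FU = {u : F. ALL e>0. EX \<phi>:LU. E1.nrm (%x. \<phi> x - u x) < e}"

lemma FU_F: "u : FU ==> u : F" by (simp add: FU_def)

lemma LU_FU: "u : LU ==> u : FU"
proof -
 assume u: "u : LU"
 have "E1.nrm (%x. u x - u x) = 0" using E1.diff_self[OF LU_F[OF u] LU_F[OF u]] by simp
 thus ?thesis using u LU_F[OF u] unfolding FU_def by force
qed

lemma FU_sequence:
 assumes "u : FU"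
 obtains \<phi> where "!!n::nat. \<phi> n : LU" "(%n. E1.nrm (%x. \<phi> n x - u x)) ----> 0"
proof -
 have "ALL n::nat. EX \<phi>. \<phi> : LU & E1.nrm (%x. \<phi> x - u x) < 1 / real (Suc n)"
 proof
  fix n show "EX \<phi>. \<phi> : LU & E1.nrm (%x. \<phi> x - u x) < 1 / real (Suc n)"
   using assms[unfolded FU_def, simplified, THEN conjunct2, rule_format, of "1 / real (Suc n)"] by (auto simp del: of_nat_Suc)
 qed
 from choice[OF this] obtain \<phi> where p: "!!n. \<phi> n : LU" "!!n. E1.nrm (%x. \<phi> n x - u x) < 1 / real (Suc n)" by blast
 have "(%n. E1.nrm (%x. \<phi> n x - u x)) ----> 0"
 proof (rule Lim_null_comparison[OF _ LIMSEQ_Suc[OF lim_1_over_n]])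
  show "\<forall>\<^sub>F n in sequentially. norm (E1.nrm (%x. \<phi> n x - u x)) <= 1 / real (Suc n)"
   using p(2) E1.nrm_nonneg[OF E.diff_mem[OF LU_F[OF p(1)] FU_F[OF assms]]] by (auto intro!: always_eventually less_imp_le simp del: of_nat_Suc)
 qed
 thus thesis using that p by blast
qed

lemma DU_dom: "dom_of DU = {u. ext u : FU}"
proof -
 have "(EX \<phi>. (ALL n::nat. \<phi> n : F \<inter> Cc_space X U) & (%n. form_dist D (\<phi> n) v) ----> 0) \<longleftrightarrow>
   (ALL e>0. EX \<phi>:LU. E1.nrm (%x. \<phi> x - v x) < e)" if v: "v : F" for v
 proof
  assume "EX \<phi>. (ALL n::nat. \<phi> n : F \<inter> Cc_space X U) & (%n. form_dist D (\<phi> n) v) ----> 0"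
  then obtain \<phi> where p: "!!n::nat. \<phi> n : LU" "(%n. E1.nrm (%x. \<phi> n x - v x)) ----> 0"
   unfolding LU_eq form_dist_nrm by blast
  show "ALL e>0. EX \<phi>:LU. E1.nrm (%x. \<phi> x - v x) < e"
  proof (intro allI impI)
   fix e :: real assume "0 < e"
   hence "\<forall>\<^sub>F n in sequentially. E1.nrm (%x. \<phi> n x - v x) < e" by (rule order_tendstoD(2)[OF p(2)])
   hence "EX n. E1.nrm (%x. \<phi> n x - v x) < e" using eventually_happens'[OF sequentially_bot] by blast
   then obtain n where "E1.nrm (%x. \<phi> n x - v x) < e" ..
   thus "EX \<phi>:LU. E1.nrm (%x. \<phi> x - v x) < e" using p(1) by blast
  qed
 next
  assume "ALL e>0. EX \<phi>:LU. E1.nrm (%x. \<phi> x - v x) < e"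
  hence "v : FU" using v by (simp add: FU_def)
  then obtain \<phi> where p: "!!n::nat. \<phi> n : LU" "(%n. E1.nrm (%x. \<phi> n x - v x)) ----> 0" by (rule FU_sequence) blast
  thus "EX \<phi>. (ALL n::nat. \<phi> n : F \<inter> Cc_space X U) & (%n. form_dist D (\<phi> n) v) ----> 0"
   unfolding LU_eq form_dist_nrm by blast
 qed
 thus ?thesis by (auto simp: subspace_def FU_def)
qed

lemma FU_closed:
 assumes u: "u : F" and ap: "!!e. 0 < e ==> EX v:FU. E1.nrm (%x. v x - u x) < e"
 shows "u : FU"
 unfolding FU_def
proof (intro CollectI conjI allI impI u)
 fix e :: real assume "0 < e"
 hence e2: "0 < e / 2" by simp
 obtain v where v: "v : FU" "E1.nrm (%x. v x - u x) < e / 2" using ap[OF e2] by blast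
 obtain \<phi> where p: "\<phi> : LU" "E1.nrm (%x. \<phi> x - v x) < e / 2" using v(1) e2 unfolding FU_def by blast
 have "E1.nrm (%x. \<phi> x - u x) < e"
  using E1.nrm_triangle[OF LU_F[OF p(1)] FU_F[OF v(1)] u] p(2) v(2) by simp
 thus "EX \<phi>:LU. E1.nrm (%x. \<phi> x - u x) < e" using p(1) by blast
qed

lemma FU_cong:
 assumes u: "u : FU" and v: "v : borel_measurable M" and ae: "AE x in M. u x = v x"
 shows "v : FU"
proof -
 have vF: "v : F" by (rule dom_cong[OF FU_F[OF u] v ae])
 show ?thesis
 proof (rule FU_closed[OF vF])
  fix e :: real assume "0 < e"
  have "AE x in M. u x - v x = 0" using ae by eventually_elim simp
  hence "shifted_form D 1 (%x. u x - v x) (%x. u x - v x) = shifted_form D 1 (%x. 0) (%x. 0)"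
   by (intro E1_cong E.diff_mem FU_F[OF u] vF zero_dom)
  also have "... = 0" by (rule E1.zero_left[OF zero_dom])
  finally show "EX w:FU. E1.nrm (%x. w x - v x) < e" using u \<open>0 < e\<close> by (intro bexI[of _ u]) simp_all
 qed
qed

lemma FU_lin:
 assumes u: "u : FU" and v: "v : FU"
 shows "(%x. a * u x + b * v x) : FU"
proof (rule FU_closed)
 note F = FU_F[OF u] FU_F[OF v]
 show "(%x. a * u x + b * v x) : F" using F by (rule E.lin_mem)
 fix e :: real assume e: "0 < e"
 define K where "K = \<bar>a\<bar> + \<bar>b\<bar> + 1"
 have K: "0 < K" by (simp add: K_def)
 obtain \<phi> \<psi> where p: "\<phi> : LU" "E1.nrm (%x. \<phi> x - u x) < e / K" and q: "\<psi> : LU" "E1.nrm (%x. \<psi> x - v x) < e / K"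
 proof -
  have "0 < e / K" using e K by simp
  thus thesis using that u v unfolding FU_def by blast
 qed
 let ?p = "%x. \<phi> x - u x" and ?q = "%x. \<psi> x - v x"
 have m: "?p : F" "?q : F" using LU_F p q F by (auto intro: E.diff_mem)
 have eq: "(%x. (a * \<phi> x + b * \<psi> x) - (a * u x + b * v x)) = (%x. a * ?p x + b * ?q x)"
  by (auto simp: algebra_simps)
 have "E1.nrm (%x. a * ?p x + b * ?q x) <= \<bar>a\<bar> * E1.nrm ?p + \<bar>b\<bar> * E1.nrm ?q"
  using E1.nrm_add[OF E.scale_mem[OF m(1)] E.scale_mem[OF m(2)], of a b] E1.nrm_scale[OF m(1)] E1.nrm_scale[OF m(2)] by simp
 also have "... <= \<bar>a\<bar> * (e / K) + \<bar>b\<bar> * (e / K)" using p q by (intro add_mono mult_left_mono) auto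
 also have "... = e * ((K - 1) / K)" by (simp add: K_def add_divide_distrib algebra_simps)
 also have "... < e * 1" using K e by (intro mult_strict_left_mono) (auto simp: field_simps)
 finally have "E1.nrm (%x. (a * \<phi> x + b * \<psi> x) - (a * u x + b * v x)) < e" unfolding eq by simp
 thus "EX w:FU. E1.nrm (%x. w x - (a * u x + b * v x)) < e" by (intro bexI[OF _ LU_FU[OF LU_lin[OF p(1) q(1)]]])
qed

lemma FU_complete: "complete_semi_inner FU (shifted_form D 1)"
proof
 fix u v w a b
 assume *: "u : FU" "v : FU"
 thus "(%x. a * u x + b * v x) : FU" by (rule FU_lin)
 show "shifted_form D 1 u v = shifted_form D 1 v u" using * FU_F E1.sym by blast
 assume "w : FU"
 thus "shifted_form D 1 (%x. a * u x + b * v x) w = a * shifted_form D 1 u w + b * shifted_form D 1 v w"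
  using * FU_F by (intro E1.lin_left) auto
next
 show "0 <= shifted_form D 1 u u" if "u : FU" for u using E1.nonneg[OF FU_F[OF that]] .
 have "(%x. 0) : LU" using L_zero by (simp add: LU_def)
 thus "FU ~= {}" using LU_FU by blast
next
 fix s :: "nat => 'a => real"
 assume s: "!!n. s n : FU"
  and c: "!!e. e > 0 ==> EX N. ALL m>=N. ALL n>=N. shifted_form D 1 (%x. s m x - s n x) (%x. s m x - s n x) < e"
 have "EX u:F. (%n. E1.nrm (%x. s n x - u x)) ----> 0" by (rule E1.complete[OF FU_F[OF s] c])
 then obtain u where u: "u : F" "(%n. E1.nrm (%x. s n x - u x)) ----> 0" ..
 have "u : FU"
 proof (rule FU_closed[OF u(1)])
  fix e :: real assume "0 < e"
  hence "\<forall>\<^sub>F n in sequentially. E1.nrm (%x. s n x - u x) < e" by (rule order_tendstoD(2)[OF u(2)])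
  hence "EX n. E1.nrm (%x. s n x - u x) < e" using eventually_happens'[OF sequentially_bot] by blast
   then obtain n where "E1.nrm (%x. s n x - u x) < e" ..
  thus "EX v:FU. E1.nrm (%x. v x - u x) < e" using s by blast
 qed
 thus "EX u:FU. (%n. E1.nrm (%x. s n x - u x)) ----> 0" using u(2) by blast
qed

text \<open>The idea is to project \<open>u\<close> onto \<open>FU\<close>.\<close>

lemma FU_weakly_closed:
 assumes s: "!!n::nat. s n : FU" and u: "u : F"
  and lim: "(%n. L2_nrm M (%x. s n x - u x)) ----> 0" and bdd: "!!n. E (s n) (s n) <= C"
 shows "u : FU"
proof -
 interpret P: complete_semi_inner FU "shifted_form D 1" by (rule FU_complete)
 obtain p where p: "p : FU" "!!v. v : FU ==> shifted_form D 1 p v = shifted_form D 1 u v"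
 proof (rule P.riesz_representation[of "%v. shifted_form D 1 u v" "E1.nrm u"])
  show "shifted_form D 1 u (%x. a * v x + b * w x) = a * shifted_form D 1 u v + b * shifted_form D 1 u w"
   if "v : FU" "w : FU" for v w a b using that u FU_F by (intro E1.lin_right) auto
  show "\<bar>shifted_form D 1 u v\<bar> <= E1.nrm u * P.nrm v" if "v : FU" for v
   by (rule E1.abs_le_nrm[OF u FU_F[OF that]])
 qed auto
 \<comment> \<open>The residual is orthogonal to \<open>FU\<close>, hence to every
   \<open>s n\<close>, hence to their weak limit \<open>u\<close>. Being orthogonal to
   \<open>u\<close> and to \<open>p\<close>, it has norm 0.\<close>
 let ?z = "%x. u x - p x"
 have z: "?z : F" using u FU_F[OF p(1)] E.diff_mem by blast
 have z0: "shifted_form D 1 ?z v = 0" if "v : FU" for v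
  using p(2)[OF that] E1.diff_left[OF u FU_F[OF p(1)] FU_F[OF that]] by simp
 have "(%n. E (s n) ?z + ip (s n) ?z) ----> E u ?z + ip u ?z"
  by (intro tendsto_add weak_form_tendsto[OF FU_F[OF s] u z lim bdd]
    L2.tendsto_left[OF dom_L2[OF FU_F[OF s]] dom_L2[OF u] dom_L2[OF z] lim])
 moreover have "E (s n) ?z + ip (s n) ?z = 0" for n
  using z0[OF s[of n]] E1.sym[OF z FU_F[OF s[of n]]] by (simp add: shifted_form_def)
 ultimately have "E u ?z + ip u ?z = 0" by (simp add: LIMSEQ_const_iff)
 hence "shifted_form D 1 ?z u = 0" using E1.sym[OF z u] by (simp add: shifted_form_def)
 hence "shifted_form D 1 ?z ?z = 0" using z0[OF p(1)] E1.diff_right[OF u FU_F[OF p(1)] z] by simp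
 hence "E1.nrm (%x. p x - u x) = 0" using E1.diff_self_commute[OF u FU_F[OF p(1)]] by simp
 thus ?thesis using p(1) by (intro FU_closed[OF u]) (metis)
qed

text \<open>Composition with \<open>T\<close> need not be continuous in form norm, but it keeps
  energies bounded and is continuous in \<open>L^2\<close>, which is enough for
  \<open>FU_weakly_closed\<close>.\<close>

lemma FU_lipschitz:
 assumes u: "u : FU" and T: "1-lipschitz_on UNIV T" "T 0 = 0"
 shows "(%x. T (u x)) : FU"
proof -
 obtain \<phi> where p: "!!n::nat. \<phi> n : LU" "(%n. E1.nrm (%x. \<phi> n x - u x)) ----> 0" by (rule FU_sequence[OF u]) blast
 obtain C where C: "!!n. E (\<phi> n) (\<phi> n) <= C" by (rule E_bounded_of_tendsto[OF LU_F[OF p(1)] FU_F[OF u] p(2)]) blast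
 have l2: "(%n. L2_nrm M (%x. \<phi> n x - u x)) ----> 0" by (rule L2_tendsto_of_E1[OF LU_F[OF p(1)] FU_F[OF u] p(2)])
 note Tp = lipschitz_dom[OF LU_F[OF p(1)] T] and Tu = lipschitz_dom[OF FU_F[OF u] T]
 show ?thesis
 proof (rule FU_weakly_closed[of "%n x. T (\<phi> n x)" _ C])
  show "(%x. T (\<phi> n x)) : FU" for n by (rule LU_FU[OF LU_lipschitz[OF p(1) T]])
  show "(%x. T (u x)) : F" by (rule Tu(1))
  show "E (%x. T (\<phi> n x)) (%x. T (\<phi> n x)) <= C" for n using Tp(2)[of n] C[of n] by simp
  show "(%n. L2_nrm M (%x. T (\<phi> n x) - T (u x))) ----> 0"
  proof (rule Lim_null_comparison[OF _ l2], rule always_eventually, rule allI)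
   fix n
   have d: "(%x. T (\<phi> n x) - T (u x)) : L2 M" using Tp(1) Tu(1) dom_L2 by (intro L2.diff_mem) auto
   have "\<bar>T (\<phi> n x) - T (u x)\<bar> <= \<bar>\<phi> n x - u x\<bar>" for x
    using lipschitz_onD[OF T(1), of "\<phi> n x" "u x"] by (simp add: dist_real_def)
   hence "L2_nrm M (%x. T (\<phi> n x) - T (u x)) <= L2_nrm M (%x. \<phi> n x - u x)"
    using LU_F[OF p(1)] FU_F[OF u] dom_L2 by (intro L2_nrm_mono L2.diff_mem L2_measurable[OF d]) auto
   thus "norm (L2_nrm M (%x. T (\<phi> n x) - T (u x))) <= L2_nrm M (%x. \<phi> n x - u x)"
    using L2.nrm_nonneg[OF d] by simp
  qed
 qed
qed

text \<open>Approximate \<open>v\<close> by bounded test functions; the products with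
  \<open>\<eta>\<close> have bounded energy and converge in \<open>L^2\<close>, so weak closedness
  applies. The test functions of the final estimate arise this way.\<close>

lemma FU_times:
 assumes \<eta>: "\<eta> : LU" and v: "v : Fb"
 shows "(%x. \<eta> x * v x) : FU"
proof -
 note \<eta>b = L_Fb[OF LU_L[OF \<eta>]]
 obtain c where c: "0 < c" "AE x in M. \<bar>v x\<bar> <= c" by (rule Fb_bound[OF v])
 have cv: "AE x in M. - c <= v x & v x <= c" using c(2) by eventually_elim auto
 have nc: "- c <= 0" "0 <= c" using c(1) by auto
 obtain g C where g: "!!n. g n : L" "!!n x. - c <= g n x & g n x <= c"
  and l2: "(%n. L2_nrm M (%x. g n x - v x)) ----> 0" and C: "0 <= C" "!!n. E (g n) (g n) <= C"
  by (rule L_bounded_sequence[OF FbD[OF v] cv nc]) blast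
 have gc: "AE x in M. \<bar>g n x\<bar> <= c" for n using g(2)[of n] by (intro AE_I2) (simp add: abs_le_iff minus_le_iff)
 show ?thesis
  by (rule mult_bounded_tendsto[OF \<eta>b L_Fb[OF g(1)] v gc l2 C(2)])
   (rule FU_weakly_closed[OF LU_FU[OF LU_mult[OF \<eta> g(1)]] FbD[OF Fb_mult[OF \<eta>b v]]])
qed

lemma FU_zero_off:
 assumes u: "u : FU" shows "AE x in M. x \<notin> U --> u x = 0"
proof -
 obtain \<phi> where p: "!!n::nat. \<phi> n : LU" "(%n. E1.nrm (%x. \<phi> n x - u x)) ----> 0" by (rule FU_sequence[OF u]) blast
 have uF: "u : F" by (rule FU_F[OF u])
 let ?w = "%x. (1 - indicator U x) * u x"
 have w: "?w : L2 M"
  using U_sets dom_measurable[OF uF] by (intro L2_bound[OF dom_L2[OF uF]]) (auto simp: indicator_def)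
 have "L2_nrm M ?w <= E1.nrm (%x. \<phi> n x - u x)" for n
 proof -
  have d: "(%x. \<phi> n x - u x) : F" by (intro E.diff_mem LU_F p uF)
  have "AE x in M. \<bar>?w x\<bar> <= \<bar>\<phi> n x - u x\<bar>" using AE_space
  proof eventually_elim
   case (elim x)
   have "\<phi> n x = 0" if "x \<notin> U" using supp_zero[of x "\<phi> n"] elim that p(1)[of n] by (auto simp: LU_def M_space)
   thus ?case by (auto simp: indicator_def)
  qed
  hence "L2_nrm M ?w <= L2_nrm M (%x. \<phi> n x - u x)" by (intro L2_nrm_mono dom_L2[OF d] L2_measurable[OF w])
  thus ?thesis using L2_le_E1[OF d] by simp
 qed
 hence "L2_nrm M ?w <= 0" by (intro LIMSEQ_le_const[OF p(2)]) blast
 hence "ip ?w ?w <= 0" by simp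
 hence "AE x in M. ?w x = 0" by (rule L2_null[OF w])
 thus ?thesis by eventually_elim (auto simp: indicator_def split: if_splits)
qed

lemma FU_ext: "u : FU ==> ext u : FU"
proof -
 assume u: "u : FU"
 have "AE x in M. u x = ext u x" using FU_zero_off[OF u] by eventually_elim (auto simp: indicator_def)
 thus ?thesis using U_sets dom_measurable[OF FU_F[OF u]] by (intro FU_cong[OF u]) auto
qed

text \<open>Approximate the extension by a test function on \<open>X\<close>, then multiply by
  Urysohn functions that become 1 on compact sets exhausting \<open>U\<close>; dominated convergence
  controls the loss on \<open>U\<close>.\<close>

lemma DU_dense:
 assumes f: "f : L2 (meas_of DU)" and e: "0 < e"
 shows "EX u:dom_of DU. L2_nrm (meas_of DU) (%x. f x - u x) < e"
proof -
 have fL: "ext f : L2 M" using f by (simp add: MU_L2)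
 have e4: "0 < e / 4" using e by simp
 obtain h where h: "h : F" "L2_nrm M (%x. ext f x - h x) < e / 4" by (rule dom_dense[OF fL e4])
 obtain g where g: "g : L" "form_dist D h g < e / 4" by (rule L_dense[OF h(1) e4])
 have gF: "g : F" by (rule L_F[OF g(1)])
 have gL: "g : L2 M" by (rule dom_L2[OF gF])
 have fg: "L2_nrm M (%x. ext f x - g x) < e / 2"
  using L2.nrm_triangle[OF fL dom_L2[OF h(1)] gL] h(2) g(2)[unfolded form_dist_nrm] L2_le_E1[OF E.diff_mem[OF h(1) gF]]
  by linarith
 obtain K where K: "!!n::nat. compactin X (K n)" "!!n. K n <= K (Suc n)" "(\<Union>n. K n) = U"
  by (rule open_Union_compact[OF U_open]) blast
 have "ALL n. EX w. w : L & (ALL x. 0 <= w x & w x <= 1) & (ALL x:K n. w x = 1) & supp w <= U"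
 proof
  fix n show "EX w. w : L & (ALL x. 0 <= w x & w x <= 1) & (ALL x:K n. w x = 1) & supp w <= U"
   using L_urysohn[OF K(1)[of n] U_open] K(3) by blast
 qed
 from choice[OF this] obtain w where w0: "ALL n. w n : L & (ALL x. 0 <= w n x & w n x <= 1) & (ALL x:K n. w n x = 1) & supp (w n) <= U" ..
 have w: "!!n. w n : LU" "!!n x. 0 <= w n x" "!!n x. w n x <= 1" "!!n x. x : K n ==> w n x = 1"
  using w0 by (auto simp: LU_def)
 have wm: "w n : borel_measurable M" for n by (rule dom_measurable[OF LU_F[OF w(1)]])
 let ?d = "%(n::nat) x. indicator U x * (g x - w n x * g x)"
 have dm: "?d n : borel_measurable M" for n using U_sets wm dom_measurable[OF gF] by measurable
 have db: "\<bar>?d n x\<bar> <= \<bar>g x\<bar>" for n x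
 proof -
  have "?d n x = indicator U x * ((1 - w n x) * g x)" by (simp add: algebra_simps)
  hence "\<bar>?d n x\<bar> = \<bar>indicator U x\<bar> * (\<bar>1 - w n x\<bar> * \<bar>g x\<bar>)" by (simp only: abs_mult)
  also have "... <= 1 * (1 * \<bar>g x\<bar>)" using w(2,3)[of n x] by (intro mult_mono) (auto simp: indicator_def)
  finally show ?thesis by simp
 qed
 have dL: "?d n : L2 M" for n by (rule L2_bound[OF gL dm]) (simp add: db)
 have "(%n. \<integral>x. ?d n x * ?d n x \<partial>M) ----> (LINT x|M. 0)"
 proof (rule integral_dominated_convergence)
  show "integrable M (%x. (g x)\<^sup>2)" by (rule L2_integrable_square[OF gL])
  show "(%x. ?d n x * ?d n x) : borel_measurable M" for n using dm by measurable
  show "AE x in M. norm (?d n x * ?d n x) <= (g x)\<^sup>2" for n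
  proof (rule AE_I2)
   fix x
   have "(?d n x)\<^sup>2 <= (g x)\<^sup>2" unfolding abs_le_square_iff[symmetric] by (rule db)
   thus "norm (?d n x * ?d n x) <= (g x)\<^sup>2" by (simp add: power2_eq_square)
  qed
  show "AE x in M. (%n. ?d n x * ?d n x) ----> 0"
  proof (rule AE_I2)
   fix x
   have "\<forall>\<^sub>F n in sequentially. ?d n x * ?d n x = 0"
   proof (cases "x : U")
    case True
    then obtain m where m: "x : K m" using K(3) by blast
    have "w n x = 1" if "n >= m" for n using lift_Suc_mono_le[where f=K, OF K(2) that] m w(4) by blast
    thus ?thesis unfolding eventually_sequentially by (intro exI[of _ m]) simp
   qed simp
   thus "(%n. ?d n x * ?d n x) ----> 0" by (rule tendsto_eventually)
  qed
 qed simp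
 hence "(%n. ip (?d n) (?d n)) ----> 0" by (simp add: L2_inner_def)
 hence "(%n. L2_nrm M (?d n)) ----> 0" using tendsto_real_sqrt by fastforce
 hence "\<forall>\<^sub>F n in sequentially. L2_nrm M (?d n) < e / 2" using e by (intro order_tendstoD(2)) auto
 hence "EX n. L2_nrm M (?d n) < e / 2" using eventually_happens'[OF sequentially_bot] by blast
   then obtain n where n: "L2_nrm M (?d n) < e / 2" ..
 let ?v = "%x. w n x * g x"
 have v: "?v : FU" by (rule LU_FU[OF LU_mult[OF w(1) g(1)]])
 have eq: "ext (%x. f x - ?v x) = (%x. ext (%x. ext f x - g x) x + ?d n x)" by (auto simp: indicator_def)
 have fg2: "(%x. ext f x - g x) : L2 M" by (rule L2.diff_mem[OF fL gL])
 have efg: "ext (%x. ext f x - g x) : L2 M"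
  using U_sets by (intro L2_bound[OF fg2] borel_measurable_times L2_measurable[OF fg2]) (auto simp: indicator_def)
 have "L2_nrm (meas_of DU) (%x. f x - ?v x) = L2_nrm M (%x. ext (%x. ext f x - g x) x + ?d n x)"
  unfolding MU_inner eq ..
 also have "... <= L2_nrm M (ext (%x. ext f x - g x)) + L2_nrm M (?d n)" by (rule L2.nrm_add[OF efg dL])
 also have "L2_nrm M (ext (%x. ext f x - g x)) <= L2_nrm M (%x. ext f x - g x)"
  by (rule L2_nrm_mono[OF fg2 L2_measurable[OF efg]]) (auto simp: indicator_def)
 finally have "L2_nrm (meas_of DU) (%x. f x - ?v x) < e" using fg n by simp
 moreover have "?v : dom_of DU" using FU_ext[OF v] by (simp add: DU_dom)
 ultimately show ?thesis by (intro bexI[of _ ?v])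
qed

lemma DU_closed: "closed_form DU"
 unfolding closed_form_def Lp_2 Lp_norm_2
proof (intro conjI ballI allI impI subsetI)
 fix u assume u: "u : dom_of DU"
 hence uF: "ext u : FU" by (simp add: DU_dom)
 show "u : L2 (meas_of DU)" using dom_L2[OF FU_F[OF uF]] by (simp add: MU_L2)
 show "0 <= form_of DU u u" using E.nonneg[OF FU_F[OF uF]] by (simp add: DU_form)
 {
  fix u' assume "u' : borel_measurable (meas_of DU)" "AE x in meas_of DU. u x = u' x"
  thus "u' : dom_of DU" using FU_cong[OF uF] by (simp add: DU_dom MU_measurable MU_AE_eq)
 }
 fix v assume v: "v : dom_of DU"
 hence vF: "ext v : FU" by (simp add: DU_dom)
 show "(%x. a * u x + b * v x) : dom_of DU" for a b
  using FU_lin[OF uF vF] by (simp only: DU_dom mem_Collect_eq ext_lin)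
 show "form_of DU u v = form_of DU v u" using E.sym[OF FU_F[OF uF] FU_F[OF vF]] by (simp add: DU_form)
 fix w assume w: "w : dom_of DU"
 hence wF: "ext w : FU" by (simp add: DU_dom)
 show "form_of DU (%x. a * u x + b * v x) w = a * form_of DU u w + b * form_of DU v w" for a b
  unfolding DU_form ext_lin by (intro E.lin_left FU_F uF vF wF)
 show "form_of DU u w = form_of DU v w" if "AE x in meas_of DU. u x = v x"
  unfolding DU_form by (intro form_cong_left FU_F uF vF wF) (use that in \<open>simp add: MU_AE_eq\<close>)
next
 fix f and e :: real assume "f : L2 (meas_of DU)" "0 < e"
 thus "EX u:dom_of DU. L2_nrm (meas_of DU) (%x. f x - u x) < e" by (rule DU_dense)
next
 fix s :: "nat => 'a => real"
 assume *: "(ALL n. s n : dom_of DU) & (ALL \<epsilon>>0. EX N. ALL m>=N. ALL n>=N. form_dist DU (s m) (s n) < \<epsilon>)"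
 hence s: "!!n. ext (s n) : FU" by (simp add: DU_dom)
 interpret P: complete_semi_inner FU "shifted_form D 1" by (rule FU_complete)
 have "EX N. ALL m>=N. ALL n>=N. shifted_form D 1 (%x. ext (s m) x - ext (s n) x) (%x. ext (s m) x - ext (s n) x) < e" if "0 < e" for e
 proof -
  have "0 < sqrt e" using that by simp
  then obtain N where N: "ALL m>=N. ALL n>=N. form_dist DU (s m) (s n) < sqrt e" using * by blast
  show ?thesis
  proof (intro exI[of _ N] allI impI)
   fix m n assume "m >= N" "n >= N"
   hence "form_dist DU (s m) (s n) < sqrt e" using N by blast
   thus "shifted_form D 1 (%x. ext (s m) x - ext (s n) x) (%x. ext (s m) x - ext (s n) x) < e"
    unfolding DU_form_dist form_dist_nrm by simp
  qed
 qed
 hence "EX u:FU. (%n. P.nrm (%x. ext (s n) x - u x)) ----> 0" by (rule P.complete[OF s])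
 then obtain u where u: "u : FU" "(%n. P.nrm (%x. ext (s n) x - u x)) ----> 0" ..
 have ue: "AE x in M. u x = ext u x" using FU_zero_off[OF u(1)] by eventually_elim (auto simp: indicator_def)
 have "form_dist DU (s n) u = P.nrm (%x. ext (s n) x - u x)" for n
 proof -
  have "shifted_form D 1 (%x. ext (s n) x - ext u x) (%x. ext (s n) x - ext u x) =
    shifted_form D 1 (%x. ext (s n) x - u x) (%x. ext (s n) x - u x)"
   by (intro E1_cong E.diff_mem FU_F s FU_ext u(1)) (use ue in \<open>eventually_elim, simp\<close>)
  thus ?thesis unfolding DU_form_dist form_dist_nrm by simp
 qed
 thus "EX u:dom_of DU. (%n. form_dist DU (s n) u) ----> 0"
  using u(2) FU_ext[OF u(1)] by (intro bexI[of _ u]) (auto simp: DU_dom)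
qed

lemma DU_markovian: "markovian DU"
 unfolding markovian_def comp_def
proof (intro allI impI ballI)
 fix T :: "real => real" and u
 assume T: "1-lipschitz_on UNIV T & T 0 = 0" and u: "u : dom_of DU"
 hence uF: "ext u : FU" by (simp add: DU_dom)
 have eq: "ext (%x. T (u x)) = (%x. T (ext u x))" using T by (auto simp: indicator_def)
 show "(%x. T (u x)) : dom_of DU & form_of DU (%x. T (u x)) (%x. T (u x)) <= form_of DU u u"
  unfolding DU_dom DU_form mem_Collect_eq eq
  using FU_lipschitz[OF uF] lipschitz_dom(2)[OF FU_F[OF uF]] T by blast
qed

lemma DU_closed_markovian: "closed_markovian_form DU"
 by (unfold_locales) (rule DU_closed DU_markovian)+

end

section \<open>Integrable functions and convergence in mean\<close>

abbreviation L1_nrm :: "'a measure => ('a => real) => real" where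
 "L1_nrm M f \<equiv> (LINT x|M. \<bar>f x\<bar>)"

lemma L1_nrm_mono:
 assumes "integrable M f" "g : borel_measurable M" "AE x in M. \<bar>g x\<bar> <= \<bar>f x\<bar>"
 shows "L1_nrm M g <= L1_nrm M f"
proof -
 have "integrable M g" by (rule Bochner_Integration.integrable_bound[OF assms(1,2)]) (use assms(3) in simp)
 thus ?thesis using assms by (intro integral_mono_AE) auto
qed

lemma L1_nrm_triangle:
 fixes f g h :: "'a => real"
 assumes "integrable M f" "integrable M g" "integrable M h"
 shows "L1_nrm M (%x. f x - h x) <= L1_nrm M (%x. f x - g x) + L1_nrm M (%x. g x - h x)"
proof -
 have "L1_nrm M (%x. f x - h x) <= (LINT x|M. \<bar>f x - g x\<bar> + \<bar>g x - h x\<bar>)"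
  using assms by (intro integral_mono) auto
 also have "... = L1_nrm M (%x. f x - g x) + L1_nrm M (%x. g x - h x)" using assms by simp
 finally show ?thesis .
qed

lemma L1_nrm_lin:
 fixes f g :: "'a => real"
 assumes "integrable M f" "integrable M g"
 shows "L1_nrm M (%x. a * f x + b * g x) <= \<bar>a\<bar> * L1_nrm M f + \<bar>b\<bar> * L1_nrm M g"
proof -
 have "L1_nrm M (%x. a * f x + b * g x) <= (LINT x|M. \<bar>a\<bar> * \<bar>f x\<bar> + \<bar>b\<bar> * \<bar>g x\<bar>)"
  using assms by (intro integral_mono) (auto simp: abs_mult[symmetric])
 thus ?thesis using assms by simp
qed

lemma L1_nrm_null:
 assumes "integrable M f" "L1_nrm M f <= 0"
 shows "AE x in M. f x = 0"
proof -
 have "L1_nrm M f = 0" using assms(2) by (simp add: antisym)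
 hence "AE x in M. \<bar>f x\<bar> = 0" using assms(1) by (subst (asm) integral_nonneg_eq_0_iff_AE) auto
 thus ?thesis by simp
qed

lemma fatou:
 fixes w :: "nat => 'a => real"
 assumes w: "!!j. integrable M (w j)" "!!j x. 0 <= w j x" "!!j. (LINT x|M. w j x) <= C"
  and lim: "AE x in M. (%j. w j x) ----> v x" and [measurable]: "v : borel_measurable M"
 shows "integrable M v" "(LINT x|M. v x) <= C"
proof -
 have [measurable]: "w j : borel_measurable M" for j using w(1) by simp
 have v0: "AE x in M. 0 <= v x" using lim
  by eventually_elim (rule LIMSEQ_le_const, assumption, use w(2) in blast)
 have "(\<integral>\<^sup>+x. ennreal (v x) \<partial>M) = (\<integral>\<^sup>+x. liminf (%j. ennreal (w j x)) \<partial>M)"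
  using lim
  by (intro nn_integral_cong_AE, eventually_elim) (metis lim_imp_Liminf sequentially_bot tendsto_ennrealI)
 also have "... <= liminf (%j. \<integral>\<^sup>+x. ennreal (w j x) \<partial>M)" by (rule nn_integral_liminf) simp
 also have "... <= liminf (%j. ennreal C)"
  using w by (intro Liminf_mono always_eventually allI) (simp add: nn_integral_eq_integral ennreal_leI)
 also have "... = ennreal C" by (rule Liminf_const) simp
 finally have le: "(\<integral>\<^sup>+x. ennreal (v x) \<partial>M) <= ennreal C" .
 have "(\<integral>\<^sup>+x. ennreal (norm (v x)) \<partial>M) = (\<integral>\<^sup>+x. ennreal (v x) \<partial>M)"
  using v0 by (intro nn_integral_cong_AE, eventually_elim) simp
 also have "... < \<infinity>" using le ennreal_less_top le_less_trans by (metis infinity_ennreal_def)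
 finally show i: "integrable M v" by (simp add: integrable_iff_bounded)
 have "0 <= (LINT x|M. w 0 x)" using w(2) by simp
 hence "0 <= C" using w(3)[of 0] by linarith
 thus "(LINT x|M. v x) <= C" using le nn_integral_eq_integral[OF i v0] by (simp add: ennreal_le_iff)
qed

lemma L1_subsequence:
 fixes s :: "nat => 'a => real"
 assumes "!!n. integrable M (s n)" "integrable M u" "(%n. L1_nrm M (%x. s n x - u x)) ----> 0"
 obtains r :: "nat => nat" where "strict_mono r" "AE x in M. (%n. s (r n) x) ----> u x"
proof -
 have "EX r::nat=>nat. strict_mono r & (AE x in M. (%n. s (r n) x - u x) ----> 0)"
  by (rule tendsto_L1_AE_subseq) (use assms in auto)
 then obtain r :: "nat => nat" where r: "strict_mono r" "AE x in M. (%n. s (r n) x - u x) ----> 0" by blast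
 have "AE x in M. (%n. s (r n) x) ----> u x" using r(2) by eventually_elim (rule LIM_zero_cancel)
 thus thesis using that r(1) by blast
qed

text \<open>Convergence in mean gives an almost everywhere convergent subsequence, to which Fatou's
  lemma applies. Bounds on the Euler scheme are transferred to the semigroup by this lemma.\<close>

lemma fatou_mean:
 fixes s :: "nat => 'a => real"
 assumes s: "!!n. integrable M (s n)" "integrable M u" "(%n. L1_nrm M (%x. s n x - u x)) ----> 0"
  and \<phi>: "continuous_on UNIV \<phi>" "!!y::real. 0 <= (\<phi> y :: real)"
  and b: "!!n. integrable M (%x. \<phi> (s n x))" "!!n. (LINT x|M. \<phi> (s n x)) <= C"
 shows "integrable M (%x. \<phi> (u x))" "(LINT x|M. \<phi> (u x)) <= C"
proof -
 obtain r where r: "strict_mono r" "AE x in M. (%n. s (r n) x) ----> u x"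
  by (rule L1_subsequence[OF s])
 have l: "AE x in M. (%n. \<phi> (s (r n) x)) ----> \<phi> (u x)"
  using r(2) by eventually_elim (rule continuous_on_tendsto_compose[OF \<phi>(1)], auto)
 have m: "(%x. \<phi> (u x)) : borel_measurable M"
  using borel_measurable_continuous_onI[OF \<phi>(1)] s(2) by measurable
 show "integrable M (%x. \<phi> (u x))" "(LINT x|M. \<phi> (u x)) <= C"
  by (rule fatou[OF b(1) \<phi>(2) b(2) l m])+
qed

lemma L1_complete:
 fixes s :: "nat => 'a => real"
 assumes s: "!!n. integrable M (s n)"
  and c: "!!e. e > 0 ==> EX N. ALL i>=N. ALL j>=N. L1_nrm M (%x. s i x - s j x) < e"
 obtains u where "integrable M u" "(%n. L1_nrm M (%x. s n x - u x)) ----> 0"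
proof -
 obtain r :: "nat => nat" where r: "strict_mono r" "AE x in M. Cauchy (%i. s (r i) x)"
  by (rule cauchy_L1_AE_cauchy_subseq[of M s]) (use s c in auto)
 define u where "u x = lim (%i. s (r i) x)" for x
 have [measurable]: "s i : borel_measurable M" for i using s by simp
 have um [measurable]: "u : borel_measurable M" unfolding u_def by measurable
 have lim: "AE x in M. (%i. s (r i) x) ----> u x"
  using r(2) by eventually_elim (simp add: u_def convergent_LIMSEQ_iff Cauchy_convergent_iff)
 have key: "integrable M (%x. \<bar>s i x - u x\<bar>) & L1_nrm M (%x. s i x - u x) <= e"
  if N: "ALL i>=N. ALL j>=N. L1_nrm M (%x. s i x - s j x) < e" and i: "i >= N" for i N e
 proof -
  have rj: "N <= r (j + N)" for j using seq_suble[OF r(1), of "j + N"] by simp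
  have l: "AE x in M. (%j. \<bar>s i x - s (r (j + N)) x\<bar>) ----> \<bar>s i x - u x\<bar>"
   using lim by eventually_elim (intro tendsto_rabs tendsto_diff tendsto_const LIMSEQ_ignore_initial_segment)
  have a: "integrable M (%x. \<bar>s i x - s (r (j + N)) x\<bar>)" for j using s by simp
  have b: "L1_nrm M (%x. s i x - s (r (j + N)) x) <= e" for j using N i rj[of j] by (simp add: less_imp_le)
  show ?thesis using fatou[OF a abs_ge_zero b l] by simp
 qed
 obtain N where "ALL i>=N. ALL j>=N. L1_nrm M (%x. s i x - s j x) < 1" using c[of 1] by auto
 hence "integrable M (%x. \<bar>s N x - u x\<bar>)" using key[of N 1 N] by simp
 hence "integrable M (%x. s N x - u x)" by (subst (asm) integrable_abs_iff) auto
 from Bochner_Integration.integrable_diff[OF s[of N] this] have "integrable M (%x. s N x - (s N x - u x))" .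
 moreover have "(%x. s N x - (s N x - u x)) = u" by auto
 ultimately have "integrable M u" by metis
 moreover have "(%n. L1_nrm M (%x. s n x - u x)) ----> 0"
 proof (rule LIMSEQ_I)
  fix e :: real assume "0 < e"
  then obtain N where N: "ALL i>=N. ALL j>=N. L1_nrm M (%x. s i x - s j x) < e / 2" using c[of "e / 2"] by auto
  have "norm (L1_nrm M (%x. s n x - u x) - 0) < e" if "n >= N" for n
   using key[OF N that] \<open>0 < e\<close> by simp
  thus "EX N. ALL n>=N. norm (L1_nrm M (%x. s n x - u x) - 0) < e" by blast
 qed
 ultimately show thesis by (rule that)
qed

definition truncate :: "nat => ('a => real) => 'a => real" where
 "truncate n f = (%x. max (- real n) (min (real n) (f x)))"

lemma truncate_abs: "\<bar>truncate n f x\<bar> <= \<bar>f x\<bar>" "\<bar>truncate n f x\<bar> <= real n"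
 by (auto simp: truncate_def)

lemma truncate_measurable [measurable]: "f : borel_measurable M ==> truncate n f : borel_measurable M"
 unfolding truncate_def by (intro borel_measurable_max borel_measurable_min borel_measurable_const)

lemma truncate_eventually: "\<forall>\<^sub>F n in sequentially. truncate n f x = f x"
proof -
 obtain m :: nat where "\<bar>f x\<bar> <= real m" using real_arch_simple by blast
 hence "ALL n>=m. truncate n f x = f x" by (auto simp: truncate_def)
 thus ?thesis unfolding eventually_sequentially by blast
qed

lemma truncate_tendsto_L1:
 assumes f: "integrable M f"
 shows "(%n. L1_nrm M (%x. truncate n f x - f x)) ----> 0"
proof -
 have [measurable]: "f : borel_measurable M" using f by simp
 have "(%n. L1_nrm M (%x. truncate n f x - f x)) ----> (LINT x|M. 0)"
 proof (rule integral_dominated_convergence)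
  show "integrable M (%x. 2 * \<bar>f x\<bar>)" using f by simp
  show "AE x in M. (%n. \<bar>truncate n f x - f x\<bar>) ----> 0"
  proof (rule AE_I2, rule tendsto_eventually)
   fix x show "\<forall>\<^sub>F n in sequentially. \<bar>truncate n f x - f x\<bar> = 0"
    using truncate_eventually[of f x] by eventually_elim simp
  qed
  show "AE x in M. norm \<bar>truncate n f x - f x\<bar> <= 2 * \<bar>f x\<bar>" for n
   by (rule AE_I2) (use truncate_abs(1)[of n f] in \<open>smt (verit) real_norm_def\<close>)
 qed auto
 thus ?thesis by simp
qed

section \<open>Powers of the resolvent\<close>

locale finite_markovian_form = closed_markovian_form D + finite_measure "meas_of D" for D :: "'a form_space"
begin

abbreviation N1 :: "('a => real) => real" where "N1 \<equiv> L1_nrm M"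
abbreviation N2 :: "('a => real) => real" where "N2 \<equiv> L2_nrm M"

lemma bounded_L2:
 assumes "f : borel_measurable M" "AE x in M. \<bar>f x\<bar> <= c" shows "f : L2 M"
proof (rule L2_bound[OF _ assms(1)])
 show "(%x. c) : L2 M" by (simp add: L2_def)
 show "AE x in M. \<bar>f x\<bar> <= \<bar>c\<bar>" using assms(2) by eventually_elim simp
qed

lemma one_L2: "(%x. 1) : L2 M" by (rule bounded_L2[of _ 1]) auto

lemma truncate_L2: "f : borel_measurable M ==> truncate n f : L2 M"
 by (rule bounded_L2[of _ "real n"]) (auto simp: truncate_abs)

lemma L2_integrable: "f : L2 M ==> integrable M f"
 using L2_integrable_mult[OF _ one_L2] by simp

definition vol :: real where "vol = N2 (%x. 1)"

lemma vol_nonneg: "0 <= vol" unfolding vol_def by (rule L2.nrm_nonneg[OF one_L2])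

lemma N1_le_N2: "f : L2 M ==> N1 f <= vol * N2 f"
proof -
 assume f: "f : L2 M"
 have "N1 f = ip (%x. \<bar>f x\<bar>) (%x. 1)" by (simp add: L2_inner_def)
 also have "... <= N2 (%x. \<bar>f x\<bar>) * vol"
  using L2.abs_le_nrm[OF L2_abs[OF f] one_L2] unfolding vol_def by linarith
 also have "N2 (%x. \<bar>f x\<bar>) = N2 f" by (simp add: L2_inner_def)
 finally show ?thesis by (simp add: mult.commute)
qed

lemma R_abs:
 assumes "0 < \<alpha>" "f : L2 M"
 shows "AE x in M. \<bar>R \<alpha> f x\<bar> <= R \<alpha> (%x. \<bar>f x\<bar>) x"
proof -
 have "AE x in M. R \<alpha> f x <= R \<alpha> (%x. \<bar>f x\<bar>) x" by (rule R_mono[OF assms L2_abs[OF assms(2)]]) auto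
 moreover have "AE x in M. R \<alpha> (%x. - f x) x <= R \<alpha> (%x. \<bar>f x\<bar>) x"
  by (rule R_mono[OF assms(1) L2.uminus_mem[OF assms(2)] L2_abs[OF assms(2)]]) auto
 ultimately show ?thesis using R_uminus[OF assms] by eventually_elim auto
qed

lemma R_N1:
 assumes "0 < \<alpha>" "f : L2 M"
 shows "N1 (R \<alpha> f) <= N1 f"
proof -
 note a = L2_abs[OF assms(2)]
 have "N1 (R \<alpha> f) <= (LINT x|M. R \<alpha> (%x. \<bar>f x\<bar>) x)"
  using R_abs[OF assms] by (intro integral_mono_AE integrable_abs L2_integrable R_L2 assms a)
 also have "... <= N1 f" using R_L1(2)[OF assms(1) a L2_integrable[OF a]] by simp
 finally show ?thesis .
qed

lemma R_powr:
 assumes "0 < \<alpha>" "f : L2 M" "(%x. \<bar>f x\<bar> powr q) : L2 M" "1 < q"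
 shows "AE x in M. \<bar>R \<alpha> f x\<bar> powr q <= R \<alpha> (%x. \<bar>f x\<bar> powr q) x"
proof -
 define p where "p = q / (q - 1)"
 have p: "1 < p" "1 / q + 1 / p = 1" using assms(4) by (auto simp: p_def field_simps)
 let ?b = "%x. \<bar>R \<alpha> (%x. \<bar>f x\<bar>) x\<bar> powr (q - 1)"
 note a = L2_abs[OF assms(2)]
  \<comment> \<open>Jensen's inequality, by applying the kernel lemma to Young's inequality.\<close>
 have "AE x in M. 0 <= ?b x powr p / p + (\<Sum>(f, g)\<leftarrow>[(%x. 1 / q, %x. \<bar>f x\<bar> powr q), (%x. - ?b x, %x. \<bar>f x\<bar>)]. f x * R \<alpha> g x)"
 proof (rule R_kernel[OF assms(1)])
  show "g : L2 M" if "(h, g) : set [(%x. 1 / q, %x. \<bar>f x\<bar> powr q), (%x. - ?b x, %x. \<bar>f x\<bar>)]" for g h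
   using that assms(3) a by auto
  show "0 <= ?b x powr p / p" for x using p(1) by simp
  show "0 <= ?b x powr p / p + (\<Sum>(f, g)\<leftarrow>[(%x. 1 / q, %x. \<bar>f x\<bar> powr q), (%x. - ?b x, %x. \<bar>f x\<bar>)]. f x * g y)" for x y
   using Youngs_inequality[OF assms(4) p(1) p(2), of "\<bar>f y\<bar>" "?b x"] by (simp add: mult.commute)
 qed
 moreover have "AE x in M. 0 <= R \<alpha> (%x. \<bar>f x\<bar>) x" by (rule R_nonneg[OF assms(1) a]) simp
 ultimately show ?thesis using R_abs[OF assms(1,2)]
 proof eventually_elim
  case (elim x)
  define r where "r = R \<alpha> (%x. \<bar>f x\<bar>) x"
  have r: "0 <= r" "\<bar>R \<alpha> f x\<bar> <= r" using elim by (auto simp: r_def)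
  have "(q - 1) * p = q" using assms(4) by (simp add: p_def)
  hence e1: "(r powr (q - 1)) powr p = r powr q" by (simp add: powr_powr)
  have e2: "r powr (q - 1) * r = r powr q" using r(1) assms(4) powr_add[of r "q - 1" 1] by (cases "r = 0") auto
  have "0 <= r powr q / p + (1 / q * R \<alpha> (%x. \<bar>f x\<bar> powr q) x - r powr (q - 1) * r)"
   using elim(1) r(1) e1 by (simp add: r_def[symmetric])
  hence "(1 - 1 / p) * r powr q <= 1 / q * R \<alpha> (%x. \<bar>f x\<bar> powr q) x" unfolding e2 by (simp add: algebra_simps)
  moreover have "1 - 1 / p = 1 / q" using p(2) by linarith
  ultimately have "r powr q <= R \<alpha> (%x. \<bar>f x\<bar> powr q) x" using assms(4) by (simp add: field_simps)
  moreover have "\<bar>R \<alpha> f x\<bar> powr q <= r powr q" using r assms(4) by (intro powr_mono2) auto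
  ultimately show ?case by linarith
 qed
qed

lemma R_pow_L2: "0 < \<alpha> ==> f : L2 M ==> (R \<alpha> ^^ k) f : L2 M"
 by (induction k) (auto intro: R_L2)

lemma R_pow_lin:
 assumes "0 < \<alpha>" "f : L2 M" "g : L2 M"
 shows "AE x in M. (R \<alpha> ^^ k) (%x. a * f x + b * g x) x = a * (R \<alpha> ^^ k) f x + b * (R \<alpha> ^^ k) g x"
proof (induction k)
 case (Suc k)
 note m = R_pow_L2[OF assms(1,2), of k] R_pow_L2[OF assms(1,3), of k]
 have "AE x in M. R \<alpha> ((R \<alpha> ^^ k) (%x. a * f x + b * g x)) x = R \<alpha> (%x. a * (R \<alpha> ^^ k) f x + b * (R \<alpha> ^^ k) g x) x"
  by (rule R_cong[OF assms(1) R_pow_L2[OF assms(1) L2_lin[OF assms(2,3)]] L2_lin[OF m] Suc.IH])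
 thus ?case using R_lin[OF assms(1) m, of a b] by eventually_elim simp
qed simp

lemma R_pow_N1: "0 < \<alpha> ==> f : L2 M ==> N1 ((R \<alpha> ^^ k) f) <= N1 f"
proof (induction k)
 case (Suc k) thus ?case using R_N1[OF _ R_pow_L2, of \<alpha> \<alpha> f k] by simp
qed simp

lemma R_pow_N2: "0 < \<alpha> ==> f : L2 M ==> N2 ((R \<alpha> ^^ k) f) <= N2 f"
proof (induction k)
 case (Suc k)
 have "N2 (R \<alpha> ((R \<alpha> ^^ k) f)) <= N2 ((R \<alpha> ^^ k) f)" by (rule R_contraction[OF Suc.prems(1) R_pow_L2[OF Suc.prems]])
 thus ?case using Suc by simp
qed simp

lemma R_pow_diff:
 assumes "0 < \<alpha>" "f : L2 M" "g : L2 M"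
 shows "AE x in M. (R \<alpha> ^^ k) f x - (R \<alpha> ^^ k) g x = (R \<alpha> ^^ k) (%x. f x - g x) x"
 using R_pow_lin[OF assms, of k 1 "-1"] by eventually_elim simp

lemma R_pow_N1_diff:
 assumes "0 < \<alpha>" "f : L2 M" "g : L2 M"
 shows "N1 (%x. (R \<alpha> ^^ k) f x - (R \<alpha> ^^ k) g x) <= N1 (%x. f x - g x)"
proof -
 have "N1 (%x. (R \<alpha> ^^ k) f x - (R \<alpha> ^^ k) g x) = N1 ((R \<alpha> ^^ k) (%x. f x - g x))"
  using R_pow_diff[OF assms, of k] R_pow_L2[OF assms(1)] assms L2.diff_mem[OF assms(2,3)]
  by (intro integral_cong_AE borel_measurable_abs borel_measurable_diff L2_measurable) auto
 thus ?thesis using R_pow_N1[OF assms(1) L2.diff_mem[OF assms(2,3)]] by simp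
qed

lemma R_pow_N2_diff:
 assumes "0 < \<alpha>" "f : L2 M" "g : L2 M"
 shows "N2 (%x. (R \<alpha> ^^ k) f x - (R \<alpha> ^^ k) g x) <= N2 (%x. f x - g x)"
proof -
 note d = L2.diff_mem[OF R_pow_L2[OF assms(1,2)] R_pow_L2[OF assms(1,3)]]
 have "N2 (%x. (R \<alpha> ^^ k) f x - (R \<alpha> ^^ k) g x) = N2 ((R \<alpha> ^^ k) (%x. f x - g x))"
  by (intro arg_cong[of _ _ sqrt] L2_inner_cong_AE R_pow_diff[OF assms] L2_measurable d R_pow_L2 L2.diff_mem assms)
 thus ?thesis using R_pow_N2[OF assms(1) L2.diff_mem[OF assms(2,3)]] by simp
qed

lemma R_pow_nonneg:
 assumes "0 < \<alpha>" "f : L2 M" "AE x in M. 0 <= f x"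
 shows "AE x in M. 0 <= (R \<alpha> ^^ k) f x"
proof (induction k)
 case (Suc k) thus ?case using R_nonneg[OF assms(1) R_pow_L2[OF assms(1,2)]] by simp
qed (use assms in simp)

lemma R_pow_bounded:
 assumes "0 < \<alpha>" "f : L2 M" "AE x in M. \<bar>f x\<bar> <= c" "0 <= c"
 shows "AE x in M. \<bar>(R \<alpha> ^^ k) f x\<bar> <= c"
proof (induction k)
 case (Suc k)
 note m = R_pow_L2[OF assms(1,2), of k]
 have "AE x in M. (R \<alpha> ^^ k) f x <= c" "AE x in M. - c <= (R \<alpha> ^^ k) f x"
  using Suc.IH by (eventually_elim, simp)+
 hence "AE x in M. R \<alpha> ((R \<alpha> ^^ k) f) x <= c" "AE x in M. - c <= R \<alpha> ((R \<alpha> ^^ k) f) x"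
  using R_le[OF assms(1) m assms(4)] R_ge[OF assms(1) m, of "- c"] assms(4) by auto
 thus ?case by (simp, eventually_elim) auto
qed (use assms in simp)

lemma R_pow_powr:
 assumes "0 < \<alpha>" "f : L2 M" "AE x in M. \<bar>f x\<bar> <= c" "0 <= c" "1 < q"
 shows "integrable M (%x. \<bar>(R \<alpha> ^^ k) f x\<bar> powr q)"
  and "(LINT x|M. \<bar>(R \<alpha> ^^ k) f x\<bar> powr q) <= (LINT x|M. \<bar>f x\<bar> powr q)"
proof -
 have L: "(%x. \<bar>(R \<alpha> ^^ k) f x\<bar> powr q) : L2 M" for k
 proof (rule bounded_L2[of _ "c powr q"])
  show "(%x. \<bar>(R \<alpha> ^^ k) f x\<bar> powr q) : borel_measurable M" using R_pow_L2[OF assms(1,2), of k] by measurable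
  show "AE x in M. \<bar>\<bar>(R \<alpha> ^^ k) f x\<bar> powr q\<bar> <= c powr q"
   using R_pow_bounded[OF assms(1-4), of k] by eventually_elim (use assms(5) in \<open>auto intro: powr_mono2\<close>)
 qed
 thus "integrable M (%x. \<bar>(R \<alpha> ^^ k) f x\<bar> powr q)" by (rule L2_integrable)
 show "(LINT x|M. \<bar>(R \<alpha> ^^ k) f x\<bar> powr q) <= (LINT x|M. \<bar>f x\<bar> powr q)"
 proof (induction k)
  case (Suc k)
  have "(LINT x|M. \<bar>(R \<alpha> ^^ Suc k) f x\<bar> powr q) <= (LINT x|M. R \<alpha> (%x. \<bar>(R \<alpha> ^^ k) f x\<bar> powr q) x)"
   using R_powr[OF assms(1) R_pow_L2[OF assms(1,2)] L assms(5), of k] L[of "Suc k"]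
   by (intro integral_mono_AE L2_integrable R_L2 assms L) simp_all
  also have "... <= (LINT x|M. \<bar>(R \<alpha> ^^ k) f x\<bar> powr q)" by (rule R_L1(2)[OF assms(1) L L2_integrable[OF L]]) simp
  finally show ?case using Suc by simp
 qed simp
qed

abbreviation Hop :: "('a => real) => ('a => real) => bool" where "Hop \<equiv> form_operator D"

lemma HopD: assumes "Hop f h" shows "f : F" "f : L2 M" "h : L2 M" "!!v. v : F ==> E f v = ip h v"
 using assms dom_L2 by (auto simp: form_operator_def Lp_2)

lemma Hop_lin: "Hop f h ==> Hop g k ==> Hop (%x. a * f x + b * g x) (%x. a * h x + b * k x)"
 unfolding form_operator_def Lp_2 by (auto simp: E.lin_mem L2_lin E.lin_left L2.lin_left dom_L2)

lemma Hop_R: "0 < \<alpha> ==> g : L2 M ==> Hop (R \<alpha> g) (%x. \<alpha> * (g x - R \<alpha> g x))"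
 unfolding form_operator_def Lp_2
 by (auto simp: R_mem R_eq L2.scale_mem L2.diff_mem R_L2 L2.scale_left L2.diff_left dom_L2)

text \<open>The resolvent commutes with the operator, and one step changes \<open>f\<close> by
  \<open>R \<alpha> h / \<alpha>\<close>. All error estimates of the Euler scheme are derived from
  these two facts.\<close>

lemma R_of_Hop:
 assumes a: "0 < \<alpha>" and H: "Hop f h"
 shows "AE x in M. R \<alpha> f x = f x - R \<alpha> h x / \<alpha>" "Hop (R \<alpha> f) (R \<alpha> h)"
proof -
 note D = HopD[OF H]
 let ?u = "%x. 1 * f x + (- 1 / \<alpha>) * R \<alpha> h x"
 have r: "R \<alpha> h : F" by (rule R_mem[OF a D(3)])
 have u: "?u : F" by (rule E.lin_mem[OF D(1) r])
 have "AE x in M. ?u x = R \<alpha> f x"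
 proof (rule R_unique[OF a D(2) u])
  fix v assume v: "v : F"
  show "E ?u v = \<alpha> * (ip f v - ip ?u v)"
   unfolding E.lin_left[OF D(1) r v] L2.lin_left[OF D(2) dom_L2[OF r] dom_L2[OF v]] R_eq[OF a D(3) v] D(4)[OF v]
   using a by (simp add: field_simps)
 qed
 thus ae: "AE x in M. R \<alpha> f x = f x - R \<alpha> h x / \<alpha>" by eventually_elim simp
 note H' = Hop_R[OF a D(2)]
 have "AE x in M. \<alpha> * (f x - R \<alpha> f x) = R \<alpha> h x" using ae by eventually_elim (use a in simp)
 hence "ip (%x. \<alpha> * (f x - R \<alpha> f x)) v = ip (R \<alpha> h) v" if "v : F" for v
  using HopD(3)[OF H'] that r by (intro L2_inner_cong_AE) (auto intro: dom_measurable L2_measurable)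
 thus "Hop (R \<alpha> f) (R \<alpha> h)" using H' dom_L2[OF r] by (simp add: form_operator_def Lp_2)
qed

lemma R_Hop_N2:
 assumes a: "0 < \<alpha>" and H: "Hop f h"
 shows "N2 (%x. R \<alpha> f x - f x) <= N2 h / \<alpha>"
proof -
 note D = HopD[OF H]
 have "N2 (%x. R \<alpha> f x - f x) = N2 (%x. (- 1 / \<alpha>) * R \<alpha> h x)"
  by (intro arg_cong[of _ _ sqrt] L2_inner_cong_AE L2_measurable L2.diff_mem L2.scale_mem R_L2 a D)
   (use R_of_Hop(1)[OF a H] in \<open>eventually_elim, simp\<close>)+
 also have "... = 1 / \<alpha> * N2 (R \<alpha> h)" using L2.nrm_scale[OF R_L2[OF a D(3)], of "- 1 / \<alpha>"] a by simp
 also have "... <= 1 / \<alpha> * N2 h" using R_contraction[OF a D(3)] a by (intro mult_left_mono) auto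
 finally show ?thesis by simp
qed

lemma R_pow_Hop: "0 < \<alpha> ==> Hop f h ==> Hop ((R \<alpha> ^^ k) f) ((R \<alpha> ^^ k) h)"
 by (induction k) (auto intro: R_of_Hop(2))

lemma R_pow_Hop_N2:
 assumes a: "0 < \<alpha>" and H: "Hop f h"
 shows "N2 (%x. (R \<alpha> ^^ k) f x - f x) <= real k * (N2 h / \<alpha>)"
proof (induction k)
 case 0 thus ?case by (simp add: L2_inner_def)
next
 case (Suc k)
 note D = HopD[OF H] and D' = HopD[OF R_pow_Hop[OF a H, of k]] and D'' = HopD[OF R_pow_Hop[OF a H, of "Suc k"]]
 have "N2 (%x. (R \<alpha> ^^ Suc k) f x - f x) <= N2 (%x. (R \<alpha> ^^ Suc k) f x - (R \<alpha> ^^ k) f x) + N2 (%x. (R \<alpha> ^^ k) f x - f x)"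
  by (rule L2.nrm_triangle[OF D''(2) D'(2) D(2)])
 also have "N2 (%x. (R \<alpha> ^^ Suc k) f x - (R \<alpha> ^^ k) f x) <= N2 ((R \<alpha> ^^ k) h) / \<alpha>"
  using R_Hop_N2[OF a R_pow_Hop[OF a H, of k]] by simp
 also have "... <= N2 h / \<alpha>" using R_pow_N2[OF a D(3)] a by (intro divide_right_mono) auto
 finally show ?case using Suc by (simp add: algebra_simps add_divide_distrib)
qed

text \<open>First order Taylor expansion at time \<open>m / \<alpha>\<close> with a quadratic
  remainder; its consequence in the limit, \<open>sg_Hop2_N2\<close>, identifies the
  generator.\<close>

lemma R_pow_Hop2_N2:
 assumes a: "0 < \<alpha>" and H: "Hop f h" "Hop h k"
 shows "N2 (%x. (R \<alpha> ^^ m) f x - f x + (real m / \<alpha>) * h x) <= (real m / \<alpha>)\<^sup>2 * N2 k"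
proof (induction m)
 case 0 thus ?case by (simp add: L2_inner_def)
next
 case (Suc m)
 note D = HopD[OF H(1)] HopD[OF H(2)]
 note Dm = HopD[OF R_pow_Hop[OF a H(1), of m]]
 let ?a = "%x. (R \<alpha> ^^ m) f x - f x + (real m / \<alpha>) * h x" and ?b = "%x. (1 / \<alpha>) * ((R \<alpha> ^^ Suc m) h x - h x)"
 have m: "?a : L2 M" "(%x. (R \<alpha> ^^ Suc m) h x - h x) : L2 M" "?b : L2 M"
  by (intro L2.add_mem L2.diff_mem L2.scale_mem R_pow_L2 a D)+
 have "AE x in M. (R \<alpha> ^^ Suc m) f x - f x + (real (Suc m) / \<alpha>) * h x = ?a x - ?b x"
  using R_of_Hop(1)[OF a R_pow_Hop[OF a H(1), of m]] by eventually_elim (simp add: add_divide_distrib algebra_simps diff_divide_distrib)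
 hence "N2 (%x. (R \<alpha> ^^ Suc m) f x - f x + (real (Suc m) / \<alpha>) * h x) = N2 (%x. ?a x - ?b x)"
  by (intro arg_cong[of _ _ sqrt] L2_inner_cong_AE L2_measurable L2.add_mem L2.diff_mem L2.scale_mem R_pow_L2 a D m)
 also have "... <= N2 ?a + N2 ?b" by (rule L2.nrm_diff[OF m(1,3)])
 also have "N2 ?b = 1 / \<alpha> * N2 (%x. (R \<alpha> ^^ Suc m) h x - h x)" using L2.nrm_scale[OF m(2), of "1 / \<alpha>"] a by simp
 also have "... <= 1 / \<alpha> * (real (Suc m) * (N2 k / \<alpha>))"
  using R_pow_Hop_N2[OF a H(2), of "Suc m"] a by (intro mult_left_mono) auto
 also have "N2 ?a + 1 / \<alpha> * (real (Suc m) * (N2 k / \<alpha>)) <= (real m / \<alpha>)\<^sup>2 * N2 k + 1 / \<alpha> * (real (Suc m) * (N2 k / \<alpha>))"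
  using Suc.IH by simp
 \<comment> \<open>The remainder closes up because \<open>m^2 + m + 1\<close> is at most the square
   of \<open>m + 1\<close>.\<close>
 also have "... = ((real m)\<^sup>2 + real (Suc m)) / \<alpha>\<^sup>2 * N2 k" by (simp add: power_divide add_divide_distrib power2_eq_square algebra_simps)
 also have "... <= (real (Suc m))\<^sup>2 / \<alpha>\<^sup>2 * N2 k"
  using L2.nrm_nonneg[OF D(7)] by (intro mult_right_mono divide_right_mono) (auto simp: power2_eq_square algebra_simps)
 finally show ?case by (simp add: power_divide)
qed

text \<open>\<open>R \<alpha>\<close> is a backward Euler step of length \<open>1 / \<alpha>\<close>.\<close>

lemma R_double:
 assumes a: "0 < \<alpha>" and H: "Hop f h" "Hop h k"
 shows "N2 (%x. R \<alpha> f x - (R (2 * \<alpha>) ^^ 2) f x) <= 2 / \<alpha>\<^sup>2 * N2 k"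
proof -
 note D = HopD[OF H(1)] HopD[OF H(2)]
 define \<beta> where "\<beta> = 2 * \<alpha>"
 have b: "0 < \<beta>" using a by (simp add: \<beta>_def)
 let ?A = "R \<alpha>" and ?B = "R \<beta>"
 note Ak = R_L2[OF a D(7)] and Bk = R_L2[OF b D(7)] and BBk = R_L2[OF b R_L2[OF b D(7)]]
 have B1: "AE x in M. ?B f x = f x - ?B h x / \<beta>" "AE x in M. ?B h x = h x - ?B k x / \<beta>"
  using R_of_Hop(1)[OF b] H by auto
 have B2: "AE x in M. ?B (?B f) x = ?B f x - ?B (?B h) x / \<beta>" "AE x in M. ?B (?B h) x = ?B h x - ?B (?B k) x / \<beta>"
  using R_of_Hop(1)[OF b] R_of_Hop(2)[OF b] H by blast+
 have A: "AE x in M. ?A f x = f x - ?A h x / \<alpha>" "AE x in M. ?A h x = h x - ?A k x / \<alpha>"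
  using R_of_Hop(1)[OF a] H by auto
 let ?v = "%x. (1 / \<alpha>\<^sup>2) * ?A k x - ((2 / \<beta>\<^sup>2) * ?B k x + (1 / \<beta>\<^sup>2) * ?B (?B k) x)"
 have "AE x in M. ?A f x - ?B (?B f) x = ?v x" using B1 B2 A
 proof eventually_elim
  case (elim x)
  have "?A f x = f x - h x / \<alpha> + ?A k x / \<alpha>\<^sup>2"
   using elim(5,6) a by (simp add: field_simps power2_eq_square)
  moreover have "?B (?B f) x = f x - 2 * h x / \<beta> + 2 * ?B k x / \<beta>\<^sup>2 + ?B (?B k) x / \<beta>\<^sup>2"
   using elim(1-4) b by (simp add: field_simps power2_eq_square)
  moreover have "2 * h x / \<beta> = h x / \<alpha>" by (simp add: \<beta>_def)
  ultimately show ?case by simp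
 qed
 hence "N2 (%x. ?A f x - ?B (?B f) x) = N2 ?v"
  by (intro arg_cong[of _ _ sqrt] L2_inner_cong_AE L2_measurable L2.add_mem L2.diff_mem L2.scale_mem R_L2 a b D)
 also have "... <= N2 (%x. (1 / \<alpha>\<^sup>2) * ?A k x) + (N2 (%x. (2 / \<beta>\<^sup>2) * ?B k x) + N2 (%x. (1 / \<beta>\<^sup>2) * ?B (?B k) x))"
  by (rule order_trans[OF L2.nrm_diff add_left_mono[OF L2.nrm_add]]) (intro L2.add_mem L2.scale_mem Ak Bk BBk)+
 also have "... = 1 / \<alpha>\<^sup>2 * N2 (?A k) + (2 / \<beta>\<^sup>2 * N2 (?B k) + 1 / \<beta>\<^sup>2 * N2 (?B (?B k)))"
  unfolding L2.nrm_scale[OF Ak] L2.nrm_scale[OF Bk] L2.nrm_scale[OF BBk] by simp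
 also have "... <= 1 / \<alpha>\<^sup>2 * N2 k + (2 / \<beta>\<^sup>2 * N2 k + 1 / \<beta>\<^sup>2 * N2 k)"
  using R_contraction[OF a D(7)] R_contraction[OF b D(7)] R_contraction[OF b R_L2[OF b D(7)]]
  by (intro add_mono mult_left_mono) auto
 \<comment> \<open>With \<open>\<beta> = 2 * \<alpha>\<close> the three terms contribute
   \<open>1 + 2/4 + 1/4 = 7/4\<close>.\<close>
 also have "... = (7 / 4) / \<alpha>\<^sup>2 * N2 k" by (simp add: \<beta>_def power2_eq_square field_simps)
 also have "... <= 2 / \<alpha>\<^sup>2 * N2 k" using L2.nrm_nonneg[OF D(7)] by (intro mult_right_mono divide_right_mono) auto
 finally show ?thesis by (simp add: \<beta>_def numeral_2_eq_2)
qed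

text \<open>Contractivity propagates the error of one step without amplification, so the errors of
  \<open>m\<close> steps merely add. The induction hypothesis is applied after the first step, to
  vectors whose second image has no larger norm.\<close>

lemma R_pow_double:
 assumes a: "0 < \<alpha>" and H: "Hop f h" "Hop h k"
 shows "N2 (%x. (R \<alpha> ^^ m) f x - (R (2 * \<alpha>) ^^ (2 * m)) f x) <= real m * (2 / \<alpha>\<^sup>2 * N2 k)"
 using H
proof (induction m arbitrary: f h k)
 case 0 thus ?case by (simp add: L2_inner_def)
next
 case (Suc m)
 have b: "0 < 2 * \<alpha>" using a by simp
 note D = HopD[OF Suc.prems(1)] HopD[OF Suc.prems(2)]
 let ?C = "R (2 * \<alpha>) ^^ 2"
 note C = R_pow_Hop[OF b Suc.prems(1), of 2] R_pow_Hop[OF b Suc.prems(2), of 2]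
 note DC = HopD[OF C(1)]
 have eq: "(R \<alpha> ^^ Suc m) f = (R \<alpha> ^^ m) (R \<alpha> f)" "(R (2 * \<alpha>) ^^ (2 * Suc m)) f = (R (2 * \<alpha>) ^^ (2 * m)) (?C f)"
  by (simp_all add: funpow_swap1 funpow_add[of "2*m" 2 "R (2 * \<alpha>)", unfolded comp_def, THEN fun_cong, symmetric] add.commute)
 have "N2 (%x. (R \<alpha> ^^ Suc m) f x - (R (2 * \<alpha>) ^^ (2 * Suc m)) f x) <=
   N2 (%x. (R \<alpha> ^^ m) (R \<alpha> f) x - (R \<alpha> ^^ m) (?C f) x) + N2 (%x. (R \<alpha> ^^ m) (?C f) x - (R (2 * \<alpha>) ^^ (2 * m)) (?C f) x)"
  unfolding eq by (intro L2.nrm_triangle R_pow_L2 R_L2 a b D)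
 also have "N2 (%x. (R \<alpha> ^^ m) (R \<alpha> f) x - (R \<alpha> ^^ m) (?C f) x) <= N2 (%x. R \<alpha> f x - ?C f x)"
  by (intro R_pow_N2_diff R_L2 a D DC)
 also have "... <= 2 / \<alpha>\<^sup>2 * N2 k" by (rule R_double[OF a Suc.prems])
 also have "N2 (%x. (R \<alpha> ^^ m) (?C f) x - (R (2 * \<alpha>) ^^ (2 * m)) (?C f) x) <= real m * (2 / \<alpha>\<^sup>2 * N2 (?C k))"
  by (rule Suc.IH[OF C])
 also have "... <= real m * (2 / \<alpha>\<^sup>2 * N2 k)" by (intro mult_left_mono R_pow_N2 b D) auto
 finally show ?case by (simp add: algebra_simps add_divide_distrib)
qed

lemma Hop2_dense:
 assumes f: "f : L2 M" and e: "0 < e"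
 obtains d h k where "Hop d h" "Hop h k" "N2 (%x. d x - f x) < e"
proof -
 have "\<forall>\<^sub>F n in sequentially. N2 (%x. Rn n f x - f x) < e / 2"
  using e by (intro order_tendstoD(2)[OF Rn_L2_tendsto[OF f]]) simp
 hence "EX n. N2 (%x. Rn n f x - f x) < e / 2" by (rule eventually_happens'[OF sequentially_bot])
 then obtain n where n: "N2 (%x. Rn n f x - f x) < e / 2" ..
 have p: "0 < real (Suc n)" by simp
 note r = R_L2[OF p f]
 have "N2 (%x. Rn n (Rn n f) x - f x) <= N2 (%x. Rn n (Rn n f) x - Rn n f x) + N2 (%x. Rn n f x - f x)"
  by (rule L2.nrm_triangle[OF R_L2[OF p r] r f])
 moreover have "N2 (%x. Rn n (Rn n f) x - Rn n f x) <= N2 (%x. Rn n f x - f x)"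
  using R_pow_N2_diff[OF p r f, of 1] by simp
 ultimately have "N2 (%x. Rn n (Rn n f) x - f x) < e" using n by linarith
 moreover note R_of_Hop(2)[OF p Hop_R[OF p f]] Hop_R[OF p L2.scale_mem[OF L2.diff_mem[OF f r]]]
 ultimately show thesis using that by blast
qed

end

section \<open>Construction of the heat semigroup\<close>

context finite_markovian_form
begin

text \<open>Dyadic step lengths make passing to the next level a halving of each step. Rounding down
  costs at most one additional step, both there (\<open>steps_Suc\<close>) and when times are added
  (\<open>steps_add\<close>).\<close>

definition steps :: "nat => real => nat" where "steps n t = nat \<lfloor>t * 2 ^ n\<rfloor>"

definition euler :: "nat => real => ('a => real) => 'a => real" where
 "euler n t f = (R (2 ^ n) ^^ steps n t) f"

lemma p2: "(0::real) < 2 ^ n" by simp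

lemmas euler_L2 = R_pow_L2[where \<alpha> = "2 ^ n" and k = "steps n t" for n t, OF p2, folded euler_def]
 and euler_lin = R_pow_lin[where \<alpha> = "2 ^ n" and k = "steps n t" for n t, OF p2, folded euler_def]
 and euler_N1_diff = R_pow_N1_diff[where \<alpha> = "2 ^ n" and k = "steps n t" for n t, OF p2, folded euler_def]
 and euler_nonneg = R_pow_nonneg[where \<alpha> = "2 ^ n" and k = "steps n t" for n t, OF p2, folded euler_def]
 and euler_bounded = R_pow_bounded[where \<alpha> = "2 ^ n" and k = "steps n t" for n t, OF p2, folded euler_def]
 and euler_powr = R_pow_powr[where \<alpha> = "2 ^ n" and k = "steps n t" for n t, OF p2, folded euler_def]
 and euler_Hop_N2 = R_pow_Hop_N2[where \<alpha> = "2 ^ n" and k = "steps n t" for n t, OF p2, folded euler_def]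
 and euler_Hop2_N2 = R_pow_Hop2_N2[where \<alpha> = "2 ^ n" and m = "steps n t" for n t, OF p2, folded euler_def]

lemma steps_bounds:
 assumes "0 <= t" shows "real (steps n t) <= t * 2 ^ n" "t * 2 ^ n < real (steps n t) + 1"
proof -
 have "0 <= \<lfloor>t * 2 ^ n\<rfloor>" using assms by simp
 hence "real (steps n t) = of_int \<lfloor>t * 2 ^ n\<rfloor>" by (simp add: steps_def)
 thus "real (steps n t) <= t * 2 ^ n" "t * 2 ^ n < real (steps n t) + 1" by linarith+
qed

lemma steps_Suc:
 assumes "0 <= t" shows "steps (Suc n) t = 2 * steps n t | steps (Suc n) t = Suc (2 * steps n t)"
proof -
 have "real (steps (Suc n) t) < real (2 * steps n t + 2)" "real (2 * steps n t) < real (steps (Suc n) t + 1)"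
  using steps_bounds[OF assms, of n] steps_bounds[OF assms, of "Suc n"] by (simp_all add: mult.left_commute)
 thus ?thesis unfolding of_nat_less_iff by linarith
qed

lemma steps_add:
 assumes "0 <= s" "0 <= t"
 shows "steps n (s + t) = steps n s + steps n t | steps n (s + t) = Suc (steps n s + steps n t)"
proof -
 have "real (steps n (s + t)) < real (steps n s + steps n t + 2)" "real (steps n s + steps n t) < real (steps n (s + t) + 1)"
  using steps_bounds[OF assms(1), of n] steps_bounds[OF assms(2), of n] steps_bounds[of "s + t" n] assms by (simp_all add: distrib_right)
 thus ?thesis unfolding of_nat_less_iff by linarith
qed

text \<open>The first term is \<open>R_pow_double\<close> with about \<open>t * 2 ^ n\<close> steps
  of length \<open>1 / 2 ^ n\<close>; the term \<open>N2 h\<close> pays for the possible extra step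
  from rounding.\<close>

lemma euler_step:
 assumes t: "0 <= t" and H: "Hop f h" "Hop h k"
 shows "N2 (%x. euler (Suc n) t f x - euler n t f x) <= (2 * t * N2 k + N2 h) * (1 / 2) ^ n"
proof -
 note D = HopD[OF H(1)] HopD[OF H(2)]
 let ?m = "steps n t" and ?B = "R (2 ^ Suc n)"
 have d: "N2 (%x. (?B ^^ (2 * ?m)) f x - (R (2 ^ n) ^^ ?m) f x) <= 2 * t * N2 k * (1 / 2) ^ n"
 proof -
  have "N2 (%x. (?B ^^ (2 * ?m)) f x - (R (2 ^ n) ^^ ?m) f x) <= real ?m * (2 / (2 ^ n)\<^sup>2 * N2 k)"
   using R_pow_double[OF p2[of n] H, of ?m] L2.nrm_diff_commute[OF R_pow_L2[OF p2[of n] D(2), of ?m] R_pow_L2[OF p2[of "Suc n"] D(2), of "2 * ?m"]] by simp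
  also have "... <= (t * 2 ^ n) * (2 / (2 ^ n)\<^sup>2 * N2 k)"
   using steps_bounds(1)[OF t] L2.nrm_nonneg[OF D(7)] by (intro mult_right_mono) auto
  also have "... = 2 * t * N2 k * (1 / 2) ^ n" by (simp add: power2_eq_square power_divide)
  finally show ?thesis .
 qed
 have "N2 (%x. (?B ^^ j) f x - (?B ^^ (2 * ?m)) f x) <= N2 h * (1 / 2) ^ n"
  if j: "j = 2 * ?m | j = Suc (2 * ?m)" for j
  using j
 proof
  assume "j = 2 * ?m"
  thus ?thesis using L2.nrm_nonneg[OF D(3)] by (simp add: L2_inner_def)
 next
  assume j: "j = Suc (2 * ?m)"
  have "N2 (%x. ?B ((?B ^^ (2 * ?m)) f) x - (?B ^^ (2 * ?m)) f x) <= N2 ((?B ^^ (2 * ?m)) h) / 2 ^ Suc n"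
   by (rule R_Hop_N2[OF p2 R_pow_Hop[OF p2 H(1)]])
  also have "... <= N2 h / 2 ^ Suc n" by (intro divide_right_mono R_pow_N2 p2 D) simp
  also have "... <= N2 h / 2 ^ n" using L2.nrm_nonneg[OF D(3)] by (intro divide_left_mono) auto
  finally show ?thesis unfolding j by (simp add: power_divide)
 qed
 hence e: "N2 (%x. euler (Suc n) t f x - (?B ^^ (2 * ?m)) f x) <= N2 h * (1 / 2) ^ n"
  using steps_Suc[OF t] unfolding euler_def by blast
 have "N2 (%x. euler (Suc n) t f x - euler n t f x) <=
   N2 (%x. euler (Suc n) t f x - (?B ^^ (2 * ?m)) f x) + N2 (%x. (?B ^^ (2 * ?m)) f x - (R (2 ^ n) ^^ ?m) f x)"
  unfolding euler_def by (intro L2.nrm_triangle R_pow_L2 p2 D)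
 thus ?thesis using d e by (simp add: algebra_simps)
qed

text \<open>The increments of \<open>euler_step\<close> sum geometrically. The estimate is in
  \<open>L^2\<close>; finiteness of the measure turns it into one in mean.\<close>

lemma euler_Cauchy:
 assumes t: "0 <= t" and H: "Hop f h" "Hop h k" and e: "0 < e"
 shows "EX N. ALL i>=N. ALL j>=N. N1 (%x. euler i t f x - euler j t f x) < e"
proof -
 note D = HopD[OF H(1)] HopD[OF H(2)]
 define C where "C = 2 * t * N2 k + N2 h"
 have C: "0 <= C" using t L2.nrm_nonneg[OF D(3)] L2.nrm_nonneg[OF D(7)] by (simp add: C_def)
 have dist: "N2 (%x. euler (n + p) t f x - euler n t f x) <= 2 * C * (1 / 2) ^ n - 2 * C * (1 / 2) ^ (n + p)" for n p
 proof (induction p)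
  case 0 thus ?case by (simp add: L2_inner_def)
 next
  case (Suc p)
  have "N2 (%x. euler (n + Suc p) t f x - euler n t f x) <=
    N2 (%x. euler (Suc (n + p)) t f x - euler (n + p) t f x) + N2 (%x. euler (n + p) t f x - euler n t f x)"
   unfolding add_Suc_right by (intro L2.nrm_triangle euler_L2 D)
  thus ?case using Suc euler_step[OF t H, of "n + p", folded C_def] by simp
 qed
 have "(%n. vol * (4 * C * (1 / 2) ^ n)) ----> vol * (4 * C * 0)"
  by (intro tendsto_intros LIMSEQ_power_zero) simp
 hence "\<forall>\<^sub>F n in sequentially. vol * (4 * C * (1 / 2) ^ n) < e" using e by (intro order_tendstoD(2)) auto
 hence "EX N. vol * (4 * C * (1 / 2) ^ N) < e" by (rule eventually_happens'[OF sequentially_bot])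
 then obtain N where N: "vol * (4 * C * (1 / 2) ^ N) < e" ..
 have le: "N2 (%x. euler i t f x - euler N t f x) <= 2 * C * (1 / 2) ^ N" if "i >= N" for i
 proof -
  have "N2 (%x. euler (N + (i - N)) t f x - euler N t f x) <= 2 * C * (1 / 2) ^ N - 2 * C * (1 / 2) ^ (N + (i - N))" by (rule dist)
  moreover have "0 <= 2 * C * (1 / 2) ^ (N + (i - N))" using C by simp
  ultimately have "N2 (%x. euler (N + (i - N)) t f x - euler N t f x) <= 2 * C * (1 / 2) ^ N" by linarith
  thus ?thesis using that by simp
 qed
 have "N1 (%x. euler i t f x - euler j t f x) < e" if "i >= N" "j >= N" for i j
 proof -
  note eu = euler_L2[OF D(2)]
  have "N2 (%x. euler i t f x - euler j t f x) <= N2 (%x. euler i t f x - euler N t f x) + N2 (%x. euler N t f x - euler j t f x)"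
   by (rule L2.nrm_triangle[OF eu eu eu])
  also have "... <= 4 * C * (1 / 2) ^ N" using le[OF that(1)] le[OF that(2)] L2.nrm_diff_commute[OF eu eu, of N t j t] by simp
  finally have "vol * N2 (%x. euler i t f x - euler j t f x) <= vol * (4 * C * (1 / 2) ^ N)" using vol_nonneg by (rule mult_left_mono)
  thus ?thesis using N N1_le_N2[OF L2.diff_mem[OF eu eu], of i t j t] by linarith
 qed
 thus ?thesis by blast
qed

lemma Hop2_dense_L1:
 assumes f: "integrable M f" and e: "0 < e"
 obtains d h k where "Hop d h" "Hop h k" "N1 (%x. d x - f x) < e"
proof -
 have fm: "f : borel_measurable M" using f by simp
 have "\<forall>\<^sub>F n in sequentially. N1 (%x. truncate n f x - f x) < e / 2"
  using e by (intro order_tendstoD(2)[OF truncate_tendsto_L1[OF f]]) simp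
 hence "EX n. N1 (%x. truncate n f x - f x) < e / 2" by (rule eventually_happens'[OF sequentially_bot])
 then obtain n where n: "N1 (%x. truncate n f x - f x) < e / 2" ..
 note c = truncate_L2[OF fm, of n]
 have "0 < e / (2 * (vol + 1))" using e vol_nonneg by simp
 then obtain d h k where d: "Hop d h" "Hop h k" "N2 (%x. d x - truncate n f x) < e / (2 * (vol + 1))"
  by (rule Hop2_dense[OF c])
 note D = HopD[OF d(1)]
 have "N1 (%x. d x - truncate n f x) <= vol * N2 (%x. d x - truncate n f x)" by (rule N1_le_N2[OF L2.diff_mem[OF D(2) c]])
 also have "... <= vol * (e / (2 * (vol + 1)))" using d(3) vol_nonneg by (intro mult_left_mono) auto
 also have "... <= e / 2" using vol_nonneg e by (simp add: field_simps)
 finally have "N1 (%x. d x - f x) < e"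
  using n L1_nrm_triangle[OF L2_integrable[OF D(2)] L2_integrable[OF c] f] by linarith
 thus thesis using that d by blast
qed

text \<open>The limit is only required to be integrable, while the approximants must be in
  \<open>L^2\<close>, where the resolvent is available. On a finite measure space this one notion of
  limit covers all \<open>L^q\<close> at once.\<close>

definition approximates :: "(nat => 'a => real) => ('a => real) => bool" where
 "approximates g f \<longleftrightarrow> (ALL n. g n : L2 M) & integrable M f & (%n. N1 (%x. g n x - f x)) ----> 0"

lemma approximatesD:
 assumes "approximates g f"
 shows "!!n. g n : L2 M" "!!n. integrable M (g n)" "integrable M f" "(%n. N1 (%x. g n x - f x)) ----> 0"
 using assms L2_integrable by (auto simp: approximates_def)

lemma approximates_const: "f : L2 M ==> approximates (%n. f) f"
 using L2_integrable by (simp add: approximates_def)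

lemma approximates_truncate: "integrable M f ==> approximates (%n. truncate n f) f"
 using truncate_tendsto_L1 truncate_L2 by (simp add: approximates_def)

lemma approximates_lin:
 assumes "approximates g f" "approximates g' f'"
 shows "approximates (%n x. a * g n x + b * g' n x) (%x. a * f x + b * f' x)"
 unfolding approximates_def
proof (intro conjI allI)
 note A = approximatesD[OF assms(1)] and B = approximatesD[OF assms(2)]
 show "(%x. a * g n x + b * g' n x) : L2 M" for n by (rule L2_lin[OF A(1) B(1)])
 show "integrable M (%x. a * f x + b * f' x)" using A B by simp
 have l: "(%n. \<bar>a\<bar> * N1 (%x. g n x - f x) + \<bar>b\<bar> * N1 (%x. g' n x - f' x)) ----> 0"
  using tendsto_add[OF tendsto_mult_left[OF A(4), of "\<bar>a\<bar>"] tendsto_mult_left[OF B(4), of "\<bar>b\<bar>"]] by simp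
 show "(%n. N1 (%x. a * g n x + b * g' n x - (a * f x + b * f' x))) ----> 0"
 proof (rule Lim_null_comparison[OF always_eventually l], rule allI)
  fix n
  have eq: "a * g n x + b * g' n x - (a * f x + b * f' x) = a * (g n x - f x) + b * (g' n x - f' x)" for x
   by (simp add: algebra_simps)
  have "N1 (%x. a * (g n x - f x) + b * (g' n x - f' x)) <= \<bar>a\<bar> * N1 (%x. g n x - f x) + \<bar>b\<bar> * N1 (%x. g' n x - f' x)"
   by (rule L1_nrm_lin) (use A(2)[of n] A(3) B(2)[of n] B(3) in simp_all)
  thus "norm (N1 (%x. a * g n x + b * g' n x - (a * f x + b * f' x))) <= \<bar>a\<bar> * N1 (%x. g n x - f x) + \<bar>b\<bar> * N1 (%x. g' n x - f' x)"
   unfolding eq by (subst real_norm_def, subst abs_of_nonneg) (assumption | rule integral_nonneg_AE AE_I2 abs_ge_zero)+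
 qed
qed

lemma approximates_trans:
 assumes g: "approximates g f" and g': "!!n. g' n : L2 M" and l: "(%n. N1 (%x. g' n x - g n x)) ----> 0"
 shows "approximates g' f"
 unfolding approximates_def
proof (intro conjI allI g' approximatesD(3)[OF g])
 note A = approximatesD[OF g]
 have l2: "(%n. N1 (%x. g' n x - g n x) + N1 (%x. g n x - f x)) ----> 0" using tendsto_add[OF l A(4)] by simp
 show "(%n. N1 (%x. g' n x - f x)) ----> 0"
  by (rule Lim_null_comparison[OF always_eventually l2])
   (use L1_nrm_triangle[OF L2_integrable[OF g'] A(2) A(3)] in simp)
qed

lemma approximates_limit_unique:
 assumes "approximates g u" "approximates g v"
 shows "AE x in M. u x = v x"
proof -
 note A = approximatesD[OF assms(1)] and B = approximatesD[OF assms(2)]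
 have "(%n. N1 (%x. g n x - u x) + N1 (%x. g n x - v x)) ----> 0 + 0" by (intro tendsto_add A B)
 moreover have "N1 (%x. u x - v x) <= N1 (%x. g n x - u x) + N1 (%x. g n x - v x)" for n
  using L1_nrm_triangle[OF A(3) A(2) B(3), of n] by (simp add: abs_minus_commute)
 ultimately have "N1 (%x. u x - v x) <= 0" by (intro LIMSEQ_le_const) auto
 hence "AE x in M. u x - v x = 0" using A(3) B(3) by (intro L1_nrm_null) auto
 thus ?thesis by simp
qed

definition sg :: "real => ('a => real) => 'a => real" where
 "sg t f = (SOME u. approximates (%n. euler n t (truncate n f)) u)"

text \<open>Vectors on which the operator can be applied twice are dense in mean, and the scheme
  contracts in mean, so it converges along every approximating sequence and to the same limit. This
  freedom is what linearity and the semigroup law need; the five parts of \<open>e\<close> are two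
  for each replacement and one for the scheme.\<close>

lemma euler_approximates:
 assumes t: "0 <= t" and g: "approximates g f"
 shows "approximates (%n. euler n t (g n)) (sg t f)"
proof -
 have ex: "EX u. approximates (%n. euler n t (c n)) u" if c: "approximates c f" for c
 proof -
  note A = approximatesD[OF c]
  obtain u where "integrable M u" "(%n. N1 (%x. euler n t (c n) x - u x)) ----> 0"
  proof (rule L1_complete)
   show "integrable M (euler n t (c n))" for n by (rule L2_integrable[OF euler_L2[OF A(1)]])
   fix e :: real assume "0 < e"
   hence e4: "0 < e / 5" by simp
   obtain d h k where d: "Hop d h" "Hop h k" "N1 (%x. d x - f x) < e / 5" by (rule Hop2_dense_L1[OF A(3) e4])
   note D = HopD[OF d(1)]
   obtain N1' where N1': "ALL i>=N1'. ALL j>=N1'. N1 (%x. euler i t d x - euler j t d x) < e / 5" using euler_Cauchy[OF t d(1,2) e4] by blast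
   have "\<forall>\<^sub>F n in sequentially. N1 (%x. c n x - f x) < e / 5" using e4 by (intro order_tendstoD(2)[OF A(4)])
   then obtain N2' where N2': "ALL n>=N2'. N1 (%x. c n x - f x) < e / 5" unfolding eventually_sequentially by blast
   have cd: "N1 (%x. euler n t (c n) x - euler n t d x) < 2 * (e / 5)" if "n >= N2'" for n
   proof -
    have "N1 (%x. euler n t (c n) x - euler n t d x) <= N1 (%x. c n x - d x)" by (rule euler_N1_diff[OF A(1) D(2)])
    also have "... <= N1 (%x. c n x - f x) + N1 (%x. f x - d x)" by (rule L1_nrm_triangle[OF A(2,3) L2_integrable[OF D(2)]])
    also have "N1 (%x. f x - d x) = N1 (%x. d x - f x)" by (simp add: abs_minus_commute)
    finally show ?thesis using N2'[rule_format, OF that] d(3) by linarith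
   qed
   have "N1 (%x. euler i t (c i) x - euler j t (c j) x) < e" if "i >= max N1' N2'" "j >= max N1' N2'" for i j
   proof -
    note ii = L2_integrable[OF euler_L2[OF A(1)]] L2_integrable[OF euler_L2[OF D(2)]]
    have "N1 (%x. euler i t (c i) x - euler j t (c j) x) <=
     N1 (%x. euler i t (c i) x - euler i t d x) + N1 (%x. euler i t d x - euler j t (c j) x)"
     by (rule L1_nrm_triangle[OF ii(1) ii(2) ii(1)])
    moreover have "N1 (%x. euler i t d x - euler j t (c j) x) <=
     N1 (%x. euler i t d x - euler j t d x) + N1 (%x. euler j t d x - euler j t (c j) x)"
     by (rule L1_nrm_triangle[OF ii(2) ii(2) ii(1)])
    moreover have "N1 (%x. euler j t d x - euler j t (c j) x) = N1 (%x. euler j t (c j) x - euler j t d x)"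
     by (simp add: abs_minus_commute)
    moreover have "N1 (%x. euler i t d x - euler j t d x) < e / 5" using N1' that by simp
    ultimately show ?thesis using cd[of i] cd[of j] that by simp
   qed
   thus "EX N. ALL i>=N. ALL j>=N. N1 (%x. euler i t (c i) x - euler j t (c j) x) < e" by blast
  qed
  thus ?thesis using euler_L2[OF A(1)] unfolding approximates_def by blast
 qed
 note A = approximatesD[OF g] and Bc = approximates_truncate[OF approximatesD(3)[OF g]]
 note B = approximatesD[OF Bc]
 have sg: "approximates (%n. euler n t (truncate n f)) (sg t f)"
  unfolding sg_def by (rule someI_ex[OF ex[OF Bc]])
 have l: "(%n. N1 (%x. g n x - f x) + N1 (%x. truncate n f x - f x)) ----> 0" using tendsto_add[OF A(4) B(4)] by simp
 show ?thesis
 proof (rule approximates_trans[OF sg euler_L2[OF A(1)]], rule Lim_null_comparison[OF always_eventually l], rule allI)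
  fix n
  have "N1 (%x. euler n t (g n) x - euler n t (truncate n f) x) <= N1 (%x. g n x - truncate n f x)"
   by (rule euler_N1_diff[OF A(1) B(1)])
  also have "... <= N1 (%x. g n x - f x) + N1 (%x. truncate n f x - f x)"
   using L1_nrm_triangle[OF A(2) A(3) B(2), of n n] by (simp add: abs_minus_commute)
  finally show "norm (N1 (%x. euler n t (g n) x - euler n t (truncate n f) x)) <= N1 (%x. g n x - f x) + N1 (%x. truncate n f x - f x)"
   by simp
 qed
qed

lemmas sg_approximates = euler_approximates[OF _ approximates_truncate]

lemma sg_integrable: "0 <= t ==> integrable M f ==> integrable M (sg t f)"
 using approximatesD(3)[OF sg_approximates] by blast

lemma sg_lin:
 assumes t: "0 <= t" and f: "integrable M f" "integrable M g"
 shows "AE x in M. sg t (%y. a * f y + b * g y) x = a * sg t f x + b * sg t g x"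
proof -
 let ?f = "%n. truncate n f" and ?g = "%n. truncate n g"
 note A = approximates_truncate[OF f(1)] and B = approximates_truncate[OF f(2)]
 note A' = approximatesD(1)[OF A] and B' = approximatesD(1)[OF B]
 have 1: "approximates (%n. euler n t (%x. a * ?f n x + b * ?g n x)) (sg t (%y. a * f y + b * g y))"
  by (rule euler_approximates[OF t approximates_lin[OF A B]])
 have 2: "approximates (%n x. a * euler n t (?f n) x + b * euler n t (?g n) x) (%x. a * sg t f x + b * sg t g x)"
  by (rule approximates_lin[OF euler_approximates[OF t A] euler_approximates[OF t B]])
 have "approximates (%n. euler n t (%x. a * ?f n x + b * ?g n x)) (%x. a * sg t f x + b * sg t g x)"
 proof (rule approximates_trans[OF 2 approximatesD(1)[OF 1]])
  have "N1 (%x. euler n t (%x. a * ?f n x + b * ?g n x) x - (a * euler n t (?f n) x + b * euler n t (?g n) x)) = (LINT x|M. 0)" for n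
  proof (rule integral_cong_AE)
   show "AE x in M. \<bar>euler n t (%x. a * ?f n x + b * ?g n x) x - (a * euler n t (?f n) x + b * euler n t (?g n) x)\<bar> = 0"
    using euler_lin[OF A'[of n] B'[of n], of n t a b] by eventually_elim simp
  qed (intro borel_measurable_abs borel_measurable_diff L2_measurable L2_lin euler_L2 A' B' borel_measurable_const)+
  thus "(%n. N1 (%x. euler n t (%x. a * ?f n x + b * ?g n x) x - (a * euler n t (?f n) x + b * euler n t (?g n) x))) ----> 0" by simp
 qed
 thus ?thesis by (rule approximates_limit_unique[OF 1])
qed

lemma sg_diff:
 assumes "0 <= t" "integrable M f" "integrable M g"
 shows "AE x in M. sg t (%y. f y - g y) x = sg t f x - sg t g x"
 using sg_lin[OF assms, of 1 "-1"] by simp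

lemma sg_AE_limit:
 assumes t: "0 <= t" and f: "integrable M f"
 obtains r :: "nat => nat" where "AE x in M. (%n. euler (r n) t (truncate (r n) f) x) ----> sg t f x"
proof -
 note A = approximatesD[OF sg_approximates[OF t f]]
 show thesis by (rule L1_subsequence[OF A(2,3,4)]) (use that in blast)
qed

lemma sg_nonneg:
 assumes t: "0 <= t" and f: "integrable M f" and f0: "AE x in M. 0 <= f x"
 shows "AE x in M. 0 <= sg t f x"
proof -
 obtain r :: "nat => nat" where r: "AE x in M. (%n. euler (r n) t (truncate (r n) f) x) ----> sg t f x"
  by (rule sg_AE_limit[OF t f])
 have fm: "f : borel_measurable M" using f by simp
 have "AE x in M. 0 <= truncate n f x" for n using f0 by eventually_elim (simp add: truncate_def)
 hence "AE x in M. 0 <= euler m t (truncate n f) x" for m n by (rule euler_nonneg[OF truncate_L2[OF fm]])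
 hence "AE x in M. ALL n. 0 <= euler (r n) t (truncate (r n) f) x" by (simp add: AE_all_countable)
 with r show ?thesis by eventually_elim (rule LIMSEQ_le_const, assumption, blast)
qed

lemma sg_bounded:
 assumes t: "0 <= t" and f: "integrable M f" and c: "AE x in M. \<bar>f x\<bar> <= c" "0 <= c"
 shows "AE x in M. \<bar>sg t f x\<bar> <= c"
proof -
 obtain r :: "nat => nat" where r: "AE x in M. (%n. euler (r n) t (truncate (r n) f) x) ----> sg t f x"
  by (rule sg_AE_limit[OF t f])
 have fm: "f : borel_measurable M" using f by simp
 have "AE x in M. \<bar>truncate n f x\<bar> <= c" for n using c(1) by eventually_elim (use truncate_abs(1)[of n f] order_trans in blast)
 hence "AE x in M. \<bar>euler m t (truncate n f) x\<bar> <= c" for m n by (rule euler_bounded[OF truncate_L2[OF fm] _ c(2)])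
 hence "AE x in M. ALL n. \<bar>euler (r n) t (truncate (r n) f) x\<bar> <= c" by (simp add: AE_all_countable)
 with r show ?thesis
 proof eventually_elim
  case (elim x)
  thus ?case by (intro LIMSEQ_le_const2[OF tendsto_rabs[OF elim(1)]]) blast
 qed
qed

lemma sg_N1:
 assumes t: "0 <= t" and f: "integrable M f"
 shows "N1 (sg t f) <= N1 f"
proof (rule fatou_mean(2)[of M "%n. euler n t (truncate n f)" "sg t f" abs])
 note A = approximatesD[OF sg_approximates[OF t f]]
 have fm: "f : borel_measurable M" using f by simp
 show "integrable M (euler n t (truncate n f))" "integrable M (%x. \<bar>euler n t (truncate n f) x\<bar>)" for n using A(2) by auto
 show "integrable M (sg t f)" "(%n. N1 (%x. euler n t (truncate n f) x - sg t f x)) ----> 0" by fact+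
 show "continuous_on UNIV (abs :: real => real)" by (intro continuous_intros)
 show "N1 (euler n t (truncate n f)) <= N1 f" for n
 proof -
  have "N1 (euler n t (truncate n f)) <= N1 (truncate n f)" unfolding euler_def by (rule R_pow_N1[OF p2 truncate_L2[OF fm]])
  also have "... <= N1 f" by (rule L1_nrm_mono[OF f]) (use fm truncate_measurable in \<open>auto simp: truncate_abs\<close>)
  finally show ?thesis .
 qed
qed simp

lemma sg_powr:
 assumes t: "0 <= t" and f: "integrable M f" "integrable M (%x. \<bar>f x\<bar> powr q)" and q: "1 < q"
 shows "integrable M (%x. \<bar>sg t f x\<bar> powr q)" "(LINT x|M. \<bar>sg t f x\<bar> powr q) <= (LINT x|M. \<bar>f x\<bar> powr q)"
proof -
 note A = approximatesD[OF sg_approximates[OF t f(1)]]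
 have fm: "f : borel_measurable M" using f by simp
 have cl: "AE x in M. \<bar>truncate n f x\<bar> <= real n" for n by (simp add: truncate_abs)
 note ep = euler_powr[OF truncate_L2[OF fm] cl of_nat_0_le_iff q]
 have 1: "(LINT x|M. \<bar>euler n t (truncate n f) x\<bar> powr q) <= (LINT x|M. \<bar>f x\<bar> powr q)" for n
 proof -
  have "(LINT x|M. \<bar>euler n t (truncate n f) x\<bar> powr q) <= (LINT x|M. \<bar>truncate n f x\<bar> powr q)" by (rule ep(2))
  also have "... <= (LINT x|M. \<bar>f x\<bar> powr q)"
  proof (rule integral_mono_AE')
   show "integrable M (%x. \<bar>f x\<bar> powr q)" by fact
   show "AE x in M. \<bar>truncate n f x\<bar> powr q <= \<bar>f x\<bar> powr q" using q truncate_abs(1)[of n f] by (intro AE_I2 powr_mono2) auto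
  qed simp
  finally show ?thesis .
 qed
 have 2: "continuous_on UNIV (%y::real. \<bar>y\<bar> powr q)"
  by (rule continuous_on_powr') (use q in \<open>auto intro: continuous_intros\<close>)
 show "integrable M (%x. \<bar>sg t f x\<bar> powr q)" "(LINT x|M. \<bar>sg t f x\<bar> powr q) <= (LINT x|M. \<bar>f x\<bar> powr q)"
  by (rule fatou_mean[OF A(2,3,4) 2 _ ep(1) 1]; simp)+
qed

lemma N2_mean_le:
 assumes g: "approximates g u" and le: "!!n. N2 (g n) <= C"
 shows "u : L2 M" "N2 u <= C"
proof -
 note A = approximatesD[OF g]
 have C: "0 <= C" using le[of 0] L2.nrm_nonneg[OF A(1)[of 0]] by linarith
 have b: "(LINT x|M. (g n x)\<^sup>2) <= C\<^sup>2" for n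
  using le[of n] L2.nonneg[OF A(1)[of n]] C by (simp add: L2_inner_def power2_eq_square sqrt_le_D real_sqrt_le_iff' sqrt_le_D[unfolded power2_eq_square])
 have co: "continuous_on UNIV (%y::real. y\<^sup>2)" by (intro continuous_intros)
 have "integrable M (%x. (u x)\<^sup>2)" "(LINT x|M. (u x)\<^sup>2) <= C\<^sup>2"
  by (rule fatou_mean[OF A(2,3,4) co _ L2_integrable_square[OF A(1)] b]; simp)+
 thus "u : L2 M" "N2 u <= C" using A(3) C by (auto simp: L2_def L2_inner_def power2_eq_square[symmetric] intro: real_le_lsqrt)
qed

lemma sg_N2:
 assumes t: "0 <= t" and f: "f : L2 M"
 shows "sg t f : L2 M" "N2 (sg t f) <= N2 f"
 by (rule N2_mean_le[OF euler_approximates[OF t approximates_const[OF f]]], simp only: euler_def, rule R_pow_N2[OF p2 f])+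

lemma sg_zero: "integrable M f ==> AE x in M. sg 0 f x = f x"
 using approximates_limit_unique[OF sg_approximates[of 0 f]] approximates_truncate[of f]
 by (simp add: euler_def steps_def)

text \<open>The numbers of steps for \<open>s + t\<close> and for \<open>s\<close> followed by
  \<open>t\<close> differ by at most one, and a single resolvent step tends to the identity in mean,
  which is \<open>J\<close>.\<close>

lemma sg_add:
 assumes s: "0 <= s" and t: "0 <= t" and f: "integrable M f"
 shows "AE x in M. sg (s + t) f x = sg s (sg t f) x"
proof -
 let ?f = "%n. truncate n f"
 note A = approximatesD[OF approximates_truncate[OF f]]
 have 1: "approximates (%n. euler n (s + t) (?f n)) (sg (s + t) f)" using s t by (intro sg_approximates f) simp
 have 2: "approximates (%n. euler n s (euler n t (?f n))) (sg s (sg t f))"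
  by (rule euler_approximates[OF s sg_approximates[OF t f]])
 have J: "(%n. N1 (%x. R (2 ^ n) (?f n) x - ?f n x)) ----> 0"
 proof (rule LIMSEQ_I)
  fix e :: real assume "0 < e"
  hence e6: "0 < e / 6" by simp
  obtain d h k where d: "Hop d h" "Hop h k" "N1 (%x. d x - f x) < e / 6" by (rule Hop2_dense_L1[OF f e6])
  note D = HopD[OF d(1)]
  have "(%n. vol * (N2 h * (1 / 2) ^ n)) ----> vol * (N2 h * 0)" by (intro tendsto_intros LIMSEQ_power_zero) simp
  hence "\<forall>\<^sub>F n in sequentially. vol * (N2 h * (1 / 2) ^ n) < e / 6" using e6 by (intro order_tendstoD(2)) auto
  moreover have "\<forall>\<^sub>F n in sequentially. N1 (%x. ?f n x - f x) < e / 6" using e6 by (intro order_tendstoD(2)[OF A(4)])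
  ultimately have "\<forall>\<^sub>F n in sequentially. N1 (%x. R (2 ^ n) (?f n) x - ?f n x) < e"
  proof eventually_elim
   case (elim n)
   note i = L2_integrable[OF A(1)[of n]] L2_integrable[OF D(2)] L2_integrable[OF R_L2[OF p2[of n] A(1)[of n]]] L2_integrable[OF R_L2[OF p2[of n] D(2)]]
   have 1: "N1 (%x. ?f n x - d x) <= 2 * (e / 6)"
    using L1_nrm_triangle[OF i(1) f i(2)] elim(2) d(3) by (simp add: abs_minus_commute)
   have 2: "N1 (%x. R (2 ^ n) (?f n) x - R (2 ^ n) d x) <= N1 (%x. ?f n x - d x)"
    using R_pow_N1_diff[OF p2[of n] A(1)[of n] D(2), of 1] by simp
   have "N1 (%x. R (2 ^ n) d x - d x) <= vol * N2 (%x. R (2 ^ n) d x - d x)"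
    by (rule N1_le_N2[OF L2.diff_mem[OF R_L2[OF p2 D(2)] D(2)]])
   also have "... <= vol * (N2 h * (1 / 2) ^ n)"
    using R_Hop_N2[OF p2[of n] d(1)] by (intro mult_left_mono vol_nonneg) (simp add: power_divide)
   finally have 3: "N1 (%x. R (2 ^ n) d x - d x) < e / 6" using elim(1) by linarith
   have "N1 (%x. R (2 ^ n) (?f n) x - ?f n x) <= N1 (%x. R (2 ^ n) (?f n) x - R (2 ^ n) d x) + N1 (%x. R (2 ^ n) d x - ?f n x)"
    by (rule L1_nrm_triangle[OF i(3,4,1)])
   moreover have "N1 (%x. R (2 ^ n) d x - ?f n x) <= N1 (%x. R (2 ^ n) d x - d x) + N1 (%x. ?f n x - d x)"
    using L1_nrm_triangle[OF i(4,2,1)] by (simp add: abs_minus_commute)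
   ultimately show ?case using 1 2 3 \<open>0 < e\<close> by linarith
  qed
  thus "EX N. ALL n>=N. norm (N1 (%x. R (2 ^ n) (?f n) x - ?f n x) - 0) < e"
   unfolding eventually_sequentially by simp
 qed
 have "approximates (%n. euler n (s + t) (?f n)) (sg s (sg t f))"
 proof (rule approximates_trans[OF 2 euler_L2[OF A(1)]], rule Lim_null_comparison[OF always_eventually J], rule allI)
  fix n
  let ?J = "R (2 ^ n)" and ?p = "steps n s + steps n t"
  have eq: "euler n s (euler n t (?f n)) = (?J ^^ ?p) (?f n)" by (simp add: euler_def funpow_add)
  show "norm (N1 (%x. euler n (s + t) (?f n) x - euler n s (euler n t (?f n)) x)) <= N1 (%x. ?J (?f n) x - ?f n x)"
   using steps_add[OF s t, of n]
  proof
   assume "steps n (s + t) = ?p" thus ?thesis unfolding eq by (simp add: euler_def)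
  next
   assume "steps n (s + t) = Suc ?p"
   hence "euler n (s + t) (?f n) = (?J ^^ ?p) (?J (?f n))" by (simp add: euler_def funpow_swap1)
   thus ?thesis unfolding eq using R_pow_N1_diff[OF p2[of n] R_L2[OF p2[of n] A(1)[of n]] A(1)[of n], of ?p] by simp
  qed
 qed
 thus ?thesis by (rule approximates_limit_unique[OF 1])
qed

lemma sg_Hop_N2:
 assumes t: "0 <= t" and H: "Hop f h"
 shows "N2 (%x. sg t f x - f x) <= t * N2 h"
proof (rule N2_mean_le(2))
 note D = HopD[OF H]
 show "approximates (%n x. euler n t f x - f x) (%x. sg t f x - f x)"
  using approximates_lin[OF euler_approximates[OF t approximates_const[OF D(2)]] approximates_const[OF D(2)], of 1 "-1"] by simp
 fix n
 have "real (steps n t) * (N2 h / 2 ^ n) <= (t * 2 ^ n) * (N2 h / 2 ^ n)"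
  using L2.nrm_nonneg[OF D(3)] by (intro mult_right_mono steps_bounds(1)[OF t]) simp
 thus "N2 (%x. euler n t f x - f x) <= t * N2 h" using euler_Hop_N2[OF H, of n t] by simp
qed

lemma sg_Hop2_N2:
 assumes t: "0 <= t" and H: "Hop f h" "Hop h k"
 shows "N2 (%x. sg t f x - f x + t * h x) <= t\<^sup>2 * N2 k"
proof (rule N2_mean_le(2))
 note D = HopD[OF H(1)] HopD[OF H(2)]
 let ?c = "%n. real (steps n t) / 2 ^ n"
 have c: "?c n <= t" "t - ?c n <= (1 / 2) ^ n" for n
 proof -
  have "?c n <= (t * 2 ^ n) / 2 ^ n" "(t * 2 ^ n) / 2 ^ n <= (real (steps n t) + 1) / 2 ^ n"
   using steps_bounds[OF t, of n] by (intro divide_right_mono; simp)+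
  thus "?c n <= t" "t - ?c n <= (1 / 2) ^ n" by (simp_all add: add_divide_distrib power_divide)
 qed
 have "?c ----> t"
 proof (rule LIM_zero_cancel, rule Lim_null_comparison)
  show "\<forall>\<^sub>F n in sequentially. norm (?c n - t) <= (1 / 2) ^ n"
  proof (intro always_eventually allI)
   fix n show "norm (?c n - t) <= (1 / 2) ^ n" using c[of n] by simp
  qed
  show "(%n. (1 / 2) ^ n :: real) ----> 0" by (rule LIMSEQ_power_zero) simp
 qed
 hence l: "(%n. \<bar>?c n - t\<bar> * N1 h) ----> 0" by (intro tendsto_mult_left_zero tendsto_rabs_zero LIM_zero)
 have ch: "approximates (%n x. ?c n * h x) (%x. t * h x)"
  unfolding approximates_def
 proof (intro conjI allI L2.scale_mem D)
  show "integrable M (%x. t * h x)" using L2_integrable[OF D(3)] by simp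
  show "(%n. N1 (%x. ?c n * h x - t * h x)) ----> 0"
   using l unfolding left_diff_distrib[symmetric] abs_mult by simp
 qed
 note a1 = approximates_lin[OF euler_approximates[OF t approximates_const[OF D(2)]] approximates_const[OF D(2)], of 1 "-1"]
 show "approximates (%n x. euler n t f x - f x + ?c n * h x) (%x. sg t f x - f x + t * h x)"
  using approximates_lin[OF a1 ch, of 1 1] by simp
 fix n
 have "(?c n)\<^sup>2 * N2 k <= t\<^sup>2 * N2 k" using c(1)[of n] L2.nrm_nonneg[OF D(7)] by (intro mult_right_mono power_mono) auto
 thus "N2 (%x. euler n t f x - f x + ?c n * h x) <= t\<^sup>2 * N2 k" using euler_Hop2_N2[OF H, of n t] by linarith
qed

lemma sg_continuous:
 assumes f: "f : L2 M"
 shows "((%t. N2 (%x. sg t f x - f x)) \<longlongrightarrow> 0) (at_right 0)"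
proof (rule tendstoI)
 fix e :: real assume "0 < e"
 hence e4: "0 < e / 4" by simp
 obtain d h k where d: "Hop d h" "Hop h k" "N2 (%x. d x - f x) < e / 4" by (rule Hop2_dense[OF f e4])
 note D = HopD[OF d(1)]
 have "((%t. t * N2 h) \<longlongrightarrow> 0 * N2 h) (at_right 0)" by (intro tendsto_intros)
 hence "\<forall>\<^sub>F t in at_right 0. t * N2 h < e / 4" using e4 by (intro order_tendstoD(2)) auto
 thus "\<forall>\<^sub>F t in at_right 0. dist (N2 (%x. sg t f x - f x)) 0 < e" using eventually_at_right_less[of 0]
 proof eventually_elim
  case (elim t)
  hence t: "0 <= t" by simp
  note m = sg_N2(1)[OF t f] sg_N2(1)[OF t D(2)]
  have "N2 (%x. sg t f x - sg t d x) = N2 (sg t (%x. f x - d x))"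
   by (intro arg_cong[of _ _ sqrt] L2_inner_cong_AE L2_measurable L2.diff_mem m sg_N2(1)[OF t] f D)
    (use sg_diff[OF t L2_integrable[OF f] L2_integrable[OF D(2)]] in \<open>eventually_elim, simp\<close>)+
  also have "... <= N2 (%x. f x - d x)" by (rule sg_N2(2)[OF t L2.diff_mem[OF f D(2)]])
  finally have 1: "N2 (%x. sg t f x - sg t d x) < e / 4" using d(3) L2.nrm_diff_commute[OF f D(2)] by linarith
  have 2: "N2 (%x. sg t d x - d x) < e / 4" using sg_Hop_N2[OF t d(1)] elim(1) by linarith
  have "N2 (%x. sg t f x - f x) < e"
   using L2.nrm_triangle[OF m(1,2) f] L2.nrm_triangle[OF m(2) D(2) f] 1 2 d(3) \<open>0 < e\<close> by linarith
  thus ?case using L2.nrm_nonneg[OF L2.diff_mem[OF m(1) f]] by (simp add: dist_real_def)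
 qed
qed

end

section \<open>The generator and the \<open>L^q\<close> bounds of the constructed semigroup\<close>

context finite_markovian_form
begin

text \<open>Split \<open>f\<close> into a regularised part \<open>d\<close>, to which the quadratic
  remainder of \<open>sg_Hop2_N2\<close> applies, and \<open>f - d\<close>, whose difference
  quotient is bounded by the norm of \<open>g - h\<close> through \<open>sg_Hop_N2\<close>.\<close>

lemma sg_generator:
 assumes H: "Hop f g"
 shows "((%t. N2 (%x. (sg t f x - f x) / t + g x)) \<longlongrightarrow> 0) (at_right 0)"
proof (rule tendstoI)
 fix e :: real assume "0 < e"
 hence e4: "0 < e / 4" by simp
 note D = HopD[OF H]
 have "\<forall>\<^sub>F n in sequentially. N2 (%x. Rn n g x - g x) < e / 4" by (intro order_tendstoD(2)[OF Rn_L2_tendsto[OF D(3)] e4])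
 hence "EX n. N2 (%x. Rn n g x - g x) < e / 4" by (rule eventually_happens'[OF sequentially_bot])
 then obtain n where n: "N2 (%x. Rn n g x - g x) < e / 4" ..
 have p: "0 < real (Suc n)" by simp
 define d h k where "d = Rn n f" and "h = Rn n g" and "k = (%x. real (Suc n) * (g x - Rn n g x))"
 have d: "Hop d h" "Hop h k" unfolding d_def h_def k_def by (rule R_of_Hop(2)[OF p H], rule Hop_R[OF p D(3)])
 note Dd = HopD[OF d(1)]
 have fd: "Hop (%x. f x - d x) (%x. g x - h x)" using Hop_lin[OF H d(1), of 1 "-1"] by simp
 have gh: "N2 (%x. g x - h x) < e / 4" using n L2.nrm_diff_commute[OF D(3) Dd(3)] by (simp add: h_def)
 have "((%t. t * N2 k) \<longlongrightarrow> 0 * N2 k) (at_right 0)" by (intro tendsto_intros)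
 hence "\<forall>\<^sub>F t in at_right 0. t * N2 k < e / 4" using e4 by (intro order_tendstoD(2)) auto
 thus "\<forall>\<^sub>F t in at_right 0. dist (N2 (%x. (sg t f x - f x) / t + g x)) 0 < e" using eventually_at_right_less[of 0]
 proof eventually_elim
  case (elim t)
  hence t: "0 <= t" by simp
  note mf = sg_N2(1)[OF t D(2)] and md = sg_N2(1)[OF t Dd(2)] and mfd = sg_N2(1)[OF t L2.diff_mem[OF D(2) Dd(2)]]
  let ?a = "%x. sg t (%x. f x - d x) x - (f x - d x)" and ?b = "%x. sg t d x - d x + t * h x" and ?c = "%x. g x - h x"
  have m: "?a : L2 M" "?b : L2 M" "?c : L2 M"
   by (intro L2.add_mem L2.diff_mem L2.scale_mem mf md mfd D Dd)+
  have u: "(%x. (sg t f x - f x) / t + g x) : L2 M"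
   using L2.add_mem[OF L2.scale_mem[OF L2.diff_mem[OF mf D(2)], of "1 / t"] D(3)] by simp
  have r: "(%x. 1 / t * ?a x + (1 / t * ?b x + ?c x)) : L2 M"
   by (intro L2.add_mem L2.scale_mem m)
  have "AE x in M. (sg t f x - f x) / t + g x = 1 / t * ?a x + (1 / t * ?b x + ?c x)"
   using sg_diff[OF t L2_integrable[OF D(2)] L2_integrable[OF Dd(2)]]
  proof eventually_elim
   case (elim x)
   have "1 / t * ?a x + (1 / t * ?b x + ?c x) = (?a x + (sg t d x - d x)) / t + g x"
    using \<open>0 < t\<close> by (simp add: field_simps)
   thus ?case using elim by simp
  qed
  hence "N2 (%x. (sg t f x - f x) / t + g x) = N2 (%x. 1 / t * ?a x + (1 / t * ?b x + ?c x))"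
   by (intro arg_cong[of _ _ sqrt] L2_inner_cong_AE L2_measurable u r)
  also have "... <= N2 (%x. 1 / t * ?a x) + (N2 (%x. 1 / t * ?b x) + N2 ?c)"
   by (rule order_trans[OF L2.nrm_add add_left_mono[OF L2.nrm_add]]) (intro L2.add_mem L2.scale_mem m)+
  also have "... = 1 / t * N2 ?a + (1 / t * N2 ?b + N2 ?c)"
   unfolding L2.nrm_scale[OF m(1)] L2.nrm_scale[OF m(2)] using t by simp
  also have "... <= 1 / t * (t * N2 ?c) + (1 / t * (t\<^sup>2 * N2 k) + N2 ?c)"
   using sg_Hop_N2[OF t fd] sg_Hop2_N2[OF t d] t by (intro add_mono mult_left_mono) auto
  also have "... = 2 * N2 ?c + t * N2 k" using elim(2) by (simp add: power2_eq_square field_simps)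
  also have "... < e" using gh elim(1) \<open>0 < e\<close> by linarith
  finally show ?case using L2.nrm_nonneg[OF u] by (simp add: dist_real_def)
 qed
qed

text \<open>Let \<open>d\<close> solve the resolvent equation for \<open>f + g\<close> at 1. The
  difference quotient of \<open>w = f - d\<close> tends to \<open>k - g = w\<close>, whereas
  contractivity makes its inner product with \<open>w\<close> nonpositive; hence
  \<open>w = 0\<close>.\<close>

lemma sg_generator_converse:
 assumes f: "f : L2 M" and g: "g : L2 M"
  and lim: "((%t. N2 (%x. (sg t f x - f x) / t + g x)) \<longlongrightarrow> 0) (at_right 0)"
 shows "Hop f g"
proof -
 have fg: "(%x. f x + g x) : L2 M" by (rule L2.add_mem[OF f g])
 define d where "d = R 1 (%x. f x + g x)"
 define k where "k x = f x + g x - d x" for x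
 have H: "Hop d k" using Hop_R[OF zero_less_one fg] by (simp add: d_def k_def[abs_def])
 note D = HopD[OF H]
 define w where "w x = f x - d x" for x
 have w: "w : L2 M" unfolding w_def by (rule L2.diff_mem[OF f D(2)])
 let ?Q = "%t. N2 (%x. (sg t f x - f x) / t + g x) + N2 (%x. (sg t d x - d x) / t + k x)"
 have Q: "((%t. ?Q t * N2 w) \<longlongrightarrow> 0) (at_right 0)"
  using tendsto_mult_right[OF tendsto_add[OF lim sg_generator[OF H]], of "N2 w"] by simp
 have "ip w w <= 0"
 proof (rule tendsto_lowerbound[OF Q])
  show "\<forall>\<^sub>F t in at_right 0. ip w w <= ?Q t * N2 w" using eventually_at_right_less[of 0]
  proof eventually_elim
   case (elim t)
   hence t: "0 <= t" by simp
   note mf = sg_N2(1)[OF t f] and md = sg_N2(1)[OF t D(2)] and mw = sg_N2(1)[OF t w]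
   have u: "(%x. (sg t f x - f x) / t + g x) : L2 M" "(%x. (sg t d x - d x) / t + k x) : L2 M"
    using L2.add_mem[OF L2.scale_mem[OF L2.diff_mem[OF mf f], of "1 / t"] g]
     L2.add_mem[OF L2.scale_mem[OF L2.diff_mem[OF md D(2)], of "1 / t"] D(3)] by simp_all
   let ?v = "%x. ((sg t f x - f x) / t + g x) - ((sg t d x - d x) / t + k x)"
   have v: "?v : L2 M" by (rule L2.diff_mem[OF u])
   have "AE x in M. w x = (1 / t) * (sg t w x - w x) - ?v x"
    using sg_diff[OF t L2_integrable[OF f] L2_integrable[OF D(2)]]
   proof eventually_elim
    case (elim x)
    show ?case unfolding w_def[abs_def] k_def elim using \<open>0 < t\<close> by (simp add: field_simps)
   qed
   hence "ip w w = ip (%x. (1 / t) * (sg t w x - w x) - ?v x) w"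
    by (intro L2_inner_cong_AE L2_measurable w L2.scale_mem L2.diff_mem mw u) auto
   also have "... = (1 / t) * (ip (sg t w) w - ip w w) - ip ?v w"
    unfolding L2.diff_left[OF L2.scale_mem[OF L2.diff_mem[OF mw w]] v w] L2.scale_left[OF L2.diff_mem[OF mw w] w]
     L2.diff_left[OF mw w w] ..
   also have "... <= 0 + N2 ?v * N2 w"
   proof -
    have "ip (sg t w) w <= N2 (sg t w) * N2 w" using L2.abs_le_nrm[OF mw w] by linarith
    also have "... <= N2 w * N2 w" using sg_N2(2)[OF t w] L2.nrm_nonneg[OF w] by (rule mult_right_mono)
    also have "... = ip w w" using L2.nonneg[OF w] by simp
    finally have "(1 / t) * (ip (sg t w) w - ip w w) <= 0" using t by (simp add: divide_nonpos_nonneg)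
    moreover have "- ip ?v w <= N2 ?v * N2 w" using L2.abs_le_nrm[OF v w] by linarith
    ultimately show ?thesis by linarith
   qed
   also have "... <= ?Q t * N2 w" using L2.nrm_diff[OF u] L2.nrm_nonneg[OF w] by (simp add: mult_right_mono)
   finally show ?case .
  qed
 qed simp
 hence "AE x in M. w x = 0" by (rule L2_null[OF w])
 hence ae: "AE x in M. d x = f x" by eventually_elim (simp add: w_def)
 have fF: "f : F" by (rule dom_cong[OF D(1) L2_measurable[OF f] ae])
 have "E f v = ip g v" if v: "v : F" for v
 proof -
  have "E f v = ip k v" using form_cong_left[OF D(1) fF v ae] D(4)[OF v] by simp
  also have "... = ip g v"
   by (intro L2_inner_cong_AE L2_measurable D g dom_L2 v) (use ae in \<open>eventually_elim, simp add: k_def\<close>, simp)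
  finally show ?thesis .
 qed
 thus "Hop f g" using fF g by (simp add: form_operator_def Lp_2)
qed

lemma Lp_integrable:
 assumes q: "1 <= q" and f: "f : Lp q M"
 shows "integrable M f"
proof (cases "q = \<infinity>")
 case True
 then obtain C where "f : borel_measurable M" "AE x in M. \<bar>f x\<bar> <= C" using f by (auto simp: Lp_def)
 thus ?thesis by (rule L2_integrable[OF bounded_L2])
next
 case False
 hence fi: "f : borel_measurable M" "integrable M (%x. \<bar>f x\<bar> powr enn2real q)" using f by (auto simp: Lp_def)
 have q1: "1 <= enn2real q" using q False enn2real_mono[of 1 q] by (simp add: top.not_eq_extremum)
 show ?thesis
 proof (rule Bochner_Integration.integrable_bound)
  show "integrable M (%x. 1 + \<bar>f x\<bar> powr enn2real q)" using fi by simp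
  have "\<bar>y\<bar> <= 1 + \<bar>y\<bar> powr enn2real q" for y :: real
   using powr_mono[OF q1, of "\<bar>y\<bar>"] by (cases "\<bar>y\<bar> <= 1") (auto intro: add_increasing2)
  thus "AE x in M. norm (f x) <= norm (1 + \<bar>f x\<bar> powr enn2real q)" by (intro AE_I2) (simp add: order_trans[OF _ abs_ge_self])
 qed (rule fi)
qed

lemma sg_Lp:
 assumes q: "1 <= q" and t: "0 <= t" and f: "f : Lp q M"
 shows "sg t f : Lp q M" "Lp_norm q M (sg t f) <= Lp_norm q M f"
proof -
 note fi = Lp_integrable[OF q f]
 have m: "sg t f : borel_measurable M" using sg_integrable[OF t fi] by simp
 have "sg t f : Lp q M & Lp_norm q M (sg t f) <= Lp_norm q M f"
 proof (cases "q = \<infinity>")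
  case True
  obtain C where C: "AE x in M. \<bar>f x\<bar> <= C" using f True by (auto simp: Lp_def)
  have b: "AE x in M. \<bar>sg t f x\<bar> <= c" if "0 <= c" "AE x in M. \<bar>f x\<bar> <= c" for c
   by (rule sg_bounded[OF t fi that(2,1)])
  have C': "AE x in M. \<bar>f x\<bar> <= \<bar>C\<bar>" using C by eventually_elim simp
  have "Inf {C. 0 <= C & (AE x in M. \<bar>sg t f x\<bar> <= C)} <= Inf {C. 0 <= C & (AE x in M. \<bar>f x\<bar> <= C)}"
  proof (rule cInf_superset_mono)
   show "{C. 0 <= C & (AE x in M. \<bar>f x\<bar> <= C)} ~= {}" using C' abs_ge_zero by blast
   show "bdd_below {C. 0 <= C & (AE x in M. \<bar>sg t f x\<bar> <= C)}" by (rule bdd_belowI[of _ 0]) blast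
   show "{C. 0 <= C & (AE x in M. \<bar>f x\<bar> <= C)} <= {C. 0 <= C & (AE x in M. \<bar>sg t f x\<bar> <= C)}" using b by blast
  qed
  thus ?thesis using m b[OF _ C'] True by (auto simp: Lp_def Lp_norm_def)
 next
  case False
  define r where "r = enn2real q"
  have r1: "1 <= r" using q False enn2real_mono[of 1 q] by (simp add: r_def top.not_eq_extremum)
  have fr: "integrable M (%x. \<bar>f x\<bar> powr r)" using f False by (simp add: Lp_def r_def)
  have "integrable M (%x. \<bar>sg t f x\<bar> powr r) & (LINT x|M. \<bar>sg t f x\<bar> powr r) <= (LINT x|M. \<bar>f x\<bar> powr r)"
  proof (cases "r = 1")
   case True thus ?thesis using sg_N1[OF t fi] sg_integrable[OF t fi] by simp
  next
   case False thus ?thesis using sg_powr[OF t fi fr] r1 by simp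
  qed
  thus ?thesis using m False r1 by (auto simp: Lp_def Lp_norm_def r_def[symmetric] intro: powr_mono2)
 qed
 thus "sg t f : Lp q M" "Lp_norm q M (sg t f) <= Lp_norm q M f" by auto
qed

text \<open>Contractivity in mean gives convergence along a subsequence almost everywhere, and
  monotonicity in \<open>n\<close> extends it to the whole sequence.\<close>

lemma sg_monotone_limit:
 assumes t: "0 <= t" and f: "f : Lp \<infinity> M" and s: "!!n::nat. s n : Lp \<infinity> M"
  and mono: "AE x in M. (ALL n. 0 <= s n x & s n x <= s (Suc n) x) & (%n. s n x) ----> f x"
 shows "AE x in M. (%n. sg t (s n) x) ----> sg t f x"
proof -
 have one: "(1::ennreal) <= \<infinity>" by simp
 note fi = Lp_integrable[OF one f] and si = Lp_integrable[OF one s]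
 have le: "AE x in M. s n x <= f x" for n using mono
 proof eventually_elim
  case (elim x)
  have "incseq (%n. s n x)" using elim by (intro incseq_SucI) simp
  thus ?case using elim incseq_le by blast
 qed
 have "(%n. L1_nrm M (%x. s n x - f x)) ----> (LINT x|M. 0)"
 proof (rule integral_dominated_convergence)
  show "integrable M (%x. \<bar>f x\<bar>)" using fi by simp
  show "(%x. \<bar>s n x - f x\<bar>) : borel_measurable M" for n
   using borel_measurable_integrable[OF si[of n]] borel_measurable_integrable[OF fi] by measurable
  show "AE x in M. (%n. \<bar>s n x - f x\<bar>) ----> 0" using mono
   by eventually_elim (intro tendsto_rabs_zero LIM_zero, simp)
  show "AE x in M. norm \<bar>s n x - f x\<bar> <= \<bar>f x\<bar>" for n using mono le[of n]
   by eventually_elim (smt (verit) real_norm_def)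
 qed simp
 hence l0: "(%n. L1_nrm M (%x. s n x - f x)) ----> 0" by simp
 have N1_sg: "N1 (%x. sg t u x - sg t v x) <= N1 (%x. u x - v x)" if "integrable M u" "integrable M v" for u v
 proof -
  have m: "sg t u : borel_measurable M" "sg t v : borel_measurable M" "sg t (%x. u x - v x) : borel_measurable M"
   using that by (auto intro!: borel_measurable_integrable sg_integrable t)
  have "N1 (%x. sg t u x - sg t v x) = N1 (sg t (%x. u x - v x))"
   by (intro integral_cong_AE borel_measurable_abs borel_measurable_diff m)
    (use sg_diff[OF t that] in \<open>eventually_elim, simp\<close>)
  thus ?thesis using sg_N1[OF t, of "%x. u x - v x"] that by simp
 qed
 have l: "(%n. N1 (%x. sg t (s n) x - sg t f x)) ----> 0"
  by (rule Lim_null_comparison[OF always_eventually l0]) (use N1_sg[OF si fi] in simp)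
 obtain r :: "nat => nat" where r: "strict_mono r" "AE x in M. (%n. sg t (s (r n)) x) ----> sg t f x"
  by (rule L1_subsequence[OF sg_integrable[OF t si] sg_integrable[OF t fi] l])
 have sgm: "AE x in M. sg t u x <= sg t v x" if "integrable M u" "integrable M v" "AE x in M. u x <= v x" for u v
 proof -
  have "AE x in M. 0 <= sg t (%x. v x - u x) x" by (rule sg_nonneg[OF t]) (use that in auto)
  with sg_diff[OF t that(2,1)] show ?thesis by eventually_elim simp
 qed
 have "AE x in M. sg t (s n) x <= sg t (s (Suc n)) x" for n
  by (rule sgm[OF si si]) (use mono in \<open>eventually_elim, simp\<close>)
 hence "AE x in M. ALL n. sg t (s n) x <= sg t (s (Suc n)) x" by (simp add: AE_all_countable)
 with r(2) show ?thesis
 proof eventually_elim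
  case (elim x)
  have inc: "incseq (%n. sg t (s n) x)" using elim(2) by (intro incseq_SucI) simp
  have "sg t (s n) x <= sg t f x" for n
  proof (rule LIMSEQ_le_const[OF elim(1)], intro exI allI impI)
   fix m assume "n <= m"
   thus "sg t (s n) x <= sg t (s (r m)) x" using seq_suble[OF r(1), of m] incseqD[OF inc, of n "r m"] by simp
  qed
  then obtain c where c: "(%n. sg t (s n) x) ----> c" using incseq_convergent[OF inc] by blast
  have "c = sg t f x" using LIMSEQ_unique[OF LIMSEQ_subseq_LIMSEQ[OF c r(1), unfolded comp_def] elim(1)] .
  thus ?case using c by simp
 qed
qed

theorem is_heat_semigroup_sg: "is_heat_semigroup D sg"
 unfolding is_heat_semigroup_def Lp_2 Lp_norm_2
proof (intro conjI ballI allI impI)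
 fix q :: ennreal assume q: "1 <= q"
 show "positive_contraction_semigroup q M sg"
  unfolding positive_contraction_semigroup_def
  using sg_Lp[OF q] sg_lin sg_zero sg_add sg_nonneg Lp_integrable[OF q] by (intro conjI allI ballI impI) auto
next
 fix f assume "f : L2 M"
 thus "((%t. N2 (%x. sg t f x - f x)) \<longlongrightarrow> 0) (at_right 0)" by (rule sg_continuous)
 fix g assume "g : L2 M"
 with \<open>f : L2 M\<close> show "Hop f g = ((%t. N2 (%x. (sg t f x - f x) / t + g x)) \<longlongrightarrow> 0) (at_right 0)"
  using sg_generator sg_generator_converse by blast
next
 fix t :: real and f and s :: "nat => 'a => real"
 assume "0 <= t" "f : Lp \<infinity> M" "(ALL n. s n : Lp \<infinity> M) & (AE x in M. (ALL n. 0 <= s n x & s n x <= s (Suc n) x) & (%n. s n x) ----> f x)"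
 thus "AE x in M. (%n. sg t (s n) x) ----> sg t f x" using sg_monotone_limit by blast
qed

text \<open>Existence of some heat semigroup is the whole purpose of \<open>sg\<close>. From here on
  only the defining properties of \<open>heat\<close> are used, so its uniqueness never comes
  up.\<close>

lemma is_heat_semigroup_heat: "is_heat_semigroup D (heat D)"
 unfolding heat_def by (rule someI[of "is_heat_semigroup D", OF is_heat_semigroup_sg])

end

section \<open>Excessive functions and resolvents\<close>

lemma Lp_1: "Lp 1 M = {f. integrable M f}"
 by (auto simp: Lp_def integrable_abs_iff)

lemma Lp_norm_1: "Lp_norm 1 M f = L1_nrm M f"
 by (simp add: Lp_norm_def)

context finite_markovian_form
begin

abbreviation "Pt \<equiv> heat D"

lemma heat_Lp:
 assumes "1 <= q" "0 <= t" "f : Lp q M"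
 shows "Pt t f : Lp q M" "Lp_norm q M (Pt t f) <= Lp_norm q M f"
  "g : Lp q M ==> AE x in M. Pt t (%x. f x - g x) x = Pt t f x - Pt t g x"
  "(AE x in M. 0 <= f x) ==> AE x in M. 0 <= Pt t f x"
proof -
 have *: "positive_contraction_semigroup q M Pt"
  using is_heat_semigroup_heat assms(1) unfolding is_heat_semigroup_def by blast
 show "Pt t f : Lp q M" "Lp_norm q M (Pt t f) <= Lp_norm q M f"
  using * assms(2,3) unfolding positive_contraction_semigroup_def by blast+
 show "(AE x in M. 0 <= f x) ==> AE x in M. 0 <= Pt t f x"
  using * assms(2,3) unfolding positive_contraction_semigroup_def by blast
 show "AE x in M. Pt t (%x. f x - g x) x = Pt t f x - Pt t g x" if "g : Lp q M"
 proof -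
  have "AE x in M. Pt t (%x. 1 * f x + (-1) * g x) x = 1 * Pt t f x + (-1) * Pt t g x"
   using * assms(2,3) that unfolding positive_contraction_semigroup_def by blast
  thus ?thesis by simp
 qed
qed

lemma heat_mono:
 assumes "1 <= q" "0 <= t" "f : Lp q M" "g : Lp q M" "(%x. g x - f x) : Lp q M" "AE x in M. f x <= g x"
 shows "AE x in M. Pt t f x <= Pt t g x"
proof -
 have "AE x in M. 0 <= Pt t (%x. g x - f x) x" by (rule heat_Lp(4)[OF assms(1,2,5)]) (use assms(6) in simp)
 with heat_Lp(3)[OF assms(1,2,4,3)] show ?thesis by eventually_elim simp
qed

lemma heat_le_const:
 assumes t: "0 <= t" and f: "f : borel_measurable M" "AE x in M. \<bar>f x\<bar> <= c" and c: "0 <= c"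
 shows "AE x in M. Pt t f x <= c"
proof -
 have fL: "f : Lp \<infinity> M" using f by (auto simp: Lp_def)
 have q: "(1::ennreal) <= \<infinity>" by simp
 note P = heat_Lp[OF q t fL]
 let ?A = "{C. 0 <= C & (AE x in M. \<bar>Pt t f x\<bar> <= C)}"
 obtain C where "AE x in M. \<bar>Pt t f x\<bar> <= C" using P(1) by (auto simp: Lp_def)
 hence "AE x in M. \<bar>Pt t f x\<bar> <= \<bar>C\<bar>" by eventually_elim simp
 hence ne: "?A ~= {}" using abs_ge_zero by blast
 have "Inf {C. 0 <= C & (AE x in M. \<bar>f x\<bar> <= C)} <= c"
  by (rule cInf_lower) (use f c in \<open>auto intro: bdd_belowI[of _ 0]\<close>)
 hence "Inf ?A <= c" using P(2) by (simp add: Lp_norm_def)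
 \<comment> \<open>Bounds slightly above the infimum are essential bounds; intersecting countably
   many of them reaches \<open>c\<close> without discussing whether the infimum is attained.\<close>
 have "AE x in M. Pt t f x <= c + 1 / real (Suc n)" for n
 proof -
  have "Inf ?A < c + 1 / real (Suc n)" using \<open>Inf ?A <= c\<close> by (simp add: add_strict_increasing2 less_le_trans le_less_trans)
  then obtain C where "C : ?A" "C < c + 1 / real (Suc n)" using cInf_lessD[OF ne] by blast
  thus ?thesis by (auto elim!: eventually_mono)
 qed
 hence "AE x in M. ALL n. Pt t f x <= c + 1 / real (Suc n)" by (simp add: AE_all_countable del: of_nat_Suc)
 thus ?thesis
 proof eventually_elim
  case (elim x)
  have "(%n. c + 1 / real (Suc n)) ----> c + 0" by (intro tendsto_add tendsto_const LIMSEQ_Suc[OF lim_1_over_n])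
  thus ?case using elim by (intro LIMSEQ_le_const[of _ "c"]) auto
 qed
qed

text \<open>Positivity gives the same inequality for the positive part. Integrating it and using
  contractivity in mean bounds the integral by \<open>exp (- t)\<close> times itself, so it
  vanishes.\<close>

lemma defective_nonpos:
 assumes v: "integrable M v" and t: "0 < t" and le: "AE x in M. v x <= exp (- t) * Pt t v x"
 shows "AE x in M. v x <= 0"
proof -
 let ?p = "%x. max (v x) 0"
 have p: "integrable M ?p" "integrable M (%x. ?p x - v x)" using v by auto
 have t0: "0 <= t" using t by simp
 note q = order_refl[of "1::ennreal"]
 note pL = p[folded mem_Collect_eq[of _ "integrable M"], folded Lp_1] and vL = v[folded mem_Collect_eq[of _ "integrable M"], folded Lp_1]
 note P = heat_Lp[OF q t0 pL(1)]
 have "AE x in M. Pt t v x <= Pt t ?p x" by (rule heat_mono[OF q t0 vL pL]) simp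
 moreover have "AE x in M. 0 <= Pt t ?p x" by (rule P(4)) simp
 ultimately have "AE x in M. ?p x <= exp (- t) * \<bar>Pt t ?p x\<bar>" using le
 proof eventually_elim
  case (elim x)
  have "exp (- t) * Pt t v x <= exp (- t) * \<bar>Pt t ?p x\<bar>" using elim(1,2) by (intro mult_left_mono) auto
  moreover have "0 <= exp (- t) * \<bar>Pt t ?p x\<bar>" by simp
  ultimately show ?case using elim(3) by (intro max.boundedI) linarith+
 qed
 hence "(LINT x|M. ?p x) <= (LINT x|M. exp (- t) * \<bar>Pt t ?p x\<bar>)"
  using p P(1) by (intro integral_mono_AE) (auto simp: Lp_1)
 also have "... <= exp (- t) * (LINT x|M. ?p x)" using P(2) by (simp add: Lp_norm_1)
 finally have "(1 - exp (- t)) * (LINT x|M. ?p x) <= 0" by (simp add: algebra_simps)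
 moreover have "exp (- t) < 1" using t by simp
 ultimately have "(LINT x|M. ?p x) <= 0" by (simp add: mult_le_0_iff)
 hence "AE x in M. ?p x = 0" using p by (intro L1_nrm_null) auto
 thus ?thesis by eventually_elim (simp add: max_def split: if_splits)
qed

text \<open>Both \<open>w\<close> and the constant \<open>c\<close> are excessive for the damped
  semigroup, and positivity preserves this under minima.\<close>

lemma excessive_min:
 assumes w: "integrable M w" "AE x in M. 0 <= w x" and c: "0 <= c" and t: "0 <= t"
  and ex: "AE x in M. exp (- t) * Pt t w x <= w x"
 shows "AE x in M. exp (- t) * Pt t (%x. min (w x) c) x <= min (w x) c"
proof -
 let ?b = "%x. min (w x) c"
 have wm: "w : borel_measurable M" using w by simp
 have b: "AE x in M. \<bar>?b x\<bar> <= c" using w(2) by eventually_elim (use c in auto)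
 have bi: "integrable M ?b" using w(1) by (intro integrable_min) auto
 have "AE x in M. Pt t ?b x <= Pt t w x"
  by (rule heat_mono[OF order_refl t]) (use bi w in \<open>auto simp: Lp_1\<close>)
 moreover have "AE x in M. Pt t ?b x <= c" by (rule heat_le_const[OF t _ b c]) (use wm in measurable)
 ultimately show ?thesis using ex
 proof eventually_elim
  case (elim x)
  have "exp (- t) * Pt t ?b x <= exp (- t) * Pt t w x" "exp (- t) * Pt t ?b x <= exp (- t) * c"
   using elim(1,2) by (auto intro: mult_left_mono)
  moreover have "exp (- t) * c <= 1 * c" using c t by (intro mult_right_mono) auto
  ultimately show ?case using elim(3) by (intro min.boundedI) linarith+
 qed
qed

text \<open>Testing \<open>(H + 1) y = \<beta> (b - y)\<close> with the positive part of \<open>y - b\<close>.\<close>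

lemma excessive_resolvent_le:
 assumes b: "b : L2 M" and ex: "!!t. 0 < t ==> AE x in M. exp (- t) * Pt t b x <= b x"
  and y: "Hop y (%x. \<beta> * (b x - y x) - y x)" and \<beta>: "0 < \<beta>"
 shows "AE x in M. y x <= b x"
proof -
 note D = HopD[OF y]
 let ?d = "%x. y x - b x" and ?z = "%x. max (y x - b x) 0" and ?h = "%x. \<beta> * (b x - y x) - y x"
 have d: "?d : L2 M" by (rule L2.diff_mem[OF D(2) b])
 have zm: "?z : borel_measurable M" using L2_measurable[OF d] by (intro borel_measurable_max) auto
 have z: "?z : L2 M" by (rule L2_bound[OF d zm]) auto
 have zd: "(%x. ?z x - ?d x) : L2 M" by (rule L2.diff_mem[OF z d])
 have q: "(1::ennreal) <= 2" by simp
 note hp = heat_Lp[OF q, unfolded Lp_2 Lp_norm_2]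
 let ?Q = "%t. N2 (%x. (Pt t y x - y x) / t + ?h x)"
 have lim: "(?Q \<longlongrightarrow> 0) (at_right 0)"
 proof -
  have "ALL f:L2 M. ALL g:L2 M. Hop f g \<longleftrightarrow> ((%t. N2 (%x. (Pt t f x - f x) / t + g x)) \<longlongrightarrow> 0) (at_right 0)"
   using is_heat_semigroup_heat unfolding is_heat_semigroup_def Lp_2 Lp_norm_2 by blast
  from this[rule_format, OF D(2,3), THEN iffD1, OF y] show ?thesis .
 qed
 \<comment> \<open>This bounds the difference quotient of the semigroup at \<open>y\<close>, tested
   with \<open>?z\<close>. Excessiveness replaces \<open>y - b\<close> by its positive part inside
   the semigroup, and \<open>L^2\<close> contractivity discards the rest; dividing out
   \<open>exp (- t)\<close> leaves the factor \<open>(exp t - 1) / t\<close>.\<close>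
 have bd: "- (?Q t * N2 ?z) <= ip ?h ?z + (exp t - 1) / t * ip y ?z" if t: "0 < t" for t
 proof -
  have t0: "0 <= t" using t by simp
  note Py = hp(1)[OF t0 D(2)] and Pb = hp(1)[OF t0 b] and Pd = hp(1)[OF t0 d] and Pz = hp(1)[OF t0 z]
  have mono: "AE x in M. Pt t ?d x <= Pt t ?z x" by (rule heat_mono[OF q t0, unfolded Lp_2, OF d z zd]) simp
  have "AE x in M. (y x - exp (- t) * Pt t y x) * ?z x >= ?z x * ?z x - exp (- t) * (Pt t ?z x * ?z x)"
   using mono hp(3)[OF t0 D(2) b] ex[OF t]
  proof eventually_elim
   case (elim x)
   have "exp (- t) * (Pt t y x - Pt t b x) <= exp (- t) * Pt t ?z x" using elim by simp
   hence "?d x - exp (- t) * Pt t ?z x <= y x - exp (- t) * Pt t y x" using elim(3) by (simp add: algebra_simps)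
   hence "(?d x - exp (- t) * Pt t ?z x) * ?z x <= (y x - exp (- t) * Pt t y x) * ?z x" by (rule mult_right_mono) simp
   moreover have "?d x * ?z x = ?z x * ?z x" by (simp add: max_def)
   ultimately show ?case by (simp add: algebra_simps)
  qed
  hence "(LINT x|M. ?z x * ?z x - exp (- t) * (Pt t ?z x * ?z x)) <= (LINT x|M. (y x - exp (- t) * Pt t y x) * ?z x)"
   by (intro integral_mono_AE Bochner_Integration.integrable_diff integrable_mult_right L2_integrable_mult L2.diff_mem L2.scale_mem z Pz Py D)
  hence "ip ?z ?z - exp (- t) * ip (Pt t ?z) ?z <= ip (%x. y x - exp (- t) * Pt t y x) ?z"
   using L2_integrable_mult[OF z z] L2_integrable_mult[OF Pz z] by (simp add: L2_inner_def)
  also have "... = ip y ?z - exp (- t) * ip (Pt t y) ?z"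
   using L2.diff_left[OF D(2) L2.scale_mem[OF Py] z] L2.scale_left[OF Py z] by simp
  finally have 1: "ip ?z ?z - exp (- t) * ip (Pt t ?z) ?z <= ip y ?z - exp (- t) * ip (Pt t y) ?z" .
  have "ip (Pt t ?z) ?z <= N2 (Pt t ?z) * N2 ?z" using L2.abs_le_nrm[OF Pz z] by linarith
  also have "... <= N2 ?z * N2 ?z" using hp(2)[OF t0 z] L2.nrm_nonneg[OF z] by (rule mult_right_mono)
  finally have "ip (Pt t ?z) ?z <= ip ?z ?z" using L2.nonneg[OF z] by simp
  hence "exp (- t) * ip (Pt t ?z) ?z <= 1 * ip ?z ?z"
   using t L2.nonneg[OF z] by (intro order_trans[OF mult_left_mono mult_right_mono]) auto
  hence "exp (- t) * ip (Pt t y) ?z <= ip y ?z" using 1 by simp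
  hence "ip (Pt t y) ?z <= exp t * ip y ?z" by (simp add: exp_minus field_simps)
  hence 2: "(ip (Pt t y) ?z - ip y ?z) / t <= (exp t - 1) / t * ip y ?z"
   using t by (simp add: divide_right_mono algebra_simps)
  let ?r = "%x. (1 / t) * (Pt t y x - y x) + ?h x"
  have m: "(%x. Pt t y x - y x) : L2 M" "(%x. (1 / t) * (Pt t y x - y x)) : L2 M" "?r : L2 M"
   by (intro L2.add_mem L2.scale_mem L2.diff_mem Py D)+
  have "\<bar>ip ?r ?z\<bar> <= ?Q t * N2 ?z" using L2.abs_le_nrm[OF m(3) z] by simp
  moreover have "ip ?r ?z = (ip (Pt t y) ?z - ip y ?z) / t + ip ?h ?z"
   unfolding L2.add_left[OF m(2) D(3) z] L2.scale_left[OF m(1) z] L2.diff_left[OF Py D(2) z] by simp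
  ultimately show ?thesis using 2 by linarith
 qed
 have "((%t. (exp t - 1) / t) \<longlongrightarrow> (1::real)) (at 0)"
  using DERIV_exp[of "0::real"] by (simp add: DERIV_def)
 hence e: "((%t. (exp t - 1) / t) \<longlongrightarrow> (1::real)) (at_right 0)" by (rule tendsto_within_subset) simp
 \<comment> \<open>As \<open>t\<close> tends to 0 that factor tends to 1 and supplies the zeroth
   order term, so \<open>?h + y = \<beta> * (b - y)\<close> is what remains to be tested.\<close>
 have "0 <= ip ?h ?z + 1 * ip y ?z"
 proof (rule tendsto_le[OF trivial_limit_at_right_real])
  show "((%t. - (?Q t * N2 ?z)) \<longlongrightarrow> 0) (at_right 0)" using tendsto_minus[OF tendsto_mult_right[OF lim, of "N2 ?z"]] by simp
  show "((%t. ip ?h ?z + (exp t - 1) / t * ip y ?z) \<longlongrightarrow> ip ?h ?z + 1 * ip y ?z) (at_right 0)" by (intro tendsto_intros e)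
  show "\<forall>\<^sub>F t in at_right 0. - (?Q t * N2 ?z) <= ip ?h ?z + (exp t - 1) / t * ip y ?z"
   using eventually_at_right_less[of 0] by eventually_elim (rule bd)
 qed
 also have "... = ip (%x. ?h x + y x) ?z" using L2.add_left[OF D(3,2) z] by simp
 also have "... = - \<beta> * ip ?z ?z"
  unfolding L2_inner_def by (subst integral_mult_right_zero[symmetric], rule Bochner_Integration.integral_cong) (auto simp: max_def algebra_simps)
 finally have "ip ?z ?z <= 0" using \<beta> by (simp add: mult_le_0_iff zero_le_mult_iff)
 hence "AE x in M. ?z x = 0" by (rule L2_null[OF z])
 thus ?thesis by eventually_elim (simp add: max_def split: if_splits)
qed

text \<open>The operator plus 1, applied to \<open>y j\<close>, is
  \<open>(j + 1) * (b - y j)\<close> with \<open>b = min w c\<close>.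
  \<open>excessive_resolvent_le\<close> makes this nonnegative, so each \<open>y j\<close> is a
  supersolution lying below \<open>b\<close>.\<close>

lemma excessive_approximation:
 assumes w: "integrable M w" "AE x in M. 0 <= w x" and c: "0 <= c"
  and ex: "!!t. 0 < t ==> AE x in M. exp (- t) * Pt t w x <= w x"
 obtains y where "!!j::nat. y j : F" "!!j. AE x in M. 0 <= y j x & y j x <= min (w x) c"
  "!!j \<phi>. \<phi> : F ==> AE x in M. 0 <= \<phi> x ==> 0 <= E (y j) \<phi> + ip (y j) \<phi>"
  "(%j. N2 (%x. y j x - min (w x) c)) ----> 0"
proof -
 let ?b = "%x. min (w x) c"
 have wm: "w : borel_measurable M" using w by simp
 have b0: "AE x in M. 0 <= ?b x" using w(2) by eventually_elim (use c in auto)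
 have "AE x in M. \<bar>?b x\<bar> <= c" using b0 by eventually_elim auto
 hence b: "?b : L2 M" using wm by (intro bounded_L2) measurable
 have exb: "AE x in M. exp (- t) * Pt t ?b x <= ?b x" if "0 < t" for t
  by (rule excessive_min[OF w c _ ex[OF that]]) (use that in simp)
 \<comment> \<open>With \<open>\<beta> = j + 1\<close>, the equation says that the operator plus
   \<open>\<beta> + 1\<close> sends \<open>y\<close> to \<open>\<beta> * b\<close>. As resolvents
   carry their parameter as a factor, the solution is \<open>\<beta> / (\<beta> + 1)\<close> times
   the resolvent of \<open>b\<close> at \<open>j + 2\<close>, which is
   \<open>Rn (Suc j)\<close>.\<close>
 define \<rho> where "\<rho> j = (real j + 1) / (real j + 2)" for j :: nat
 have \<rho>: "0 < \<rho> j" "\<rho> j <= 1" "\<rho> j * (real j + 2) = real j + 1" for j by (auto simp: \<rho>_def)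
 have p: "0 < real (Suc (Suc j))" for j by simp
 let ?r = "%j. Rn (Suc j) ?b"
 define y where "y j x = \<rho> j * ?r j x" for j x
 note r = R_L2[OF p b]
 have H: "Hop (y j) (%x. (real j + 1) * (?b x - y j x) - y j x)" for j
 proof -
  have "\<rho> j * ((real j + 2) * (?b x - ?r j x)) = (real j + 1) * (?b x - y j x) - y j x" for x
  proof -
   have "\<rho> j * ((real j + 2) * (?b x - ?r j x)) = (real j + 1) * ?b x - \<rho> j * (real j + 2) * ?r j x"
    unfolding \<rho>(3)[symmetric] by (simp add: algebra_simps)
   thus ?thesis by (simp add: y_def algebra_simps)
  qed
  thus ?thesis using Hop_lin[OF Hop_R[OF p b] Hop_R[OF p b], of "\<rho> j" j 0 j] unfolding y_def[abs_def] by (simp add: add.commute)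
 qed
 note D = HopD[OF H]
 have y0: "AE x in M. 0 <= y j x" for j
  using R_nonneg[OF p b b0, of j] by eventually_elim (use \<rho>(1)[of j] in \<open>simp add: y_def\<close>)
 have yb: "AE x in M. y j x <= ?b x" for j by (rule excessive_resolvent_le[OF b exb H]) simp_all
 show thesis
 proof (rule that)
  show "y j : F" for j by (rule D(1))
  show "AE x in M. 0 <= y j x & y j x <= ?b x" for j using y0[of j] yb[of j] by eventually_elim simp
  show "0 <= E (y j) \<phi> + ip (y j) \<phi>" if f: "\<phi> : F" "AE x in M. 0 <= \<phi> x" for j \<phi>
  proof -
   note fL = dom_L2[OF f(1)] and bL = L2.diff_mem[OF b D(2)[of j]]
   have "E (y j) \<phi> + ip (y j) \<phi> = (real j + 1) * ip (%x. ?b x - y j x) \<phi>"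
    unfolding D(4)[OF f(1)] L2.diff_left[OF L2.scale_mem[OF bL] D(2) fL] L2.scale_left[OF bL fL] by simp
   moreover have "0 <= ip (%x. ?b x - y j x) \<phi>"
    by (rule L2_inner_nonneg) (use yb[of j] f(2) in auto)
   ultimately show ?thesis by simp
  qed
  have "(%j. N2 (%x. ?r j x - ?b x) + 1 / (real j + 2) * N2 ?b) ----> 0 + 0 * N2 ?b"
  proof (intro tendsto_intros)
   show "(%j. N2 (%x. ?r j x - ?b x)) ----> 0" by (rule LIMSEQ_Suc[OF Rn_L2_tendsto[OF b]])
   show "(%j. 1 / (real j + 2)) ----> 0"
    using LIMSEQ_Suc[OF LIMSEQ_Suc[OF lim_1_over_n]] by (simp add: add.commute)
  qed
  hence l: "(%j. N2 (%x. ?r j x - ?b x) + 1 / (real j + 2) * N2 ?b) ----> 0" by simp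
  show "(%j. N2 (%x. y j x - ?b x)) ----> 0"
  proof (rule Lim_null_comparison[OF always_eventually l], rule allI)
   fix j
   have "(%x. y j x - ?b x) = (%x. (?r j x - ?b x) + (- 1 / (real j + 2)) * ?r j x)"
    by (auto simp: y_def \<rho>_def field_simps)
   hence "N2 (%x. y j x - ?b x) <= N2 (%x. ?r j x - ?b x) + N2 (%x. (- 1 / (real j + 2)) * ?r j x)"
    using L2.nrm_add[OF L2.diff_mem[OF r b] L2.scale_mem[OF r], of j "- 1 / (real j + 2)" j] by simp
   also have "N2 (%x. (- 1 / (real j + 2)) * ?r j x) = 1 / (real j + 2) * N2 (?r j)"
    unfolding L2.nrm_scale[OF r] by simp
   also have "... <= 1 / (real j + 2) * N2 ?b" using R_contraction[OF p b] by (intro mult_left_mono) auto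
   finally show "norm (N2 (%x. y j x - ?b x)) <= N2 (%x. ?r j x - ?b x) + 1 / (real j + 2) * N2 ?b"
    using L2.nrm_nonneg[OF L2.diff_mem[OF D(2) b]] by simp
  qed
 qed
qed

end

section \<open>The truncated power function\<close>

text \<open>The quotient of the two constants in \<open>powr_complement_bounds\<close>; it equals 1
  for \<open>p = 1\<close> and measures the loss in \<open>lip_powr_slope\<close>.\<close>

definition powr_ratio :: "real => real" where "powr_ratio p = min 1 p / max 1 p"

text \<open>For \<open>p < 1\<close> the power is shifted by \<open>1\<close> to make it Lipschitz at \<open>0\<close>.\<close>

definition offset :: "real => real" where "offset p = (if p < 1 then 1 else 0)"

definition lip_powr :: "real => real => real" where
 "lip_powr p x = (max x 0 + offset p) powr p - offset p powr p"

text \<open>Compare the power with its tangent at 1 and with its chord on \<open>[0, 1]\<close>;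
  which of the two is the lower bound depends on whether \<open>p\<close> is below 1. The tangent
  inequality is Young's inequality with one factor 1.\<close>

lemma powr_complement_bounds:
 assumes p: "0 < p" and y': "0 <= y" "y <= (1::real)"
 shows "min 1 p * (1 - y) <= 1 - y powr p" "1 - y powr p <= max 1 p * (1 - y)"
proof -
 have "y = 0 | 0 < y & y <= 1" using y' by auto
 moreover have "min 1 p * (1 - y) <= 1 - y powr p & 1 - y powr p <= max 1 p * (1 - y)" if y: "0 < y & y <= 1"
 proof (cases "p <= 1")
  case True
  have "y powr p * 1 powr (1 - p) <= p * y + (1 - p) * 1" using True p y by (intro Youngs_inequality_0) auto
  moreover have "y powr 1 <= y powr p" using True y by (intro powr_mono') auto
  ultimately show ?thesis using True y by (simp add: algebra_simps)
 next
  case False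
  have "(y powr p) powr (1 / p) * 1 powr (1 - 1 / p) <= 1 / p * (y powr p) + (1 - 1 / p) * 1"
   using False p y by (intro Youngs_inequality_0) auto
  hence "y <= 1 / p * (y powr p) + (1 - 1 / p)" using p y by (simp add: powr_powr)
  hence "p * y <= p * (1 / p * (y powr p) + (1 - 1 / p))" using p by (intro mult_left_mono) auto
  also have "... = y powr p + (p - 1)" using p by (simp add: algebra_simps)
  finally have "p * y <= y powr p + (p - 1)" .
  moreover have "y powr p <= y powr 1" using False y by (intro powr_mono') auto
  ultimately show ?thesis using False y by (simp add: algebra_simps)
 qed
 ultimately show "min 1 p * (1 - y) <= 1 - y powr p" "1 - y powr p <= max 1 p * (1 - y)" by auto
qed

lemma powr_difference:
 assumes "0 < A" "0 <= (B::real)" shows "A powr p - B powr p = A powr p * (1 - (B / A) powr p)"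
 using assms by (simp add: powr_divide field_simps)

lemma lip_powr_0: "x <= 0 ==> lip_powr p x = 0"
 by (simp add: lip_powr_def)

context
 fixes p :: real
 assumes p: "0 < p"
begin

abbreviation d where "d \<equiv> offset p"

lemma d: "0 <= d" by (simp add: offset_def)

lemma powr_ratio_pos: "0 < powr_ratio p" using p by (simp add: powr_ratio_def)

lemma lip_powr_mono: "x <= y ==> lip_powr p x <= lip_powr p y"
 using p d by (simp add: lip_powr_def powr_mono2)

lemma lip_powr_nonneg: "0 <= lip_powr p x"
 using lip_powr_mono[of 0 x] lip_powr_mono[of x 0] lip_powr_0[of x p] lip_powr_0[of 0 p] by (cases "x <= 0") auto

lemma lip_powr_times_nonneg: "0 <= x * lip_powr p x"
 using lip_powr_nonneg[of x] lip_powr_0[of x p] by (cases "x <= 0") auto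

text \<open>A difference version of the statement that \<open>a\<close> times the derivative at
  \<open>a\<close> dominates a multiple of the value. In the shifted variables the upper bound is
  used for the value and the lower one for the difference, whence the constant.\<close>

lemma lip_powr_slope:
 assumes "0 < b" "b <= a"
 shows "powr_ratio p * (a - b) * lip_powr p a <= a * (lip_powr p a - lip_powr p b)"
proof -
 define A B where "A = a + d" and "B = b + d"
 have AB: "0 < A" "0 < B" "B <= A" "d <= B" "a - b = A - B" "a = A - d" using assms d by (auto simp: A_def B_def)
 have \<psi>: "lip_powr p a = A powr p - d powr p" "lip_powr p a - lip_powr p b = A powr p - B powr p"
  using assms by (auto simp: lip_powr_def A_def B_def)
 have "max 1 p * (powr_ratio p * (A - B) * (1 - (d / A) powr p)) = min 1 p * (A - B) * (1 - (d / A) powr p)"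
  using p by (simp add: powr_ratio_def)
 also have "... <= min 1 p * (A - B) * (max 1 p * (1 - d / A))"
  using powr_complement_bounds(2)[OF p, of "d / A"] d AB p by (intro mult_left_mono) auto
 also have "... = max 1 p * ((A - d) * (min 1 p * (1 - B / A)))" using AB(1) by (simp add: field_simps)
 finally have "powr_ratio p * (A - B) * (1 - (d / A) powr p) <= (A - d) * (min 1 p * (1 - B / A))"
  using p by (simp add: mult_le_cancel_left_pos less_max_iff_disj)
 also have "... <= (A - d) * (1 - (B / A) powr p)"
  using powr_complement_bounds(1)[OF p, of "B / A"] AB by (intro mult_left_mono) auto
 finally have "A powr p * (powr_ratio p * (A - B) * (1 - (d / A) powr p)) <= A powr p * ((A - d) * (1 - (B / A) powr p))"
  by (rule mult_left_mono) simp
 thus ?thesis unfolding \<psi>(2) unfolding \<psi>(1) AB(5) powr_difference[OF AB(1) d] powr_difference[OF AB(1) less_imp_le[OF AB(2)]] using AB(6) by (simp add: mult_ac)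
qed

text \<open>For \<open>p < 1\<close> the shift keeps the base at least 1, so the decreasing factor
  \<open>A powr (p - 1)\<close> stays bounded; for other \<open>p\<close> it is bounded by its value
  at \<open>c + 1\<close>.\<close>

lemma lip_powr_lipschitz:
 assumes "\<bar>x\<bar> <= c" "\<bar>y\<bar> <= c"
 shows "\<bar>lip_powr p x - lip_powr p y\<bar> <= (max 1 p * (c + 1) powr p) * \<bar>x - y\<bar>"
proof -
 let ?L = "max 1 p * (c + 1) powr p"
 have *: "lip_powr p a - lip_powr p b <= ?L * (a - b)" if "\<bar>a\<bar> <= c" "b <= a" for a b
 proof (cases "a <= 0")
  case True thus ?thesis using that by (simp add: lip_powr_0)
 next
  case False
  define A B where "A = max a 0 + d" and "B = max b 0 + d"
  have AB: "0 < A" "0 <= B" "B <= A" "d <= A" "A - B <= a - b" "A <= c + 1"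
   using that False by (auto simp: A_def B_def offset_def)
  have "A powr (p - 1) <= (c + 1) powr p"
  proof (cases "p < 1")
   case True
   hence "1 <= A" using AB(4) by (simp add: offset_def)
   hence "A powr (p - 1) <= A powr 0" "1 powr p <= (c + 1) powr p" using True p that by (intro powr_mono powr_mono2; simp)+
   thus ?thesis using AB(1) by simp
  next
   case False
   hence "A powr (p - 1) <= (c + 1) powr (p - 1)" "(c + 1) powr (p - 1) <= (c + 1) powr p"
    using AB that by (intro powr_mono2 powr_mono; simp)+
   thus ?thesis by simp
  qed
  hence L: "max 1 p * A powr (p - 1) <= ?L" by (intro mult_left_mono) auto
  have "lip_powr p a - lip_powr p b = A powr p * (1 - (B / A) powr p)"
   unfolding powr_difference[OF AB(1,2), symmetric] by (simp add: lip_powr_def A_def B_def)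
  also have "... <= A powr p * (max 1 p * (1 - B / A))"
   using powr_complement_bounds(2)[OF p, of "B / A"] AB by (intro mult_left_mono) auto
  also have "... = (max 1 p * A powr (p - 1)) * (A - B)" using AB(1) by (simp add: Transcendental.powr_diff field_simps)
  also have "... <= ?L * (a - b)" by (rule mult_mono[OF L AB(5)]) (use AB p in auto)
  finally show ?thesis .
 qed
 show ?thesis
 proof (cases "y <= x")
  case True thus ?thesis using *[OF assms(1) True] lip_powr_mono[OF True] by simp
 next
  case False
  hence xy: "x <= y" by simp
  thus ?thesis using *[OF assms(2) xy] lip_powr_mono[OF xy] by simp
 qed
qed

text \<open>For \<open>p < 1\<close> this is subadditivity of the power, which allows the shift to
  be dropped; it follows from \<open>y <= y powr p\<close> on the unit interval.\<close>

lemma lip_powr_le: "x * lip_powr p x <= max x 0 powr (p + 1)"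
proof (cases "0 < x")
 case True
 have "lip_powr p x <= x powr p"
 proof (cases "p < 1")
  case p1: True
  have y: "y <= y powr p" if "0 <= y" "y <= 1" for y using powr_complement_bounds(2)[OF p that] p1 by simp
  have "x / (x + 1) + 1 / (x + 1) <= (x / (x + 1)) powr p + (1 / (x + 1)) powr p" using True by (intro add_mono y) auto
  hence "(x + 1) powr p <= x powr p + 1" using True by (simp add: powr_divide add_divide_distrib[symmetric] field_simps)
  thus ?thesis using p1 True by (simp add: lip_powr_def offset_def)
 qed (use True in \<open>simp add: lip_powr_def offset_def\<close>)
 hence "x * lip_powr p x <= x * x powr p" using True by simp
 thus ?thesis using True by (simp add: powr_add mult.commute)
qed (simp add: lip_powr_0)

lemma lip_powr_pos: "0 < x ==> 0 < lip_powr p x"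
 using powr_less_mono2[OF p d, of "x + d"] by (simp add: lip_powr_def)

text \<open>The Caccioppoli estimate at a pair of points, with \<open>a\<close>, \<open>b\<close>
  values of the subsolution and \<open>s\<close>, \<open>t\<close> values of the cutoff. By symmetry
  let \<open>b <= a\<close>; if \<open>b <= 0\<close> every term is nonnegative. Otherwise, in
  \<open>s\<close> and \<open>u = s - t\<close>, the expression times \<open>powr_ratio p\<close> is
  a quadratic form, and \<open>lip_powr_slope\<close> is what makes its discriminant
  nonpositive.\<close>

lemma caccioppoli_pointwise:
 "0 <= (a - b) * (s\<^sup>2 * lip_powr p a - t\<^sup>2 * lip_powr p b)
  + 1 / powr_ratio p * ((s - t)\<^sup>2 * (a * lip_powr p a + b * lip_powr p b))"
proof -
 have main: "0 <= (a - b) * (s\<^sup>2 * lip_powr p a - t\<^sup>2 * lip_powr p b)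
  + 1 / powr_ratio p * ((s - t)\<^sup>2 * (a * lip_powr p a + b * lip_powr p b))"
  if ba: "b <= a" for a b s t
 proof -
  let ?P = "lip_powr p a" and ?Q = "lip_powr p b"
  have n: "0 <= 1 / powr_ratio p * ((s - t)\<^sup>2 * (a * ?P + b * ?Q))"
   by (intro mult_nonneg_nonneg[of "1 / powr_ratio p"] mult_nonneg_nonneg[of "(s - t)\<^sup>2"] add_nonneg_nonneg lip_powr_times_nonneg)
    (use powr_ratio_pos in auto)
  show ?thesis
  proof (cases "0 < b")
   case False
   hence "?Q = 0" by (intro lip_powr_0) simp
   moreover have "0 <= (a - b) * (s\<^sup>2 * ?P)" using ba lip_powr_nonneg[of a] by (intro mult_nonneg_nonneg) auto
   ultimately show ?thesis using n by simp
  next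
   case True
   define m where "m = powr_ratio p * (a - b)"
   define u where "u = s - t"
   define N where "N = a * ?P + b * ?Q - m * ?Q"
   have m: "0 <= m" using ba powr_ratio_pos by (simp add: m_def)
   have Q: "0 <= ?Q" "?Q <= ?P" using lip_powr_nonneg lip_powr_mono[OF ba] by auto
   have slope: "m * ?P <= a * (?P - ?Q)" unfolding m_def by (rule lip_powr_slope[OF True ba])
   have mQ: "m * ?Q <= a * (?P - ?Q)" using mult_left_mono[OF Q(2) m] slope by linarith
   have "a * (?P - ?Q) <= a * ?P" using Q True ba by (intro mult_left_mono) auto
   hence N1: "a * ?P - m * ?Q <= N" "0 <= a * ?P - m * ?Q" using True Q mQ by (auto simp: N_def)
   have eq: "powr_ratio p * ((a - b) * (s\<^sup>2 * ?P - t\<^sup>2 * ?Q) + 1 / powr_ratio p * (u\<^sup>2 * (a * ?P + b * ?Q)))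
     = m * (?P - ?Q) * s\<^sup>2 + 2 * (m * ?Q) * s * u + N * u\<^sup>2"
    using powr_ratio_pos by (simp add: m_def N_def u_def power2_eq_square algebra_simps)
   have disc: "(m * ?Q)\<^sup>2 <= (m * (?P - ?Q)) * N"
   proof -
    have "(m * ?Q) * ?P <= a * (?P - ?Q) * ?P" using mQ Q by (intro mult_right_mono) auto
    hence "m * (?Q * ?Q) <= (?P - ?Q) * (a * ?P - m * ?Q)" by (simp add: algebra_simps)
    also have "... <= (?P - ?Q) * N" using N1 Q by (intro mult_left_mono) auto
    finally have "m * (m * (?Q * ?Q)) <= m * ((?P - ?Q) * N)" using m by (rule mult_left_mono)
    thus ?thesis by (simp add: power2_eq_square mult_ac)
   qed
   have A0: "0 <= m * (?P - ?Q)" using m Q by simp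
   have "0 <= m * (?P - ?Q) * s\<^sup>2 + 2 * (m * ?Q) * s * u + N * u\<^sup>2"
   proof (cases "m * (?P - ?Q) = 0")
    case True
    have Q0: "m * ?Q = 0" using disc unfolding True by simp
    show ?thesis unfolding True Q0 using N1 by simp
   next
    case False
    have "m * (?P - ?Q) * (m * (?P - ?Q) * s\<^sup>2 + 2 * (m * ?Q) * s * u + N * u\<^sup>2)
     = (m * (?P - ?Q) * s + m * ?Q * u)\<^sup>2 + (m * (?P - ?Q) * N - (m * ?Q)\<^sup>2) * u\<^sup>2"
     by (simp add: power2_eq_square algebra_simps)
    also have "... >= 0" using disc by (intro add_nonneg_nonneg mult_nonneg_nonneg) auto
    finally show ?thesis using A0 False by (simp add: zero_le_mult_iff)
   qed
   thus ?thesis unfolding eq[symmetric] unfolding u_def using powr_ratio_pos by (simp only: zero_le_mult_iff) auto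
  qed
 qed
 show ?thesis
 proof (cases "b <= a")
  case True thus ?thesis by (rule main)
 next
  case False
  thus ?thesis using main[of a b t s] by (simp add: power2_commute[of s t] add.commute algebra_simps)
 qed
qed

lemma lip_powr_times_lipschitz:
 assumes "\<bar>x\<bar> <= c" "\<bar>y\<bar> <= c"
 shows "\<bar>x * lip_powr p x - y * lip_powr p y\<bar> <= 2 * c * (max 1 p * (c + 1) powr p) * \<bar>x - y\<bar>"
proof -
 let ?L = "max 1 p * (c + 1) powr p"
 have L: "0 <= ?L" using d p by simp
 have "\<bar>lip_powr p y\<bar> <= ?L * \<bar>y\<bar>"
  using lip_powr_lipschitz[OF assms(2), of 0] assms(2) lip_powr_0[of 0 p] by simp
 also have "... <= ?L * c" using assms(2) L by (rule mult_left_mono)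
 finally have 1: "\<bar>lip_powr p y\<bar> * \<bar>x - y\<bar> <= ?L * c * \<bar>x - y\<bar>" by (rule mult_right_mono) simp
 have 2: "\<bar>x\<bar> * \<bar>lip_powr p x - lip_powr p y\<bar> <= c * (?L * \<bar>x - y\<bar>)"
  using assms lip_powr_lipschitz[OF assms] L by (intro mult_mono) auto
 have "x * lip_powr p x - y * lip_powr p y = x * (lip_powr p x - lip_powr p y) + lip_powr p y * (x - y)"
  by (simp add: algebra_simps)
 hence "\<bar>x * lip_powr p x - y * lip_powr p y\<bar> <= \<bar>x\<bar> * \<bar>lip_powr p x - lip_powr p y\<bar> + \<bar>lip_powr p y\<bar> * \<bar>x - y\<bar>"
  using abs_triangle_ineq by (simp add: abs_mult[symmetric])
 moreover have "2 * c * ?L * \<bar>x - y\<bar> = c * (?L * \<bar>x - y\<bar>) + ?L * c * \<bar>x - y\<bar>" by simp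
 ultimately show ?thesis using 1 2 by linarith
qed

end

section \<open>The local energy estimate\<close>

context dirichlet
begin

text \<open>Extends the density bound from test functions to bounded domain functions, which need be
  neither continuous nor compactly supported. The factor \<open>\<theta>\<close>, equal to 1 on the
  support of \<open>\<eta>\<close>, localises the weight; bounded energies suffice for the passage
  to the limit.\<close>

lemma energy_cutoff_le:
 assumes \<eta>: "\<eta> : L" and bd: "!!\<phi>. \<phi> : L ==> (!!x. 0 <= \<phi> x) ==> energy \<phi> \<eta> \<eta> <= e * (LINT x|M. \<phi> x)"
  and \<theta>: "\<theta> : L" "!!x. 0 <= \<theta> x" "!!x. x : supp \<eta> ==> \<theta> x = 1"
  and \<phi>: "\<phi> : Fb" "!!x. 0 <= \<phi> x"
 shows "energy \<phi> \<eta> \<eta> <= e * ip \<theta> \<phi>"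
proof -
 note \<eta>b = L_Fb[OF \<eta>] and \<theta>b = L_Fb[OF \<theta>(1)]
 let ?w = "%x. \<theta> x * \<phi> x"
 have w: "?w : Fb" by (rule Fb_mult[OF \<theta>b \<phi>(1)])
 obtain c1 where c1: "0 < c1" "AE x in M. \<bar>\<phi> x\<bar> <= c1" by (rule Fb_bound[OF \<phi>(1)])
 obtain c2 where c2: "0 < c2" "AE x in M. \<bar>\<theta> x\<bar> <= c2" by (rule Fb_bound[OF \<theta>b])
 have r: "AE x in M. 0 <= \<phi> x & \<phi> x <= c1" using c1(2) by eventually_elim (use \<phi>(2) in auto)
 obtain g C where g: "!!n. g n : L" "!!n x. 0 <= g n x & g n x <= c1"
  "(%n. L2_nrm M (%x. g n x - \<phi> x)) ----> 0" "0 <= C" "!!n. E (g n) (g n) <= C"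
  by (rule L_bounded_sequence[OF FbD[OF \<phi>(1)] r order_refl less_imp_le[OF c1(1)]]) blast
 let ?g = "%n x. \<theta> x * g n x"
 have gL: "?g n : L" for n by (rule L_mult[OF \<theta>(1) g(1)])
 note gb = L_Fb[OF g(1)] and wb = L_Fb[OF gL]
 have gbd: "AE x in M. \<bar>g n x\<bar> <= c1" for n by (rule AE_I2) (use g(2)[of n] in auto)
 have wbd: "AE x in M. \<bar>?g n x\<bar> <= c2 * c1" for n
  using gbd[of n] c2(2) by eventually_elim (use c2(1) in \<open>auto simp: abs_mult intro: mult_mono\<close>)
 obtain C1 where m1: "(%n. L2_nrm M (%x. ?g n x - ?w x)) ----> 0" "!!n. E (?g n) (?g n) <= C1"
  by (rule mult_bounded_tendsto[OF \<theta>b gb \<phi>(1) gbd g(3,5)]) (rule that)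
 obtain C2 where m2: "(%n. L2_nrm M (%x. \<eta> x * ?g n x - \<eta> x * ?w x)) ----> 0"
  "!!n. E (%x. \<eta> x * ?g n x) (%x. \<eta> x * ?g n x) <= C2"
  by (rule mult_bounded_tendsto[OF \<eta>b wb w wbd m1]) (rule that)
 have en: "energy k \<eta> \<eta> = E (%x. \<eta> x * k x) \<eta> - 1/2 * E k (%x. (\<eta> x)\<^sup>2)" if "k : Fb" for k
  unfolding energy_self using E.sym[OF FbD[OF \<eta>b] FbD[OF Fb_mult[OF \<eta>b that]]] E.sym[OF FbD[OF that] FbD[OF Fb_square[OF \<eta>b]]]
  by (simp add: mult.commute)
 have "(%n. energy (?g n) \<eta> \<eta>) ----> energy ?w \<eta> \<eta>"
  unfolding en[OF wb] en[OF w]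
  by (intro tendsto_diff tendsto_mult tendsto_const weak_form_tendsto[OF FbD[OF wb] FbD[OF w] FbD[OF Fb_square[OF \<eta>b]] m1]
    weak_form_tendsto[OF FbD[OF Fb_mult[OF \<eta>b wb]] FbD[OF Fb_mult[OF \<eta>b w]] FbD[OF \<eta>b] m2])
 moreover have "(%n. e * ip (g n) \<theta>) ----> e * ip \<phi> \<theta>"
  by (intro tendsto_mult tendsto_const L2.tendsto_left[OF Fb_L2[OF gb] Fb_L2[OF \<phi>(1)] Fb_L2[OF \<theta>b] g(3)])
 moreover have "energy (?g n) \<eta> \<eta> <= e * ip (g n) \<theta>" for n
  using bd[OF gL[of n]] \<theta>(2) g(2) by (simp add: L2_inner_def mult.commute)
 ultimately have "energy ?w \<eta> \<eta> <= e * ip \<phi> \<theta>" by (intro LIMSEQ_le) auto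
 moreover have "energy \<phi> \<eta> \<eta> = energy ?w \<eta> \<eta>"
 proof -
  have d: "(%x. \<phi> x - ?w x) : F" by (rule E.diff_mem[OF FbD[OF \<phi>(1)] FbD[OF w]])
  have "E (%x. \<phi> x - ?w x) (%x. (\<eta> x)\<^sup>2) = 0"
  proof (rule form_local[OF d FbD[OF Fb_square[OF \<eta>b]] closedin_closure_of])
   show "AE x in M. x \<notin> supp \<eta> --> (\<eta> x)\<^sup>2 = 0" using AE_supp_zero[of \<eta>] by eventually_elim simp
   show "AE x in M. x : supp \<eta> --> \<phi> x - ?w x = 0" using \<theta>(3) by simp
  qed
  moreover have "E (%x. \<eta> x * \<phi> x) \<eta> = E (%x. \<eta> x * ?w x) \<eta>"
   by (rule form_cong_left[OF FbD[OF Fb_mult[OF \<eta>b \<phi>(1)]] FbD[OF Fb_mult[OF \<eta>b w]] FbD[OF \<eta>b]])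
    (rule AE_mp[OF AE_supp_zero[of \<eta>]], rule AE_I2, use \<theta>(3) in auto)
  ultimately show ?thesis
   unfolding en[OF \<phi>(1)] en[OF w] using E.diff_left[OF FbD[OF \<phi>(1)] FbD[OF w] FbD[OF Fb_square[OF \<eta>b]]] by simp
 qed
 moreover have "ip \<phi> \<theta> = ip \<theta> \<phi>" by (rule L2.sym[OF Fb_L2[OF \<phi>(1)] Fb_L2[OF \<theta>b]])
 ultimately show ?thesis by simp
qed

end

section \<open>Testing on a relatively compact open set\<close>

locale relatively_compact_open = open_subset +
 assumes U_compact: "compactin (top_of D) (top_of D closure_of U)"
begin

lemma U_top: "U <= \<Omega>" using U_open by (rule openin_subset)

lemma U_finite: "emeasure M U < \<infinity>"
proof -
 have "emeasure M U <= emeasure M (X closure_of U)"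
  by (rule emeasure_mono[OF closure_of_subset[OF U_top] compact_sets[OF M_sets U_compact]])
 also have "... < \<infinity>" using M_radon U_compact by (simp add: radon_measure_def)
 finally show ?thesis .
qed

sublocale DU: finite_markovian_form "subspace D U"
proof (intro finite_markovian_form.intro DU_closed_markovian finite_measureI)
 have "space (meas_of DU) = U" using U_top by (simp add: MU space_restrict_space M_space Int_absorb2)
 thus "emeasure (meas_of DU) (space (meas_of DU)) ~= \<infinity>"
  using U_finite U_top U_sets by (simp add: MU emeasure_restrict_space M_space Int_absorb2 less_top)
qed

text \<open>Trades the local form on the subspace for the global form: \<open>g\<close> is replaced
  by one function \<open>G\<close> of the domain that agrees with it on \<open>W\<close>, and test
  functions supported inside \<open>W\<close> cannot tell the difference.\<close>

lemma weakly_harmonic_test: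
 assumes g: "weakly_harmonic DU 1 g" and c: "0 <= c" "!!x. x : U ==> \<bar>g x\<bar> <= c"
  and W: "openin X W" "compactin X (X closure_of W)" "X closure_of W <= U"
 obtains G where "G : FU" "!!x. \<bar>G x\<bar> <= c" "AE x in M. x : W --> G x = g x"
  "ALL S k. compactin X S & S <= W & k : FU & (ALL x. 0 <= k x) & (AE x in M. x \<notin> S --> k x = 0) --> E G k + ip G k <= 0"
proof -
 have top: "top_of DU = subtopology X U" by (simp add: subspace_def)
 have WU: "W <= U" using closure_of_subset[OF openin_subset[OF W(1)]] W(3) by blast
 have opU: "openin (subtopology X U) V \<longleftrightarrow> openin X V & V <= U" for V by (rule openin_open_subtopology[OF U_open])
 have wi: "well_inside (top_of DU) W (topspace (top_of DU))"
  using W WU U_top unfolding well_inside_def top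
  by (simp add: opU U_open closure_of_subtopology Int_absorb1 compactin_subtopology)
 obtain h where h: "h : dom_of DU" "AE x in meas_of DU. x : W --> g x = h x"
  using g wi unfolding weakly_harmonic_def dom_loc_def by blast
 have hF: "ext h : FU" using h(1) by (simp add: DU_dom)
 have gm: "ext g : borel_measurable M"
  using g unfolding weakly_harmonic_def dom_loc_def Lp_loc_def by (auto simp: MU_measurable)
 \<comment> \<open>The representative of \<open>g\<close> is uncontrolled off \<open>W\<close>.
   Clamping it at the bound of \<open>g\<close> makes it bounded everywhere and leaves it unchanged
   on \<open>W\<close>.\<close>
 define T where "T y = max (- c) (min c y)" for y
 have T: "1-lipschitz_on UNIV T" "T 0 = 0" using c(1) by (auto intro!: lipschitz_onI simp: T_def dist_real_def)
 define G where "G x = T (ext h x)" for x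
 have G: "G : FU" unfolding G_def by (rule FU_lipschitz[OF hF T])
 have GW: "AE x in M. x : W --> G x = g x" using h(2) unfolding MU_AE
 proof eventually_elim
  case (elim x)
  show ?case
  proof
   assume x: "x : W"
   hence "ext h x = g x" "\<bar>g x\<bar> <= c" using elim WU c(2)[of x] by auto
   thus "G x = g x" by (auto simp: G_def T_def)
  qed
 qed
 have Ge: "ext G = G" using T(2) by (auto simp: G_def indicator_def)
 have test: "E G k + ip G k <= 0"
  if S: "compactin X S" "S <= W" and k: "k : FU" "!!x. 0 <= k x" "AE x in M. x \<notin> S --> k x = 0" for S k
 proof -
  have kF: "k : F" by (rule FU_F[OF k(1)])
  have ek: "ext k : FU" by (rule FU_ext[OF k(1)])
  have eke: "AE x in M. ext k x = k x" using FU_zero_off[OF k(1)] by eventually_elim (auto simp: indicator_def)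
  let ?A = "ae_support (top_of DU) (meas_of DU) k"
  have A_eq: "?A = U - \<Union>{V. openin X V & V <= U & (AE x in M. x : U --> x : V --> k x = 0)}"
   using U_top by (simp add: ae_support_def top opU MU_AE Int_absorb1)
  have SX: "closedin X S" by (rule compact_closed[OF S(1)])
  have AS: "?A <= S"
  proof -
   have "openin X (U - S)" by (rule openin_diff[OF U_open SX])
   moreover have "AE x in M. x : U --> x : U - S --> k x = 0" using k(3) by eventually_elim simp
   ultimately show ?thesis unfolding A_eq by blast
  qed
  have "closedin (top_of DU) ?A" unfolding ae_support_def by (intro closedin_diff closedin_topspace openin_Union) blast
  moreover have "compactin (top_of DU) S" using S WU by (simp add: top compactin_subtopology)
  ultimately have "compactin (top_of DU) ?A" using AS closed_compactin by blast
  hence kc: "k : dom_cpt DU" using ek by (simp add: dom_cpt_def DU_dom)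
  \<comment> \<open>\<open>form_loc\<close> is a definite description, so every admissible
    representative must be shown to give the same value; strong locality does this.\<close>
  have loc: "form_loc DU g k = E G k"
   unfolding form_loc_def
  proof (rule the_equality)
   have "E G k = form_of DU G k" unfolding DU_form Ge
    by (rule form_cong_right[OF FU_F[OF G] kF FU_F[OF ek]]) (use eke in \<open>eventually_elim, simp\<close>)
   moreover have "G : dom_of DU" using G Ge by (simp add: DU_dom)
   moreover have "openin (top_of DU) W" using W(1) WU by (simp add: top opU)
   moreover have "AE x in meas_of DU. x : W --> g x = G x" unfolding MU_AE using GW by eventually_elim simp
   ultimately show "EX h:dom_of DU. EX V. openin (top_of DU) V & ?A <= V & (AE x in meas_of DU. x : V --> g x = h x) & E G k = form_of DU h k"
    using AS S(2) by blast
  next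
   fix r assume "EX h:dom_of DU. EX V. openin (top_of DU) V & ?A <= V & (AE x in meas_of DU. x : V --> g x = h x) & r = form_of DU h k"
   then obtain h' V where h': "h' : dom_of DU" "?A <= V" "AE x in meas_of DU. x : V --> g x = h' x" "r = form_of DU h' k" by blast
   have h'F: "ext h' : F" using h'(1) FU_F by (simp add: DU_dom)
   \<comment> \<open>Supports are taken in \<open>X\<close> for one space and in \<open>U\<close>
     for the other. They can be compared because \<open>k\<close> vanishes off a compact subset of
     \<open>U\<close>.\<close>
   have sub: "ae_support X M k <= ?A"
   proof
    fix x assume x: "x : ae_support X M k"
    have xS: "x : S" using ae_support_subset[OF SX k(3)] x by blast
    show "x : ?A"
    proof (rule ccontr)
     assume "x \<notin> ?A"
     then obtain V' where V': "openin X V'" "V' <= U" "AE x in M. x : U --> x : V' --> k x = 0" "x : V'"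
      using xS S(2) WU unfolding A_eq by blast
     hence "AE x in M. x : V' --> k x = 0" by (auto elim!: eventually_mono)
     thus False using x V'(1,4) unfolding ae_support_def by blast
    qed
   qed
   have "AE x in M. x : ae_support X M k --> G x - ext h' x = 0" using GW h'(3)[unfolded MU_AE]
   proof eventually_elim
    case (elim x)
    show ?case
    proof
     assume "x : ae_support X M k"
     hence "x : ?A" using sub by blast
     hence "x : V" "x : W" using h'(2) AS S(2) by auto
     thus "G x - ext h' x = 0" using elim WU by auto
    qed
   qed
   hence ex: "EX c. AE x in M. x : ae_support X M k --> G x - ext h' x = c" by (rule exI)
   have "strongly_local_form D" using dirichlet by (simp add: strongly_local_dirichlet_space_def)
   from this[unfolded strongly_local_form_def, THEN bspec, OF E.diff_mem[OF FU_F[OF G] h'F], THEN bspec, OF kF, THEN mp, OF ex]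
   have "E (%x. G x - ext h' x) k = 0" .
   hence "E (ext h') k = E G k" using E.diff_left[OF FU_F[OF G] h'F kF] by simp
   moreover have "E (ext h') (ext k) = E (ext h') k" by (rule form_cong_right[OF h'F FU_F[OF ek] kF eke])
   ultimately show "r = E G k" using h'(4) by (simp add: DU_form)
  qed
  have "AE x in meas_of DU. 0 <= k x" using k(2) by simp
  hence "shifted_form_loc DU 1 g k <= 0" using g kc unfolding weakly_harmonic_def by blast
  moreover have "L2_inner (meas_of DU) g k = ip G k"
   unfolding MU_inner unfolding L2_inner_def
  proof (rule integral_cong_AE)
   show "AE x in M. ext g x * ext k x = G x * k x" using GW k(3)
    by eventually_elim (use WU S(2) in \<open>auto simp: indicator_def\<close>)
   show "(%x. ext g x * ext k x) : borel_measurable M" "(%x. G x * k x) : borel_measurable M"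
    using gm dom_measurable[OF FU_F[OF ek]] dom_measurable[OF FU_F[OF G]] dom_measurable[OF kF] by (auto intro: borel_measurable_times)
  qed
  ultimately show ?thesis by (simp add: shifted_form_loc_def loc)
 qed
 have "\<bar>G x\<bar> <= c" for x using c(1) by (auto simp: G_def T_def)
 thus thesis using test by (intro that[OF G _ GW]) auto
qed

lemma MU_indicator_integrable: "integrable M (%x. indicator U x * c :: real)"
 using U_finite U_sets by (simp add: less_top)

text \<open>The function \<open>g - h\<close> is nonnegative and excessive, its truncation is
  approximated from below by supersolutions \<open>y j\<close>, and \<open>G - y j\<close> is a
  bounded subsolution on \<open>W\<close> lying above \<open>h\<close>. The Caccioppoli estimate is
  applied to these subsolutions before \<open>j\<close> tends to infinity.\<close>

lemma local_estimate:
 assumes h: "integrable M (ext h)"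
  and g: "g : Cb_space (subtopology X U)" "weakly_harmonic DU 1 g"
  and defective: "!!t. 0 < t ==> AE x in meas_of DU. h x - g x <= exp (- t) * heat DU t (%y. h y - g y) x"
  and W: "openin X W" "compactin X (X closure_of W)" "X closure_of W <= U"
  and \<eta>: "\<eta> : L" "!!x. 0 <= \<eta> x & \<eta> x <= 1" "supp \<eta> <= W"
  and bd: "!!\<phi>. \<phi> : L ==> (!!x. 0 <= \<phi> x) ==> energy \<phi> \<eta> \<eta> <= e * (LINT x|M. \<phi> x)"
  and e: "0 <= e" and p: "0 < p"
 shows "(LINT x|M. (\<eta> x)\<^sup>2 * (h x * lip_powr p (h x))) <=
  2 / powr_ratio p * e * (LINT x|M. ext (%x. max (h x) 0 powr (p + 1)) x)"
proof -
 have WU: "W <= U" using closure_of_subset[OF openin_subset[OF W(1)]] W(3) by blast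
 have topU: "topspace (subtopology X U) = U" using U_top by (simp add: Int_absorb1)
 obtain c0 where c0: "!!x. x : U ==> \<bar>g x\<bar> <= c0"
  using g(1) unfolding Cb_space_def bounded_iff topU by auto
 \<comment> \<open>The maximum with 1 makes the bound strictly positive, as the Lipschitz estimates
   below require.\<close>
 define c where "c = max c0 1"
 have c: "0 < c" "!!x. x : U ==> \<bar>g x\<bar> <= c" using c0 by (auto simp: c_def intro: max.coboundedI1)
 have c_le: "0 <= c" using c(1) by simp
 have gm: "ext g : borel_measurable M"
  using g(2) unfolding weakly_harmonic_def dom_loc_def Lp_loc_def by (auto simp: MU_measurable)
 have gi: "integrable (meas_of DU) g"
  unfolding MU_integrable
  by (rule Bochner_Integration.integrable_bound[OF MU_indicator_integrable[of c] gm])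
   (rule AE_I2, use c in \<open>auto simp: indicator_def\<close>)
 have hi: "integrable (meas_of DU) h" using h by (simp add: MU_integrable)
 define v w where "v x = h x - g x" and "w x = g x - h x" for x
 have vi: "integrable (meas_of DU) v" and wi: "integrable (meas_of DU) w" unfolding v_def[abs_def] w_def[abs_def] using gi hi by auto
 have hg: "AE x in meas_of DU. v x <= 0"
  by (rule DU.defective_nonpos[OF vi zero_less_one]) (use defective[of 1] in \<open>simp add: v_def[abs_def]\<close>)
 have w0: "AE x in meas_of DU. 0 <= w x" using hg by eventually_elim (simp add: v_def w_def)
 have wex: "AE x in meas_of DU. exp (- t) * DU.Pt t w x <= w x" if t: "0 < t" for t
 proof -
  have q: "(1::ennreal) <= 1" "0 <= t" using t by auto
  have vL: "v : Lp 1 (meas_of DU)" "(%x. 0) : Lp 1 (meas_of DU)" using vi by (auto simp: Lp_1)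
  have eq: "w = (%x. 0 - v x)" by (auto simp: v_def w_def)
  show ?thesis
   unfolding eq using DU.heat_Lp(3)[OF q vL(2,1)] DU.heat_Lp(3)[OF q vL(1,1)] defective[OF t, folded v_def]
   by eventually_elim simp
 qed
 \<comment> \<open>The truncation level is the bound of \<open>g\<close>, which is what later
   identifies the positive parts of \<open>z\<close> and \<open>h\<close>.\<close>
 obtain y where y: "!!j::nat. y j : dom_of DU" "!!j. AE x in meas_of DU. 0 <= y j x & y j x <= min (w x) c"
  "!!j \<phi>. \<phi> : dom_of DU ==> AE x in meas_of DU. 0 <= \<phi> x ==> 0 <= form_of DU (y j) \<phi> + L2_inner (meas_of DU) (y j) \<phi>"
  "(%j. DU.N2 (%x. y j x - min (w x) c)) ----> 0"
  by (rule DU.excessive_approximation[OF wi w0 c_le wex]) (assumption | rule that)+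
 obtain G where G: "G : FU" "!!x. \<bar>G x\<bar> <= c" "AE x in M. x : W --> G x = g x"
  and test: "ALL S k. compactin X S & S <= W & k : FU & (ALL x. 0 <= k x) & (AE x in M. x \<notin> S --> k x = 0) --> E G k + ip G k <= 0"
  by (rule weakly_harmonic_test[OF g(2) c_le c(2) W]) (assumption | rule that)+
 have S: "compactin X (supp \<eta>)" using \<eta>(1) by (simp add: L_iff)
 have \<eta>U: "\<eta> : LU" using \<eta>(1,3) WU by (auto simp: LU_def)
 note \<eta>b = L_Fb[OF \<eta>(1)]
 obtain \<theta> where \<theta>: "\<theta> : L" "!!x. 0 <= \<theta> x & \<theta> x <= 1" "!!x. x : supp \<eta> ==> \<theta> x = 1" "supp \<theta> <= W"
  using L_urysohn[OF S W(1) \<eta>(3)] by blast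
 define u where "u j x = G x - ext (y j) x" for j x
 define z where "z x = G x - ext (%x. min (w x) c) x" for x
 have yF: "ext (y j) : FU" for j using y(1)[of j] by (simp add: DU_dom)
 have uFU: "u j : FU" for j unfolding u_def[abs_def] using FU_lin[OF G(1) yF[of j], of 1 "-1"] by simp
 have ub: "AE x in M. \<bar>u j x\<bar> <= 2 * c" for j
  using y(2)[of j, unfolded MU_AE]
 proof eventually_elim
  case (elim x)
  thus ?case using G(2)[of x] c(1) by (auto simp: u_def indicator_def)
 qed
 have uFb: "u j : Fb" for j by (rule FbI[OF FU_F[OF uFU] ub])
 have zb: "AE x in M. \<bar>z x\<bar> <= 2 * c"
  using w0[unfolded MU_AE]
 proof eventually_elim
  case (elim x)
  thus ?case using G(2)[of x] c(1) by (auto simp: z_def indicator_def)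
 qed
 have uz: "(%j. L2_nrm M (%x. u j x - z x)) ----> 0"
 proof -
  have "L2_nrm M (%x. u j x - z x) = DU.N2 (%x. y j x - min (w x) c)" for j
   unfolding MU_inner unfolding L2_inner_def
   by (intro arg_cong[of _ _ sqrt] Bochner_Integration.integral_cong) (auto simp: u_def z_def indicator_def algebra_simps)
  thus ?thesis using y(4) by simp
 qed
 let ?f = "lip_powr p" and ?C = "2 / powr_ratio p"
 define K where "K = max 1 p * (2 * c + 1) powr p"
 have K: "0 < K" using p c(1) by (simp add: K_def less_max_iff_disj)
 have fm: "?f : borel_measurable borel" unfolding lip_powr_def[abs_def] by measurable
 have f0: "?f 0 = 0" by (simp add: lip_powr_0)
 have rp: "0 < powr_ratio p" by (rule powr_ratio_pos[OF p])
 note fl = lip_powr_lipschitz[OF p, where c="2 * c", folded K_def]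
 have fu: "(%x. ?f (u j x)) : Fb" for j
 proof (rule FbI)
  show "(%x. ?f (u j x)) : F" by (rule lipschitz_mem(1)[OF FU_F[OF uFU] ub fl f0 K _ fm]) (use c in auto)
  show "AE x in M. \<bar>?f (u j x)\<bar> <= K * (2 * c)" using ub[of j]
  proof eventually_elim
   case (elim x)
   have "\<bar>?f (u j x)\<bar> <= K * \<bar>u j x\<bar>" using fl[OF elim, of 0] f0 c(1) by simp
   also have "... <= K * (2 * c)" using elim K by (intro mult_left_mono) auto
   finally show ?case .
  qed
 qed
 let ?P = "%j x. u j x * ?f (u j x)" and ?T = "%x. x * ?f x" and ?m = "%x. max (h x) 0 powr (p + 1)"
 have P: "?P j : Fb" for j by (rule Fb_mult[OF uFb fu])
 have P0: "0 <= ?P j x" for j x by (rule lip_powr_times_nonneg[OF p])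
 have main: "ip (%x. (\<eta> x)\<^sup>2) (?P j) <= ?C * e * ip \<theta> (?P j)" for j
 proof -
  \<comment> \<open>One factor \<open>\<eta>\<close> is kept outside so that \<open>FU_times\<close>
    applies; the remaining product is bounded and in the domain.\<close>
  let ?k = "%x. \<eta> x * (\<eta> x * ?f (u j x))"
  have k1: "(%x. \<eta> x * ?f (u j x)) : Fb" by (rule Fb_mult[OF \<eta>b fu])
  have k: "?k : FU" "?k : Fb" by (rule FU_times[OF \<eta>U k1], rule Fb_mult[OF \<eta>b k1])
  have k0: "0 <= ?k x" for x using \<eta>(2)[of x] lip_powr_nonneg[OF p] by (intro mult_nonneg_nonneg) auto
  have ks: "AE x in M. x \<notin> supp \<eta> --> ?k x = 0" using AE_supp_zero[of \<eta>] by eventually_elim simp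
  have 1: "E G ?k + ip G ?k <= 0" by (rule test[rule_format]) (use S \<eta>(3) k(1) k0 ks in auto)
  note ek = FU_ext[OF k(1)] and kF = FU_F[OF k(1)]
  have eke: "AE x in M. ext ?k x = ?k x" using FU_zero_off[OF k(1)] by eventually_elim (auto simp: indicator_def)
  have kd: "?k : dom_of DU" using ek by (simp add: DU_dom)
  have "AE x in meas_of DU. 0 <= ?k x" using k0 by simp
  note y3 = y(3)[OF kd this, of j, unfolded DU_form MU_inner]
  have "E (ext (y j)) (ext ?k) = E (ext (y j)) ?k" by (rule form_cong_right[OF FU_F[OF yF] FU_F[OF ek] kF eke])
  moreover have "ip (ext (y j)) (ext ?k) = ip (ext (y j)) ?k"
   by (rule L2_inner_cong_AE[OF _ eke]) (use dom_measurable[OF FU_F[OF yF[of j]]] dom_measurable[OF FU_F[OF ek]] dom_measurable[OF kF] in auto)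
  ultimately have 2: "0 <= E (ext (y j)) ?k + ip (ext (y j)) ?k" using y3 by linarith
  have "E (u j) ?k = E G ?k - E (ext (y j)) ?k" by (rule E.diff_left[OF FU_F[OF G(1)] FU_F[OF yF] kF, folded u_def])
  moreover have "ip (u j) ?k = ip G ?k - ip (ext (y j)) ?k"
   by (rule L2.diff_left[OF dom_L2[OF FU_F[OF G(1)]] dom_L2[OF FU_F[OF yF]] dom_L2[OF kF], folded u_def])
  moreover have "ip (u j) ?k = ip (%x. (\<eta> x)\<^sup>2) (?P j)"
   unfolding L2_inner_def by (rule Bochner_Integration.integral_cong) (auto simp: power2_eq_square)
  ultimately have 3: "E (u j) ?k <= - ip (%x. (\<eta> x)\<^sup>2) (?P j)" using 1 2 by linarith
  have "0 <= E (u j) ?k + ?C * energy (?P j) \<eta> \<eta>"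
  \<comment> \<open>\<open>?C\<close> is twice the constant of \<open>caccioppoli_pointwise\<close>,
    because the hypothesis to be met contains \<open>C / 2\<close>.\<close>
  proof (rule form_energy_nonneg[OF uFb k(2) \<eta>b P _ _ P0])
   show "0 <= ?C" using rp by simp
   show "0 <= u j x * ?k x" for x
    using mult_nonneg_nonneg[OF zero_le_square[of "\<eta> x"] P0[of j x]] by (simp add: mult_ac)
   show "0 <= (u j x - u j x') * (?k x - ?k x') + ?C / 2 * ((\<eta> x - \<eta> x')\<^sup>2 * (?P j x + ?P j x'))" for x x'
    using caccioppoli_pointwise[OF p, of "u j x" "u j x'" "\<eta> x" "\<eta> x'"] by (simp add: power2_eq_square[of "\<eta> _"] mult.assoc)
  qed
  moreover have "?C * energy (?P j) \<eta> \<eta> <= ?C * (e * ip \<theta> (?P j))"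
   by (intro mult_left_mono energy_cutoff_le \<eta>(1) bd \<theta> P P0) (use \<theta>(2) rp in auto)
  ultimately show ?thesis using 3 by simp
 qed
 have Tm: "?T : borel_measurable borel" using fm by measurable
 have "(%x. min (w x) c) : L2 (meas_of DU)"
 proof (rule DU.bounded_L2)
  show "(%x. min (w x) c) : borel_measurable (meas_of DU)" using borel_measurable_integrable[OF wi] by measurable
  show "AE x in meas_of DU. \<bar>min (w x) c\<bar> <= c" using w0 by eventually_elim (use c(1) in auto)
 qed
 hence zL: "z : L2 M" unfolding z_def[abs_def] MU_L2 by (rule L2.diff_mem[OF dom_L2[OF FU_F[OF G(1)]]])
 have K': "0 <= 2 * (2 * c) * K" "0 <= 2 * c" using K c(1) by auto
 have T0: "?T 0 = 0" by simp
 note Tz = lipschitz_L2_tendsto[OF Fb_L2[OF uFb] ub zL zb uz Tm T0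
   lip_powr_times_lipschitz[OF p, where c="2 * c", folded K_def] K']
 have \<theta>2: "\<theta> : L2 M" by (rule Fb_L2[OF L_Fb[OF \<theta>(1)]])
 have lim: "(%j. ip \<theta> (?P j)) ----> ip \<theta> (%x. ?T (z x))"
  using L2.tendsto_left[OF Fb_L2[OF P] Tz(1) \<theta>2 Tz(2)] L2.sym[OF \<theta>2 Fb_L2[OF P]] L2.sym[OF \<theta>2 Tz(1)] by simp
 have off: "x : \<Omega> ==> x \<notin> W ==> \<eta> x = 0 & \<theta> x = 0" for x
  using supp_zero[of x \<eta>] supp_zero[of x \<theta>] \<eta>(3) \<theta>(4) by blast
 have "(LINT x|M. (\<eta> x)\<^sup>2 * ?T (h x)) <= ip (%x. (\<eta> x)\<^sup>2) (?P j)" for j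
  unfolding L2_inner_def
 proof (rule integral_mono_AE')
  show "integrable M (%x. (\<eta> x)\<^sup>2 * ?P j x)" by (rule L2_integrable_mult[OF Fb_L2[OF Fb_square[OF \<eta>b]] Fb_L2[OF P]])
  show "AE x in M. (\<eta> x)\<^sup>2 * ?T (h x) <= (\<eta> x)\<^sup>2 * ?P j x"
   using G(3) y(2)[of j, unfolded MU_AE] AE_space
  proof eventually_elim
   case (elim x)
   show ?case
   proof (cases "x : W")
    case True
    \<comment> \<open>\<open>y j\<close> lies below \<open>g - h\<close>, so \<open>G - y j\<close>
      lies above \<open>h\<close> on \<open>W\<close>; the left side can therefore be bounded for
      each \<open>j\<close> without a limit.\<close>
    hence hu: "h x <= u j x" using elim WU by (auto simp: u_def w_def)
    have "?T (h x) <= ?P j x"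
     using P0[of j x] hu lip_powr_0[of "h x" p] lip_powr_nonneg[OF p, of "h x"] lip_powr_mono[OF p hu]
     by (cases "h x <= 0") (auto intro: mult_mono)
    thus ?thesis by (rule mult_left_mono) simp
   qed (use off[of x] elim M_space in auto)
  qed
  show "AE x in M. 0 <= (\<eta> x)\<^sup>2 * ?P j x" by (intro AE_I2 mult_nonneg_nonneg[OF _ P0]) simp
 qed
 hence "(LINT x|M. (\<eta> x)\<^sup>2 * ?T (h x)) <= ?C * e * ip \<theta> (?P j)" for j using main[of j] by (rule order_trans)
 hence "(LINT x|M. (\<eta> x)\<^sup>2 * ?T (h x)) <= ?C * e * ip \<theta> (%x. ?T (z x))"
  by (intro LIMSEQ_le_const[OF tendsto_mult[OF tendsto_const lim]]) blast
 also have "ip \<theta> (%x. ?T (z x)) <= (LINT x|M. ext ?m x)"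
  unfolding L2_inner_def
 proof (rule integral_mono_AE')
  have "ext (%x. max (ext h x) 0 powr (p + 1)) : borel_measurable M" using h U_sets by measurable
  hence m: "ext (%x. max (h x) 0 powr (p + 1)) : borel_measurable M"
   by (rule measurable_cong[THEN iffD1, rotated]) (auto simp: indicator_def)
  show "integrable M (ext (%x. max (h x) 0 powr (p + 1)))"
  proof (rule Bochner_Integration.integrable_bound[OF MU_indicator_integrable[of "c powr (p + 1)"] m])
   show "AE x in M. norm (ext (%x. max (h x) 0 powr (p + 1)) x) <= norm (indicator U x * c powr (p + 1))"
    using hg[unfolded MU_AE]
   proof eventually_elim
    case (elim x)
    show ?case
    proof (cases "x : U")
     case True
     hence "max (h x) 0 <= c" using elim c(2)[of x] c_le by (auto simp: v_def)
     thus ?thesis using True p by (auto intro!: powr_mono2)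
    qed simp
   qed
  qed
  show "AE x in M. \<theta> x * ?T (z x) <= ext ?m x" using G(3) hg[unfolded MU_AE] AE_space
  proof eventually_elim
   case (elim x)
   show ?case
   proof (cases "x : W")
    case True
    hence x: "x : U" using WU by blast
    hence "z x = g x - min (g x - h x) c" "h x <= g x" "\<bar>g x\<bar> <= c"
     using elim True c(2)[of x] by (auto simp: z_def v_def w_def)
    \<comment> \<open>If the truncation is inactive, \<open>z\<close> equals \<open>h\<close>.
      Otherwise \<open>h < g - c <= 0\<close> and \<open>z = g - c <= 0\<close>, so both positive
      parts vanish.\<close>
    hence "max (z x) 0 = max (h x) 0" by auto
    hence "?T (z x) <= ?m x" using lip_powr_le[OF p, of "z x"] by simp
    hence "\<theta> x * ?T (z x) <= 1 * ?m x"
     using \<theta>(2)[of x] lip_powr_times_nonneg[OF p, of "z x"] by (intro mult_mono) auto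
    thus ?thesis using x by simp
   qed (use off[of x] elim M_space in auto)
  qed
 qed (auto simp: indicator_def)
 finally show ?thesis using e rp by (simp add: mult_left_mono divide_right_mono)
qed

end

section \<open>Positivity preservation\<close>

context complete_dirichlet
begin

lemma defective_integral_le:
 assumes p: "0 < p" and h: "h : borel_measurable M" "integrable M (%x. max (h x) 0 powr (p + 1))"
  and def: "locally_shift_defective D 1 h" and K: "compactin X K" and e: "0 < \<epsilon>"
  and i: "integrable M (%x. h x * lip_powr p (h x))"
 shows "(LINT x|M. indicator K x * (h x * lip_powr p (h x))) <=
  2 / powr_ratio p * \<epsilon>\<^sup>2 * (LINT x|M. max (h x) 0 powr (p + 1))"
proof -
 let ?m = "%x. max (h x) 0 powr (p + 1)" and ?T = "%x. h x * lip_powr p (h x)"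
 have T0: "0 <= ?T x" for x by (rule lip_powr_times_nonneg[OF p])
 obtain \<eta> where \<eta>: "\<eta> : L" "!!x. 0 <= \<eta> x & \<eta> x <= 1" "!!x. x : K ==> \<eta> x = 1"
  "!!\<phi>. \<phi> : L ==> (!!x. 0 <= \<phi> x) ==> energy \<phi> \<eta> \<eta> <= \<epsilon>\<^sup>2 * (LINT x|M. \<phi> x)"
  using cutoff[OF K e] by metis
 have S: "compactin X (supp \<eta>)" using \<eta>(1) by (simp add: L_iff)
 \<comment> \<open>\<open>U\<close> is chosen after the cutoff function, so that its support fits
   inside; \<open>W\<close> leaves room between that support and the boundary of
   \<open>U\<close>.\<close>
 obtain U where U: "openin X U" "supp \<eta> <= U" "compactin X (X closure_of U)"
  by (rule compact_open_interpolate[OF S openin_topspace compactin_subset_topspace[OF S]])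
 obtain W where W: "openin X W" "supp \<eta> <= W" "compactin X (X closure_of W)" "X closure_of W <= U"
  by (rule compact_open_interpolate[OF S U(1,2)])
 interpret relatively_compact_open D U by unfold_locales (rule U)+
 have "well_inside X U \<Omega>" unfolding well_inside_def by (intro conjI U openin_topspace closure_of_subset_topspace)
 then obtain g where g: "g : Cb_space (subtopology X U)" "weakly_harmonic DU 1 g"
  "!!t. 0 < t ==> AE x in restrict_space M U. h x - g x <= exp (- t * 1) * heat DU t (%y. h y - g y) x"
  using def unfolding locally_shift_defective_def by blast
 have "(%x. indicator (X closure_of U) x * h x) : Lp 1 M"
  using def U(3) unfolding locally_shift_defective_def Lp_loc_def by blast
 hence hU: "integrable M (%x. indicator (X closure_of U) x * h x)" by (simp add: Lp_1)
 have hi: "integrable M (ext h)"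
 proof (rule Bochner_Integration.integrable_bound[OF hU])
  show "ext h : borel_measurable M" using h(1) U_sets by measurable
  show "AE x in M. norm (ext h x) <= norm (indicator (X closure_of U) x * h x)"
   using closure_of_subset[OF U_top] by (intro AE_I2) (auto simp: indicator_def)
 qed
 have df: "AE x in meas_of DU. h x - g x <= exp (- t) * heat DU t (%y. h y - g y) x" if "0 < t" for t
  using g(3)[OF that] unfolding MU by simp
 note est = local_estimate[OF hi g(1,2) df W(1,3,4) \<eta>(1,2) W(2) \<eta>(4) zero_le_power2 p]
 have "(LINT x|M. indicator K x * ?T x) <= (LINT x|M. (\<eta> x)\<^sup>2 * ?T x)"
 proof (rule integral_mono_AE')
  show "integrable M (%x. (\<eta> x)\<^sup>2 * ?T x)"
  proof (rule Bochner_Integration.integrable_bound[OF i])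
   show "(%x. (\<eta> x)\<^sup>2 * ?T x) : borel_measurable M"
    by (rule borel_measurable_times[OF borel_measurable_power[OF dom_measurable[OF L_F[OF \<eta>(1)]]] borel_measurable_integrable[OF i]])
   show "AE x in M. norm ((\<eta> x)\<^sup>2 * ?T x) <= norm (?T x)"
    by (rule AE_I2) (use \<eta>(2) in \<open>auto simp: abs_mult power_le_one intro!: mult_left_le_one_le\<close>)
  qed
 qed (use \<eta>(3) T0 in \<open>auto simp: indicator_def\<close>)
 also note est
 also have "2 / powr_ratio p * \<epsilon>\<^sup>2 * (LINT x|M. ext ?m x) <= 2 / powr_ratio p * \<epsilon>\<^sup>2 * (LINT x|M. ?m x)"
 proof (rule mult_left_mono)
  show "(LINT x|M. ext ?m x) <= (LINT x|M. ?m x)"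
   by (rule integral_mono_AE'[OF h(2)]) (rule AE_I2, simp add: indicator_def)+
 qed (use powr_ratio_pos[OF p] in simp)
 finally show ?thesis .
qed

text \<open>For a fixed compact set the constant in \<open>defective_integral_le\<close> is a fixed
  multiple of the square of \<open>\<epsilon>\<close>, so \<open>\<epsilon> = 1 / Suc n\<close>
  forces the integral to 0. The integrand is positive wherever \<open>h\<close> is, and countably
  many compact sets exhaust the space.\<close>

lemma defective_nonpos_global:
 assumes p: "0 < p" and h: "h : borel_measurable M" "integrable M (%x. max (h x) 0 powr (p + 1))"
  and def: "locally_shift_defective D 1 h"
 shows "AE x in M. h x <= 0"
proof -
 let ?m = "%x. max (h x) 0 powr (p + 1)" and ?T = "%x. h x * lip_powr p (h x)"
 have T0: "0 <= ?T x" for x by (rule lip_powr_times_nonneg[OF p])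
 have Ti: "integrable M ?T"
 proof (rule Bochner_Integration.integrable_bound[OF h(2)])
  show "?T : borel_measurable M" unfolding lip_powr_def using h(1) by measurable
  show "AE x in M. norm (?T x) <= norm (?m x)" using lip_powr_le[OF p] T0 by (intro AE_I2) simp
 qed
 have K0: "AE x in M. x : K --> h x <= 0" if K: "compactin X K" for K
 proof -
  define C where "C = 2 / powr_ratio p * (LINT x|M. ?m x)"
  let ?k = "%x. indicator K x * ?T x"
  have km: "integrable M ?k"
   by (rule Bochner_Integration.integrable_bound[OF Ti])
    (use compact_sets[OF M_sets K] borel_measurable_integrable[OF Ti] in \<open>auto simp: indicator_def\<close>)
  have "(%n. C * (1 / real (Suc n))\<^sup>2) ----> C * 0\<^sup>2"
   by (intro tendsto_mult tendsto_power tendsto_const LIMSEQ_Suc[OF lim_1_over_n])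
  moreover have "(LINT x|M. ?k x) <= C * (1 / real (Suc n))\<^sup>2" for n
   using defective_integral_le[OF p h def K _ Ti, of "1 / real (Suc n)"] by (simp add: C_def mult_ac del: of_nat_Suc)
  ultimately have "(LINT x|M. ?k x) <= C * 0\<^sup>2" by (intro LIMSEQ_le_const) auto
  moreover have "\<bar>?k x\<bar> = ?k x" for x by (intro abs_of_nonneg mult_nonneg_nonneg[OF _ T0]) simp
  ultimately have "L1_nrm M ?k <= 0" by simp
  hence "AE x in M. ?k x = 0" by (rule L1_nrm_null[OF km])
  thus ?thesis
  proof eventually_elim
   case (elim x)
   show ?case using elim lip_powr_pos[OF p, of "h x"] by (cases "0 < h x") auto
  qed
 qed
 obtain C where C: "!!n::nat. compactin X (C n)" "!!n. C n <= C (Suc n)" "(\<Union>n. C n) = \<Omega>"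
  by (rule open_Union_compact[OF openin_topspace]) blast
 have "AE x in M. ALL n. x : C n --> h x <= 0" unfolding AE_all_countable using K0[OF C(1)] by blast
 with AE_space show ?thesis by eventually_elim (use C(3) M_space in blast)
qed

end

theorem theorem7p5:
  fixes D :: "'a form_space"
  assumes "strongly_local_dirichlet_space D"
    and "locally_smoothing D"
    and "intrinsically_complete D"
    and "irreducible_form D"
  shows "\<forall>q::ennreal. 1 < q \<and> q < \<infinity> \<longrightarrow> Lq_positivity_preserving D q"
proof (intro allI impI)
 fix q :: ennreal assume q: "1 < q & q < \<infinity>"
 interpret complete_dirichlet D by unfold_locales (rule assms)+
 define p where "p = enn2real q - 1"
 have "enn2real 1 < enn2real q"
  using q by (cases q) (auto simp: ennreal_less_iff simp flip: ennreal_1)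
 hence p: "0 < p" by (simp add: p_def)
 show "Lq_positivity_preserving D q"
  unfolding Lq_positivity_preserving_def
 proof (intro ballI impI)
  fix f assume f: "f : Lp q M" "locally_shift_excessive D 1 f"
  have fi: "f : borel_measurable M" "integrable M (%x. \<bar>f x\<bar> powr (p + 1))" using f(1) q by (auto simp: Lp_def p_def)
  have hm: "(%x. - f x) : borel_measurable M" using fi(1) by simp
  have "integrable M (%x. max (- f x) 0 powr (p + 1))"
  proof (rule Bochner_Integration.integrable_bound[OF fi(2)])
   show "(%x. max (- f x) 0 powr (p + 1)) : borel_measurable M" using fi(1) by measurable
   show "AE x in M. norm (max (- f x) 0 powr (p + 1)) <= norm (\<bar>f x\<bar> powr (p + 1))"
    by (rule AE_I2) (use p in \<open>auto intro: powr_mono2\<close>)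
  qed
  from defective_nonpos_global[OF p hm this f(2)[unfolded locally_shift_excessive_def]]
  show "AE x in M. 0 <= f x" by simp
 qed
qed

end
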